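(* Let $\mathbf{k}$ be a commutative ring, $\delta\in\mathbf{k}$, and let $r\ge0$. Suppose that $\delta$ is non-singular at ranks $\preceq r$. Then the Brauer algebra $B(r)=B^{\mathbf{k},\delta}(r)$ is Morita equivalent to the algebra $\bigoplus_{q\preceq r}\mathbb{S}_q$, where $\mathbb{S}_q=\mathbf{k}[\mathfrak{S}_q]$.
   Context: For $p,q\ge0$, a $(p,q)$-Brauer diagram is a partition of $[p]^+\sqcup[q]^-=\{1^+,\dots,p^+\}\sqcup\{1^-,\dots,q^-\}$ into unordered pairs ($i^+$ top points, $i^-$ bottom points). Upward: no pair of two top points; level: every pair has one top and one bottom point; monotone: $(i-k)(j-l)>0$ for any two distinct pairs $\{i^+,j^-\},\{k^+,l^-\}$. $\mathbb{B}^{+,m}(p,q)$: upward monotone diagrams. $\overline f$: exchange $i^\pm\leftrightarrow i^\mp$. $p\preceq q$ iff $p\le q$ and $q-p$ even. For composable diagrams, $f\circ g=\delta^{l(f,g)}f\hat\circ g$, where $g$ is placed above $f$, $l(f,g)$ is the number of closed loops formed and $f\hat\circ g$ is the diagram after deleting loops. The Brauer algebra $B(r)$ is the free $\mathbf{k}$-module on $(r,r)$-Brauer diagrams with product $\circ$. Level $(p,p)$-diagrams are identified with $\mathfrak{S}_p$. Non-singularity: for $p\preceq q$ and $f,g\in\mathbb{B}^{+,m}(p,q)$, over $\mathbb{Z}[x]$ with parameter $x$ in place of $\delta$, let $a_{f,g}=\overline f\circ g\in\mathbb{Z}[x][\mathfrak{S}_p]$ if $\overline f\hat\circ g$ is level,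 and $0$ otherwise; $A_{p,q}=(a_{f,g})\in M_n(\mathbb{Z}[x][\mathfrak{S}_p])$, $n=|\mathbb{B}^{+,m}(p,q)|$; $\iota:M_n(\mathbb{Z}[x][\mathfrak{S}_p])\hookrightarrow M_{n\,p!}(\mathbb{Z}[x])$ induced by the left regular representation; $f_{p,q}(x)=\det\iota(A_{p,q})\in\mathbb{Z}[x]$. $\delta$ is non-singular at ranks $\preceq r$ if $f_{p,q}(\delta)$ is invertible in $\mathbf{k}$ for all $p\preceq q\preceq r$. *)

theory Defs
  imports
    "HOL-Library.Disjoint_Sets"
    "HOL-Library.Infinite_Typeclass"
    "HOL-Algebra.Module"
    "HOL-Algebra.Sym_Groups"
    "HOL-Computational_Algebra.Polynomial"
    "Jordan_Normal_Form.Determinant"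
begin

section \<open>Brauer diagrams\<close>

datatype point = Top nat | Bot nat

definition brauer_points :: "nat \<Rightarrow> nat \<Rightarrow> point set" where
  "brauer_points p q = Top ` {1..p} \<union> Bot ` {1..q}"

definition brauer_diagrams :: "nat \<Rightarrow> nat \<Rightarrow> point set set set" where
  "brauer_diagrams p q =
     {d. partition_on (brauer_points p q) d \<and> (\<forall>e\<in>d. card e = 2)}"

definition upward :: "point set set \<Rightarrow> bool" where
  "upward d \<longleftrightarrow> (\<forall>i k. {Top i, Top k} \<notin> d)"

definition monotone_diagram :: "point set set \<Rightarrow> bool" where
  "monotone_diagram d \<longleftrightarrow>
     (\<forall>i j k l. {Top i, Bot j} \<in> d \<and> {Top k, Bot l} \<in> d \<and> {Top i, Bot j} \<noteq> {Top k, Bot l} \<longrightarrow>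
        (int i - int k) * (int j - int l) > 0)"

definition upward_monotone_diagrams :: "nat \<Rightarrow> nat \<Rightarrow> point set set set" where
  "upward_monotone_diagrams p q =
     {d \<in> brauer_diagrams p q. upward d \<and> monotone_diagram d}"

fun flip_point :: "point \<Rightarrow> point" where
  "flip_point (Top i) = Bot i"
| "flip_point (Bot i) = Top i"

definition flip_diagram :: "point set set \<Rightarrow> point set set" where
  "flip_diagram d = (\<lambda>e. flip_point ` e) ` d"


subsection \<open>Composition\<close>

text \<open>To compose \<open>f\<close> with \<open>g\<close>, where \<open>g\<close> is placed above \<open>f\<close>, the bottom points of \<open>g\<close> are
  glued to the top points of \<open>f\<close>; the glued points are the vertices \<open>Middle i\<close>.  Every
  connected component of the resulting graph is either a path joining two outer vertices
  or a closed loop, which runs through middle vertices only.\<close>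

datatype vertex = Upper nat | Middle nat | Lower nat

fun upper_half :: "point \<Rightarrow> vertex" where
  "upper_half (Top i) = Upper i"
| "upper_half (Bot i) = Middle i"

fun lower_half :: "point \<Rightarrow> vertex" where
  "lower_half (Top i) = Middle i"
| "lower_half (Bot i) = Lower i"

definition stack_edges :: "point set set \<Rightarrow> point set set \<Rightarrow> vertex set set" where
  "stack_edges f g = (\<lambda>e. lower_half ` e) ` f \<union> (\<lambda>e. upper_half ` e) ` g"

definition stack_components :: "point set set \<Rightarrow> point set set \<Rightarrow> vertex set set" where
  "stack_components f g =
     \<Union>(stack_edges f g) // {(x, y). \<exists>e\<in>stack_edges f g. x \<in> e \<and> y \<in> e}\<^sup>*"

definition outer_points :: "vertex set \<Rightarrow> point set" where
  "outer_points C = {Top i | i. Upper i \<in> C} \<union> {Bot i | i. Lower i \<in> C}"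

definition loop_count :: "point set set \<Rightarrow> point set set \<Rightarrow> nat" where
  "loop_count f g = card {C \<in> stack_components f g. outer_points C = {}}"

definition diagram_comp :: "point set set \<Rightarrow> point set set \<Rightarrow> point set set" where
  "diagram_comp f g = {outer_points C | C. C \<in> stack_components f g \<and> outer_points C \<noteq> {}}"


section \<open>The algebras\<close>

text \<open>An algebra over \<open>k\<close> is represented by a record of type \<open>module\<close>, which extends the
  type of rings by a scalar multiplication.  The locale \<open>algebra\<close> of the library
  is not used since it requires commutativity.\<close>

locale assoc_algebra = module k A + A?: ring A for k (structure) and A (structure) +
  assumes smult_mult_left:
      "\<lbrakk>c \<in> carrier k; x \<in> carrier A; y \<in> carrier A\<rbrakk> \<Longrightarrow>
         (c \<odot>\<^bsub>A\<^esub> x) \<otimes>\<^bsub>A\<^esub> y = c \<odot>\<^bsub>A\<^esub> (x \<otimes>\<^bsub>A\<^esub> y)"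
    and smult_mult_right:
      "\<lbrakk>c \<in> carrier k; x \<in> carrier A; y \<in> carrier A\<rbrakk> \<Longrightarrow>
         x \<otimes>\<^bsub>A\<^esub> (c \<odot>\<^bsub>A\<^esub> y) = c \<odot>\<^bsub>A\<^esub> (x \<otimes>\<^bsub>A\<^esub> y)"

definition identity_diagram :: "nat \<Rightarrow> point set set" where
  "identity_diagram r = {{Top i, Bot i} | i. i \<in> {1..r}}"

text \<open>The free module on a finite set \<open>X\<close> is \<open>X \<rightarrow>\<^sub>E carrier k\<close>, a function being the family
  of its coefficients.\<close>

definition brauer_algebra ::
    "('k, 'm) ring_scheme \<Rightarrow> 'k \<Rightarrow> nat \<Rightarrow> ('k, point set set \<Rightarrow> 'k) module" where
  "brauer_algebra k \<delta> r =
     \<lparr>carrier = brauer_diagrams r r \<rightarrow>\<^sub>E carrier k,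
      mult = (\<lambda>a b. \<lambda>h\<in>brauer_diagrams r r.
        finsum k (\<lambda>(f, g). (a f \<otimes>\<^bsub>k\<^esub> b g) \<otimes>\<^bsub>k\<^esub> (\<delta> [^]\<^bsub>k\<^esub> loop_count f g))
          {(f, g) \<in> brauer_diagrams r r \<times> brauer_diagrams r r. diagram_comp f g = h}),
      one = (\<lambda>h\<in>brauer_diagrams r r. if h = identity_diagram r then \<one>\<^bsub>k\<^esub> else \<zero>\<^bsub>k\<^esub>),
      zero = (\<lambda>h\<in>brauer_diagrams r r. \<zero>\<^bsub>k\<^esub>),
      add = (\<lambda>a b. \<lambda>h\<in>brauer_diagrams r r. a h \<oplus>\<^bsub>k\<^esub> b h),
      module.smult = (\<lambda>c a. \<lambda>h\<in>brauer_diagrams r r. c \<otimes>\<^bsub>k\<^esub> a h)\<rparr>"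

text \<open>This is the group algebra for finite \<open>G\<close> only, as no finiteness of supports is imposed.\<close>

definition group_algebra ::
    "('k, 'm) ring_scheme \<Rightarrow> ('g, 'n) monoid_scheme \<Rightarrow> ('k, 'g \<Rightarrow> 'k) module" where
  "group_algebra k G =
     \<lparr>carrier = carrier G \<rightarrow>\<^sub>E carrier k,
      mult = (\<lambda>a b. \<lambda>h\<in>carrier G.
        finsum k (\<lambda>(x, y). a x \<otimes>\<^bsub>k\<^esub> b y)
          {(x, y) \<in> carrier G \<times> carrier G. x \<otimes>\<^bsub>G\<^esub> y = h}),
      one = (\<lambda>h\<in>carrier G. if h = \<one>\<^bsub>G\<^esub> then \<one>\<^bsub>k\<^esub> else \<zero>\<^bsub>k\<^esub>),
      zero = (\<lambda>h\<in>carrier G. \<zero>\<^bsub>k\<^esub>),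
      add = (\<lambda>a b. \<lambda>h\<in>carrier G. a h \<oplus>\<^bsub>k\<^esub> b h),
      module.smult = (\<lambda>c a. \<lambda>h\<in>carrier G. c \<otimes>\<^bsub>k\<^esub> a h)\<rparr>"

text \<open>For a finite index set the direct sum is the full product.\<close>

definition direct_sum_algebra ::
    "'i set \<Rightarrow> ('i \<Rightarrow> ('k, 'a) module) \<Rightarrow> ('k, 'i \<Rightarrow> 'a) module" where
  "direct_sum_algebra I A =
     \<lparr>carrier = (\<Pi>\<^sub>E i\<in>I. carrier (A i)),
      mult = (\<lambda>x y. \<lambda>i\<in>I. x i \<otimes>\<^bsub>A i\<^esub> y i),
      one = (\<lambda>i\<in>I. \<one>\<^bsub>A i\<^esub>),
      zero = (\<lambda>i\<in>I. \<zero>\<^bsub>A i\<^esub>),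
      add = (\<lambda>x y. \<lambda>i\<in>I. x i \<oplus>\<^bsub>A i\<^esub> y i),
      module.smult = (\<lambda>c x. \<lambda>i\<in>I. c \<odot>\<^bsub>A i\<^esub> x i)\<rparr>"


section \<open>Non-singular parameters\<close>

definition parity_le :: "nat \<Rightarrow> nat \<Rightarrow> bool"  (infix \<open>\<preceq>\<close> 50) where
  "p \<preceq> q \<longleftrightarrow> p \<le> q \<and> even (q - p)"

text \<open>The level diagram identified with a permutation.  Since \<open>g\<close> is placed above \<open>f\<close> in a
  composite of \<open>f\<close> and \<open>g\<close>, reading diagrams from top to bottom turns the composition of level
  diagrams into the composition of functions.\<close>

definition perm_diagram :: "nat \<Rightarrow> (nat \<Rightarrow> nat) \<Rightarrow> point set set" where
  "perm_diagram p \<sigma> = {{Top i, Bot (\<sigma> i)} | i. i \<in> {1..p}}"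

definition level :: "point set set \<Rightarrow> bool" where
  "level d \<longleftrightarrow> (\<forall>e\<in>d. \<exists>i j. e = {Top i, Bot j})"

text \<open>The coefficient of \<open>a\<^bsub>f,g\<^esub>\<close> at a permutation \<open>\<sigma>\<close>; the indeterminate is \<open>[:0, 1:]\<close>.\<close>

definition gram_entry ::
    "nat \<Rightarrow> point set set \<Rightarrow> point set set \<Rightarrow> (nat \<Rightarrow> nat) \<Rightarrow> int poly" where
  "gram_entry p f g \<sigma> =
     (let d = diagram_comp (flip_diagram f) g in
      if level d \<and> d = perm_diagram p \<sigma> then [:0, 1:] ^ loop_count (flip_diagram f) g else 0)"

text \<open>The matrix of left multiplication by \<open>a\<close> with respect to the basis of permutations:
  the coefficient of \<open>a \<tau>\<close> at \<open>\<sigma>\<close> is the coefficient of \<open>a\<close> at \<open>\<sigma> \<tau>\<inverse>\<close>.\<close>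

definition left_regular ::
    "((nat \<Rightarrow> nat) \<Rightarrow> int poly) \<Rightarrow> (nat \<Rightarrow> nat) \<Rightarrow> (nat \<Rightarrow> nat) \<Rightarrow> int poly" where
  "left_regular a \<sigma> \<tau> = a (\<sigma> \<circ> Hilbert_Choice.inv \<tau>)"

text \<open>Rows and columns of \<open>\<iota>(A\<^bsub>p,q\<^esub>)\<close> are both indexed by the pairs \<open>(f, \<sigma>)\<close>, in an arbitrary
  common order, on which the determinant does not depend.\<close>

definition gram_indices :: "nat \<Rightarrow> nat \<Rightarrow> (point set set \<times> (nat \<Rightarrow> nat)) list" where
  "gram_indices p q =
     (SOME es. distinct es \<and>
        set es = upward_monotone_diagrams p q \<times> carrier (sym_group p))"

definition gram_matrix :: "nat \<Rightarrow> nat \<Rightarrow> int poly mat" where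
  "gram_matrix p q =
     (let es = gram_indices p q in
      mat (length es) (length es)
        (\<lambda>(i, j). case (es ! i, es ! j) of
           ((f, \<sigma>), (g, \<tau>)) \<Rightarrow> left_regular (gram_entry p f g) \<sigma> \<tau>))"

definition gram_det :: "nat \<Rightarrow> nat \<Rightarrow> int poly" where
  "gram_det p q = det (gram_matrix p q)"

definition eval_int_poly :: "('k, 'm) ring_scheme \<Rightarrow> 'k \<Rightarrow> int poly \<Rightarrow> 'k" where
  "eval_int_poly k \<delta> P =
     (\<Oplus>\<^bsub>k\<^esub>i\<in>{..degree P}. [Polynomial.coeff P i] \<cdot>\<^bsub>k\<^esub> (\<delta> [^]\<^bsub>k\<^esub> i))"

definition nonsingular_upto :: "('k, 'm) ring_scheme \<Rightarrow> 'k \<Rightarrow> nat \<Rightarrow> bool" where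
  "nonsingular_upto k \<delta> r \<longleftrightarrow>
     (\<forall>p q. p \<preceq> q \<and> q \<preceq> r \<longrightarrow> eval_int_poly k \<delta> (gram_det p q) \<in> Units k)"


section \<open>Morita equivalence\<close>

locale left_module = A?: ring A + M?: abelian_group M for A (structure) and M (structure) +
  assumes smult_closed:
      "\<lbrakk>a \<in> carrier A; x \<in> carrier M\<rbrakk> \<Longrightarrow> a \<odot>\<^bsub>M\<^esub> x \<in> carrier M"
    and smult_l_distr:
      "\<lbrakk>a \<in> carrier A; b \<in> carrier A; x \<in> carrier M\<rbrakk> \<Longrightarrow>
         (a \<oplus>\<^bsub>A\<^esub> b) \<odot>\<^bsub>M\<^esub> x = a \<odot>\<^bsub>M\<^esub> x \<oplus>\<^bsub>M\<^esub> b \<odot>\<^bsub>M\<^esub> x"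
    and smult_r_distr:
      "\<lbrakk>a \<in> carrier A; x \<in> carrier M; y \<in> carrier M\<rbrakk> \<Longrightarrow>
         a \<odot>\<^bsub>M\<^esub> (x \<oplus>\<^bsub>M\<^esub> y) = a \<odot>\<^bsub>M\<^esub> x \<oplus>\<^bsub>M\<^esub> a \<odot>\<^bsub>M\<^esub> y"
    and smult_assoc:
      "\<lbrakk>a \<in> carrier A; b \<in> carrier A; x \<in> carrier M\<rbrakk> \<Longrightarrow>
         (a \<otimes>\<^bsub>A\<^esub> b) \<odot>\<^bsub>M\<^esub> x = a \<odot>\<^bsub>M\<^esub> (b \<odot>\<^bsub>M\<^esub> x)"
    and smult_one:
      "x \<in> carrier M \<Longrightarrow> \<one>\<^bsub>A\<^esub> \<odot>\<^bsub>M\<^esub> x = x"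

text \<open>The objects of the category of left \<open>A\<close>-modules are the modules with carrier in a type
  \<open>'u\<close>, which plays the role of the universe of sets.  Homomorphisms are extensional
  functions, so that equality of morphisms is equality of functions.\<close>

definition module_homs :: "('a, 'm) ring_scheme \<Rightarrow> ('a, 'u) module \<Rightarrow> ('a, 'u) module \<Rightarrow> ('u \<Rightarrow> 'u) set"
  where
  "module_homs A M N =
     {f \<in> carrier M \<rightarrow>\<^sub>E carrier N.
        (\<forall>x\<in>carrier M. \<forall>y\<in>carrier M. f (x \<oplus>\<^bsub>M\<^esub> y) = f x \<oplus>\<^bsub>N\<^esub> f y) \<and>
        (\<forall>a\<in>carrier A. \<forall>x\<in>carrier M. f (a \<odot>\<^bsub>M\<^esub> x) = a \<odot>\<^bsub>N\<^esub> f x)}"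

definition module_isos :: "('a, 'm) ring_scheme \<Rightarrow> ('a, 'u) module \<Rightarrow> ('a, 'u) module \<Rightarrow> ('u \<Rightarrow> 'u) set"
  where
  "module_isos A M N = {f \<in> module_homs A M N. bij_betw f (carrier M) (carrier N)}"

text \<open>A \<open>k\<close>-linear functor from \<open>A\<close>-modules to \<open>B\<close>-modules, with object part \<open>Fo\<close> and
  morphism part \<open>Fm\<close>.  A scalar \<open>c\<close> acts on a module over \<open>A\<close> as the element
  \<open>c \<odot>\<^bsub>A\<^esub> \<one>\<^bsub>A\<^esub>\<close> of \<open>A\<close>.\<close>

locale linear_module_functor =
  fixes k :: "('k, 'm) ring_scheme"
    and A :: "('k, 'a) module"
    and B :: "('k, 'b) module"
    and Fo :: "('a, 'u) module \<Rightarrow> ('b, 'u) module"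
    and Fm :: "('a, 'u) module \<Rightarrow> ('a, 'u) module \<Rightarrow> ('u \<Rightarrow> 'u) \<Rightarrow> ('u \<Rightarrow> 'u)"
  assumes obj: "left_module A M \<Longrightarrow> left_module B (Fo M)"
    and hom: "\<lbrakk>left_module A M; left_module A N; f \<in> module_homs A M N\<rbrakk> \<Longrightarrow>
        Fm M N f \<in> module_homs B (Fo M) (Fo N)"
    and ident: "left_module A M \<Longrightarrow>
        Fm M M (\<lambda>x\<in>carrier M. x) = (\<lambda>x\<in>carrier (Fo M). x)"
    and comp: "\<lbrakk>left_module A M; left_module A N; left_module A P;
         f \<in> module_homs A M N; g \<in> module_homs A N P\<rbrakk> \<Longrightarrow>
        Fm M P (compose (carrier M) g f) = compose (carrier (Fo M)) (Fm N P g) (Fm M N f)"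
    and add: "\<lbrakk>left_module A M; left_module A N;
         f \<in> module_homs A M N; g \<in> module_homs A M N\<rbrakk> \<Longrightarrow>
        Fm M N (\<lambda>x\<in>carrier M. f x \<oplus>\<^bsub>N\<^esub> g x) =
          (\<lambda>x\<in>carrier (Fo M). Fm M N f x \<oplus>\<^bsub>Fo N\<^esub> Fm M N g x)"
    and scalar: "\<lbrakk>left_module A M; left_module A N; f \<in> module_homs A M N; c \<in> carrier k\<rbrakk> \<Longrightarrow>
        Fm M N (\<lambda>x\<in>carrier M. (c \<odot>\<^bsub>A\<^esub> \<one>\<^bsub>A\<^esub>) \<odot>\<^bsub>N\<^esub> f x) =
          (\<lambda>x\<in>carrier (Fo M). (c \<odot>\<^bsub>B\<^esub> \<one>\<^bsub>B\<^esub>) \<odot>\<^bsub>Fo N\<^esub> Fm M N f x)"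

text \<open>\<open>\<eta>\<close> is a natural isomorphism from the functor \<open>(Fo, Fm)\<close> to the identity functor of the
  category of left \<open>A\<close>-modules.\<close>

definition natural_iso_to_identity ::
    "('a, 'm) ring_scheme \<Rightarrow> (('a, 'u) module \<Rightarrow> ('a, 'u) module) \<Rightarrow>
      (('a, 'u) module \<Rightarrow> ('a, 'u) module \<Rightarrow> ('u \<Rightarrow> 'u) \<Rightarrow> ('u \<Rightarrow> 'u)) \<Rightarrow>
      (('a, 'u) module \<Rightarrow> 'u \<Rightarrow> 'u) \<Rightarrow> bool" where
  "natural_iso_to_identity A Fo Fm \<eta> \<longleftrightarrow>
     (\<forall>M. left_module A M \<longrightarrow> \<eta> M \<in> module_isos A (Fo M) M) \<and>
     (\<forall>M N f. left_module A M \<and> left_module A N \<and> f \<in> module_homs A M N \<longrightarrow>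
        compose (carrier (Fo M)) (\<eta> N) (Fm M N f) = compose (carrier (Fo M)) f (\<eta> M))"

text \<open>Morita equivalence of \<open>k\<close>-algebras: the categories of left modules are equivalent by
  \<open>k\<close>-linear functors.  The universe \<open>'u\<close> is a parameter, as it is impossible to quantify over
  types inside a formula; a statement about \<open>morita_equivalent TYPE('u)\<close> with a type variable
  \<open>'u\<close> covers universes of arbitrarily large cardinality.  The universe is required to be
  infinite because the modules on subsets of a finite set are not closed under finite
  direct sums.\<close>

definition morita_equivalent ::
    "'u::infinite itself \<Rightarrow> ('k, 'm) ring_scheme \<Rightarrow> ('k, 'a) module \<Rightarrow> ('k, 'b) module \<Rightarrow> bool" where
  "morita_equivalent U k A B \<longleftrightarrow>
     assoc_algebra k A \<and> assoc_algebra k B \<and>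
     (\<exists>(Fo :: ('a, 'u) module \<Rightarrow> ('b, 'u) module) Fm Go Gm \<eta> \<epsilon>.
        linear_module_functor k A B Fo Fm \<and>
        linear_module_functor k B A Go Gm \<and>
        natural_iso_to_identity A (Go \<circ> Fo) (\<lambda>M N f. Gm (Fo M) (Fo N) (Fm M N f)) \<eta> \<and>
        natural_iso_to_identity B (Fo \<circ> Go) (\<lambda>M N f. Fm (Go M) (Go N) (Gm M N f)) \<epsilon>)"

end

theory Submission
  imports Defs
begin

text \<open>A colouring of the end points of a diagram by two colours is compatible with the diagram if the
ends of every pair agree. Compatibility turns composition of diagrams into relational composition, and
the number of compatible colourings of the middle points is $2^l$ with $l$ the number of loops; since a
diagram is determined by its compatible colourings, associativity of composition and the cocycle
identity for the loop numbers follow by counting.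

A diagram with $q$ through strands is $u \circ \overline w$ with upward $u, w$ from $q$ points, unique
up to permuting these $q$ points. The algebra $B(r)$ acts on the cell module spanned by the upward
$(q,r)$-diagrams, and this action commutes with $\mathfrak{S}_q$. On elements supported on diagrams with
at most $q$ through strands it is the coefficient matrix multiplied by the Gram matrix. If all Gram
determinants are invertible, a triangularity argument on $q$ therefore shows that $B(r)$ is isomorphic
to the product over $q \preceq r$ of the $\mathfrak{S}_q$-equivariant endomorphism rings of the cell
modules, that is, of the matrix rings over $\mathbf{k}[\mathfrak{S}_q]$ indexed by the monotone upward
diagrams. A matrix unit in each factor gives a full idempotent $e$ whose corner $e B(r) e$ is
$\bigoplus_q \mathbf{k}[\mathfrak{S}_q]$, and $M \mapsto e M$ is the equivalence of module categories.\<close>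

section \<open>Colourings compatible with a diagram\<close>

text \<open>Over an arbitrary commutative ring there is no semisimplicity to rely on and no
  comparison of dimensions, so bijectivity onto the matrix rings is shown with an explicit two-sided
  inverse of the Gram matrix: the adjugate identity holds over integer polynomials and survives
  evaluation at \<delta>. The hypothesis speaks of determinants of scalar matrices, while the
  endomorphisms wanted are linear over group rings. The two fit together because an upward diagram
  is uniquely a monotone one times a permutation: indexed by all upward diagrams, the image of
  A_{p,q} under the regular representation is a scalar matrix invariant under permutations, and the
  inverse of an invariant matrix is invariant. Two colours are used because they give the action of
  diagrams on tensor powers of a free module of rank two, with parameter 2, where a diagram is a 0-1
  matrix and the exponent of 2 determines the number of loops. Modules must have their carriers in
  one fixed infinite type. The inverse functor, a tensor product with A e, is therefore realised as
  a direct summand of N^n, with n-tuples coded as single elements of that type.\<close>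

definition saturated :: "'a set \<Rightarrow> 'a set set \<Rightarrow> bool" where
  "saturated K E \<longleftrightarrow> (\<forall>e\<in>E. e \<subseteq> K \<or> e \<inter> K = {})"

text \<open>A set saturated for a partition is a union of blocks. Whether a block that meets
  \<open>S\<close> lies in \<open>K\<close> is decided by whether it meets \<open>c\<close>, so only
  the blocks missing \<open>S\<close> are free, which gives the power of two. A block that meets
  both \<open>c\<close> and the rest of \<open>S\<close> rules out every extension. In the
  application \<open>S\<close> consists of the outer vertices of a stack, and the free blocks are
  the closed loops.\<close>

lemma card_saturated_extensions:
  assumes P: "partition_on V P" and V: "finite V" and c: "c \<subseteq> S" and S: "S \<subseteq> V"
  shows "card {K. K \<subseteq> V \<and> saturated K P \<and> K \<inter> S = c} =
    (if \<forall>C\<in>P. C \<inter> S \<subseteq> c \<or> C \<inter> c = {} then 2 ^ card {C\<in>P. C \<inter> S = {}} else 0)"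
proof (cases "\<forall>C\<in>P. C \<inter> S \<subseteq> c \<or> C \<inter> c = {}")
  case True
  have UP: "\<Union>P = V" and ne: "{} \<notin> P" and dj: "\<And>C D. C \<in> P \<Longrightarrow> D \<in> P \<Longrightarrow> C \<inter> D \<noteq> {} \<Longrightarrow> C = D"
    using P by (auto simp: partition_on_def disjoint_def)
  have fin: "finite P" using V UP by (metis finite_UnionD)
  let ?L = "{C\<in>P. C \<inter> S = {}}"
  let ?A = "{K. K \<subseteq> V \<and> saturated K P \<and> K \<inter> S = c}"
  \<comment> \<open>\<open>K\<close> is recorded by the free blocks that it contains; the blocks
    meeting \<open>c\<close> are always added back.\<close>
  have "bij_betw (\<lambda>K. {C\<in>?L. C \<subseteq> K}) ?A (Pow ?L)"
  proof (rule bij_betw_byWitness[where f' = "\<lambda>T. \<Union>T \<union> \<Union>{C\<in>P. C \<inter> c \<noteq> {}}"])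
    show "\<forall>K\<in>?A. \<Union>{C\<in>?L. C \<subseteq> K} \<union> \<Union>{C\<in>P. C \<inter> c \<noteq> {}} = K"
    proof
      fix K assume K: "K \<in> ?A"
      show "\<Union>{C\<in>?L. C \<subseteq> K} \<union> \<Union>{C\<in>P. C \<inter> c \<noteq> {}} = K"
      proof
        show "\<Union>{C\<in>?L. C \<subseteq> K} \<union> \<Union>{C\<in>P. C \<inter> c \<noteq> {}} \<subseteq> K"
          using K by (fastforce simp: saturated_def)
      next
        show "K \<subseteq> \<Union>{C\<in>?L. C \<subseteq> K} \<union> \<Union>{C\<in>P. C \<inter> c \<noteq> {}}"
        proof
          fix x assume x: "x \<in> K"
          then obtain C where C: "C \<in> P" "x \<in> C" using K UP by blast
          then have CK: "C \<subseteq> K" using K x by (auto simp: saturated_def)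
          show "x \<in> \<Union>{C\<in>?L. C \<subseteq> K} \<union> \<Union>{C\<in>P. C \<inter> c \<noteq> {}}"
          proof (cases "C \<inter> S = {}")
            case True then show ?thesis using C CK by blast
          next
            case False
            then have "C \<inter> c \<noteq> {}" using CK K by blast
            then show ?thesis using C by blast
          qed
        qed
      qed
    qed
    show "\<forall>T\<in>Pow ?L. {C\<in>?L. C \<subseteq> \<Union>T \<union> \<Union>{C\<in>P. C \<inter> c \<noteq> {}}} = T"
    proof
      fix T assume T: "T \<in> Pow ?L"
      have "C \<in> T" if "C \<in> ?L" "C \<subseteq> \<Union>T \<union> \<Union>{C\<in>P. C \<inter> c \<noteq> {}}" for C
      proof -
        have "C \<noteq> {}" using that(1) ne by auto
        then obtain x where x: "x \<in> C" by blast
        then have "x \<in> \<Union>T \<union> \<Union>{C\<in>P. C \<inter> c \<noteq> {}}" using that(2) by blast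
        then consider D where "D \<in> T" "x \<in> D" | D where "D \<in> P" "D \<inter> c \<noteq> {}" "x \<in> D" by blast
        then show ?thesis
        proof cases
          case 1 then show ?thesis using T that(1) dj[of C D] x by blast
        next
          case 2 then have "C = D" using dj[of C D] that(1) x by blast
          then show ?thesis using 2 that(1) c by blast
        qed
      qed
      then show "{C\<in>?L. C \<subseteq> \<Union>T \<union> \<Union>{C\<in>P. C \<inter> c \<noteq> {}}} = T" using T by blast
    qed
    show "(\<lambda>K. {C\<in>?L. C \<subseteq> K}) ` ?A \<subseteq> Pow ?L" by blast
    show "(\<lambda>T. \<Union>T \<union> \<Union>{C\<in>P. C \<inter> c \<noteq> {}}) ` Pow ?L \<subseteq> ?A"
    proof (rule image_subsetI)
      fix T assume T: "T \<in> Pow ?L"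
      let ?K = "\<Union>T \<union> \<Union>{C\<in>P. C \<inter> c \<noteq> {}}"
      have 1: "?K = \<Union>(T \<union> {C\<in>P. C \<inter> c \<noteq> {}})" by blast
      have "saturated ?K P" unfolding saturated_def
      proof
        fix e assume e: "e \<in> P"
        show "e \<subseteq> ?K \<or> e \<inter> ?K = {}"
        proof (cases "e \<inter> ?K = {}")
          case False
          then obtain D where "D \<in> T \<union> {C\<in>P. C \<inter> c \<noteq> {}}" "e \<inter> D \<noteq> {}" by blast
          moreover from this have "D = e" using dj[of e D] e T by blast
          ultimately show ?thesis by blast
        qed simp
      qed
      moreover have "?K \<inter> S = c"
      proof
        show "?K \<inter> S \<subseteq> c" using T True by blast
        show "c \<subseteq> ?K \<inter> S" using c S UP by blast
      qed
      moreover have "?K \<subseteq> V" using T UP by blast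
      ultimately show "?K \<in> ?A" by blast
    qed
  qed
  then have "card ?A = card (Pow ?L)" by (rule bij_betw_same_card)
  then show ?thesis using True fin by (simp add: card_Pow)
next
  case False
  then have "{K. K \<subseteq> V \<and> saturated K P \<and> K \<inter> S = c} = {}"
    using c by (auto simp: saturated_def)
  then show ?thesis using False by (metis (no_types, lifting) card.empty)
qed

text \<open>The spanning tree bound: a connected graph has at most one vertex more than it has
  edges. A vertex set \<open>W\<close> and a set of edges inside it grow together, one vertex and
  one edge at a time; as long as \<open>W\<close> is not all of \<open>C\<close> some edge leaves
  it, because a set that contains \<open>x\<close> and is closed under adjacency contains the whole
  component.\<close>

lemma card_connected_le:
  assumes E: "finite E" and E2: "\<And>e. e \<in> E \<Longrightarrow> card e = 2"
    and C: "C = {(x, y). \<exists>e\<in>E. x \<in> e \<and> y \<in> e}\<^sup>* `` {x}" and finC: "finite C"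
  shows "card C \<le> card {e\<in>E. e \<subseteq> C} + 1"
proof -
  let ?R = "{(x, y). \<exists>e\<in>E. x \<in> e \<and> y \<in> e}"
  have *: "n < card C \<Longrightarrow> \<exists>W F. x \<in> W \<and> W \<subseteq> C \<and> card W = Suc n \<and> F \<subseteq> {e\<in>E. e \<subseteq> W} \<and> card F = n" for n
  proof (induction n)
    case 0
    show ?case by (rule exI[of _ "{x}"], rule exI[of _ "{}"]) (auto simp: C)
  next
    case (Suc n)
    then obtain W F where W: "x \<in> W" "W \<subseteq> C" "card W = Suc n" "F \<subseteq> {e\<in>E. e \<subseteq> W}" "card F = n" by auto
    have "\<exists>y z. y \<in> W \<and> z \<notin> W \<and> (y, z) \<in> ?R"
    proof (rule ccontr)
      assume "\<not> ?thesis"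
      then have cl: "\<And>y z. y \<in> W \<Longrightarrow> (y, z) \<in> ?R \<Longrightarrow> z \<in> W" by blast
      have "z \<in> W" if "(x, z) \<in> ?R\<^sup>*" for z
        using that by (induction rule: rtrancl_induct) (use W cl in blast)+
      then have "C \<subseteq> W" unfolding C by blast
      then show False using W Suc.prems by (metis nat_less_le subset_antisym)
    qed
    then obtain y z e where yz: "y \<in> W" "z \<notin> W" "e \<in> E" "y \<in> e" "z \<in> e" by blast
    have e: "e = {y, z}" using E2[OF yz(3)] yz by (auto simp: card_2_iff)
    have "(x, z) \<in> ?R\<^sup>*" using yz W(2) unfolding C by (auto intro: rtrancl_into_rtrancl)
    then have zC: "z \<in> C" unfolding C by blast
    have finW: "finite W" using W finC finite_subset by blast
    have finF: "finite F" using W(4) E finite_subset by fastforce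
    show ?case
      by (rule exI[of _ "insert z W"], rule exI[of _ "insert e F"])
        (use W yz e zC finW finF in \<open>auto simp: card_insert_if\<close>)
  qed
  have "x \<in> C" unfolding C by blast
  then have "card C - 1 < card C" using finC by (auto simp: card_gt_0_iff intro!: diff_less)
  from *[OF this] obtain W F where W: "W \<subseteq> C" "F \<subseteq> {e\<in>E. e \<subseteq> W}" "card F = card C - 1" by blast
  have "card F \<le> card {e\<in>E. e \<subseteq> C}" by (rule card_mono) (use W E in auto)
  then show ?thesis using W by linarith
qed

definition graph_rel :: "'a set set \<Rightarrow> ('a \<times> 'a) set" where
  "graph_rel E = {(x, y). \<exists>e\<in>E. x \<in> e \<and> y \<in> e}"

lemma sym_graph_rel: "sym ((graph_rel E)\<^sup>*)"
  by (rule sym_rtrancl) (auto simp: graph_rel_def sym_def)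

lemma graph_rel_closed:
  assumes "(x, y) \<in> (graph_rel E)\<^sup>*" and "saturated K E" and "x \<in> K"
  shows "y \<in> K"
  using assms(1) by (induction rule: rtrancl_induct) (use assms(2,3) in \<open>auto simp: graph_rel_def saturated_def\<close>)

lemma saturated_Compl: "saturated (- K) E \<longleftrightarrow> saturated K E"
  unfolding saturated_def by blast

lemma graph_component_eqI:
  assumes "z \<in> (graph_rel E)\<^sup>* `` {x}" and "z \<in> (graph_rel E)\<^sup>* `` {y}"
  shows "(graph_rel E)\<^sup>* `` {x} = (graph_rel E)\<^sup>* `` {y}"
proof -
  have "(x, y) \<in> (graph_rel E)\<^sup>*"
    using assms sym_graph_rel[of E] by (meson Image_singleton_iff rtrancl_trans symD)
  then show ?thesis
    using sym_graph_rel[of E] by (auto intro: rtrancl_trans dest: symD)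
qed

lemma partition_on_components: "partition_on (\<Union>E) (\<Union>E // (graph_rel E)\<^sup>*)"
proof -
  have *: "y \<in> \<Union>E" if "(x, y) \<in> (graph_rel E)\<^sup>*" "x \<in> \<Union>E" for x y
    using that by (induction rule: rtrancl_induct) (auto simp: graph_rel_def)
  show ?thesis unfolding partition_on_def
  proof (intro conjI)
    show "\<Union>(\<Union>E // (graph_rel E)\<^sup>*) = \<Union>E"
    proof
      show "\<Union>(\<Union>E // (graph_rel E)\<^sup>*) \<subseteq> \<Union>E" using * unfolding quotient_def by blast
      show "\<Union>E \<subseteq> \<Union>(\<Union>E // (graph_rel E)\<^sup>*)" unfolding quotient_def by blast
    qed
    show "disjoint (\<Union>E // (graph_rel E)\<^sup>*)"
      unfolding disjoint_def quotient_def using graph_component_eqI[of _ E] by fast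
    show "{} \<notin> \<Union>E // (graph_rel E)\<^sup>*" unfolding quotient_def by blast
  qed
qed

text \<open>An edge lies inside one component, and a component cannot leave a set that no edge
  leaves. Components are defined by a transitive closure; this equivalence reduces colourings that
  are constant on components to a condition on single edges, which splits into one condition for
  each of the two stacked diagrams.\<close>

lemma saturated_components: "saturated K (\<Union>E // (graph_rel E)\<^sup>*) \<longleftrightarrow> saturated K E"
proof
  assume K: "saturated K (\<Union>E // (graph_rel E)\<^sup>*)"
  show "saturated K E" unfolding saturated_def
  proof
    fix e assume e: "e \<in> E"
    show "e \<subseteq> K \<or> e \<inter> K = {}"
    proof (cases "e = {}")
      case False
      then obtain x where x: "x \<in> e" by blast
      then have "e \<subseteq> (graph_rel E)\<^sup>* `` {x}" using e by (auto simp: graph_rel_def)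
      moreover have "(graph_rel E)\<^sup>* `` {x} \<in> \<Union>E // (graph_rel E)\<^sup>*" using x e by (auto simp: quotient_def)
      ultimately show ?thesis using K unfolding saturated_def by blast
    qed simp
  qed
next
  assume K: "saturated K E"
  show "saturated K (\<Union>E // (graph_rel E)\<^sup>*)" unfolding saturated_def
  proof
    fix C assume "C \<in> \<Union>E // (graph_rel E)\<^sup>*"
    then obtain x where C: "C = (graph_rel E)\<^sup>* `` {x}" by (auto simp: quotient_def)
    show "C \<subseteq> K \<or> C \<inter> K = {}"
    proof (cases "x \<in> K")
      case True then show ?thesis using graph_rel_closed[OF _ K] C by blast
    next
      case False
      then have "y \<notin> K" if "y \<in> C" for y
        using graph_rel_closed[of x y E "- K"] K that C saturated_Compl[of K E] by auto
      then show ?thesis by blast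
    qed
  qed
qed

lemma saturated_image: "saturated K ((\<lambda>e. \<phi> ` e) ` E) \<longleftrightarrow> saturated (\<phi> -` K) E"
proof -
  have "\<phi> ` e \<subseteq> K \<longleftrightarrow> e \<subseteq> \<phi> -` K" "\<phi> ` e \<inter> K = {} \<longleftrightarrow> e \<inter> \<phi> -` K = {}" for e
    by auto
  then show ?thesis unfolding saturated_def by simp
qed

lemma saturated_Un: "saturated K (E \<union> F) \<longleftrightarrow> saturated K E \<and> saturated K F"
  unfolding saturated_def by blast

section \<open>Elementary facts on diagrams and on the graph of two stacked diagrams\<close>

lemma brauer_diagramsD:
  assumes "d \<in> brauer_diagrams p q"
  shows "\<Union>d = brauer_points p q" and "e \<in> d \<Longrightarrow> card e = 2" and "finite d"
    and "e \<in> d \<Longrightarrow> e' \<in> d \<Longrightarrow> e \<noteq> e' \<Longrightarrow> e \<inter> e' = {}" and "e \<in> d \<Longrightarrow> finite e"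
proof -
  have 1: "finite (brauer_points p q)" by (simp add: brauer_points_def)
  show "\<Union>d = brauer_points p q" and 2: "e \<in> d \<Longrightarrow> card e = 2"
    "e \<in> d \<Longrightarrow> e' \<in> d \<Longrightarrow> e \<noteq> e' \<Longrightarrow> e \<inter> e' = {}"
    using assms by (auto simp: brauer_diagrams_def partition_on_def disjoint_def)
  then show "finite d" using 1 by (metis finite_UnionD)
  show "e \<in> d \<Longrightarrow> finite e" using 2 by (metis card.infinite zero_neq_numeral)
qed

lemma brauer_diagramsI:
  assumes "\<Union>d = brauer_points p q" and "\<And>e. e \<in> d \<Longrightarrow> card e = 2"
    and "\<And>e e'. e \<in> d \<Longrightarrow> e' \<in> d \<Longrightarrow> e \<inter> e' \<noteq> {} \<Longrightarrow> e = e'"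
  shows "d \<in> brauer_diagrams p q"
proof -
  have "disjoint d" using assms(3) unfolding disjoint_def by blast
  moreover have "{} \<notin> d" using assms(2) by force
  ultimately show ?thesis using assms(1,2) by (simp add: brauer_diagrams_def partition_on_def)
qed

lemma card_Top_Bot:
  assumes "finite A" and "finite B"
  shows "card (Top ` A \<union> Bot ` B) = card A + card B"
proof -
  have "Top ` A \<inter> Bot ` B = {}" by auto
  then show ?thesis using assms by (simp add: card_Un_disjoint card_image inj_on_def)
qed

lemma inj_lower_half: "inj lower_half"
proof (rule injI)
  fix x y show "lower_half x = lower_half y \<Longrightarrow> x = y" by (cases x; cases y) auto
qed

lemma inj_upper_half: "inj upper_half"
proof (rule injI)
  fix x y show "upper_half x = upper_half y \<Longrightarrow> x = y" by (cases x; cases y) auto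
qed

lemma stack_components_eq:
  "stack_components f g = \<Union>(stack_edges f g) // (graph_rel (stack_edges f g))\<^sup>*"
  by (simp add: stack_components_def graph_rel_def)

lemma Union_stack_edges:
  assumes "f \<in> brauer_diagrams b c" and "g \<in> brauer_diagrams a b"
  shows "\<Union>(stack_edges f g) = Upper ` {1..a} \<union> Middle ` {1..b} \<union> Lower ` {1..c}"
proof -
  have "\<Union>(stack_edges f g) = lower_half ` \<Union>f \<union> upper_half ` \<Union>g"
    by (auto simp: stack_edges_def)
  also have "\<dots> = Upper ` {1..a} \<union> Middle ` {1..b} \<union> Lower ` {1..c}"
    unfolding brauer_diagramsD(1)[OF assms(1)] brauer_diagramsD(1)[OF assms(2)] brauer_points_def image_Un image_image
    by auto
  finally show ?thesis .
qed

text \<open>A colouring is given by the sets of coloured top and bottom points, so a diagram becomes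
  a relation between subsets. Read as a 0-1 matrix indexed by subsets, it is the action of the
  diagram on tensor powers of a free module of rank two.\<close>

definition compatible :: "point set set \<Rightarrow> nat set \<Rightarrow> nat set \<Rightarrow> bool" where
  "compatible d A B \<longleftrightarrow> saturated (Top ` A \<union> Bot ` B) d"

lemma saturated_stack_edges:
  "saturated (Upper ` A \<union> Middle ` M \<union> Lower ` B) (stack_edges f g) \<longleftrightarrow>
     compatible g A M \<and> compatible f M B"
proof -
  have "lower_half -` (Upper ` A \<union> Middle ` M \<union> Lower ` B) = Top ` M \<union> Bot ` B"
  proof (rule Set.set_eqI)
    fix x show "x \<in> lower_half -` (Upper ` A \<union> Middle ` M \<union> Lower ` B) \<longleftrightarrow> x \<in> Top ` M \<union> Bot ` B"
      by (cases x) auto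
  qed
  moreover have "upper_half -` (Upper ` A \<union> Middle ` M \<union> Lower ` B) = Top ` A \<union> Bot ` M"
  proof (rule Set.set_eqI)
    fix x show "x \<in> upper_half -` (Upper ` A \<union> Middle ` M \<union> Lower ` B) \<longleftrightarrow> x \<in> Top ` A \<union> Bot ` M"
      by (cases x) auto
  qed
  ultimately show ?thesis
    by (auto simp: stack_edges_def saturated_Un saturated_image compatible_def)
qed

lemma outer_points_iff [simp]: "Top i \<in> outer_points C \<longleftrightarrow> Upper i \<in> C" "Bot i \<in> outer_points C \<longleftrightarrow> Lower i \<in> C"
  by (auto simp: outer_points_def)

text \<open>Translates between the pairs of the composite, which consist of points, and the
  components of the stack, which consist of vertices; the count of extensions takes place among the
  vertices.\<close>

lemma outer_points_subset_iff:
  assumes "C \<subseteq> Upper ` X \<union> Middle ` Y \<union> Lower ` Z"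
  shows "outer_points C \<subseteq> Top ` A \<union> Bot ` B \<longleftrightarrow> C \<inter> (Upper ` X \<union> Lower ` Z) \<subseteq> Upper ` A \<union> Lower ` B"
    and "outer_points C \<inter> (Top ` A \<union> Bot ` B) = {} \<longleftrightarrow> C \<inter> (Upper ` A \<union> Lower ` B) = {}"
    and "outer_points C = {} \<longleftrightarrow> C \<inter> (Upper ` X \<union> Lower ` Z) = {}"
proof -
  have "outer_points C \<subseteq> Top ` A \<union> Bot ` B \<longleftrightarrow> (\<forall>i. Upper i \<in> C \<longrightarrow> i \<in> A) \<and> (\<forall>i. Lower i \<in> C \<longrightarrow> i \<in> B)"
    unfolding outer_points_def by auto
  also have "\<dots> \<longleftrightarrow> C \<inter> (Upper ` X \<union> Lower ` Z) \<subseteq> Upper ` A \<union> Lower ` B" using assms by auto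
  finally show "outer_points C \<subseteq> Top ` A \<union> Bot ` B \<longleftrightarrow> C \<inter> (Upper ` X \<union> Lower ` Z) \<subseteq> Upper ` A \<union> Lower ` B" .
  have "outer_points C \<inter> (Top ` A \<union> Bot ` B) = {} \<longleftrightarrow> (\<forall>i\<in>A. Upper i \<notin> C) \<and> (\<forall>i\<in>B. Lower i \<notin> C)"
    unfolding outer_points_def by auto
  also have "\<dots> \<longleftrightarrow> C \<inter> (Upper ` A \<union> Lower ` B) = {}" by auto
  finally show "outer_points C \<inter> (Top ` A \<union> Bot ` B) = {} \<longleftrightarrow> C \<inter> (Upper ` A \<union> Lower ` B) = {}" .
  have "outer_points C = {} \<longleftrightarrow> (\<forall>i. Upper i \<notin> C) \<and> (\<forall>i. Lower i \<notin> C)"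
    unfolding outer_points_def by auto
  also have "\<dots> \<longleftrightarrow> C \<inter> (Upper ` X \<union> Lower ` Z) = {}" using assms by auto
  finally show "outer_points C = {} \<longleftrightarrow> C \<inter> (Upper ` X \<union> Lower ` Z) = {}" .
qed

text \<open>Colourings of the whole stack that extend given outer colourings are the saturated
  vertex sets with prescribed trace on the outer vertices, and
  \<open>card_saturated_extensions\<close> counts them. In matrix terms, the matrices of
  \<open>g\<close> and \<open>f\<close> multiply to \<open>2 ^ loop_count f g\<close> times the
  matrix of the composite.\<close>

lemma card_compatible_middle:
  assumes f: "f \<in> brauer_diagrams b c" and g: "g \<in> brauer_diagrams a b"
    and A: "A \<subseteq> {1..a}" and B: "B \<subseteq> {1..c}"
  shows "card {M. M \<subseteq> {1..b} \<and> compatible g A M \<and> compatible f M B} =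
    (if compatible (diagram_comp f g) A B then 2 ^ loop_count f g else 0)"
proof -
  let ?V = "Upper ` {1..a} \<union> Middle ` {1..b} \<union> Lower ` {1..c}"
  let ?S = "Upper ` {1..a} \<union> Lower ` {1..c}"
  let ?c = "Upper ` A \<union> Lower ` B"
  let ?P = "stack_components f g"
  have P: "partition_on ?V ?P"
    using partition_on_components[of "stack_edges f g"] unfolding Union_stack_edges[OF f g] stack_components_eq .
  have CV: "C \<subseteq> ?V" if "C \<in> ?P" for C using P that by (auto simp: partition_on_def)
  let ?A = "{M. M \<subseteq> {1..b} \<and> compatible g A M \<and> compatible f M B}"
  let ?B = "{K. K \<subseteq> ?V \<and> saturated K ?P \<and> K \<inter> ?S = ?c}"
  let ?h = "\<lambda>M. Upper ` A \<union> Middle ` M \<union> Lower ` B"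
  have *: "?h (Middle -` K) = K" if "K \<in> ?B" for K
  proof (rule Set.set_eqI)
    fix x
    have "x \<in> K \<inter> ?S \<longleftrightarrow> x \<in> ?c" using that by simp
    then show "x \<in> ?h (Middle -` K) \<longleftrightarrow> x \<in> K"
      using that by (cases x) auto
  qed
  have 1: "?h M \<in> ?B" if M: "M \<in> ?A" for M
  proof -
    have "saturated (?h M) ?P"
      using M by (simp add: stack_components_eq saturated_components saturated_stack_edges)
    moreover have "?h M \<inter> ?S = ?c" using A B by blast
    moreover have "?h M \<subseteq> ?V" using A B M by blast
    ultimately show ?thesis by blast
  qed
  have 2: "Middle -` K \<in> ?A" if K: "K \<in> ?B" for K
  proof -
    have "saturated (?h (Middle -` K)) (stack_edges f g)"
      unfolding *[OF K] using K by (simp add: stack_components_eq saturated_components)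
    moreover have "Middle -` K \<subseteq> {1..b}" using K by auto
    ultimately show ?thesis unfolding saturated_stack_edges by blast
  qed
  have "bij_betw ?h ?A ?B"
  proof (rule bij_betw_byWitness[where f' = "\<lambda>K. Middle -` K"])
    show "\<forall>M\<in>?A. Middle -` ?h M = M" by auto
    show "\<forall>K\<in>?B. ?h (Middle -` K) = K" using * by (rule ballI)
    show "?h ` ?A \<subseteq> ?B" using 1 by (rule image_subsetI)
    show "(\<lambda>K. Middle -` K) ` ?B \<subseteq> ?A" using 2 by (rule image_subsetI)
  qed
  then have "card {M. M \<subseteq> {1..b} \<and> compatible g A M \<and> compatible f M B} =
      card {K. K \<subseteq> ?V \<and> saturated K ?P \<and> K \<inter> ?S = ?c}"
    by (rule bij_betw_same_card)
  also have "\<dots> = (if \<forall>C\<in>?P. C \<inter> ?S \<subseteq> ?c \<or> C \<inter> ?c = {} then 2 ^ card {C\<in>?P. C \<inter> ?S = {}} else 0)"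
    by (rule card_saturated_extensions[OF P]) (use A B in auto)
  also have "(\<forall>C\<in>?P. C \<inter> ?S \<subseteq> ?c \<or> C \<inter> ?c = {}) \<longleftrightarrow>
      (\<forall>C\<in>?P. outer_points C \<subseteq> Top ` A \<union> Bot ` B \<or> outer_points C \<inter> (Top ` A \<union> Bot ` B) = {})"
    by (rule ball_cong[OF refl]) (simp only: outer_points_subset_iff(1,2)[OF CV])
  also have "\<dots> \<longleftrightarrow> compatible (diagram_comp f g) A B"
    unfolding compatible_def saturated_def diagram_comp_def by blast
  also have "{C\<in>?P. C \<inter> ?S = {}} = {C\<in>?P. outer_points C = {}}"
    by (rule Collect_cong, rule conj_cong[OF refl]) (simp only: outer_points_subset_iff(3)[OF CV])
  also have "card \<dots> = loop_count f g"
    unfolding loop_count_def ..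
  finally show ?thesis .
qed

text \<open>Counting replaces the walk along a component. If a component has u upper, m middle and l
  lower vertices, it has (m + l) / 2 edges from \<open>f\<close> and (u + m) / 2 from
  \<open>g\<close>, since the pairs of each diagram cover its points. Then
  \<open>card_connected_le\<close> gives u + l <= 2, and u + l is even, so a component with an outer
  point has exactly two of them.\<close>

lemma diagram_comp_closed:
  assumes f: "f \<in> brauer_diagrams b c" and g: "g \<in> brauer_diagrams a b"
  shows "diagram_comp f g \<in> brauer_diagrams a c"
proof (rule brauer_diagramsI)
  let ?V = "Upper ` {1..a} \<union> Middle ` {1..b} \<union> Lower ` {1..c}"
  let ?P = "stack_components f g"
  have P: "partition_on ?V ?P"
    using partition_on_components[of "stack_edges f g"] unfolding Union_stack_edges[OF f g] stack_components_eq .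
  have "\<Union>(diagram_comp f g) = outer_points (\<Union>?P)"
    unfolding diagram_comp_def by (auto simp: outer_points_def)
  also have "\<dots> = brauer_points a c" using P by (auto simp: partition_on_def outer_points_def brauer_points_def)
  finally show "\<Union>(diagram_comp f g) = brauer_points a c" .
next
  fix e e' assume "e \<in> diagram_comp f g" "e' \<in> diagram_comp f g" "e \<inter> e' \<noteq> {}"
  then obtain C C' where C: "e = outer_points C" "e' = outer_points C'" "C \<in> stack_components f g"
     "C' \<in> stack_components f g" and "outer_points C \<inter> outer_points C' \<noteq> {}"
    unfolding diagram_comp_def by blast
  then have C5: "C \<inter> C' \<noteq> {}" unfolding outer_points_def by auto
  have "disjoint (stack_components f g)"
    using partition_on_components[of "stack_edges f g"] unfolding stack_components_eq partition_on_def by simp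
  then have "C = C'" using disjointD C(3,4) C5 by metis
  then show "e = e'" using C(1,2) by simp
next
  let ?E = "stack_edges f g"
  let ?V = "Upper ` {1..a} \<union> Middle ` {1..b} \<union> Lower ` {1..c}"
  let ?P = "stack_components f g"
  have P: "partition_on ?V ?P"
    using partition_on_components[of "stack_edges f g"] unfolding Union_stack_edges[OF f g] stack_components_eq .
  fix e assume "e \<in> diagram_comp f g"
  then obtain C where C: "C \<in> ?P" "e = outer_points C" "e \<noteq> {}" unfolding diagram_comp_def by blast
  then have CV: "C \<subseteq> ?V" using P by (auto simp: partition_on_def)
  have finC: "finite C" by (rule finite_subset[OF CV]) auto
  obtain x where x: "C = (graph_rel ?E)\<^sup>* `` {x}" using C(1) unfolding stack_components_eq quotient_def by blast
  have finE: "finite ?E" using brauer_diagramsD(3)[OF f] brauer_diagramsD(3)[OF g] by (simp add: stack_edges_def)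
  have E2: "card e = 2" if "e \<in> ?E" for e
    using that brauer_diagramsD(2)[OF f] brauer_diagramsD(2)[OF g]
      card_image[OF inj_on_subset[OF inj_lower_half subset_UNIV]] card_image[OF inj_on_subset[OF inj_upper_half subset_UNIV]]
    by (auto simp: stack_edges_def)
  have le: "card C \<le> card {e\<in>?E. e \<subseteq> C} + 1"
    by (rule card_connected_le[OF finE E2 x[unfolded graph_rel_def] finC])
  have "saturated C ?P" unfolding saturated_def
  proof
    fix D assume "D \<in> ?P"
    then have "D = C \<or> D \<inter> C = {}" using P C(1) by (metis disjointD partition_onD2)
    then show "D \<subseteq> C \<or> D \<inter> C = {}" by blast
  qed
  then have sat: "saturated C ?E"
    by (simp add: saturated_components stack_components_eq)
  let ?U = "{i. Upper i \<in> C}" and ?M = "{i. Middle i \<in> C}" and ?L = "{i. Lower i \<in> C}"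
  have fin: "finite ?U" "finite ?M" "finite ?L"
    using finite_vimageI[OF finC, of Upper] finite_vimageI[OF finC, of Middle] finite_vimageI[OF finC, of Lower]
    by (auto simp: vimage_def inj_def)
  have "C = Upper ` ?U \<union> Middle ` ?M \<union> Lower ` ?L"
  proof (rule Set.set_eqI)
    fix x show "x \<in> C \<longleftrightarrow> x \<in> Upper ` ?U \<union> Middle ` ?M \<union> Lower ` ?L" by (cases x) auto
  qed
  then have "card C = card (Upper ` ?U \<union> Middle ` ?M \<union> Lower ` ?L)" by simp
  also have "\<dots> = card ?U + card ?M + card ?L"
    using fin by (subst card_Un_disjoint; auto simp: card_image inj_on_def)+
  finally have cC: "card C = card ?U + card ?M + card ?L" .
  \<comment> \<open>Since \<open>C\<close> is saturated for the edges, the edges of \<open>f\<close>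
    inside \<open>C\<close> cover exactly its middle and lower vertices, two vertices each.\<close>
  have cf: "2 * card {e\<in>f. lower_half ` e \<subseteq> C} = card ?M + card ?L"
  proof -
    have "\<Union>{e\<in>f. lower_half ` e \<subseteq> C} = Top ` ?M \<union> Bot ` ?L"
    proof
      show "\<Union>{e\<in>f. lower_half ` e \<subseteq> C} \<subseteq> Top ` ?M \<union> Bot ` ?L"
      proof
        fix y assume "y \<in> \<Union>{e\<in>f. lower_half ` e \<subseteq> C}"
        then have "lower_half y \<in> C" by blast
        then show "y \<in> Top ` ?M \<union> Bot ` ?L" by (cases y) auto
      qed
      show "Top ` ?M \<union> Bot ` ?L \<subseteq> \<Union>{e\<in>f. lower_half ` e \<subseteq> C}"
      proof
        fix y assume "y \<in> Top ` ?M \<union> Bot ` ?L"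
        then have y: "lower_half y \<in> C" by auto
        then have "lower_half y \<in> ?V" using CV by blast
        then have "y \<in> brauer_points b c" by (cases y) (auto simp: brauer_points_def)
        then obtain e where e: "e \<in> f" "y \<in> e" using brauer_diagramsD(1)[OF f] by blast
        then have "lower_half ` e \<in> ?E" by (auto simp: stack_edges_def)
        then have "lower_half ` e \<subseteq> C \<or> lower_half ` e \<inter> C = {}" by (rule bspec[OF sat[unfolded saturated_def]])
        moreover have "lower_half y \<in> lower_half ` e \<inter> C" using y e by blast
        ultimately have "lower_half ` e \<subseteq> C" by blast
        with e show "y \<in> \<Union>{e\<in>f. lower_half ` e \<subseteq> C}" by blast
      qed
    qed
    moreover have "2 * card {e\<in>f. lower_half ` e \<subseteq> C} = card (\<Union>{e\<in>f. lower_half ` e \<subseteq> C})"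
      by (rule card_partition) (use brauer_diagramsD[OF f] in auto)
    ultimately show ?thesis using fin by (simp add: card_Top_Bot)
  qed
  have cg: "2 * card {e\<in>g. upper_half ` e \<subseteq> C} = card ?U + card ?M"
  proof -
    have "\<Union>{e\<in>g. upper_half ` e \<subseteq> C} = Top ` ?U \<union> Bot ` ?M"
    proof
      show "\<Union>{e\<in>g. upper_half ` e \<subseteq> C} \<subseteq> Top ` ?U \<union> Bot ` ?M"
      proof
        fix y assume "y \<in> \<Union>{e\<in>g. upper_half ` e \<subseteq> C}"
        then have "upper_half y \<in> C" by blast
        then show "y \<in> Top ` ?U \<union> Bot ` ?M" by (cases y) auto
      qed
      show "Top ` ?U \<union> Bot ` ?M \<subseteq> \<Union>{e\<in>g. upper_half ` e \<subseteq> C}"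
      proof
        fix y assume "y \<in> Top ` ?U \<union> Bot ` ?M"
        then have y: "upper_half y \<in> C" by auto
        then have "upper_half y \<in> ?V" using CV by blast
        then have "y \<in> brauer_points a b" by (cases y) (auto simp: brauer_points_def)
        then obtain e where e: "e \<in> g" "y \<in> e" using brauer_diagramsD(1)[OF g] by blast
        then have "upper_half ` e \<in> ?E" by (auto simp: stack_edges_def)
        then have "upper_half ` e \<subseteq> C \<or> upper_half ` e \<inter> C = {}" by (rule bspec[OF sat[unfolded saturated_def]])
        moreover have "upper_half y \<in> upper_half ` e \<inter> C" using y e by blast
        ultimately have "upper_half ` e \<subseteq> C" by blast
        with e show "y \<in> \<Union>{e\<in>g. upper_half ` e \<subseteq> C}" by blast
      qed
    qed
    moreover have "2 * card {e\<in>g. upper_half ` e \<subseteq> C} = card (\<Union>{e\<in>g. upper_half ` e \<subseteq> C})"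
      by (rule card_partition) (use brauer_diagramsD[OF g] in auto)
    ultimately show ?thesis using fin by (simp add: card_Top_Bot)
  qed
  have "{e\<in>?E. e \<subseteq> C} = (\<lambda>e. lower_half ` e) ` {e\<in>f. lower_half ` e \<subseteq> C} \<union> (\<lambda>e. upper_half ` e) ` {e\<in>g. upper_half ` e \<subseteq> C}"
    unfolding stack_edges_def by blast
  then have "card {e\<in>?E. e \<subseteq> C} \<le> card ((\<lambda>e. lower_half ` e) ` {e\<in>f. lower_half ` e \<subseteq> C})
      + card ((\<lambda>e. upper_half ` e) ` {e\<in>g. upper_half ` e \<subseteq> C})"
    by (simp only: card_Un_le)
  also have "\<dots> \<le> card {e\<in>f. lower_half ` e \<subseteq> C} + card {e\<in>g. upper_half ` e \<subseteq> C}"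
    using brauer_diagramsD(3)[OF f] brauer_diagramsD(3)[OF g] by (intro add_mono card_image_le) auto
  finally have le2: "card ?U + card ?L \<le> 2" using le cC cf cg by linarith
  have ev: "even (card ?U + card ?L)" using cf cg by presburger
  have e: "e = Top ` ?U \<union> Bot ` ?L" using C(2) by (auto simp: outer_points_def)
  have ce: "card e = card ?U + card ?L"
    unfolding e using fin by (simp add: card_Top_Bot)
  have "card e > 0" using C(3) fin e by (simp add: card_gt_0_iff)
  then show "card e = 2" using le2 ev ce by presburger
qed

section \<open>Associativity of composition\<close>

lemma compatible_empty [simp]: "compatible d {} {}"
  by (simp add: compatible_def saturated_def)

lemma compatible_comp_iff:
  assumes "f \<in> brauer_diagrams b c" and "g \<in> brauer_diagrams a b" and "A \<subseteq> {1..a}" and "B \<subseteq> {1..c}"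
  shows "compatible (diagram_comp f g) A B \<longleftrightarrow> (\<exists>M. M \<subseteq> {1..b} \<and> compatible g A M \<and> compatible f M B)"
proof -
  let ?S = "{M. M \<subseteq> {1..b} \<and> compatible g A M \<and> compatible f M B}"
  have "finite ?S" by simp
  then have "?S \<noteq> {} \<longleftrightarrow> card ?S \<noteq> 0" by simp
  also have "\<dots> \<longleftrightarrow> compatible (diagram_comp f g) A B"
    unfolding card_compatible_middle[OF assms] by simp
  finally show ?thesis by blast
qed

text \<open>Colouring only the two ends of one pair is compatible because pairs are disjoint. These
  smallest colourings are the ones that recover a diagram from its relation.\<close>

lemma saturated_block:
  assumes d: "d \<in> brauer_diagrams p q" and e: "e \<in> d"
  shows "\<exists>A B. A \<subseteq> {1..p} \<and> B \<subseteq> {1..q} \<and> e = Top ` A \<union> Bot ` B \<and> compatible d A B"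
proof -
  have ep: "e \<subseteq> brauer_points p q" using brauer_diagramsD(1)[OF d] e by blast
  have 1: "e = Top ` {i. Top i \<in> e} \<union> Bot ` {i. Bot i \<in> e}"
  proof (rule Set.set_eqI)
    fix x show "x \<in> e \<longleftrightarrow> x \<in> Top ` {i. Top i \<in> e} \<union> Bot ` {i. Bot i \<in> e}" by (cases x) auto
  qed
  have "saturated e d" unfolding saturated_def
    using brauer_diagramsD(4)[OF d _ e] by blast
  then have "compatible d {i. Top i \<in> e} {i. Bot i \<in> e}" unfolding compatible_def using 1 by simp
  moreover have "{i. Top i \<in> e} \<subseteq> {1..p}" "{i. Bot i \<in> e} \<subseteq> {1..q}"
    using ep by (auto simp: brauer_points_def)
  ultimately show ?thesis using 1 by blast
qed

lemma brauer_diagrams_subset_eq: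
  assumes "d \<in> brauer_diagrams p q" and "d' \<in> brauer_diagrams p q" and "d \<subseteq> d'"
  shows "d = d'"
proof
  show "d' \<subseteq> d"
  proof
    fix e assume e: "e \<in> d'"
    then have "e \<noteq> {}" using brauer_diagramsD(2)[OF assms(2)] by force
    then obtain x where x: "x \<in> e" by blast
    then have "x \<in> \<Union>d" using brauer_diagramsD(1) assms(1,2) e by blast
    then obtain e' where "e' \<in> d" "x \<in> e'" by blast
    then have "e' = e" using brauer_diagramsD(4)[OF assms(2), of e' e] e x assms(3) by blast
    then show "e \<in> d" using \<open>e' \<in> d\<close> by simp
  qed
qed (use assms in auto)

text \<open>One implication suffices: a pair of \<open>d\<close> is a compatible colouring of
  \<open>d\<close>, hence saturated for \<open>d'\<close>, so it contains the pair of
  \<open>d'\<close> through any of its points, and both have two elements.\<close>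

lemma brauer_diagrams_eqI:
  assumes d: "d \<in> brauer_diagrams p q" and d': "d' \<in> brauer_diagrams p q"
    and eq: "\<And>A B. A \<subseteq> {1..p} \<Longrightarrow> B \<subseteq> {1..q} \<Longrightarrow> compatible d A B \<Longrightarrow> compatible d' A B"
  shows "d = d'"
proof (rule brauer_diagrams_subset_eq[symmetric, OF d' d], rule subsetI)
  fix e assume e: "e \<in> d'"
  then have "e \<noteq> {}" using brauer_diagramsD(2)[OF d'] by force
  then obtain x where x: "x \<in> e" by blast
  then have "x \<in> \<Union>d" using brauer_diagramsD(1)[OF d] brauer_diagramsD(1)[OF d'] e by blast
  then obtain e' where e': "e' \<in> d" "x \<in> e'" by blast
  obtain A B where "A \<subseteq> {1..p}" "B \<subseteq> {1..q}" "e' = Top ` A \<union> Bot ` B" "compatible d A B"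
    using saturated_block[OF d e'(1)] by blast
  then have "saturated e' d'" using eq unfolding compatible_def by blast
  then have "e \<subseteq> e'" using e x e' unfolding saturated_def by blast
  moreover have "card e = card e'" "finite e'"
    using brauer_diagramsD(2)[OF d e'(1)] brauer_diagramsD(2)[OF d' e] brauer_diagramsD(5)[OF d e'(1)] by auto
  ultimately have "e = e'" by (simp add: card_subset_eq)
  then show "e \<in> d" using e' by simp
qed

text \<open>The pair through \<open>Top i\<close> is itself a compatible colouring, and the
  hypothesis forces it to contain \<open>Bot j\<close>. This exhibits a strand of a composite
  without tracing it.\<close>

lemma through_edgeI:
  assumes d: "d \<in> brauer_diagrams p q" and i: "i \<in> {1..p}"
    and eq: "\<And>A B. A \<subseteq> {1..p} \<Longrightarrow> B \<subseteq> {1..q} \<Longrightarrow> compatible d A B \<Longrightarrow> i \<in> A \<longleftrightarrow> j \<in> B"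
  shows "{Top i, Bot j} \<in> d"
proof -
  have "Top i \<in> \<Union>d" using brauer_diagramsD(1)[OF d] i by (simp add: brauer_points_def)
  then obtain e where e: "e \<in> d" "Top i \<in> e" by blast
  obtain A B where AB: "A \<subseteq> {1..p}" "B \<subseteq> {1..q}" "e = Top ` A \<union> Bot ` B" "compatible d A B"
    using saturated_block[OF d e(1)] by blast
  have "i \<in> A" using e AB by auto
  then have "j \<in> B" using eq AB by blast
  then have "{Top i, Bot j} \<subseteq> e" using AB e by auto
  then have "{Top i, Bot j} = e" using brauer_diagramsD(2)[OF d e(1)] brauer_diagramsD(5)[OF d e(1)]
    by (intro card_subset_eq) auto
  then show ?thesis using e by simp
qed

lemma through_edgeD:
  assumes "{Top i, Bot j} \<in> d" and "compatible d A B"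
  shows "i \<in> A \<longleftrightarrow> j \<in> B"
  using assms unfolding compatible_def saturated_def by auto

lemma diagram_comp_assoc:
  assumes f: "f \<in> brauer_diagrams c e" and g: "g \<in> brauer_diagrams b c" and h: "h \<in> brauer_diagrams a b"
  shows "diagram_comp (diagram_comp f g) h = diagram_comp f (diagram_comp g h)"
proof (rule brauer_diagrams_eqI)
  note fg = diagram_comp_closed[OF f g] and gh = diagram_comp_closed[OF g h]
  show "diagram_comp (diagram_comp f g) h \<in> brauer_diagrams a e" by (rule diagram_comp_closed[OF fg h])
  show "diagram_comp f (diagram_comp g h) \<in> brauer_diagrams a e" by (rule diagram_comp_closed[OF f gh])
  fix A B assume AB: "A \<subseteq> {1..a}" "B \<subseteq> {1..e}"
  assume "compatible (diagram_comp (diagram_comp f g) h) A B"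
  then obtain M where M: "M \<subseteq> {1..b}" "compatible h A M" "compatible (diagram_comp f g) M B"
    unfolding compatible_comp_iff[OF fg h AB] by blast
  then obtain N where N: "N \<subseteq> {1..c}" "compatible g M N" "compatible f N B"
    unfolding compatible_comp_iff[OF f g M(1) AB(2)] by blast
  have "compatible (diagram_comp g h) A N" unfolding compatible_comp_iff[OF g h AB(1) N(1)] using M N by blast
  then show "compatible (diagram_comp f (diagram_comp g h)) A B"
    unfolding compatible_comp_iff[OF f gh AB] using N by blast
qed

text \<open>Both sides count the pairs of middle colourings of the triple stack whose outer points
  are all uncoloured.\<close>

lemma loop_count_assoc:
  assumes f: "f \<in> brauer_diagrams c e" and g: "g \<in> brauer_diagrams b c" and h: "h \<in> brauer_diagrams a b"
  shows "loop_count f g + loop_count (diagram_comp f g) h = loop_count g h + loop_count f (diagram_comp g h)"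
proof -
  note fg = diagram_comp_closed[OF f g] and gh = diagram_comp_closed[OF g h]
  let ?X = "{(M, N). M \<subseteq> {1..b} \<and> N \<subseteq> {1..c} \<and> compatible h {} M \<and> compatible g M N \<and> compatible f N {}}"
  have finX: "finite ?X" by (rule finite_subset[of _ "Pow {1..b} \<times> Pow {1..c}"]) auto
  have "card ?X = card (SIGMA M:{M. M \<subseteq> {1..b} \<and> compatible h {} M}. {N. N \<subseteq> {1..c} \<and> compatible g M N \<and> compatible f N {}})"
    by (rule arg_cong[of _ _ card]) auto
  also have "\<dots> = (\<Sum>M\<in>{M. M \<subseteq> {1..b} \<and> compatible h {} M}. card {N. N \<subseteq> {1..c} \<and> compatible g M N \<and> compatible f N {}})"
    by (rule card_SigmaI) auto
  also have "\<dots> = (\<Sum>M\<in>{M. M \<subseteq> {1..b} \<and> compatible h {} M}. if compatible (diagram_comp f g) M {} then 2 ^ loop_count f g else 0)"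
    by (rule sum.cong[OF refl], rule card_compatible_middle[OF f g]) auto
  also have "\<dots> = 2 ^ loop_count f g * card {M. M \<subseteq> {1..b} \<and> compatible h {} M \<and> compatible (diagram_comp f g) M {}}"
    by (simp add: sum.If_cases Int_def conj_assoc)
  also have "\<dots> = 2 ^ loop_count f g * 2 ^ loop_count (diagram_comp f g) h"
    by (subst card_compatible_middle[OF fg h]) auto
  finally have 1: "card ?X = 2 ^ (loop_count f g + loop_count (diagram_comp f g) h)" by (simp add: power_add)
  have "card ?X = card (prod.swap ` ?X)" by (simp add: card_image)
  also have "prod.swap ` ?X = (SIGMA N:{N. N \<subseteq> {1..c} \<and> compatible f N {}}. {M. M \<subseteq> {1..b} \<and> compatible h {} M \<and> compatible g M N})"
    by (auto simp: image_iff)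
  also have "card \<dots> = (\<Sum>N\<in>{N. N \<subseteq> {1..c} \<and> compatible f N {}}. card {M. M \<subseteq> {1..b} \<and> compatible h {} M \<and> compatible g M N})"
    by (rule card_SigmaI) auto
  also have "\<dots> = (\<Sum>N\<in>{N. N \<subseteq> {1..c} \<and> compatible f N {}}. if compatible (diagram_comp g h) {} N then 2 ^ loop_count g h else 0)"
    by (rule sum.cong[OF refl], rule card_compatible_middle[OF g h]) auto
  also have "\<dots> = 2 ^ loop_count g h * card {N. N \<subseteq> {1..c} \<and> compatible (diagram_comp g h) {} N \<and> compatible f N {}}"
    by (simp add: sum.If_cases Int_def conj_assoc conj_commute[of "compatible f _ _"])
  also have "\<dots> = 2 ^ loop_count g h * 2 ^ loop_count f (diagram_comp g h)"
    by (subst card_compatible_middle[OF f gh]) auto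
  finally have "card ?X = 2 ^ (loop_count g h + loop_count f (diagram_comp g h))" by (simp add: power_add)
  then have "(2::nat) ^ (loop_count f g + loop_count (diagram_comp f g) h) = 2 ^ (loop_count g h + loop_count f (diagram_comp g h))"
    using 1 by simp
  then show ?thesis by (simp only: power_inject_exp')
qed

text \<open>A closed loop coloured on its own would be a nonempty colouring of the middle points. In
  terms of the count, \<open>2 ^ loop_count f g\<close> equals 1.\<close>

lemma loop_count_eq_0I:
  assumes f: "f \<in> brauer_diagrams b c" and g: "g \<in> brauer_diagrams a b"
    and "\<And>M. M \<subseteq> {1..b} \<Longrightarrow> compatible g {} M \<Longrightarrow> compatible f M {} \<Longrightarrow> M = {}"
  shows "loop_count f g = 0"
proof -
  have "{M. M \<subseteq> {1..b} \<and> compatible g {} M \<and> compatible f M {}} = {{}}"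
    using assms(3) by auto
  then have "(2::nat) ^ loop_count f g = 1"
    using card_compatible_middle[OF f g, of "{}" "{}"] by simp
  then show ?thesis by simp
qed

section \<open>Reflection of diagrams and permutation diagrams\<close>

lemma flip_point_flip_point [simp]: "flip_point (flip_point x) = x"
  by (cases x) auto

lemma inj_flip_point: "inj flip_point"
  by (rule injI) (metis flip_point_flip_point)

lemma flip_diagram_flip_diagram [simp]: "flip_diagram (flip_diagram d) = d"
  by (simp add: flip_diagram_def image_image)

lemma flip_diagram_closed:
  assumes d: "d \<in> brauer_diagrams p q"
  shows "flip_diagram d \<in> brauer_diagrams q p"
proof (rule brauer_diagramsI)
  have "\<Union>(flip_diagram d) = flip_point ` \<Union>d" by (auto simp: flip_diagram_def)
  also have "\<dots> = brauer_points q p" unfolding brauer_diagramsD(1)[OF d]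
    by (auto simp: brauer_points_def image_Un image_image)
  finally show "\<Union>(flip_diagram d) = brauer_points q p" .
  show "card e = 2" if "e \<in> flip_diagram d" for e
    using that brauer_diagramsD(2)[OF d] card_image[OF inj_on_subset[OF inj_flip_point subset_UNIV]]
    by (auto simp: flip_diagram_def)
  fix e e' assume "e \<in> flip_diagram d" "e' \<in> flip_diagram d" and ne: "e \<inter> e' \<noteq> {}"
  then obtain a a' where a: "a \<in> d" "a' \<in> d" "e = flip_point ` a" "e' = flip_point ` a'"
    by (auto simp: flip_diagram_def)
  then have "a \<inter> a' \<noteq> {}" using ne by (auto simp: image_Int[OF inj_flip_point, symmetric])
  then have "a = a'" using brauer_diagramsD(4)[OF d a(1,2)] by blast
  then show "e = e'" using a by simp
qed

lemma compatible_flip [simp]: "compatible (flip_diagram d) A B \<longleftrightarrow> compatible d B A"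
proof -
  have "flip_point -` (Top ` A \<union> Bot ` B) = Top ` B \<union> Bot ` A"
  proof (rule Set.set_eqI)
    fix x show "x \<in> flip_point -` (Top ` A \<union> Bot ` B) \<longleftrightarrow> x \<in> Top ` B \<union> Bot ` A"
      by (cases x) auto
  qed
  then show ?thesis by (simp add: compatible_def flip_diagram_def saturated_image)
qed

lemma flip_diagram_comp:
  assumes f: "f \<in> brauer_diagrams b c" and g: "g \<in> brauer_diagrams a b"
  shows "flip_diagram (diagram_comp f g) = diagram_comp (flip_diagram g) (flip_diagram f)"
proof (rule brauer_diagrams_eqI)
  show "flip_diagram (diagram_comp f g) \<in> brauer_diagrams c a"
    by (rule flip_diagram_closed[OF diagram_comp_closed[OF f g]])
  show "diagram_comp (flip_diagram g) (flip_diagram f) \<in> brauer_diagrams c a"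
    by (rule diagram_comp_closed[OF flip_diagram_closed[OF g] flip_diagram_closed[OF f]])
  fix A B assume AB: "A \<subseteq> {1..c}" "B \<subseteq> {1..a}" and "compatible (flip_diagram (diagram_comp f g)) A B"
  then show "compatible (diagram_comp (flip_diagram g) (flip_diagram f)) A B"
    unfolding compatible_flip compatible_comp_iff[OF f g AB(2,1)]
      compatible_comp_iff[OF flip_diagram_closed[OF g] flip_diagram_closed[OF f] AB] by blast
qed

lemma perm_diagram_image: "perm_diagram p \<sigma> = (\<lambda>i. {Top i, Bot (\<sigma> i)}) ` {1..p}"
  by (simp only: perm_diagram_def Setcompr_eq_image)

lemma perm_diagram_closed:
  assumes \<sigma>: "\<sigma> permutes {1..p}"
  shows "perm_diagram p \<sigma> \<in> brauer_diagrams p p"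
proof (rule brauer_diagramsI)
  have "\<Union>(perm_diagram p \<sigma>) = Top ` {1..p} \<union> Bot ` \<sigma> ` {1..p}" unfolding perm_diagram_image by blast
  then show "\<Union>(perm_diagram p \<sigma>) = brauer_points p p"
    using permutes_image[OF \<sigma>] by (simp add: brauer_points_def)
  show "card e = 2" if "e \<in> perm_diagram p \<sigma>" for e using that unfolding perm_diagram_image by force
  show "e = e'" if "e \<in> perm_diagram p \<sigma>" "e' \<in> perm_diagram p \<sigma>" "e \<inter> e' \<noteq> {}" for e e'
    using that permutes_inj[OF \<sigma>] by (auto simp: perm_diagram_def inj_def)
qed

lemma compatible_perm_diagram:
  assumes \<sigma>: "\<sigma> permutes {1..p}" and "A \<subseteq> {1..p}" "B \<subseteq> {1..p}"
  shows "compatible (perm_diagram p \<sigma>) A B \<longleftrightarrow> B = \<sigma> ` A"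
proof -
  have "compatible (perm_diagram p \<sigma>) A B \<longleftrightarrow> (\<forall>i\<in>{1..p}. i \<in> A \<longleftrightarrow> \<sigma> i \<in> B)"
    unfolding compatible_def saturated_def perm_diagram_image ball_simps by auto
  also have "\<dots> \<longleftrightarrow> B = \<sigma> ` A"
  proof
    assume *: "\<forall>i\<in>{1..p}. i \<in> A \<longleftrightarrow> \<sigma> i \<in> B"
    show "B = \<sigma> ` A"
    proof
      show "\<sigma> ` A \<subseteq> B" using * assms by blast
      show "B \<subseteq> \<sigma> ` A"
      proof
        fix j assume j: "j \<in> B"
        then obtain i where "i \<in> {1..p}" "j = \<sigma> i" using permutes_image[OF \<sigma>] assms by blast
        then show "j \<in> \<sigma> ` A" using * j by blast
      qed
    qed
  next
    assume "B = \<sigma> ` A"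
    then show "\<forall>i\<in>{1..p}. i \<in> A \<longleftrightarrow> \<sigma> i \<in> B" using permutes_inj[OF \<sigma>] by (auto simp: inj_def)
  qed
  finally show ?thesis .
qed

lemma identity_diagram_eq: "identity_diagram p = perm_diagram p id"
  by (simp add: identity_diagram_def perm_diagram_def)

lemma compatible_comp_perm:
  assumes f: "f \<in> brauer_diagrams p q" and \<sigma>: "\<sigma> permutes {1..p}" and AB: "A \<subseteq> {1..p}" "B \<subseteq> {1..q}"
  shows "compatible (diagram_comp f (perm_diagram p \<sigma>)) A B \<longleftrightarrow> compatible f (\<sigma> ` A) B"
proof -
  have "\<sigma> ` A \<subseteq> {1..p}" using permutes_image[OF \<sigma>] AB by blast
  then show ?thesis
    unfolding compatible_comp_iff[OF f perm_diagram_closed[OF \<sigma>] AB]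
    using compatible_perm_diagram[OF \<sigma> AB(1)] by blast
qed

lemma comp_identity_right:
  assumes f: "f \<in> brauer_diagrams p q"
  shows "diagram_comp f (perm_diagram p id) = f"
proof (rule brauer_diagrams_eqI)
  show "diagram_comp f (perm_diagram p id) \<in> brauer_diagrams p q"
    by (rule diagram_comp_closed[OF f perm_diagram_closed[OF permutes_id]])
  show "compatible f A B" if "A \<subseteq> {1..p}" "B \<subseteq> {1..q}" "compatible (diagram_comp f (perm_diagram p id)) A B" for A B
    using that(3) unfolding compatible_comp_perm[OF f permutes_id that(1,2)] by simp
qed (rule f)

lemma perm_diagram_comp:
  assumes \<sigma>: "\<sigma> permutes {1..p}" and \<tau>: "\<tau> permutes {1..p}"
  shows "diagram_comp (perm_diagram p \<sigma>) (perm_diagram p \<tau>) = perm_diagram p (\<sigma> \<circ> \<tau>)"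
proof (rule brauer_diagrams_eqI)
  note cl = perm_diagram_closed[OF \<sigma>] perm_diagram_closed[OF \<tau>]
  show "diagram_comp (perm_diagram p \<sigma>) (perm_diagram p \<tau>) \<in> brauer_diagrams p p"
    by (rule diagram_comp_closed[OF cl])
  show "perm_diagram p (\<sigma> \<circ> \<tau>) \<in> brauer_diagrams p p"
    by (rule perm_diagram_closed[OF permutes_compose[OF \<tau> \<sigma>]])
  fix A B assume AB: "A \<subseteq> {1..p}" "B \<subseteq> {1..p}"
  have "\<tau> ` A \<subseteq> {1..p}" using permutes_image[OF \<tau>] AB by blast
  moreover assume "compatible (diagram_comp (perm_diagram p \<sigma>) (perm_diagram p \<tau>)) A B"
  ultimately have "B = (\<sigma> \<circ> \<tau>) ` A"
    unfolding compatible_comp_perm[OF cl(1) \<tau> AB] using compatible_perm_diagram[OF \<sigma> _ AB(2)] by (simp add: image_comp)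
  then show "compatible (perm_diagram p (\<sigma> \<circ> \<tau>)) A B"
    unfolding compatible_perm_diagram[OF permutes_compose[OF \<tau> \<sigma>] AB] .
qed

lemma flip_perm_diagram:
  assumes \<sigma>: "\<sigma> permutes {1..p}"
  shows "flip_diagram (perm_diagram p \<sigma>) = perm_diagram p (inv' \<sigma>)"
proof (rule brauer_diagrams_eqI)
  show "flip_diagram (perm_diagram p \<sigma>) \<in> brauer_diagrams p p"
    by (rule flip_diagram_closed[OF perm_diagram_closed[OF \<sigma>]])
  show "perm_diagram p (inv' \<sigma>) \<in> brauer_diagrams p p"
    by (rule perm_diagram_closed[OF permutes_inv[OF \<sigma>]])
  fix A B assume AB: "A \<subseteq> {1..p}" "B \<subseteq> {1..p}"
  assume "compatible (flip_diagram (perm_diagram p \<sigma>)) A B"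
  then have "A = \<sigma> ` B" unfolding compatible_flip compatible_perm_diagram[OF \<sigma> AB(2,1)] .
  then have "B = inv' \<sigma> ` A" using permutes_inv_o(2)[OF \<sigma>] by (simp add: image_comp)
  then show "compatible (perm_diagram p (inv' \<sigma>)) A B"
    unfolding compatible_perm_diagram[OF permutes_inv[OF \<sigma>] AB] .
qed

lemma perm_diagram_inj:
  assumes "\<sigma> permutes {1..p}" and "\<tau> permutes {1..p}" and eq: "perm_diagram p \<sigma> = perm_diagram p \<tau>"
  shows "\<sigma> = \<tau>"
proof
  fix i show "\<sigma> i = \<tau> i"
  proof (cases "i \<in> {1..p}")
    case True
    then have "{Top i, Bot (\<sigma> i)} \<in> perm_diagram p \<sigma>" unfolding perm_diagram_image by (rule imageI)
    then have "{Top i, Bot (\<sigma> i)} \<in> perm_diagram p \<tau>" using eq by simp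
    then obtain j where "{Top i, Bot (\<sigma> i)} = {Top j, Bot (\<tau> j)}" unfolding perm_diagram_image by (rule imageE)
    then show ?thesis by (auto simp: doubleton_eq_iff)
  next
    case False then show ?thesis using permutes_not_in[OF assms(1)] permutes_not_in[OF assms(2)] by simp
  qed
qed

lemma comp_identity_left:
  assumes f: "f \<in> brauer_diagrams p q"
  shows "diagram_comp (perm_diagram q id) f = f"
proof -
  have "diagram_comp (perm_diagram q id) f = flip_diagram (flip_diagram (diagram_comp (perm_diagram q id) f))" by simp
  also have "\<dots> = flip_diagram (diagram_comp (flip_diagram f) (perm_diagram q id))"
    using flip_diagram_comp[OF perm_diagram_closed[OF permutes_id] f] flip_perm_diagram[OF permutes_id] by simp
  also have "\<dots> = f" using comp_identity_right[OF flip_diagram_closed[OF f]] by simp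
  finally show ?thesis .
qed

section \<open>Factorization through upward diagrams\<close>

definition upward_diagrams :: "nat \<Rightarrow> nat \<Rightarrow> point set set set" where
  "upward_diagrams p q = {d \<in> brauer_diagrams p q. upward d}"

lemma upward_diagramsD: "u \<in> upward_diagrams p q \<Longrightarrow> u \<in> brauer_diagrams p q"
  by (simp add: upward_diagrams_def)

lemma upward_partner:
  assumes u: "u \<in> upward_diagrams p q" and i: "i \<in> {1..p}"
  obtains j where "j \<in> {1..q}" and "{Top i, Bot j} \<in> u"
proof -
  have d: "u \<in> brauer_diagrams p q" and up: "upward u" using u by (auto simp: upward_diagrams_def)
  have "Top i \<in> \<Union>u" using brauer_diagramsD(1)[OF d] i by (simp add: brauer_points_def)
  then obtain e where e: "e \<in> u" "Top i \<in> e" by blast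
  then obtain y where y: "e = {Top i, y}" using brauer_diagramsD(2)[OF d e(1)] by (auto simp: card_2_iff)
  then obtain j where j: "y = Bot j" using up e by (cases y) (auto simp: upward_def)
  have "y \<in> brauer_points p q" using brauer_diagramsD(1)[OF d] e y by blast
  then show ?thesis using that e y j by (auto simp: brauer_points_def)
qed

lemma upward_partner_unique:
  assumes d: "u \<in> brauer_diagrams p q"
  shows "{Top i, Bot j} \<in> u \<Longrightarrow> {Top i, Bot j'} \<in> u \<Longrightarrow> j = j'"
    and "{Top i, Bot j} \<in> u \<Longrightarrow> {Top i', Bot j} \<in> u \<Longrightarrow> i = i'"
proof -
  show "j = j'" if "{Top i, Bot j} \<in> u" "{Top i, Bot j'} \<in> u"
  proof (rule ccontr)
    assume "j \<noteq> j'"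
    then have "{Top i, Bot j} \<noteq> {Top i, Bot j'}" by (auto simp: doubleton_eq_iff)
    then show False using brauer_diagramsD(4)[OF d that] by blast
  qed
  show "i = i'" if "{Top i, Bot j} \<in> u" "{Top i', Bot j} \<in> u"
  proof (rule ccontr)
    assume "i \<noteq> i'"
    then have "{Top i, Bot j} \<noteq> {Top i', Bot j}" by (auto simp: doubleton_eq_iff)
    then show False using brauer_diagramsD(4)[OF d that] by blast
  qed
qed

text \<open>Every top point is joined to a bottom point and takes its colour from there. With
  \<open>upward_compatible_ex\<close>, the relation of an upward diagram is total on top colourings
  and injective.\<close>

lemma upward_compatible_inj:
  assumes u: "u \<in> upward_diagrams p q" and "A \<subseteq> {1..p}" "A' \<subseteq> {1..p}"
    and "compatible u A B" "compatible u A' B"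
  shows "A = A'"
proof -
  have "i \<in> A \<longleftrightarrow> i \<in> A'" if i: "i \<in> {1..p}" for i
  proof -
    obtain j where "{Top i, Bot j} \<in> u" using upward_partner[OF u i] by blast
    then show ?thesis using through_edgeD assms(4,5) by metis
  qed
  then show ?thesis using assms(2,3) by blast
qed

lemma upward_compatible_ex:
  assumes u: "u \<in> upward_diagrams p q" and A: "A \<subseteq> {1..p}"
  shows "\<exists>B. B \<subseteq> {1..q} \<and> compatible u A B"
proof -
  have d: "u \<in> brauer_diagrams p q" and up: "upward u" using u by (auto simp: upward_diagrams_def)
  \<comment> \<open>The partners of \<open>A\<close> are forced; the ends of bottom-bottom pairs may
    all stay uncoloured.\<close>
  let ?B = "{j\<in>{1..q}. \<exists>i\<in>A. {Top i, Bot j} \<in> u}"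
  let ?K = "Top ` A \<union> Bot ` ?B"
  have "e \<subseteq> ?K \<or> e \<inter> ?K = {}" if e: "e \<in> u" for e
  proof (cases "\<exists>i. Top i \<in> e")
    case True
    then obtain i where i: "Top i \<in> e" by blast
    then have "Top i \<in> brauer_points p q" using brauer_diagramsD(1)[OF d] e by blast
    then have ip: "i \<in> {1..p}" by (auto simp: brauer_points_def)
    then obtain j where j: "j \<in> {1..q}" "{Top i, Bot j} \<in> u" using upward_partner[OF u] by blast
    then have e': "e = {Top i, Bot j}" using brauer_diagramsD(4)[OF d e j(2)] i by blast
    have "j \<in> ?B \<longleftrightarrow> i \<in> A" using j upward_partner_unique(2)[OF d j(2)] by blast
    then show ?thesis unfolding e' by auto
  next
    case False
    have "Bot j \<notin> ?K" if "Bot j \<in> e" for j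
    proof
      assume "Bot j \<in> ?K"
      then obtain i where "{Top i, Bot j} \<in> u" by auto
      then have "e = {Top i, Bot j}" using brauer_diagramsD(4)[OF d e] that by blast
      then show False using False by blast
    qed
    moreover have "x \<in> range Bot" if "x \<in> e" for x using False that by (cases x) auto
    ultimately show ?thesis by blast
  qed
  then have "compatible u A ?B" unfolding compatible_def saturated_def by blast
  moreover have "?B \<subseteq> {1..q}" by auto
  ultimately show ?thesis by (intro exI[of _ ?B] conjI)
qed

text \<open>A pair of two top points would block the colouring of just one of them. Upward thus
  means that every top colouring extends downwards, a property that is inherited by composites and
  that passes from a composite to the factor applied first; \<open>upward_comp\<close> and
  \<open>upward_comp_right\<close> rest on this.\<close>

lemma upward_diagramsI:
  assumes d: "u \<in> brauer_diagrams p q" and ex: "\<And>A. A \<subseteq> {1..p} \<Longrightarrow> \<exists>B. B \<subseteq> {1..q} \<and> compatible u A B"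
  shows "u \<in> upward_diagrams p q"
proof -
  have "{Top i, Top k} \<notin> u" for i k
  proof
    assume e: "{Top i, Top k} \<in> u"
    then have ik: "i \<noteq> k" using brauer_diagramsD(2)[OF d e] by auto
    have "Top i \<in> brauer_points p q" using brauer_diagramsD(1)[OF d] e by blast
    then have "{i} \<subseteq> {1..p}" by (auto simp: brauer_points_def)
    then obtain B where "compatible u {i} B" using ex by blast
    then show False using e ik unfolding compatible_def saturated_def by auto
  qed
  then show ?thesis using d by (simp add: upward_diagrams_def upward_def)
qed

lemma upward_comp:
  assumes f: "f \<in> upward_diagrams b c" and g: "g \<in> upward_diagrams a b"
  shows "diagram_comp f g \<in> upward_diagrams a c"
proof (rule upward_diagramsI)
  note fg = upward_diagramsD[OF f] upward_diagramsD[OF g]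
  show "diagram_comp f g \<in> brauer_diagrams a c" by (rule diagram_comp_closed[OF fg])
  fix A assume A: "A \<subseteq> {1..a}"
  then obtain M where M: "M \<subseteq> {1..b}" "compatible g A M" using upward_compatible_ex[OF g] by blast
  then obtain B where "B \<subseteq> {1..c}" "compatible f M B" using upward_compatible_ex[OF f] by blast
  then show "\<exists>B. B \<subseteq> {1..c} \<and> compatible (diagram_comp f g) A B"
    using compatible_comp_iff[OF fg A] M by blast
qed

lemma upward_comp_right:
  assumes f: "f \<in> brauer_diagrams b c" and g: "g \<in> brauer_diagrams a b"
    and fg: "diagram_comp f g \<in> upward_diagrams a c"
  shows "g \<in> upward_diagrams a b"
proof (rule upward_diagramsI[OF g])
  fix A assume A: "A \<subseteq> {1..a}"
  then obtain B where "B \<subseteq> {1..c}" "compatible (diagram_comp f g) A B" using upward_compatible_ex[OF fg] by blast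
  then show "\<exists>B. B \<subseteq> {1..b} \<and> compatible g A B"
    using compatible_comp_iff[OF f g A] by blast
qed

text \<open>A loop would have to turn back inside \<open>f\<close> through a pair of top points, and
  there is none.\<close>

lemma loop_count_upward_left:
  assumes f: "f \<in> upward_diagrams b c" and g: "g \<in> brauer_diagrams a b"
  shows "loop_count f g = 0"
proof (rule loop_count_eq_0I[OF upward_diagramsD[OF f] g])
  fix M assume "M \<subseteq> {1..b}" "compatible f M {}"
  then show "M = {}" using upward_compatible_inj[OF f _ empty_subsetI _ compatible_empty] by simp
qed

lemma loop_count_flip_upward_right:
  assumes f: "f \<in> brauer_diagrams b c" and g: "g \<in> upward_diagrams b a"
  shows "loop_count f (flip_diagram g) = 0"
proof (rule loop_count_eq_0I[OF f flip_diagram_closed[OF upward_diagramsD[OF g]]])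
  fix M assume "M \<subseteq> {1..b}" "compatible (flip_diagram g) {} M"
  then show "M = {}" using upward_compatible_inj[OF g _ empty_subsetI _ compatible_empty] by simp
qed

text \<open>Each of the \<open>p\<close> strands runs down and straight back; whatever else is
  formed consists of closed loops, which \<open>diagram_comp\<close> drops. So
  \<open>flip_diagram u\<close> is a left inverse of \<open>u\<close> for the composition without
  loops, the basic means of cancellation.\<close>

lemma flip_upward_comp_self:
  assumes u: "u \<in> upward_diagrams p q"
  shows "diagram_comp (flip_diagram u) u = perm_diagram p id"
proof (rule brauer_diagrams_eqI)
  note d = upward_diagramsD[OF u]
  note fd = flip_diagram_closed[OF d]
  show "diagram_comp (flip_diagram u) u \<in> brauer_diagrams p p" by (rule diagram_comp_closed[OF fd d])
  show "perm_diagram p id \<in> brauer_diagrams p p" by (rule perm_diagram_closed[OF permutes_id])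
  fix A B assume AB: "A \<subseteq> {1..p}" "B \<subseteq> {1..p}" and "compatible (diagram_comp (flip_diagram u) u) A B"
  then obtain M where "compatible u A M" "compatible u B M" unfolding compatible_comp_iff[OF fd d AB] by auto
  then have "A = B" by (rule upward_compatible_inj[OF u AB])
  then show "compatible (perm_diagram p id) A B" using compatible_perm_diagram[OF permutes_id AB] by simp
qed

lemma perm_diagram_upward: "\<sigma> permutes {1..p} \<Longrightarrow> perm_diagram p \<sigma> \<in> upward_diagrams p p"
proof -
  assume \<sigma>: "\<sigma> permutes {1..p}"
  have "{Top i, Top k} \<notin> perm_diagram p \<sigma>" for i k
    unfolding perm_diagram_image by (auto simp: doubleton_eq_iff)
  then show ?thesis using perm_diagram_closed[OF \<sigma>] by (simp add: upward_diagrams_def upward_def)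
qed

lemma upward_partner_fun:
  assumes u: "u \<in> upward_diagrams p q"
  obtains s where "\<And>i. i \<in> {1..p} \<Longrightarrow> s i \<in> {1..q} \<and> {Top i, Bot (s i)} \<in> u" and "inj_on s {1..p}"
proof -
  have "\<forall>i\<in>{1..p}. \<exists>j. j \<in> {1..q} \<and> {Top i, Bot j} \<in> u" using upward_partner[OF u] by metis
  then obtain s where s: "\<And>i. i \<in> {1..p} \<Longrightarrow> s i \<in> {1..q} \<and> {Top i, Bot (s i)} \<in> u" by metis
  moreover have "inj_on s {1..p}"
  proof (rule inj_onI)
    fix i k assume ik: "i \<in> {1..p}" "k \<in> {1..p}" "s i = s k"
    show "i = k" by (rule upward_partner_unique(2)[OF upward_diagramsD[OF u]]) (use s[OF ik(1)] s[OF ik(2)] ik(3) in auto)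
  qed
  ultimately show ?thesis using that by blast
qed

lemma upward_le:
  assumes u: "u \<in> upward_diagrams p q"
  shows "p \<preceq> q"
proof -
  obtain s where s: "\<And>i. i \<in> {1..p} \<Longrightarrow> s i \<in> {1..q}" "inj_on s {1..p}" using upward_partner_fun[OF u] by metis
  then have "card {1..p} \<le> card {1..q}" by (intro card_inj_on_le[of s]) auto
  then have le: "p \<le> q" by simp
  have d: "u \<in> brauer_diagrams p q" by (rule upward_diagramsD[OF u])
  have "2 * card u = card (\<Union>u)"
    by (rule card_partition) (use brauer_diagramsD[OF d] in \<open>auto simp: brauer_points_def\<close>)
  also have "\<dots> = p + q" unfolding brauer_diagramsD(1)[OF d] brauer_points_def by (simp add: card_Top_Bot)
  finally show ?thesis using le unfolding parity_le_def by presburger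
qed

lemma upward_endo_perm:
  assumes u: "u \<in> upward_diagrams p p"
  obtains \<sigma> where "\<sigma> permutes {1..p}" and "u = perm_diagram p \<sigma>"
proof -
  obtain s where s: "\<And>i. i \<in> {1..p} \<Longrightarrow> s i \<in> {1..p} \<and> {Top i, Bot (s i)} \<in> u" "inj_on s {1..p}"
    using upward_partner_fun[OF u] by metis
  define \<sigma> where "\<sigma> i = (if i \<in> {1..p} then s i else i)" for i
  have "s ` {1..p} = {1..p}" using s by (intro endo_inj_surj) auto
  then have "bij_betw s {1..p} {1..p}" using s by (auto simp: bij_betw_def)
  moreover have "bij_betw \<sigma> {1..p} {1..p} \<longleftrightarrow> bij_betw s {1..p} {1..p}"
    by (rule bij_betw_cong) (simp only: \<sigma>_def if_True)
  ultimately have "bij_betw \<sigma> {1..p} {1..p}" by simp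
  then have \<sigma>: "\<sigma> permutes {1..p}" by (rule bij_imp_permutes) (simp only: \<sigma>_def if_False)
  have "perm_diagram p \<sigma> \<subseteq> u" unfolding perm_diagram_image using s(1) by (auto simp: \<sigma>_def)
  then have "perm_diagram p \<sigma> = u"
    by (rule brauer_diagrams_subset_eq[OF perm_diagram_closed[OF \<sigma>] upward_diagramsD[OF u]])
  then show ?thesis using \<sigma> that by simp
qed

text \<open>Uniqueness of the factorization. The permutation is \<open>flip_diagram w\<close>
  composed with \<open>w'\<close>: put above \<open>u\<close> it gives \<open>u'\<close>, which is
  upward, so it is itself upward, from \<open>p\<close> points to \<open>p\<close> points.
  Cancelling \<open>u\<close> on the left shows that the same permutation relates \<open>w\<close>
  to \<open>w'\<close>.\<close>

lemma upward_flip_cancel: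
  assumes u: "u \<in> upward_diagrams p q" and u': "u' \<in> upward_diagrams p q"
    and w: "w \<in> upward_diagrams p r" and w': "w' \<in> upward_diagrams p r"
    and eq: "diagram_comp u (flip_diagram w) = diagram_comp u' (flip_diagram w')"
  shows "\<exists>\<sigma>. \<sigma> permutes {1..p} \<and> u' = diagram_comp u (perm_diagram p \<sigma>) \<and> w' = diagram_comp w (perm_diagram p \<sigma>)"
proof -
  note d = upward_diagramsD[OF u] upward_diagramsD[OF u'] upward_diagramsD[OF w] upward_diagramsD[OF w']
  note fd = flip_diagram_closed[OF d(1)] flip_diagram_closed[OF d(2)] flip_diagram_closed[OF d(3)] flip_diagram_closed[OF d(4)]
  have "diagram_comp (diagram_comp u (flip_diagram w)) w' = diagram_comp (diagram_comp u' (flip_diagram w')) w'"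
    using eq by simp
  then have 1: "diagram_comp u (diagram_comp (flip_diagram w) w') = u'"
    unfolding diagram_comp_assoc[OF d(1) fd(3) d(4)] diagram_comp_assoc[OF d(2) fd(4) d(4)]
      flip_upward_comp_self[OF w'] comp_identity_right[OF d(2)] .
  have "diagram_comp (flip_diagram w) w' \<in> upward_diagrams p p"
    by (rule upward_comp_right[OF d(1) diagram_comp_closed[OF fd(3) d(4)]]) (simp add: 1 u')
  then obtain \<sigma> where \<sigma>: "\<sigma> permutes {1..p}" "diagram_comp (flip_diagram w) w' = perm_diagram p \<sigma>"
    by (rule upward_endo_perm)
  have u'_eq: "u' = diagram_comp u (perm_diagram p \<sigma>)" using 1 \<sigma> by simp
  note pc = perm_diagram_closed[OF \<sigma>(1)]
  have "diagram_comp (flip_diagram u) (diagram_comp u (flip_diagram w)) = diagram_comp (flip_diagram u) (diagram_comp u' (flip_diagram w'))"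
    using eq by simp
  then have "flip_diagram w = diagram_comp (diagram_comp (flip_diagram u) u') (flip_diagram w')"
    unfolding diagram_comp_assoc[OF fd(1) d(1) fd(3), symmetric] diagram_comp_assoc[OF fd(1) d(2) fd(4), symmetric]
      flip_upward_comp_self[OF u] comp_identity_left[OF fd(3)] .
  also have "diagram_comp (flip_diagram u) u' = perm_diagram p \<sigma>"
    unfolding u'_eq diagram_comp_assoc[OF fd(1) d(1) pc, symmetric] flip_upward_comp_self[OF u]
    by (rule comp_identity_left[OF pc])
  finally have "flip_diagram (flip_diagram w) = flip_diagram (diagram_comp (perm_diagram p \<sigma>) (flip_diagram w'))" by simp
  then have w_eq: "w = diagram_comp w' (perm_diagram p (inv' \<sigma>))"
    unfolding flip_diagram_comp[OF pc fd(4)] flip_perm_diagram[OF \<sigma>(1)] by simp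
  have "diagram_comp w (perm_diagram p \<sigma>) = diagram_comp w' (diagram_comp (perm_diagram p (inv' \<sigma>)) (perm_diagram p \<sigma>))"
    unfolding w_eq using diagram_comp_assoc[OF d(4) perm_diagram_closed[OF permutes_inv[OF \<sigma>(1)]] pc] .
  also have "\<dots> = w'"
    unfolding perm_diagram_comp[OF permutes_inv[OF \<sigma>(1)] \<sigma>(1)] permutes_inv_o(2)[OF \<sigma>(1)]
    by (rule comp_identity_right[OF d(4)])
  finally show ?thesis using \<sigma>(1) u'_eq by blast
qed

text \<open>The injection \<open>s\<close> gives the through strands and \<open>m\<close> is a
  perfect matching of the bottom points left over. The colour condition separates
  accordingly.\<close>

lemma upward_build:
  assumes s: "s ` {1..p} \<subseteq> {1..q}" "inj_on s {1..p}"
    and m: "\<Union>m = Bot ` ({1..q} - s ` {1..p})" "\<And>e. e \<in> m \<Longrightarrow> card e = 2"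
      "\<And>e e'. e \<in> m \<Longrightarrow> e' \<in> m \<Longrightarrow> e \<inter> e' \<noteq> {} \<Longrightarrow> e = e'"
  defines "u \<equiv> (\<lambda>i. {Top i, Bot (s i)}) ` {1..p} \<union> m"
  shows "u \<in> upward_diagrams p q"
    and "A \<subseteq> {1..p} \<Longrightarrow> compatible u A B \<longleftrightarrow> (\<forall>i\<in>{1..p}. i \<in> A \<longleftrightarrow> s i \<in> B) \<and> saturated (Bot ` B) m"
proof -
  have mB: "x \<in> Bot ` ({1..q} - s ` {1..p})" if "e \<in> m" "x \<in> e" for e x using m(1) that by blast
  have "u \<in> brauer_diagrams p q"
  proof (rule brauer_diagramsI)
    have "\<Union>u = Top ` {1..p} \<union> Bot ` s ` {1..p} \<union> \<Union>m" unfolding u_def by blast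
    also have "\<dots> = brauer_points p q" unfolding m(1) brauer_points_def using s(1) by blast
    finally show "\<Union>u = brauer_points p q" .
    show "card e = 2" if "e \<in> u" for e using that m(2) unfolding u_def by auto
    fix e e' assume e: "e \<in> u" "e' \<in> u" and ne: "e \<inter> e' \<noteq> {}"
    have *: "{Top i, Bot (s i)} \<inter> a = {}" if "a \<in> m" "i \<in> {1..p}" for i a
    proof -
      have "Top i \<notin> a" using mB[OF that(1), of "Top i"] by blast
      moreover have "Bot (s i) \<notin> a" using mB[OF that(1), of "Bot (s i)"] that(2) by blast
      ultimately show ?thesis by blast
    qed
    have **: "i = j" if "i \<in> {1..p}" "j \<in> {1..p}" "{Top i, Bot (s i)} \<inter> {Top j, Bot (s j)} \<noteq> {}" for i j
    proof -
      have "i = j \<or> s i = s j" using that(3) by auto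
      then show ?thesis using inj_onD[OF s(2) _ that(1,2)] by blast
    qed
    consider (a) i j where "i \<in> {1..p}" "j \<in> {1..p}" "e = {Top i, Bot (s i)}" "e' = {Top j, Bot (s j)}"
      | (b) i where "i \<in> {1..p}" "e = {Top i, Bot (s i)}" "e' \<in> m"
      | (c) i where "i \<in> {1..p}" "e' = {Top i, Bot (s i)}" "e \<in> m"
      | (d) "e \<in> m" "e' \<in> m"
      using e unfolding u_def by blast
    then show "e = e'"
    proof cases
      case a then show ?thesis using **[of i j] ne by simp
    next
      case b then show ?thesis using *[of e' i] ne by simp
    next
      case c then show ?thesis using *[of e i] ne by (simp add: Int_commute)
    next
      case d then show ?thesis using m(3) ne by simp
    qed
  qed
  moreover have "{Top i, Top k} \<notin> u" for i k
  proof
    assume "{Top i, Top k} \<in> u"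
    moreover have "{Top i, Top k} \<notin> m" using mB[of "{Top i, Top k}" "Top i"] by blast
    ultimately show False unfolding u_def by (auto simp: doubleton_eq_iff)
  qed
  ultimately show "u \<in> upward_diagrams p q" by (simp add: upward_diagrams_def upward_def)
  have "saturated (Top ` A \<union> Bot ` B) m \<longleftrightarrow> saturated (Bot ` B) m" for A
  proof -
    have "e \<subseteq> Top ` A \<union> Bot ` B \<longleftrightarrow> e \<subseteq> Bot ` B" "e \<inter> (Top ` A \<union> Bot ` B) = e \<inter> Bot ` B" if "e \<in> m" for e
    proof -
      have "e \<subseteq> range Bot" using mB[OF that] by blast
      moreover have "Top ` A \<inter> range Bot = {}" by auto
      ultimately have "e \<inter> Top ` A = {}" by blast
      then show "e \<subseteq> Top ` A \<union> Bot ` B \<longleftrightarrow> e \<subseteq> Bot ` B" "e \<inter> (Top ` A \<union> Bot ` B) = e \<inter> Bot ` B" by blast+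
    qed
    then show ?thesis unfolding saturated_def by simp
  qed
  moreover have "saturated (Top ` A \<union> Bot ` B) ((\<lambda>i. {Top i, Bot (s i)}) ` {1..p}) \<longleftrightarrow> (\<forall>i\<in>{1..p}. i \<in> A \<longleftrightarrow> s i \<in> B)"
    unfolding saturated_def ball_simps by auto
  ultimately show "compatible u A B \<longleftrightarrow> (\<forall>i\<in>{1..p}. i \<in> A \<longleftrightarrow> s i \<in> B) \<and> saturated (Bot ` B) m"
    unfolding compatible_def u_def saturated_Un by simp
qed

lemma through_edge_range:
  assumes d: "d \<in> brauer_diagrams p q" and e: "{Top i, Bot j} \<in> d"
  shows "i \<in> {1..p}" and "j \<in> {1..q}"
proof -
  have "Top i \<in> brauer_points p q" "Bot j \<in> brauer_points p q"
    using brauer_diagramsD(1)[OF d] e by blast+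
  then show "i \<in> {1..p}" "j \<in> {1..q}" by (auto simp: brauer_points_def)
qed

text \<open>With the through strands of \<open>h\<close> numbered, their upper ends by
  \<open>t\<close> and their lower ends by \<open>s\<close>, the remaining bottom points are matched
  among themselves by \<open>h\<close>. These are the data for \<open>upward_build\<close>. Only the
  bottom side is treated, since the lemma is applied both to \<open>h\<close> and to its
  flip.\<close>

lemma through_enumeration:
  assumes h: "h \<in> brauer_diagrams a b"
    and 1: "\<And>x. x \<in> {1..p} \<Longrightarrow> {Top (t x), Bot (s x)} \<in> h"
    and 2: "\<And>i j. {Top i, Bot j} \<in> h \<Longrightarrow> \<exists>x\<in>{1..p}. i = t x \<and> j = s x"
    and t: "inj_on t {1..p}"
  shows "inj_on s {1..p}" and "s ` {1..p} \<subseteq> {1..b}"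
    and "\<Union>{e\<in>h. e \<subseteq> range Bot} = Bot ` ({1..b} - s ` {1..p})"
proof -
  show "inj_on s {1..p}"
  proof (rule inj_onI)
    fix x y assume x: "x \<in> {1..p}" and y: "y \<in> {1..p}" and eq: "s x = s y"
    have "{Top (t y), Bot (s x)} \<in> h" using 1[OF y] eq by simp
    then have "t x = t y" by (rule upward_partner_unique(2)[OF h 1[OF x]])
    then show "x = y" using inj_onD[OF t _ x y] by simp
  qed
  show "s ` {1..p} \<subseteq> {1..b}" using through_edge_range(2)[OF h 1] by blast
  show "\<Union>{e\<in>h. e \<subseteq> range Bot} = Bot ` ({1..b} - s ` {1..p})"
  proof
    show "\<Union>{e\<in>h. e \<subseteq> range Bot} \<subseteq> Bot ` ({1..b} - s ` {1..p})"
    proof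
      fix y assume "y \<in> \<Union>{e\<in>h. e \<subseteq> range Bot}"
      then obtain e j where e: "e \<in> h" "e \<subseteq> range Bot" "y \<in> e" "y = Bot j" by blast
      have "y \<in> brauer_points a b" using brauer_diagramsD(1)[OF h] e by blast
      then have "j \<in> {1..b}" using e by (auto simp: brauer_points_def)
      moreover have "j \<notin> s ` {1..p}"
      proof
        assume "j \<in> s ` {1..p}"
        then obtain x where x: "x \<in> {1..p}" "j = s x" by blast
        then have "e = {Top (t x), Bot (s x)}" using brauer_diagramsD(4)[OF h e(1) 1[OF x(1)]] e by blast
        then show False using e(2) by auto
      qed
      ultimately show "y \<in> Bot ` ({1..b} - s ` {1..p})" using e by blast
    qed
    show "Bot ` ({1..b} - s ` {1..p}) \<subseteq> \<Union>{e\<in>h. e \<subseteq> range Bot}"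
    proof
      fix y assume "y \<in> Bot ` ({1..b} - s ` {1..p})"
      then obtain j where j: "y = Bot j" "j \<in> {1..b}" "j \<notin> s ` {1..p}" by blast
      then have "y \<in> \<Union>h" using brauer_diagramsD(1)[OF h] by (auto simp: brauer_points_def)
      then obtain e where e: "e \<in> h" "y \<in> e" by blast
      have "z \<in> range Bot" if z: "z \<in> e" for z
      proof (cases z)
        case (Top i)
        then have "{Top i, Bot j} \<subseteq> e" using e z j by blast
        then have "{Top i, Bot j} = e" using brauer_diagramsD(2)[OF h e(1)] brauer_diagramsD(5)[OF h e(1)]
          by (intro card_subset_eq) auto
        then have "\<exists>x\<in>{1..p}. i = t x \<and> j = s x" using 2 e(1) by simp
        then show ?thesis using j(3) by blast
      qed simp
      then show "y \<in> \<Union>{e\<in>h. e \<subseteq> range Bot}" using e by blast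
    qed
  qed
qed

lemma flip_edge_iff: "{Top j, Bot i} \<in> flip_diagram h \<longleftrightarrow> {Top i, Bot j} \<in> h"
proof -
  have *: "{Top j, Bot i} \<in> flip_diagram h" if "{Top i, Bot j} \<in> h" for i j h
  proof -
    have "flip_point ` {Top i, Bot j} \<in> flip_diagram h" using that unfolding flip_diagram_def by (rule imageI)
    then show ?thesis by (simp add: insert_commute)
  qed
  show ?thesis using *[of i j h] *[of j i "flip_diagram h"] by auto
qed

text \<open>Cut every through strand in the middle: \<open>u\<close> keeps the lower ends and the
  bottom pairs of \<open>h\<close>, \<open>w\<close> the reflected upper ends and top pairs, and
  \<open>p\<close> is the number of through strands.\<close>

lemma brauer_factorization:
  assumes h: "h \<in> brauer_diagrams a b"
  obtains p u w where "u \<in> upward_diagrams p b" and "w \<in> upward_diagrams p a"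
    and "h = diagram_comp u (flip_diagram w)"
proof -
  let ?I = "{i\<in>{1..a}. \<exists>j. {Top i, Bot j} \<in> h}"
  define p where "p = card ?I"
  obtain t where t: "bij_betw t {1..p} ?I" unfolding p_def using ex_bij_betw_nat_finite_1[of ?I] by auto
  have "\<forall>x\<in>{1..p}. \<exists>j. {Top (t x), Bot j} \<in> h" using bij_betwE[OF t] by blast
  then obtain s where 1: "\<And>x. x \<in> {1..p} \<Longrightarrow> {Top (t x), Bot (s x)} \<in> h" by metis
  have 2: "\<exists>x\<in>{1..p}. i = t x \<and> j = s x" if ij: "{Top i, Bot j} \<in> h" for i j
  proof -
    have "i \<in> ?I" using through_edge_range(1)[OF h ij] ij by blast
    then obtain x where x: "x \<in> {1..p}" "i = t x" using bij_betw_imp_surj_on[OF t] by blast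
    have "{Top i, Bot (s x)} \<in> h" using 1[OF x(1)] x(2) by simp
    then show ?thesis using upward_partner_unique(1)[OF h ij] x by blast
  qed
  have tinj: "inj_on t {1..p}" by (rule bij_betw_imp_inj_on[OF t])
  have S: "inj_on s {1..p}" "s ` {1..p} \<subseteq> {1..b}" "\<Union>{e\<in>h. e \<subseteq> range Bot} = Bot ` ({1..b} - s ` {1..p})"
    by (rule through_enumeration[OF h 1 2 tinj]; assumption)+
  note fh = flip_diagram_closed[OF h]
  have F1: "\<And>x. x \<in> {1..p} \<Longrightarrow> {Top (s x), Bot (t x)} \<in> flip_diagram h" using 1 by (simp add: flip_edge_iff)
  have F2: "\<exists>x\<in>{1..p}. i = s x \<and> j = t x" if "{Top i, Bot j} \<in> flip_diagram h" for i j
    using 2[of j i] that by (auto simp: flip_edge_iff)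
  have S': "inj_on t {1..p}" "t ` {1..p} \<subseteq> {1..a}"
      "\<Union>{e\<in>flip_diagram h. e \<subseteq> range Bot} = Bot ` ({1..a} - t ` {1..p})"
    by (rule through_enumeration[OF fh F1 F2 S(1)]; assumption)+
  let ?mu = "{e\<in>h. e \<subseteq> range Bot}" and ?mw = "{e\<in>flip_diagram h. e \<subseteq> range Bot}"
  define u where "u = (\<lambda>i. {Top i, Bot (s i)}) ` {1..p} \<union> ?mu"
  define w where "w = (\<lambda>i. {Top i, Bot (t i)}) ` {1..p} \<union> ?mw"
  have m: "card e = 2" "e = e'" if "e \<in> ?mu" "e' \<in> ?mu" "e \<inter> e' \<noteq> {}" for e e'
    using brauer_diagramsD(2)[OF h, of e] brauer_diagramsD(4)[OF h, of e e'] that by blast+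
  have m': "card e = 2" "e = e'" if "e \<in> ?mw" "e' \<in> ?mw" "e \<inter> e' \<noteq> {}" for e e'
    using brauer_diagramsD(2)[OF fh, of e] brauer_diagramsD(4)[OF fh, of e e'] that by blast+
  have mc: "card e = 2" if "e \<in> ?mu" for e using brauer_diagramsD(2)[OF h, of e] that by blast
  have mc': "card e = 2" if "e \<in> ?mw" for e using brauer_diagramsD(2)[OF fh, of e] that by blast
  have U: "u \<in> upward_diagrams p b"
      "M \<subseteq> {1..p} \<Longrightarrow> compatible u M B \<longleftrightarrow> (\<forall>i\<in>{1..p}. i \<in> M \<longleftrightarrow> s i \<in> B) \<and> saturated (Bot ` B) ?mu" for M B
    unfolding u_def by (rule upward_build[OF S(2,1,3) mc m(2)]; assumption)+
  have W: "w \<in> upward_diagrams p a"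
      "M \<subseteq> {1..p} \<Longrightarrow> compatible w M B \<longleftrightarrow> (\<forall>i\<in>{1..p}. i \<in> M \<longleftrightarrow> t i \<in> B) \<and> saturated (Bot ` B) ?mw" for M B
    unfolding w_def by (rule upward_build[OF S'(2,1,3) mc' m'(2)]; assumption)+
  note ud = upward_diagramsD[OF U(1)] flip_diagram_closed[OF upward_diagramsD[OF W(1)]]
  have "diagram_comp u (flip_diagram w) = h"
  proof (rule brauer_diagrams_eqI[OF diagram_comp_closed[OF ud] h])
    fix A B assume AB: "A \<subseteq> {1..a}" "B \<subseteq> {1..b}" and "compatible (diagram_comp u (flip_diagram w)) A B"
    then have "\<exists>M. M \<subseteq> {1..p} \<and> compatible (flip_diagram w) A M \<and> compatible u M B"
      using iffD1[OF compatible_comp_iff[OF ud AB]] by blast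
    then obtain M where M: "M \<subseteq> {1..p}" "compatible w M A" "compatible u M B"
      unfolding compatible_flip by blast
    let ?K = "Top ` A \<union> Bot ` B"
    \<comment> \<open>A pair of \<open>h\<close> is a through strand, whose ends agree because both
      carry the colour of the same middle point, or a bottom pair, which occurs in \<open>u\<close>,
      or a top pair, whose flip occurs in \<open>w\<close>.\<close>
    have "e \<subseteq> ?K \<or> e \<inter> ?K = {}" if e: "e \<in> h" for e
    proof -
      obtain x y where xy: "e = {x, y}" using brauer_diagramsD(2)[OF h e] by (auto simp: card_2_iff)
      consider (thr) i j where "e = {Top i, Bot j}" | (bot) "e \<subseteq> range Bot" | (top) "e \<subseteq> range Top"
      proof (cases x; cases y)
        fix i j assume "x = Top i" "y = Bot j" then show ?thesis using that(1) xy by simp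
      next
        fix i j assume "x = Bot j" "y = Top i" then show ?thesis using that(1) xy by (simp add: insert_commute)
      qed (use that xy in auto)
      then show ?thesis
      proof cases
        case thr
        then obtain x where x: "x \<in> {1..p}" "i = t x" "j = s x" using 2[of i j] e by blast
        have "i \<in> A \<longleftrightarrow> j \<in> B" using M U(2)[OF M(1), of B] W(2)[OF M(1), of A] x by auto
        then show ?thesis using thr by auto
      next
        case bot
        have "saturated (Bot ` B) ?mu" using M U(2)[OF M(1), of B] by simp
        then have "e \<subseteq> Bot ` B \<or> e \<inter> Bot ` B = {}" using e bot unfolding saturated_def by blast
        moreover have "e \<inter> Top ` A = {}" using bot by auto
        ultimately show ?thesis by blast
      next
        case top
        have "flip_point ` e \<in> flip_diagram h" using e unfolding flip_diagram_def by (rule imageI)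
        moreover have "flip_point ` e \<subseteq> range Bot" using top by auto
        ultimately have "flip_point ` e \<in> ?mw" by blast
        moreover have "saturated (Bot ` A) ?mw" using M W(2)[OF M(1), of A] by simp
        ultimately have "flip_point ` e \<subseteq> Bot ` A \<or> flip_point ` e \<inter> Bot ` A = {}" unfolding saturated_def by (rule bspec[rotated])
        then have "flip_point ` flip_point ` e \<subseteq> flip_point ` Bot ` A \<or> flip_point ` (flip_point ` e \<inter> Bot ` A) = {}"
          by (metis image_mono image_empty)
        then have "e \<subseteq> Top ` A \<or> e \<inter> Top ` A = {}"
          unfolding image_Int[OF inj_flip_point] image_image by simp
        moreover have "e \<inter> Bot ` B = {}" using top by auto
        ultimately show ?thesis by blast
      qed
    qed
    then show "compatible h A B" unfolding compatible_def saturated_def by blast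
  qed
  then show ?thesis using that U(1) W(1) by metis
qed

text \<open>The first \<open>p\<close> points go straight down, and the other bottom points, even in
  number, are paired off consecutively. It guarantees that every degree has a monotone diagram to
  serve as \<open>base\<close>.\<close>

lemma upward_diagrams_nonempty:
  assumes "p \<preceq> q"
  shows "upward_diagrams p q \<noteq> {}"
proof -
  obtain n where q: "q = p + 2 * n" using assms unfolding parity_le_def by (metis evenE le_add_diff_inverse)
  define c where "c j = {Bot (p + 2 * j + 1), Bot (p + 2 * j + 2)}" for j
  have "\<Union>(c ` {..<n}) = Bot ` ({1..q} - id ` {1..p})"
  proof
    show "\<Union>(c ` {..<n}) \<subseteq> Bot ` ({1..q} - id ` {1..p})" unfolding q c_def by auto
    show "Bot ` ({1..q} - id ` {1..p}) \<subseteq> \<Union>(c ` {..<n})"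
    proof
      fix y assume "y \<in> Bot ` ({1..q} - id ` {1..p})"
      then obtain x where x: "y = Bot x" "p < x" "x \<le> p + 2 * n" unfolding q by auto
      then have "y \<in> c ((x - p - 1) div 2)" by (auto simp: x(1) c_def)
      moreover have "(x - p - 1) div 2 < n" using x by auto
      ultimately show "y \<in> \<Union>(c ` {..<n})" by blast
    qed
  qed
  moreover have "card e = 2" if "e \<in> c ` {..<n}" for e using that by (auto simp: c_def)
  moreover have "e = e'" if "e \<in> c ` {..<n}" "e' \<in> c ` {..<n}" "e \<inter> e' \<noteq> {}" for e e'
  proof -
    note mem = that
    obtain i where i: "e = c i" using mem(1) by blast
    obtain j where "e' = c j" using mem(2) by blast
    note ij = i this
    have "\<exists>x. (x = p + 2 * i + 1 \<or> x = p + 2 * i + 2) \<and> (x = p + 2 * j + 1 \<or> x = p + 2 * j + 2)"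
      using mem(3) unfolding ij c_def by auto
    then have "i = j" by presburger
    then show ?thesis using ij by simp
  qed
  moreover have "id ` {1..p} \<subseteq> {1..q}" unfolding q by auto
  ultimately have "(\<lambda>i. {Top i, Bot (id i)}) ` {1..p} \<union> c ` {..<n} \<in> upward_diagrams p q"
    by (intro upward_build(1)) auto
  then show ?thesis by blast
qed

section \<open>Upward diagrams as monotone diagrams times permutations\<close>

lemma through_edge_comp_perm:
  assumes u: "u \<in> brauer_diagrams p q" and \<sigma>: "\<sigma> permutes {1..p}" and i: "i \<in> {1..p}"
    and e: "{Top (\<sigma> i), Bot j} \<in> u"
  shows "{Top i, Bot j} \<in> diagram_comp u (perm_diagram p \<sigma>)"
proof (rule through_edgeI[OF diagram_comp_closed[OF u perm_diagram_closed[OF \<sigma>]] i])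
  fix A B assume "A \<subseteq> {1..p}" "B \<subseteq> {1..q}" "compatible (diagram_comp u (perm_diagram p \<sigma>)) A B"
  then have "compatible u (\<sigma> ` A) B" using compatible_comp_perm[OF u \<sigma>] by blast
  then have "\<sigma> i \<in> \<sigma> ` A \<longleftrightarrow> j \<in> B" by (rule through_edgeD[OF e])
  then show "i \<in> A \<longleftrightarrow> j \<in> B" using permutes_inj[OF \<sigma>] by (simp add: inj_image_mem_iff)
qed

lemma upward_monotone_iff:
  "f \<in> upward_monotone_diagrams p q \<longleftrightarrow> f \<in> upward_diagrams p q \<and> monotone_diagram f"
  by (auto simp: upward_monotone_diagrams_def upward_diagrams_def)

lemma monotone_diagram_less:
  assumes f: "monotone_diagram f" and "{Top i, Bot j} \<in> f" "{Top k, Bot l} \<in> f" and ik: "i < k"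
  shows "j < l"
proof -
  have "{Top i, Bot j} \<noteq> {Top k, Bot l}" using ik by (auto simp: doubleton_eq_iff)
  then have "(int i - int k) * (int j - int l) > 0" using f assms(2,3) unfolding monotone_diagram_def by blast
  then have "int j - int l < 0" using ik by (simp add: zero_less_mult_iff)
  then show ?thesis by simp
qed

lemma monotone_diagramI:
  assumes "\<And>i j k l. {Top i, Bot j} \<in> f \<Longrightarrow> {Top k, Bot l} \<in> f \<Longrightarrow> i < k \<Longrightarrow> j < l"
    and f: "f \<in> brauer_diagrams p q"
  shows "monotone_diagram f"
  unfolding monotone_diagram_def
proof (intro allI impI, elim conjE)
  fix i j k l assume e: "{Top i, Bot j} \<in> f" "{Top k, Bot l} \<in> f" and ne: "{Top i, Bot j} \<noteq> {Top k, Bot l}"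
  have "i \<noteq> k"
  proof
    assume "i = k"
    then have "j = l" using upward_partner_unique(1)[OF f] e by blast
    then show False using \<open>i = k\<close> ne by simp
  qed
  then consider "i < k" | "k < i" by linarith
  then show "(int i - int k) * (int j - int l) > 0"
  proof cases
    case 1 then show ?thesis using assms(1)[OF e 1] by (intro mult_neg_neg) auto
  next
    case 2 then show ?thesis using assms(1)[OF e(2,1) 2] by (intro mult_pos_pos) auto
  qed
qed

lemma permutes_strict_mono_id:
  fixes \<sigma> :: "nat \<Rightarrow> nat"
  assumes \<sigma>: "\<sigma> permutes {1..p}" and mono: "\<And>i k. i \<in> {1..p} \<Longrightarrow> k \<in> {1..p} \<Longrightarrow> i < k \<Longrightarrow> \<sigma> i < \<sigma> k"
  shows "\<sigma> = id"
proof (rule permutes_natset_ge[OF \<sigma>], rule ballI)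
  fix i assume "i \<in> {1..p}"
  then show "i \<le> \<sigma> i"
  proof (induction i)
    case (Suc i)
    show ?case
    proof (cases "i = 0")
      case True
      have "\<sigma> (Suc i) \<in> {1..p}" using permutes_in_image[OF \<sigma>] Suc.prems by blast
      then show ?thesis using True by simp
    next
      case False
      then have i: "i \<in> {1..p}" using Suc.prems by simp
      then have "i \<le> \<sigma> i" by (rule Suc.IH)
      also have "\<sigma> i < \<sigma> (Suc i)" using mono[OF i Suc.prems] by simp
      finally show ?thesis by simp
    qed
  qed simp
qed

text \<open>Renumbering the top points in the order of their bottom partners makes the diagram
  monotone; the inverse renumbering is the permutation.\<close>

lemma upward_monotone_normal_form:
  assumes u: "u \<in> upward_diagrams p q"
  obtains f \<sigma> where "f \<in> upward_monotone_diagrams p q" and "\<sigma> permutes {1..p}"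
    and "u = diagram_comp f (perm_diagram p \<sigma>)"
proof -
  note d = upward_diagramsD[OF u]
  obtain s where s: "\<And>i. i \<in> {1..p} \<Longrightarrow> s i \<in> {1..q} \<and> {Top i, Bot (s i)} \<in> u" "inj_on s {1..p}"
    using upward_partner_fun[OF u] by metis
  have card: "card (s ` {1..p}) = p" using s(2) by (simp add: card_image)
  obtain h where h: "bij_betw h {..<p} (s ` {1..p})" "strict_mono_on {..<p} h"
    using ex_bij_betw_strict_mono_card[of "s ` {1..p}"] unfolding card by auto
  \<comment> \<open>\<open>h\<close> lists the bottom partners in increasing order from index 0,
    hence the shift \<open>i - 1\<close>. The value \<open>\<tau> i\<close> is the top point of
    \<open>u\<close> whose partner is the \<open>i\<close>-th smallest.\<close>
  define \<tau> where "\<tau> i = (if i \<in> {1..p} then inv_into {1..p} s (h (i - 1)) else i)" for i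
  have hs: "h (i - 1) \<in> s ` {1..p}" if "i \<in> {1..p}" for i
    using bij_betwE[OF h(1)] that by auto
  have s\<tau>: "s (\<tau> i) = h (i - 1)" "\<tau> i \<in> {1..p}" if "i \<in> {1..p}" for i
    using f_inv_into_f[OF hs[OF that]] inv_into_into[OF hs[OF that]] that unfolding \<tau>_def by simp_all
  have "inj_on \<tau> {1..p}"
  proof (rule inj_onI)
    fix i k assume i: "i \<in> {1..p}" and k: "k \<in> {1..p}" and "\<tau> i = \<tau> k"
    then have "h (i - 1) = h (k - 1)" using s\<tau>(1)[OF i] s\<tau>(1)[OF k] by simp
    then have "i - 1 = k - 1" using inj_onD[OF bij_betw_imp_inj_on[OF h(1)]] i k by auto
    then show "i = k" using i k by auto
  qed
  moreover from this have "\<tau> ` {1..p} = {1..p}" using s\<tau>(2) by (intro endo_inj_surj) auto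
  ultimately have "bij_betw \<tau> {1..p} {1..p}" by (simp add: bij_betw_def)
  then have \<tau>: "\<tau> permutes {1..p}" by (rule bij_imp_permutes) (simp only: \<tau>_def if_False)
  note pc = perm_diagram_closed[OF \<tau>] perm_diagram_closed[OF permutes_inv[OF \<tau>]]
  let ?f = "diagram_comp u (perm_diagram p \<tau>)"
  have fu: "?f \<in> upward_diagrams p q" by (rule upward_comp[OF u perm_diagram_upward[OF \<tau>]])
  note fd = upward_diagramsD[OF fu]
  have fe: "j = h (i - 1) \<and> i \<in> {1..p}" if e: "{Top i, Bot j} \<in> ?f" for i j
  proof -
    have i: "i \<in> {1..p}" by (rule through_edge_range(1)[OF fd e])
    have "{Top (\<tau> i), Bot (s (\<tau> i))} \<in> u" using s(1)[OF s\<tau>(2)[OF i]] by simp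
    then have "{Top i, Bot (s (\<tau> i))} \<in> ?f" by (rule through_edge_comp_perm[OF d \<tau> i])
    then have "j = s (\<tau> i)" by (rule upward_partner_unique(1)[OF fd e])
    then show ?thesis using s\<tau>(1)[OF i] i by simp
  qed
  have "monotone_diagram ?f"
  proof (rule monotone_diagramI[OF _ fd])
    fix i j k l assume "{Top i, Bot j} \<in> ?f" "{Top k, Bot l} \<in> ?f" "i < k"
    then show "j < l" using fe[of i j] fe[of k l] strict_mono_onD[OF h(2), of "i - 1" "k - 1"] by auto
  qed
  then have "?f \<in> upward_monotone_diagrams p q" using fu by (simp add: upward_monotone_iff)
  moreover have "diagram_comp ?f (perm_diagram p (inv' \<tau>)) = u"
    unfolding diagram_comp_assoc[OF d pc] perm_diagram_comp[OF \<tau> permutes_inv[OF \<tau>]] permutes_inv_o(1)[OF \<tau>]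
    by (rule comp_identity_right[OF d])
  ultimately show ?thesis using that permutes_inv[OF \<tau>] by metis
qed

text \<open>In both diagrams the partners increase from left to right, so \<open>\<sigma>\<close>
  preserves the order.\<close>

lemma upward_monotone_perm_unique:
  assumes f: "f \<in> upward_monotone_diagrams p q" and f': "f' \<in> upward_monotone_diagrams p q"
    and \<sigma>: "\<sigma> permutes {1..p}" and eq: "f' = diagram_comp f (perm_diagram p \<sigma>)"
  shows "\<sigma> = id"
proof (rule permutes_strict_mono_id[OF \<sigma>])
  have fu: "f \<in> upward_diagrams p q" "monotone_diagram f" and fu': "monotone_diagram f'"
    using f f' by (auto simp: upward_monotone_iff)
  note d = upward_diagramsD[OF fu(1)]
  obtain s where s: "\<And>i. i \<in> {1..p} \<Longrightarrow> {Top i, Bot (s i)} \<in> f"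
    using upward_partner_fun[OF fu(1)] by metis
  fix i k assume i: "i \<in> {1..p}" and k: "k \<in> {1..p}" and ik: "i < k"
  have \<sigma>i: "\<sigma> i \<in> {1..p}" "\<sigma> k \<in> {1..p}" using permutes_in_image[OF \<sigma>] i k by blast+
  have e: "{Top i, Bot (s (\<sigma> i))} \<in> f'" "{Top k, Bot (s (\<sigma> k))} \<in> f'"
    unfolding eq by (intro through_edge_comp_perm[OF d \<sigma>] i k s \<sigma>i)+
  have less: "s (\<sigma> i) < s (\<sigma> k)" by (rule monotone_diagram_less[OF fu' e ik])
  show "\<sigma> i < \<sigma> k"
  proof (rule ccontr)
    assume "\<not> \<sigma> i < \<sigma> k"
    then consider "\<sigma> k < \<sigma> i" | "\<sigma> i = \<sigma> k" by linarith
    then show False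
    proof cases
      case 1
      then have "s (\<sigma> k) < s (\<sigma> i)" by (rule monotone_diagram_less[OF fu(2) s[OF \<sigma>i(2)] s[OF \<sigma>i(1)]])
      then show False using less by simp
    qed (use less in simp)
  qed
qed

text \<open>Permutations act freely on the upward diagrams, with the monotone ones as
  representatives of the orbits. This matches the index set of \<open>gram_matrix\<close> with the
  basis of the cell module.\<close>

lemma bij_betw_upward_monotone:
  "bij_betw (\<lambda>(f, \<sigma>). diagram_comp f (perm_diagram p \<sigma>))
     (upward_monotone_diagrams p q \<times> carrier (sym_group p)) (upward_diagrams p q)"
  unfolding bij_betw_def
proof
  show "inj_on (\<lambda>(f, \<sigma>). diagram_comp f (perm_diagram p \<sigma>)) (upward_monotone_diagrams p q \<times> carrier (sym_group p))"
  proof (rule inj_onI, clarify)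
    fix f \<sigma> f' \<sigma>'
    assume f: "f \<in> upward_monotone_diagrams p q" and f': "f' \<in> upward_monotone_diagrams p q"
      and "\<sigma> \<in> carrier (sym_group p)" and "\<sigma>' \<in> carrier (sym_group p)"
      and eq: "diagram_comp f (perm_diagram p \<sigma>) = diagram_comp f' (perm_diagram p \<sigma>')"
    then have \<sigma>: "\<sigma> permutes {1..p}" and \<sigma>': "\<sigma>' permutes {1..p}" by (auto simp: sym_group_carrier)
    have d: "f \<in> brauer_diagrams p q" "f' \<in> brauer_diagrams p q"
      using f f' by (auto simp: upward_monotone_iff upward_diagrams_def)
    note pc = perm_diagram_closed[OF \<sigma>] perm_diagram_closed[OF \<sigma>'] perm_diagram_closed[OF permutes_inv[OF \<sigma>']]
    have "f' = diagram_comp f' (diagram_comp (perm_diagram p \<sigma>') (perm_diagram p (inv' \<sigma>')))"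
      unfolding perm_diagram_comp[OF \<sigma>' permutes_inv[OF \<sigma>']] permutes_inv_o(1)[OF \<sigma>']
      by (rule comp_identity_right[OF d(2), symmetric])
    also have "\<dots> = diagram_comp f (diagram_comp (perm_diagram p \<sigma>) (perm_diagram p (inv' \<sigma>')))"
      using eq diagram_comp_assoc[OF d(2) pc(2,3)] diagram_comp_assoc[OF d(1) pc(1,3)] by simp
    also have "\<dots> = diagram_comp f (perm_diagram p (\<sigma> \<circ> inv' \<sigma>'))"
      unfolding perm_diagram_comp[OF \<sigma> permutes_inv[OF \<sigma>']] ..
    finally have f'_eq: "f' = diagram_comp f (perm_diagram p (\<sigma> \<circ> inv' \<sigma>'))" .
    then have *: "\<sigma> \<circ> inv' \<sigma>' = id"
      by (rule upward_monotone_perm_unique[OF f f' permutes_compose[OF permutes_inv[OF \<sigma>'] \<sigma>]])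
    then have "\<sigma> \<circ> inv' \<sigma>' \<circ> \<sigma>' = \<sigma>'" by simp
    then have "\<sigma> = \<sigma>'" using permutes_inv_o(2)[OF \<sigma>'] by (simp add: comp_assoc)
    moreover have "f' = f" using f'_eq * comp_identity_right[OF d(1)] by simp
    ultimately show "f = f' \<and> \<sigma> = \<sigma>'" by simp
  qed
  show "(\<lambda>(f, \<sigma>). diagram_comp f (perm_diagram p \<sigma>)) ` (upward_monotone_diagrams p q \<times> carrier (sym_group p)) = upward_diagrams p q"
  proof
    show "(\<lambda>(f, \<sigma>). diagram_comp f (perm_diagram p \<sigma>)) ` (upward_monotone_diagrams p q \<times> carrier (sym_group p)) \<subseteq> upward_diagrams p q"
      using upward_comp[OF _ perm_diagram_upward] by (auto simp: sym_group_carrier upward_monotone_iff)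
    show "upward_diagrams p q \<subseteq> (\<lambda>(f, \<sigma>). diagram_comp f (perm_diagram p \<sigma>)) ` (upward_monotone_diagrams p q \<times> carrier (sym_group p))"
    proof
      fix u assume "u \<in> upward_diagrams p q"
      then obtain f \<sigma> where "f \<in> upward_monotone_diagrams p q" "\<sigma> permutes {1..p}" "u = diagram_comp f (perm_diagram p \<sigma>)"
        by (rule upward_monotone_normal_form)
      then show "u \<in> (\<lambda>(f, \<sigma>). diagram_comp f (perm_diagram p \<sigma>)) ` (upward_monotone_diagrams p q \<times> carrier (sym_group p))"
        by (intro image_eqI[of _ _ "(f, \<sigma>)"]) (simp_all add: sym_group_carrier)
    qed
  qed
qed

section \<open>Morita equivalence with a full corner\<close>

lemma (in abelian_monoid) finsum_swap:
  assumes "finite I" and J: "finite J" and "\<And>i j. i \<in> I \<Longrightarrow> j \<in> J \<Longrightarrow> f i j \<in> carrier G"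
  shows "(\<Oplus>i\<in>I. \<Oplus>j\<in>J. f i j) = (\<Oplus>j\<in>J. \<Oplus>i\<in>I. f i j)"
  using assms(1,3)
proof (induction I rule: finite_induct)
  case (insert i I)
  then have "(\<Oplus>i\<in>insert i I. \<Oplus>j\<in>J. f i j) = (\<Oplus>j\<in>J. f i j) \<oplus> (\<Oplus>j\<in>J. \<Oplus>i\<in>I. f i j)"
    using J by (subst finsum_insert) (auto simp: Pi_def intro!: finsum_closed)
  also have "\<dots> = (\<Oplus>j\<in>J. f i j \<oplus> (\<Oplus>i\<in>I. f i j))"
    using insert by (intro finsum_addf[symmetric]) (auto intro!: finsum_closed)
  also have "\<dots> = (\<Oplus>j\<in>J. \<Oplus>i\<in>insert i I. f i j)"
    using insert by (intro finsum_cong') (auto intro!: finsum_closed simp: Pi_def)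
  finally show ?case .
qed simp

lemma additive_zero:
  assumes M: "abelian_group M" and N: "abelian_group N" and h: "h \<in> carrier M \<rightarrow> carrier N"
    and add: "\<And>x y. x \<in> carrier M \<Longrightarrow> y \<in> carrier M \<Longrightarrow> h (x \<oplus>\<^bsub>M\<^esub> y) = h x \<oplus>\<^bsub>N\<^esub> h y"
  shows "h \<zero>\<^bsub>M\<^esub> = \<zero>\<^bsub>N\<^esub>"
proof -
  interpret M: abelian_group M by fact
  interpret N: abelian_group N by fact
  have c: "h \<zero>\<^bsub>M\<^esub> \<in> carrier N" using h by auto
  have "h \<zero>\<^bsub>M\<^esub> \<oplus>\<^bsub>N\<^esub> h \<zero>\<^bsub>M\<^esub> = h \<zero>\<^bsub>M\<^esub> \<oplus>\<^bsub>N\<^esub> \<zero>\<^bsub>N\<^esub>" using add[of "\<zero>\<^bsub>M\<^esub>" "\<zero>\<^bsub>M\<^esub>"] c by simp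
  then show ?thesis using N.add.l_cancel_one[OF c c] c by simp
qed

lemma additive_finsum:
  assumes M: "abelian_group M" and N: "abelian_group N" and h: "h \<in> carrier M \<rightarrow> carrier N"
    and add: "\<And>x y. x \<in> carrier M \<Longrightarrow> y \<in> carrier M \<Longrightarrow> h (x \<oplus>\<^bsub>M\<^esub> y) = h x \<oplus>\<^bsub>N\<^esub> h y"
    and "finite I" and "g \<in> I \<rightarrow> carrier M"
  shows "h (finsum M g I) = finsum N (\<lambda>i. h (g i)) I"
proof -
  interpret M: abelian_group M by fact
  interpret N: abelian_group N by fact
  show ?thesis
    using assms(5,6)
  proof (induction I rule: finite_induct)
    case empty
    show ?case using additive_zero[OF M N h add] by simp
  next
    case (insert i I)
    then have g: "g i \<in> carrier M" "g \<in> I \<rightarrow> carrier M" by auto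
    then have "h (g i) \<in> carrier N" "(\<lambda>i. h (g i)) \<in> I \<rightarrow> carrier N" using h by auto
    then show ?case using insert g add[OF g(1) M.finsum_closed[OF g(2)]] by simp
  qed
qed

context left_module
begin

lemma smult_zero: "x \<in> carrier M \<Longrightarrow> \<zero>\<^bsub>A\<^esub> \<odot>\<^bsub>M\<^esub> x = \<zero>\<^bsub>M\<^esub>"
  using additive_zero[of A M "\<lambda>a. a \<odot>\<^bsub>M\<^esub> x"] smult_closed smult_l_distr
    A.abelian_group_axioms M.abelian_group_axioms by auto

lemma smult_finsum:
  assumes "a \<in> carrier A" and "finite I" and "g \<in> I \<rightarrow> carrier M"
  shows "a \<odot>\<^bsub>M\<^esub> finsum M g I = finsum M (\<lambda>i. a \<odot>\<^bsub>M\<^esub> g i) I"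
  by (rule additive_finsum[OF M.abelian_group_axioms M.abelian_group_axioms])
    (use assms smult_closed smult_r_distr in auto)

lemma finsum_smult:
  assumes "x \<in> carrier M" and "finite I" and "g \<in> I \<rightarrow> carrier A"
  shows "finsum A g I \<odot>\<^bsub>M\<^esub> x = finsum M (\<lambda>i. g i \<odot>\<^bsub>M\<^esub> x) I"
  by (rule additive_finsum[OF A.abelian_group_axioms M.abelian_group_axioms, where h = "\<lambda>a. a \<odot>\<^bsub>M\<^esub> x"])
    (use assms smult_closed smult_l_distr in auto)

text \<open>Row times matrix times column is associative; below, the column lies in a module and the
  matrices have entries in its ring.\<close>

lemma smult_double_sum:
  assumes I: "finite I" and J: "finite J" and p: "\<And>i. i \<in> I \<Longrightarrow> p i \<in> carrier A"
    and q: "\<And>i j. i \<in> I \<Longrightarrow> j \<in> J \<Longrightarrow> q i j \<in> carrier A" and x: "\<And>j. j \<in> J \<Longrightarrow> x j \<in> carrier M"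
  shows "(\<Oplus>\<^bsub>M\<^esub>i\<in>I. p i \<odot>\<^bsub>M\<^esub> (\<Oplus>\<^bsub>M\<^esub>j\<in>J. q i j \<odot>\<^bsub>M\<^esub> x j)) =
    (\<Oplus>\<^bsub>M\<^esub>j\<in>J. (\<Oplus>\<^bsub>A\<^esub>i\<in>I. p i \<otimes>\<^bsub>A\<^esub> q i j) \<odot>\<^bsub>M\<^esub> x j)"
proof -
  have "(\<Oplus>\<^bsub>M\<^esub>i\<in>I. p i \<odot>\<^bsub>M\<^esub> (\<Oplus>\<^bsub>M\<^esub>j\<in>J. q i j \<odot>\<^bsub>M\<^esub> x j)) =
      (\<Oplus>\<^bsub>M\<^esub>i\<in>I. \<Oplus>\<^bsub>M\<^esub>j\<in>J. (p i \<otimes>\<^bsub>A\<^esub> q i j) \<odot>\<^bsub>M\<^esub> x j)"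
  proof (rule M.finsum_cong'[OF refl])
    show "(\<lambda>i. \<Oplus>\<^bsub>M\<^esub>j\<in>J. (p i \<otimes>\<^bsub>A\<^esub> q i j) \<odot>\<^bsub>M\<^esub> x j) \<in> I \<rightarrow> carrier M"
      using p q x by (auto intro!: M.finsum_closed smult_closed)
    fix i assume i: "i \<in> I"
    have "p i \<odot>\<^bsub>M\<^esub> (\<Oplus>\<^bsub>M\<^esub>j\<in>J. q i j \<odot>\<^bsub>M\<^esub> x j) = (\<Oplus>\<^bsub>M\<^esub>j\<in>J. p i \<odot>\<^bsub>M\<^esub> (q i j \<odot>\<^bsub>M\<^esub> x j))"
      using i p q x J by (intro smult_finsum) (auto intro!: smult_closed)
    also have "\<dots> = (\<Oplus>\<^bsub>M\<^esub>j\<in>J. (p i \<otimes>\<^bsub>A\<^esub> q i j) \<odot>\<^bsub>M\<^esub> x j)"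
      using i p q x by (intro M.finsum_cong') (auto intro!: smult_closed simp: smult_assoc)
    finally show "p i \<odot>\<^bsub>M\<^esub> (\<Oplus>\<^bsub>M\<^esub>j\<in>J. q i j \<odot>\<^bsub>M\<^esub> x j) = (\<Oplus>\<^bsub>M\<^esub>j\<in>J. (p i \<otimes>\<^bsub>A\<^esub> q i j) \<odot>\<^bsub>M\<^esub> x j)" .
  qed
  also have "\<dots> = (\<Oplus>\<^bsub>M\<^esub>j\<in>J. \<Oplus>\<^bsub>M\<^esub>i\<in>I. (p i \<otimes>\<^bsub>A\<^esub> q i j) \<odot>\<^bsub>M\<^esub> x j)"
    using p q x by (intro M.finsum_swap I J smult_closed) auto
  also have "\<dots> = (\<Oplus>\<^bsub>M\<^esub>j\<in>J. (\<Oplus>\<^bsub>A\<^esub>i\<in>I. p i \<otimes>\<^bsub>A\<^esub> q i j) \<odot>\<^bsub>M\<^esub> x j)"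
  proof (rule M.finsum_cong'[OF refl])
    show "(\<lambda>j. (\<Oplus>\<^bsub>A\<^esub>i\<in>I. p i \<otimes>\<^bsub>A\<^esub> q i j) \<odot>\<^bsub>M\<^esub> x j) \<in> J \<rightarrow> carrier M"
      using p q x by (auto intro!: A.finsum_closed smult_closed)
    fix j assume j: "j \<in> J"
    then show "(\<Oplus>\<^bsub>M\<^esub>i\<in>I. (p i \<otimes>\<^bsub>A\<^esub> q i j) \<odot>\<^bsub>M\<^esub> x j) = (\<Oplus>\<^bsub>A\<^esub>i\<in>I. p i \<otimes>\<^bsub>A\<^esub> q i j) \<odot>\<^bsub>M\<^esub> x j"
      using p q x I by (intro finsum_smult[symmetric]) auto
  qed
  finally show ?thesis .
qed

lemma smult_sum_smult:
  assumes I: "finite I" and p: "\<And>i. i \<in> I \<Longrightarrow> p i \<in> carrier A"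
    and q: "\<And>i. i \<in> I \<Longrightarrow> q i \<in> carrier A" and x: "x \<in> carrier M"
  shows "(\<Oplus>\<^bsub>M\<^esub>i\<in>I. p i \<odot>\<^bsub>M\<^esub> (q i \<odot>\<^bsub>M\<^esub> x)) = (\<Oplus>\<^bsub>A\<^esub>i\<in>I. p i \<otimes>\<^bsub>A\<^esub> q i) \<odot>\<^bsub>M\<^esub> x"
proof -
  have "(\<Oplus>\<^bsub>M\<^esub>i\<in>I. p i \<odot>\<^bsub>M\<^esub> (q i \<odot>\<^bsub>M\<^esub> x)) = (\<Oplus>\<^bsub>M\<^esub>i\<in>I. (p i \<otimes>\<^bsub>A\<^esub> q i) \<odot>\<^bsub>M\<^esub> x)"
    using p q x by (intro M.finsum_cong') (auto intro!: smult_closed simp: smult_assoc)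
  also have "\<dots> = (\<Oplus>\<^bsub>A\<^esub>i\<in>I. p i \<otimes>\<^bsub>A\<^esub> q i) \<odot>\<^bsub>M\<^esub> x"
    using p q x I by (intro finsum_smult[symmetric]) auto
  finally show ?thesis .
qed

end

lemma module_homsD:
  assumes "f \<in> module_homs A M N"
  shows "x \<in> carrier M \<Longrightarrow> f x \<in> carrier N" and "f \<in> extensional (carrier M)"
    and "x \<in> carrier M \<Longrightarrow> y \<in> carrier M \<Longrightarrow> f (x \<oplus>\<^bsub>M\<^esub> y) = f x \<oplus>\<^bsub>N\<^esub> f y"
    and "a \<in> carrier A \<Longrightarrow> x \<in> carrier M \<Longrightarrow> f (a \<odot>\<^bsub>M\<^esub> x) = a \<odot>\<^bsub>N\<^esub> f x"
  using assms by (auto simp: module_homs_def PiE_def)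

lemma module_homsI:
  assumes "\<And>x. x \<in> carrier M \<Longrightarrow> f x \<in> carrier N" and "f \<in> extensional (carrier M)"
    and "\<And>x y. x \<in> carrier M \<Longrightarrow> y \<in> carrier M \<Longrightarrow> f (x \<oplus>\<^bsub>M\<^esub> y) = f x \<oplus>\<^bsub>N\<^esub> f y"
    and "\<And>a x. a \<in> carrier A \<Longrightarrow> x \<in> carrier M \<Longrightarrow> f (a \<odot>\<^bsub>M\<^esub> x) = a \<odot>\<^bsub>N\<^esub> f x"
  shows "f \<in> module_homs A M N"
  using assms by (auto simp: module_homs_def PiE_def)

lemma module_homs_finsum:
  assumes "left_module A M" and "left_module A N" and f: "f \<in> module_homs A M N"
    and "finite I" and "g \<in> I \<rightarrow> carrier M"
  shows "f (finsum M g I) = finsum N (\<lambda>i. f (g i)) I"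
proof -
  interpret M: left_module A M by fact
  interpret N: left_module A N by fact
  show ?thesis
    by (rule additive_finsum[OF M.M.abelian_group_axioms N.M.abelian_group_axioms])
      (use assms(4,5) module_homsD[OF f] in auto)
qed

lemma left_moduleI:
  assumes "ring A"
    and "\<And>x y. x \<in> carrier M \<Longrightarrow> y \<in> carrier M \<Longrightarrow> x \<oplus>\<^bsub>M\<^esub> y \<in> carrier M"
    and "\<zero>\<^bsub>M\<^esub> \<in> carrier M"
    and "\<And>x y z. x \<in> carrier M \<Longrightarrow> y \<in> carrier M \<Longrightarrow> z \<in> carrier M \<Longrightarrow>
      (x \<oplus>\<^bsub>M\<^esub> y) \<oplus>\<^bsub>M\<^esub> z = x \<oplus>\<^bsub>M\<^esub> (y \<oplus>\<^bsub>M\<^esub> z)"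
    and "\<And>x y. x \<in> carrier M \<Longrightarrow> y \<in> carrier M \<Longrightarrow> x \<oplus>\<^bsub>M\<^esub> y = y \<oplus>\<^bsub>M\<^esub> x"
    and "\<And>x. x \<in> carrier M \<Longrightarrow> \<zero>\<^bsub>M\<^esub> \<oplus>\<^bsub>M\<^esub> x = x"
    and "\<And>x. x \<in> carrier M \<Longrightarrow> \<exists>y\<in>carrier M. y \<oplus>\<^bsub>M\<^esub> x = \<zero>\<^bsub>M\<^esub>"
    and "\<And>a x. a \<in> carrier A \<Longrightarrow> x \<in> carrier M \<Longrightarrow> a \<odot>\<^bsub>M\<^esub> x \<in> carrier M"
    and "\<And>a b x. a \<in> carrier A \<Longrightarrow> b \<in> carrier A \<Longrightarrow> x \<in> carrier M \<Longrightarrow>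
      (a \<oplus>\<^bsub>A\<^esub> b) \<odot>\<^bsub>M\<^esub> x = a \<odot>\<^bsub>M\<^esub> x \<oplus>\<^bsub>M\<^esub> b \<odot>\<^bsub>M\<^esub> x"
    and "\<And>a x y. a \<in> carrier A \<Longrightarrow> x \<in> carrier M \<Longrightarrow> y \<in> carrier M \<Longrightarrow>
      a \<odot>\<^bsub>M\<^esub> (x \<oplus>\<^bsub>M\<^esub> y) = a \<odot>\<^bsub>M\<^esub> x \<oplus>\<^bsub>M\<^esub> a \<odot>\<^bsub>M\<^esub> y"
    and "\<And>a b x. a \<in> carrier A \<Longrightarrow> b \<in> carrier A \<Longrightarrow> x \<in> carrier M \<Longrightarrow>
      (a \<otimes>\<^bsub>A\<^esub> b) \<odot>\<^bsub>M\<^esub> x = a \<odot>\<^bsub>M\<^esub> (b \<odot>\<^bsub>M\<^esub> x)"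
    and "\<And>x. x \<in> carrier M \<Longrightarrow> \<one>\<^bsub>A\<^esub> \<odot>\<^bsub>M\<^esub> x = x"
  shows "left_module A M"
proof -
  have "abelian_group M" by (rule abelian_groupI) (use assms in auto)
  then show ?thesis using assms by (simp add: left_module_def left_module_axioms_def)
qed

text \<open>The ring \<open>B\<close> is the corner \<open>e A e\<close> for the idempotent \<open>e = \<phi> 1\<close>, and \<open>full\<close> witnesses \<open>A e A = A\<close>.
  The injection \<open>enc\<close> stores \<open>n\<close>-tuples of elements of the universe \<open>'u\<close> of modules in \<open>'u\<close>.\<close>

locale full_corner = A: ring A + B: ring B for A :: "('k, 'a) module" and B :: "('k, 'b) module" +
  fixes \<phi> :: "'b \<Rightarrow> 'a" and n :: nat and \<alpha> \<beta> :: "nat \<Rightarrow> 'a" and enc :: "(nat \<Rightarrow> 'u) \<Rightarrow> 'u"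
  assumes \<phi>_closed: "x \<in> carrier B \<Longrightarrow> \<phi> x \<in> carrier A"
    and \<phi>_add: "x \<in> carrier B \<Longrightarrow> y \<in> carrier B \<Longrightarrow> \<phi> (x \<oplus>\<^bsub>B\<^esub> y) = \<phi> x \<oplus>\<^bsub>A\<^esub> \<phi> y"
    and \<phi>_mult: "x \<in> carrier B \<Longrightarrow> y \<in> carrier B \<Longrightarrow> \<phi> (x \<otimes>\<^bsub>B\<^esub> y) = \<phi> x \<otimes>\<^bsub>A\<^esub> \<phi> y"
    and \<phi>_inj: "inj_on \<phi> (carrier B)"
    and corner: "a \<in> carrier A \<Longrightarrow> \<phi> \<one>\<^bsub>B\<^esub> \<otimes>\<^bsub>A\<^esub> a \<otimes>\<^bsub>A\<^esub> \<phi> \<one>\<^bsub>B\<^esub> \<in> \<phi> ` carrier B"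
    and \<alpha>_closed: "i < n \<Longrightarrow> \<alpha> i \<in> carrier A" and \<beta>_closed: "i < n \<Longrightarrow> \<beta> i \<in> carrier A"
    and \<alpha>_corner: "i < n \<Longrightarrow> \<alpha> i \<otimes>\<^bsub>A\<^esub> \<phi> \<one>\<^bsub>B\<^esub> = \<alpha> i"
    and \<beta>_corner: "i < n \<Longrightarrow> \<phi> \<one>\<^bsub>B\<^esub> \<otimes>\<^bsub>A\<^esub> \<beta> i = \<beta> i"
    and full: "(\<Oplus>\<^bsub>A\<^esub>i\<in>{..<n}. \<alpha> i \<otimes>\<^bsub>A\<^esub> \<beta> i) = \<one>\<^bsub>A\<^esub>"
    and enc_inj: "inj_on enc ({..<n} \<rightarrow>\<^sub>E UNIV)"
begin

abbreviation e :: 'a where "e \<equiv> \<phi> \<one>\<^bsub>B\<^esub>"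

definition \<theta> :: "'a \<Rightarrow> 'b" where "\<theta> = inv_into (carrier B) \<phi>"

text \<open>The matrix over \<open>B\<close> of left multiplication by \<open>a\<close> on the right
  \<open>B\<close>-module \<open>A e\<close> with generators \<open>\<alpha> i\<close>: by
  \<open>full\<close>, \<open>a\<close> times \<open>\<alpha> j\<close> is the sum over
  \<open>i\<close> of \<open>\<alpha> i\<close> times \<open>\<phi> (t i a j)\<close>. The
  generators need not be free, so the matrix of 1 is in general only idempotent.\<close>

definition t :: "nat \<Rightarrow> 'a \<Rightarrow> nat \<Rightarrow> 'b" where "t i a j = \<theta> (\<beta> i \<otimes>\<^bsub>A\<^esub> a \<otimes>\<^bsub>A\<^esub> \<alpha> j)"

lemma e_closed: "e \<in> carrier A" by (simp add: \<phi>_closed)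

lemma \<phi>_e: "x \<in> carrier B \<Longrightarrow> \<phi> x \<otimes>\<^bsub>A\<^esub> e = \<phi> x" "x \<in> carrier B \<Longrightarrow> e \<otimes>\<^bsub>A\<^esub> \<phi> x = \<phi> x"
  by (simp_all flip: \<phi>_mult)

lemma \<theta>:
  assumes a: "a \<in> carrier A" and "e \<otimes>\<^bsub>A\<^esub> a = a" and "a \<otimes>\<^bsub>A\<^esub> e = a"
  shows "\<theta> a \<in> carrier B" and "\<phi> (\<theta> a) = a"
proof -
  have "a \<in> \<phi> ` carrier B" using corner[OF a] assms by simp
  then show "\<theta> a \<in> carrier B" "\<phi> (\<theta> a) = a" unfolding \<theta>_def by (auto intro: inv_into_into f_inv_into_f)
qed

lemma \<phi>_eqI: "x \<in> carrier B \<Longrightarrow> y \<in> carrier B \<Longrightarrow> \<phi> x = \<phi> y \<Longrightarrow> x = y"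
  using inj_onD[OF \<phi>_inj] by blast

lemma t:
  assumes "i < n" "j < n" and a: "a \<in> carrier A"
  shows t_closed: "t i a j \<in> carrier B" and \<phi>_t: "\<phi> (t i a j) = \<beta> i \<otimes>\<^bsub>A\<^esub> a \<otimes>\<^bsub>A\<^esub> \<alpha> j"
proof -
  note c = \<alpha>_closed[OF assms(2)] \<beta>_closed[OF assms(1)] a e_closed
  have 1: "e \<otimes>\<^bsub>A\<^esub> (\<beta> i \<otimes>\<^bsub>A\<^esub> a \<otimes>\<^bsub>A\<^esub> \<alpha> j) = \<beta> i \<otimes>\<^bsub>A\<^esub> a \<otimes>\<^bsub>A\<^esub> \<alpha> j"
    using c \<beta>_corner[OF assms(1)] by (simp flip: A.m_assoc)
  have 2: "\<beta> i \<otimes>\<^bsub>A\<^esub> a \<otimes>\<^bsub>A\<^esub> \<alpha> j \<otimes>\<^bsub>A\<^esub> e = \<beta> i \<otimes>\<^bsub>A\<^esub> a \<otimes>\<^bsub>A\<^esub> \<alpha> j"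
    using c \<alpha>_corner[OF assms(2)] by (simp add: A.m_assoc)
  show "t i a j \<in> carrier B" "\<phi> (t i a j) = \<beta> i \<otimes>\<^bsub>A\<^esub> a \<otimes>\<^bsub>A\<^esub> \<alpha> j"
    unfolding t_def using \<theta>[OF _ 1 2] c by simp_all
qed

lemma \<phi>_finsum: "finite I \<Longrightarrow> g \<in> I \<rightarrow> carrier B \<Longrightarrow> \<phi> (finsum B g I) = finsum A (\<lambda>i. \<phi> (g i)) I"
  by (rule additive_finsum[OF B.abelian_group_axioms A.abelian_group_axioms]) (use \<phi>_closed \<phi>_add in auto)

text \<open>The sum in \<open>full\<close> is inserted between \<open>a\<close> and
  \<open>b\<close>. This is how sums over the generators are contracted below.\<close>

lemma resolution:
  assumes a: "a \<in> carrier A" and b: "b \<in> carrier A"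
  shows "(\<Oplus>\<^bsub>A\<^esub>j\<in>{..<n}. (a \<otimes>\<^bsub>A\<^esub> \<alpha> j) \<otimes>\<^bsub>A\<^esub> (\<beta> j \<otimes>\<^bsub>A\<^esub> b)) = a \<otimes>\<^bsub>A\<^esub> b"
proof -
  have c: "(\<lambda>j. \<alpha> j \<otimes>\<^bsub>A\<^esub> \<beta> j) \<in> {..<n} \<rightarrow> carrier A" using \<alpha>_closed \<beta>_closed by auto
  have "(\<Oplus>\<^bsub>A\<^esub>j\<in>{..<n}. (a \<otimes>\<^bsub>A\<^esub> \<alpha> j) \<otimes>\<^bsub>A\<^esub> (\<beta> j \<otimes>\<^bsub>A\<^esub> b)) = (\<Oplus>\<^bsub>A\<^esub>j\<in>{..<n}. a \<otimes>\<^bsub>A\<^esub> (\<alpha> j \<otimes>\<^bsub>A\<^esub> \<beta> j) \<otimes>\<^bsub>A\<^esub> b)"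
    using a b \<alpha>_closed \<beta>_closed by (intro A.finsum_cong') (auto simp: A.m_assoc)
  also have "\<dots> = a \<otimes>\<^bsub>A\<^esub> (\<Oplus>\<^bsub>A\<^esub>j\<in>{..<n}. \<alpha> j \<otimes>\<^bsub>A\<^esub> \<beta> j) \<otimes>\<^bsub>A\<^esub> b"
    using a b c by (subst A.finsum_rdistr) (auto intro!: A.finsum_ldistr[symmetric])
  finally show ?thesis using a b by (simp add: full)
qed

lemma t_mult:
  assumes i: "i < n" and l: "l < n" and a: "a \<in> carrier A" and b: "b \<in> carrier A"
  shows "(\<Oplus>\<^bsub>B\<^esub>j\<in>{..<n}. t i a j \<otimes>\<^bsub>B\<^esub> t j b l) = t i (a \<otimes>\<^bsub>A\<^esub> b) l"
proof (rule \<phi>_eqI)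
  have c: "(\<lambda>j. t i a j \<otimes>\<^bsub>B\<^esub> t j b l) \<in> {..<n} \<rightarrow> carrier B" using assms t_closed by auto
  then show "(\<Oplus>\<^bsub>B\<^esub>j\<in>{..<n}. t i a j \<otimes>\<^bsub>B\<^esub> t j b l) \<in> carrier B" by (rule B.finsum_closed)
  have "\<phi> (\<Oplus>\<^bsub>B\<^esub>j\<in>{..<n}. t i a j \<otimes>\<^bsub>B\<^esub> t j b l) = (\<Oplus>\<^bsub>A\<^esub>j\<in>{..<n}. \<phi> (t i a j \<otimes>\<^bsub>B\<^esub> t j b l))"
    by (rule \<phi>_finsum[OF _ c]) simp
  also have "\<dots> = (\<Oplus>\<^bsub>A\<^esub>j\<in>{..<n}. (\<beta> i \<otimes>\<^bsub>A\<^esub> a \<otimes>\<^bsub>A\<^esub> \<alpha> j) \<otimes>\<^bsub>A\<^esub> (\<beta> j \<otimes>\<^bsub>A\<^esub> (b \<otimes>\<^bsub>A\<^esub> \<alpha> l)))"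
    using assms \<alpha>_closed \<beta>_closed by (intro A.finsum_cong') (auto simp: \<phi>_mult t_closed \<phi>_t A.m_assoc)
  also have "\<dots> = \<phi> (t i (a \<otimes>\<^bsub>A\<^esub> b) l)"
    using assms \<alpha>_closed \<beta>_closed by (subst resolution) (auto simp: \<phi>_t A.m_assoc)
  finally show "\<phi> (\<Oplus>\<^bsub>B\<^esub>j\<in>{..<n}. t i a j \<otimes>\<^bsub>B\<^esub> t j b l) = \<phi> (t i (a \<otimes>\<^bsub>A\<^esub> b) l)" .
qed (use assms t_closed in auto)

lemma t_add:
  assumes i: "i < n" and j: "j < n" and a: "a \<in> carrier A" and b: "b \<in> carrier A"
  shows "t i (a \<oplus>\<^bsub>A\<^esub> b) j = t i a j \<oplus>\<^bsub>B\<^esub> t i b j"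
  by (rule \<phi>_eqI) (use assms \<alpha>_closed \<beta>_closed in \<open>auto simp: t_closed \<phi>_t \<phi>_add A.l_distr A.r_distr\<close>)

section \<open>The functor to the corner and its inverse\<close>

definition Fo :: "('a, 'u) module \<Rightarrow> ('b, 'u) module" where
  "Fo M = \<lparr>carrier = {x \<in> carrier M. e \<odot>\<^bsub>M\<^esub> x = x}, mult = mult M, one = one M, zero = zero M,
     add = add M, module.smult = (\<lambda>b x. \<phi> b \<odot>\<^bsub>M\<^esub> x)\<rparr>"

definition Fm :: "('a, 'u) module \<Rightarrow> ('a, 'u) module \<Rightarrow> ('u \<Rightarrow> 'u) \<Rightarrow> 'u \<Rightarrow> 'u" where
  "Fm M N f = restrict f (carrier (Fo M))"

lemma Fo_simps [simp]:
  "x \<in> carrier (Fo M) \<longleftrightarrow> x \<in> carrier M \<and> e \<odot>\<^bsub>M\<^esub> x = x"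
  "\<zero>\<^bsub>Fo M\<^esub> = \<zero>\<^bsub>M\<^esub>" "x \<oplus>\<^bsub>Fo M\<^esub> y = x \<oplus>\<^bsub>M\<^esub> y" "b \<odot>\<^bsub>Fo M\<^esub> x = \<phi> b \<odot>\<^bsub>M\<^esub> x"
  by (simp_all add: Fo_def)

lemma Fo_module:
  assumes "left_module A M"
  shows "left_module B (Fo M)"
proof -
  interpret M: left_module A M by fact
  have z: "a \<odot>\<^bsub>M\<^esub> \<zero>\<^bsub>M\<^esub> = \<zero>\<^bsub>M\<^esub>" if "a \<in> carrier A" for a
    using M.smult_finsum[OF that, of "{}"] by simp
  show ?thesis
  proof (rule left_moduleI[OF B.ring_axioms])
    show "\<exists>y\<in>carrier (Fo M). y \<oplus>\<^bsub>Fo M\<^esub> x = \<zero>\<^bsub>Fo M\<^esub>" if "x \<in> carrier (Fo M)" for x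
    proof
      have x: "x \<in> carrier M" "e \<odot>\<^bsub>M\<^esub> x = x" using that by auto
      then have m: "\<ominus>\<^bsub>M\<^esub> x \<in> carrier M" by simp
      have "e \<odot>\<^bsub>M\<^esub> (\<ominus>\<^bsub>M\<^esub> x) \<oplus>\<^bsub>M\<^esub> x = e \<odot>\<^bsub>M\<^esub> (\<ominus>\<^bsub>M\<^esub> x \<oplus>\<^bsub>M\<^esub> x)"
        using x m M.smult_r_distr[OF e_closed m x(1)] by simp
      also have "\<dots> = \<zero>\<^bsub>M\<^esub>" using x z e_closed by (simp add: M.l_neg)
      finally have "e \<odot>\<^bsub>M\<^esub> (\<ominus>\<^bsub>M\<^esub> x) = \<ominus>\<^bsub>M\<^esub> x"
        using x M.smult_closed[OF e_closed m] M.minus_equality by metis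
      then show "\<ominus>\<^bsub>M\<^esub> x \<in> carrier (Fo M)" using m by simp
      show "\<ominus>\<^bsub>M\<^esub> x \<oplus>\<^bsub>Fo M\<^esub> x = \<zero>\<^bsub>Fo M\<^esub>" using x by (simp add: M.l_neg)
    qed
  qed (auto simp: M.smult_r_distr e_closed z M.M.a_ac M.smult_closed \<phi>_closed \<phi>_e
      M.smult_l_distr \<phi>_add \<phi>_mult M.smult_assoc simp flip: M.smult_assoc)
qed

lemma Fm_hom:
  assumes M: "left_module A M" and f: "f \<in> module_homs A M N"
  shows "Fm M N f \<in> module_homs B (Fo M) (Fo N)"
proof -
  interpret F: left_module B "Fo M" by (rule Fo_module[OF M])
  show ?thesis
  proof (rule module_homsI)
    show "Fm M N f x \<in> carrier (Fo N)" if "x \<in> carrier (Fo M)" for x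
      using that module_homsD(1)[OF f, of x] module_homsD(4)[OF f e_closed, of x] by (simp add: Fm_def)
    show "Fm M N f \<in> extensional (carrier (Fo M))" by (simp add: Fm_def)
    show "Fm M N f (x \<oplus>\<^bsub>Fo M\<^esub> y) = Fm M N f x \<oplus>\<^bsub>Fo N\<^esub> Fm M N f y"
      if xy: "x \<in> carrier (Fo M)" "y \<in> carrier (Fo M)" for x y
      using F.a_closed[OF xy] xy module_homsD(3)[OF f, of x y] by (simp add: Fm_def)
    show "Fm M N f (b \<odot>\<^bsub>Fo M\<^esub> x) = b \<odot>\<^bsub>Fo N\<^esub> Fm M N f x"
      if bx: "b \<in> carrier B" "x \<in> carrier (Fo M)" for b x
      using F.smult_closed[OF bx] bx module_homsD(4)[OF f \<phi>_closed[OF bx(1)], of x] by (simp add: Fm_def)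
  qed
qed

lemma finsum_Fo:
  assumes M: "left_module A M" and "finite I" and "g \<in> I \<rightarrow> carrier (Fo M)"
  shows "finsum (Fo M) g I = finsum M g I"
proof -
  interpret M: left_module A M by fact
  interpret F: left_module B "Fo M" by (rule Fo_module[OF M])
  show ?thesis
    using additive_finsum[OF F.M.abelian_group_axioms M.M.abelian_group_axioms, of "\<lambda>x. x"] assms(2,3) by auto
qed

definition act :: "('b, 'u) module \<Rightarrow> 'a \<Rightarrow> (nat \<Rightarrow> 'u) \<Rightarrow> nat \<Rightarrow> 'u" where
  "act N a x = (\<lambda>i\<in>{..<n}. \<Oplus>\<^bsub>N\<^esub>j\<in>{..<n}. t i a j \<odot>\<^bsub>N\<^esub> x j)"

definition tuple_add :: "('b, 'u) module \<Rightarrow> (nat \<Rightarrow> 'u) \<Rightarrow> (nat \<Rightarrow> 'u) \<Rightarrow> nat \<Rightarrow> 'u" where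
  "tuple_add N x y = (\<lambda>i\<in>{..<n}. x i \<oplus>\<^bsub>N\<^esub> y i)"

text \<open>A model of \<open>A e \<otimes> N\<close> (tensor product over \<open>B\<close>) without tensor products: the module \<open>A e\<close> is the image
  of the idempotent matrix \<open>t _ 1 _\<close> over \<open>B\<close>, so \<open>A e \<otimes> N\<close> is the image of that matrix on \<open>n\<close>-tuples in \<open>N\<close>.\<close>

definition tuples :: "('b, 'u) module \<Rightarrow> (nat \<Rightarrow> 'u) set" where
  "tuples N = {x \<in> {..<n} \<rightarrow>\<^sub>E carrier N. act N \<one>\<^bsub>A\<^esub> x = x}"

definition dec :: "'u \<Rightarrow> nat \<Rightarrow> 'u" where "dec = inv_into ({..<n} \<rightarrow>\<^sub>E UNIV) enc"

definition Go :: "('b, 'u) module \<Rightarrow> ('a, 'u) module" where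
  "Go N = \<lparr>carrier = enc ` tuples N, mult = mult N, one = one N, zero = enc (\<lambda>i\<in>{..<n}. \<zero>\<^bsub>N\<^esub>),
     add = (\<lambda>y z. enc (tuple_add N (dec y) (dec z))), module.smult = (\<lambda>a y. enc (act N a (dec y)))\<rparr>"

definition Gm :: "('b, 'u) module \<Rightarrow> ('b, 'u) module \<Rightarrow> ('u \<Rightarrow> 'u) \<Rightarrow> 'u \<Rightarrow> 'u" where
  "Gm N P f = (\<lambda>y\<in>carrier (Go N). enc (\<lambda>i\<in>{..<n}. f (dec y i)))"

lemma dec_enc [simp]: "x \<in> extensional {..<n} \<Longrightarrow> dec (enc x) = x"
  unfolding dec_def by (rule inv_into_f_f[OF enc_inj]) (simp add: PiE_def)

lemma enc_eqD: "enc x = enc y \<Longrightarrow> x \<in> extensional {..<n} \<Longrightarrow> y \<in> extensional {..<n} \<Longrightarrow> x = y"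
  by (metis dec_enc)

lemma act_extensional [simp]: "act N a x \<in> extensional {..<n}" by (simp add: act_def)
lemma tuple_add_extensional [simp]: "tuple_add N x y \<in> extensional {..<n}" by (simp add: tuple_add_def)

lemma tuplesD: "x \<in> tuples N \<Longrightarrow> x \<in> {..<n} \<rightarrow>\<^sub>E carrier N" "x \<in> tuples N \<Longrightarrow> act N \<one>\<^bsub>A\<^esub> x = x"
  "x \<in> tuples N \<Longrightarrow> x \<in> extensional {..<n}" "x \<in> tuples N \<Longrightarrow> i < n \<Longrightarrow> x i \<in> carrier N"
  by (auto simp: tuples_def PiE_def)

lemma Go_simps [simp]:
  "carrier (Go N) = enc ` tuples N" "\<zero>\<^bsub>Go N\<^esub> = enc (\<lambda>i\<in>{..<n}. \<zero>\<^bsub>N\<^esub>)"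
  "x \<in> extensional {..<n} \<Longrightarrow> y \<in> extensional {..<n} \<Longrightarrow> enc x \<oplus>\<^bsub>Go N\<^esub> enc y = enc (tuple_add N x y)"
  "x \<in> extensional {..<n} \<Longrightarrow> a \<odot>\<^bsub>Go N\<^esub> enc x = enc (act N a x)"
  by (simp_all add: Go_def)

lemma Gm_enc: "x \<in> tuples N \<Longrightarrow> Gm N P f (enc x) = enc (\<lambda>i\<in>{..<n}. f (x i))"
  by (simp add: Gm_def tuplesD)

context
  fixes N :: "('b, 'u) module"
  assumes N: "left_module B N"
begin

interpretation N: left_module B N by (rule N)

lemma act_closed:
  assumes "a \<in> carrier A" and x: "x \<in> {..<n} \<rightarrow>\<^sub>E carrier N"
  shows "act N a x \<in> {..<n} \<rightarrow>\<^sub>E carrier N"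
proof -
  have "(\<Oplus>\<^bsub>N\<^esub>j\<in>{..<n}. t i a j \<odot>\<^bsub>N\<^esub> x j) \<in> carrier N" if "i < n" for i
    using assms that by (intro N.M.finsum_closed) (auto intro!: N.smult_closed t_closed)
  then show ?thesis by (auto simp: act_def)
qed

lemma tuple_add_closed:
  assumes "x \<in> {..<n} \<rightarrow>\<^sub>E carrier N" and "y \<in> {..<n} \<rightarrow>\<^sub>E carrier N"
  shows "tuple_add N x y \<in> {..<n} \<rightarrow>\<^sub>E carrier N"
  using assms by (auto simp: tuple_add_def)

lemma act_mult:
  assumes a: "a \<in> carrier A" and b: "b \<in> carrier A" and x: "x \<in> {..<n} \<rightarrow>\<^sub>E carrier N"
  shows "act N a (act N b x) = act N (a \<otimes>\<^bsub>A\<^esub> b) x"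
proof (rule extensionalityI[of _ "{..<n}"])
  fix i assume i: "i \<in> {..<n}"
  have x': "x j \<in> carrier N" if "j < n" for j using x that by auto
  have "act N a (act N b x) i = (\<Oplus>\<^bsub>N\<^esub>j\<in>{..<n}. t i a j \<odot>\<^bsub>N\<^esub> (\<Oplus>\<^bsub>N\<^esub>l\<in>{..<n}. t j b l \<odot>\<^bsub>N\<^esub> x l))"
    using act_closed[OF b x] i a t_closed
    by (simp add: act_def, intro N.M.finsum_cong') (auto intro!: N.smult_closed N.M.finsum_closed t_closed b x')
  also have "\<dots> = (\<Oplus>\<^bsub>N\<^esub>l\<in>{..<n}. (\<Oplus>\<^bsub>B\<^esub>j\<in>{..<n}. t i a j \<otimes>\<^bsub>B\<^esub> t j b l) \<odot>\<^bsub>N\<^esub> x l)"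
    using i x' by (intro N.smult_double_sum) (auto intro!: t_closed a b)
  also have "\<dots> = (\<Oplus>\<^bsub>N\<^esub>l\<in>{..<n}. t i (a \<otimes>\<^bsub>A\<^esub> b) l \<odot>\<^bsub>N\<^esub> x l)"
    using i a b x' by (intro N.M.finsum_cong') (auto simp: t_mult intro!: N.smult_closed t_closed)
  also have "\<dots> = act N (a \<otimes>\<^bsub>A\<^esub> b) x i" using i by (simp add: act_def)
  finally show "act N a (act N b x) i = act N (a \<otimes>\<^bsub>A\<^esub> b) x i" .
qed simp_all

lemma act_add:
  assumes a: "a \<in> carrier A" and b: "b \<in> carrier A" and x: "x \<in> {..<n} \<rightarrow>\<^sub>E carrier N"
  shows "act N (a \<oplus>\<^bsub>A\<^esub> b) x = tuple_add N (act N a x) (act N b x)"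
proof (rule extensionalityI[of _ "{..<n}"])
  fix i assume i: "i \<in> {..<n}"
  have x': "x j \<in> carrier N" if "j < n" for j using x that by auto
  have "act N (a \<oplus>\<^bsub>A\<^esub> b) x i = (\<Oplus>\<^bsub>N\<^esub>j\<in>{..<n}. t i a j \<odot>\<^bsub>N\<^esub> x j \<oplus>\<^bsub>N\<^esub> t i b j \<odot>\<^bsub>N\<^esub> x j)"
    using i a b x' unfolding act_def
    by (simp, intro N.M.finsum_cong') (auto simp: t_add N.smult_l_distr t_closed intro!: N.smult_closed)
  also have "\<dots> = tuple_add N (act N a x) (act N b x) i"
    using i a b x' by (simp add: act_def tuple_add_def, intro N.M.finsum_addf) (auto intro!: N.smult_closed t_closed)
  finally show "act N (a \<oplus>\<^bsub>A\<^esub> b) x i = tuple_add N (act N a x) (act N b x) i" .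
qed simp_all

lemma act_tuple_add:
  assumes a: "a \<in> carrier A" and x: "x \<in> {..<n} \<rightarrow>\<^sub>E carrier N" and y: "y \<in> {..<n} \<rightarrow>\<^sub>E carrier N"
  shows "act N a (tuple_add N x y) = tuple_add N (act N a x) (act N a y)"
proof (rule extensionalityI[of _ "{..<n}"])
  fix i assume i: "i \<in> {..<n}"
  have x': "x j \<in> carrier N" "y j \<in> carrier N" if "j < n" for j using x y that by auto
  have "act N a (tuple_add N x y) i = (\<Oplus>\<^bsub>N\<^esub>j\<in>{..<n}. t i a j \<odot>\<^bsub>N\<^esub> x j \<oplus>\<^bsub>N\<^esub> t i a j \<odot>\<^bsub>N\<^esub> y j)"
    using i a x' unfolding act_def tuple_add_def
    by (simp, intro N.M.finsum_cong') (auto simp: N.smult_r_distr t_closed intro!: N.smult_closed)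
  also have "\<dots> = tuple_add N (act N a x) (act N a y) i"
    using i a x' by (simp add: act_def tuple_add_def, intro N.M.finsum_addf) (auto intro!: N.smult_closed t_closed)
  finally show "act N a (tuple_add N x y) i = tuple_add N (act N a x) (act N a y) i" .
qed simp_all

lemma act_zero:
  assumes x: "x \<in> {..<n} \<rightarrow>\<^sub>E carrier N"
  shows "act N \<zero>\<^bsub>A\<^esub> x = (\<lambda>i\<in>{..<n}. \<zero>\<^bsub>N\<^esub>)"
proof (rule extensionalityI[of _ "{..<n}"])
  fix i assume i: "i \<in> {..<n}"
  have "t i \<zero>\<^bsub>A\<^esub> j = \<zero>\<^bsub>B\<^esub>" if j: "j < n" for j
  proof (rule \<phi>_eqI)
    have "\<phi> \<zero>\<^bsub>B\<^esub> = \<zero>\<^bsub>A\<^esub>"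
      by (rule additive_zero[OF B.abelian_group_axioms A.abelian_group_axioms]) (auto simp: \<phi>_closed \<phi>_add)
    then show "\<phi> (t i \<zero>\<^bsub>A\<^esub> j) = \<phi> \<zero>\<^bsub>B\<^esub>" using i j \<alpha>_closed \<beta>_closed by (simp add: \<phi>_t)
  qed (use i j t_closed in auto)
  then have "(\<Oplus>\<^bsub>N\<^esub>j\<in>{..<n}. t i \<zero>\<^bsub>A\<^esub> j \<odot>\<^bsub>N\<^esub> x j) = (\<Oplus>\<^bsub>N\<^esub>j\<in>{..<n}. \<zero>\<^bsub>N\<^esub>)"
    using x by (intro N.M.finsum_cong') (auto simp: N.smult_zero dest: PiE_mem)
  then show "act N \<zero>\<^bsub>A\<^esub> x i = (\<lambda>i\<in>{..<n}. \<zero>\<^bsub>N\<^esub>) i" using i by (simp add: act_def)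
qed simp_all

lemma act_tuples: "a \<in> carrier A \<Longrightarrow> x \<in> {..<n} \<rightarrow>\<^sub>E carrier N \<Longrightarrow> act N a x \<in> tuples N"
  by (simp add: tuples_def act_closed act_mult)

lemma tuple_add_tuples: "x \<in> tuples N \<Longrightarrow> y \<in> tuples N \<Longrightarrow> tuple_add N x y \<in> tuples N"
  unfolding tuples_def by (simp add: tuple_add_closed act_tuple_add)

lemma Go_module: "left_module A (Go N)"
proof -
  have 0: "(\<lambda>i\<in>{..<n}. \<zero>\<^bsub>N\<^esub>) \<in> tuples N"
  proof -
    have c: "(\<lambda>i\<in>{..<n}. \<zero>\<^bsub>N\<^esub>) \<in> {..<n} \<rightarrow>\<^sub>E carrier N" by auto
    show ?thesis using act_tuples[OF A.zero_closed c] act_zero[OF c] by simp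
  qed
  show ?thesis
  proof (rule left_moduleI[OF A.ring_axioms])
    fix x y assume "x \<in> carrier (Go N)" "y \<in> carrier (Go N)"
    then obtain x' y' where xy: "x' \<in> tuples N" "y' \<in> tuples N" "x = enc x'" "y = enc y'" by auto
    note c = tuplesD(1)[OF xy(1)] tuplesD(1)[OF xy(2)]
    have x': "x' i \<in> carrier N" "y' i \<in> carrier N" if "i < n" for i using c that by auto
    show "x \<oplus>\<^bsub>Go N\<^esub> y \<in> carrier (Go N)" using xy by (simp add: tuplesD tuple_add_tuples)
    have "tuple_add N x' y' = tuple_add N y' x'" unfolding tuple_add_def
      by (rule restrict_ext) (simp add: x' N.M.a_comm)
    then show "x \<oplus>\<^bsub>Go N\<^esub> y = y \<oplus>\<^bsub>Go N\<^esub> x" using xy by (simp add: tuplesD)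
    have "tuple_add N (\<lambda>i\<in>{..<n}. \<zero>\<^bsub>N\<^esub>) x' = x'"
      by (rule extensionalityI[of _ "{..<n}"]) (use xy x' in \<open>auto simp: tuplesD tuple_add_def\<close>)
    then show "\<zero>\<^bsub>Go N\<^esub> \<oplus>\<^bsub>Go N\<^esub> x = x" using xy by (simp add: tuplesD)
    \<comment> \<open>Additive inverses come from the action of -1, because 1 acts trivially on the
      elements of \<open>tuples N\<close>.\<close>
    have "tuple_add N (act N (\<ominus>\<^bsub>A\<^esub> \<one>\<^bsub>A\<^esub>) x') (act N \<one>\<^bsub>A\<^esub> x') = act N \<zero>\<^bsub>A\<^esub> x'"
      using act_add[OF _ _ c(1), of "\<ominus>\<^bsub>A\<^esub> \<one>\<^bsub>A\<^esub>" "\<one>\<^bsub>A\<^esub>"] by (simp add: A.l_neg)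
    then have "enc (act N (\<ominus>\<^bsub>A\<^esub> \<one>\<^bsub>A\<^esub>) x') \<oplus>\<^bsub>Go N\<^esub> x = \<zero>\<^bsub>Go N\<^esub>"
      using xy by (simp add: tuplesD act_zero)
    moreover have "enc (act N (\<ominus>\<^bsub>A\<^esub> \<one>\<^bsub>A\<^esub>) x') \<in> carrier (Go N)" using c act_tuples by simp
    ultimately show "\<exists>y\<in>carrier (Go N). y \<oplus>\<^bsub>Go N\<^esub> x = \<zero>\<^bsub>Go N\<^esub>" by blast
    show "\<one>\<^bsub>A\<^esub> \<odot>\<^bsub>Go N\<^esub> x = x" using xy by (simp add: tuplesD)
    fix a assume a: "a \<in> carrier A"
    show "a \<odot>\<^bsub>Go N\<^esub> x \<in> carrier (Go N)" using a xy c by (simp add: tuplesD act_tuples)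
    show "a \<odot>\<^bsub>Go N\<^esub> (x \<oplus>\<^bsub>Go N\<^esub> y) = a \<odot>\<^bsub>Go N\<^esub> x \<oplus>\<^bsub>Go N\<^esub> a \<odot>\<^bsub>Go N\<^esub> y"
      using a xy c by (simp add: tuplesD act_tuple_add)
    fix b assume b: "b \<in> carrier A"
    show "(a \<oplus>\<^bsub>A\<^esub> b) \<odot>\<^bsub>Go N\<^esub> x = a \<odot>\<^bsub>Go N\<^esub> x \<oplus>\<^bsub>Go N\<^esub> b \<odot>\<^bsub>Go N\<^esub> x"
      using a b xy c by (simp add: tuplesD act_add)
    show "(a \<otimes>\<^bsub>A\<^esub> b) \<odot>\<^bsub>Go N\<^esub> x = a \<odot>\<^bsub>Go N\<^esub> (b \<odot>\<^bsub>Go N\<^esub> x)"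
      using a b xy c by (simp add: tuplesD act_mult)
  next
    fix x y z assume "x \<in> carrier (Go N)" "y \<in> carrier (Go N)" "z \<in> carrier (Go N)"
    then obtain x' y' z' where xy: "x' \<in> tuples N" "y' \<in> tuples N" "z' \<in> tuples N" "x = enc x'" "y = enc y'" "z = enc z'"
      by auto
    have "tuple_add N (tuple_add N x' y') z' = tuple_add N x' (tuple_add N y' z')" unfolding tuple_add_def
      by (rule restrict_ext) (use xy in \<open>simp add: tuplesD N.M.a_assoc\<close>)
    then show "x \<oplus>\<^bsub>Go N\<^esub> y \<oplus>\<^bsub>Go N\<^esub> z = x \<oplus>\<^bsub>Go N\<^esub> (y \<oplus>\<^bsub>Go N\<^esub> z)" using xy by (simp add: tuplesD)
  qed (use 0 in simp)
qed

end

text \<open>A \<open>B\<close>-linear map applied to each coordinate commutes with matrices over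
  \<open>B\<close>. In particular it respects the image of the idempotent matrix of 1, which makes
  \<open>Gm\<close> well defined.\<close>

lemma act_hom:
  assumes N: "left_module B N" and P: "left_module B P" and f: "f \<in> module_homs B N P"
    and a: "a \<in> carrier A" and x: "x \<in> {..<n} \<rightarrow>\<^sub>E carrier N"
  shows "act P a (\<lambda>i\<in>{..<n}. f (x i)) = (\<lambda>i\<in>{..<n}. f (act N a x i))"
proof (rule extensionalityI[of _ "{..<n}"])
  interpret N: left_module B N by (rule N)
  interpret P: left_module B P by (rule P)
  fix i assume i: "i \<in> {..<n}"
  have x': "x j \<in> carrier N" if "j < n" for j using x that by auto
  have "f (act N a x i) = f (\<Oplus>\<^bsub>N\<^esub>j\<in>{..<n}. t i a j \<odot>\<^bsub>N\<^esub> x j)" using i by (simp add: act_def)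
  also have "\<dots> = (\<Oplus>\<^bsub>P\<^esub>j\<in>{..<n}. f (t i a j \<odot>\<^bsub>N\<^esub> x j))"
    using i a x' by (intro module_homs_finsum[OF N P f]) (auto intro!: N.smult_closed t_closed)
  also have "\<dots> = (\<Oplus>\<^bsub>P\<^esub>j\<in>{..<n}. t i a j \<odot>\<^bsub>P\<^esub> f (x j))"
    using i a x' module_homsD[OF f] by (intro P.M.finsum_cong') (auto simp: t_closed intro!: P.smult_closed)
  also have "\<dots> = act P a (\<lambda>i\<in>{..<n}. f (x i)) i"
    using i a x' module_homsD[OF f] unfolding act_def by (simp, intro P.M.finsum_cong') (auto intro!: P.smult_closed t_closed)
  finally show "act P a (\<lambda>i\<in>{..<n}. f (x i)) i = (\<lambda>i\<in>{..<n}. f (act N a x i)) i" using i by simp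
qed simp_all

lemma hom_tuples:
  assumes N: "left_module B N" and P: "left_module B P" and f: "f \<in> module_homs B N P" and x: "x \<in> tuples N"
  shows "(\<lambda>i\<in>{..<n}. f (x i)) \<in> tuples P"
proof -
  have "act P \<one>\<^bsub>A\<^esub> (\<lambda>i\<in>{..<n}. f (x i)) = (\<lambda>i\<in>{..<n}. f (x i))"
    using act_hom[OF N P f A.one_closed tuplesD(1)[OF x]] tuplesD(2)[OF x] by simp
  then show ?thesis using module_homsD(1)[OF f] tuplesD(4)[OF x] by (auto simp: tuples_def)
qed

lemma Gm_hom:
  assumes N: "left_module B N" and P: "left_module B P" and f: "f \<in> module_homs B N P"
  shows "Gm N P f \<in> module_homs A (Go N) (Go P)"
proof (rule module_homsI)
  show "Gm N P f \<in> extensional (carrier (Go N))" by (simp add: Gm_def)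
  fix x assume "x \<in> carrier (Go N)"
  then obtain x' where x: "x' \<in> tuples N" "x = enc x'" by auto
  show "Gm N P f x \<in> carrier (Go P)" using x hom_tuples[OF N P f x(1)] by (simp add: Gm_enc)
  show "Gm N P f (a \<odot>\<^bsub>Go N\<^esub> x) = a \<odot>\<^bsub>Go P\<^esub> Gm N P f x" if "a \<in> carrier A" for a
    using x that act_hom[OF N P f that tuplesD(1)[OF x(1)]] act_tuples[OF N that tuplesD(1)[OF x(1)]]
    by (simp add: Gm_enc tuplesD)
  fix y assume "y \<in> carrier (Go N)"
  then obtain y' where y: "y' \<in> tuples N" "y = enc y'" by auto
  have "(\<lambda>i\<in>{..<n}. f (tuple_add N x' y' i)) = tuple_add P (\<lambda>i\<in>{..<n}. f (x' i)) (\<lambda>i\<in>{..<n}. f (y' i))"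
    unfolding tuple_add_def by (rule restrict_ext) (use x y in \<open>simp add: tuplesD module_homsD(3)[OF f]\<close>)
  then show "Gm N P f (x \<oplus>\<^bsub>Go N\<^esub> y) = Gm N P f x \<oplus>\<^bsub>Go P\<^esub> Gm N P f y"
    using x y tuple_add_tuples[OF N x(1) y(1)] by (simp add: Gm_enc tuplesD)
qed

end

section \<open>The natural isomorphisms\<close>

context full_corner
begin

text \<open>A tuple \<open>x\<close> stands for the sum of the tensors of \<open>\<alpha> i\<close>
  with \<open>x i\<close>, so this is the multiplication map from \<open>A e\<close> tensor
  \<open>e M\<close> to \<open>M\<close>.\<close>

definition \<eta> :: "('a, 'u) module \<Rightarrow> 'u \<Rightarrow> 'u" where
  "\<eta> M = (\<lambda>y\<in>carrier (Go (Fo M)). \<Oplus>\<^bsub>M\<^esub>i\<in>{..<n}. \<alpha> i \<odot>\<^bsub>M\<^esub> dec y i)"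

text \<open>Multiplication from \<open>e A e\<close> tensor \<open>N\<close> to \<open>N\<close>,
  with the corner identified with \<open>B\<close> by \<open>\<theta>\<close>: left multiplication
  by \<open>e\<close> brings the generators \<open>\<alpha> i\<close> into the corner.\<close>

definition \<epsilon> :: "('b, 'u) module \<Rightarrow> 'u \<Rightarrow> 'u" where
  "\<epsilon> N = (\<lambda>y\<in>carrier (Fo (Go N)). \<Oplus>\<^bsub>N\<^esub>i\<in>{..<n}. \<theta> (e \<otimes>\<^bsub>A\<^esub> \<alpha> i) \<odot>\<^bsub>N\<^esub> dec y i)"

lemma \<theta>_\<alpha>:
  assumes "i < n"
  shows "\<theta> (e \<otimes>\<^bsub>A\<^esub> \<alpha> i) \<in> carrier B" and "\<phi> (\<theta> (e \<otimes>\<^bsub>A\<^esub> \<alpha> i)) = e \<otimes>\<^bsub>A\<^esub> \<alpha> i"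
proof -
  have "e \<otimes>\<^bsub>A\<^esub> (e \<otimes>\<^bsub>A\<^esub> \<alpha> i) = e \<otimes>\<^bsub>A\<^esub> \<alpha> i"
    using assms e_closed \<alpha>_closed \<phi>_e(1)[of "\<one>\<^bsub>B\<^esub>"] by (simp flip: A.m_assoc)
  moreover have "e \<otimes>\<^bsub>A\<^esub> \<alpha> i \<otimes>\<^bsub>A\<^esub> e = e \<otimes>\<^bsub>A\<^esub> \<alpha> i"
    using assms e_closed \<alpha>_closed \<alpha>_corner by (simp add: A.m_assoc)
  ultimately show "\<theta> (e \<otimes>\<^bsub>A\<^esub> \<alpha> i) \<in> carrier B" "\<phi> (\<theta> (e \<otimes>\<^bsub>A\<^esub> \<alpha> i)) = e \<otimes>\<^bsub>A\<^esub> \<alpha> i"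
    using \<theta>[of "e \<otimes>\<^bsub>A\<^esub> \<alpha> i"] assms e_closed \<alpha>_closed by simp_all
qed

lemma \<theta>_\<beta>:
  assumes "i < n"
  shows "\<theta> (\<beta> i \<otimes>\<^bsub>A\<^esub> e) \<in> carrier B" and "\<phi> (\<theta> (\<beta> i \<otimes>\<^bsub>A\<^esub> e)) = \<beta> i \<otimes>\<^bsub>A\<^esub> e"
proof -
  have "e \<otimes>\<^bsub>A\<^esub> (\<beta> i \<otimes>\<^bsub>A\<^esub> e) = \<beta> i \<otimes>\<^bsub>A\<^esub> e"
    using assms e_closed \<beta>_closed \<beta>_corner by (simp flip: A.m_assoc)
  moreover have "\<beta> i \<otimes>\<^bsub>A\<^esub> e \<otimes>\<^bsub>A\<^esub> e = \<beta> i \<otimes>\<^bsub>A\<^esub> e"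
    using assms e_closed \<beta>_closed \<phi>_e(1)[of "\<one>\<^bsub>B\<^esub>"] by (simp add: A.m_assoc)
  ultimately show "\<theta> (\<beta> i \<otimes>\<^bsub>A\<^esub> e) \<in> carrier B" "\<phi> (\<theta> (\<beta> i \<otimes>\<^bsub>A\<^esub> e)) = \<beta> i \<otimes>\<^bsub>A\<^esub> e"
    using \<theta>[of "\<beta> i \<otimes>\<^bsub>A\<^esub> e"] assms e_closed \<beta>_closed by simp_all
qed

lemma tuples_Fo:
  assumes "x \<in> tuples (Fo M)" and "i < n"
  shows "x i \<in> carrier M" and "e \<odot>\<^bsub>M\<^esub> x i = x i"
  using tuplesD(4)[OF assms] by simp_all

lemma act_Fo:
  assumes M: "left_module A M" and a: "a \<in> carrier A" and x: "x \<in> tuples (Fo M)" and i: "i < n"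
  shows "act (Fo M) a x i = (\<Oplus>\<^bsub>M\<^esub>j\<in>{..<n}. \<phi> (t i a j) \<odot>\<^bsub>M\<^esub> x j)"
proof -
  interpret F: left_module B "Fo M" by (rule Fo_module[OF M])
  have "(\<lambda>j. t i a j \<odot>\<^bsub>Fo M\<^esub> x j) \<in> {..<n} \<rightarrow> carrier (Fo M)"
  proof
    fix j assume "j \<in> {..<n}"
    then show "t i a j \<odot>\<^bsub>Fo M\<^esub> x j \<in> carrier (Fo M)"
      using F.smult_closed[OF t_closed[OF i _ a] tuplesD(4)[OF x]] by blast
  qed
  then have "finsum (Fo M) (\<lambda>j. t i a j \<odot>\<^bsub>Fo M\<^esub> x j) {..<n} = finsum M (\<lambda>j. t i a j \<odot>\<^bsub>Fo M\<^esub> x j) {..<n}"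
    by (rule finsum_Fo[OF M finite_lessThan])
  then show ?thesis using i by (simp add: act_def)
qed

lemma \<eta>_iso:
  assumes M: "left_module A M"
  shows "\<eta> M \<in> module_isos A (Go (Fo M)) M"
proof -
  interpret M: left_module A M by (rule M)
  interpret F: left_module B "Fo M" by (rule Fo_module[OF M])
  have \<eta>_enc: "\<eta> M (enc x) = (\<Oplus>\<^bsub>M\<^esub>i\<in>{..<n}. \<alpha> i \<odot>\<^bsub>M\<^esub> x i)" if "x \<in> tuples (Fo M)" for x
    using that by (simp add: \<eta>_def tuplesD)
  have \<eta>_closed: "\<eta> M (enc x) \<in> carrier M" if "x \<in> tuples (Fo M)" for x
    unfolding \<eta>_enc[OF that] using tuples_Fo[OF that] by (auto intro!: M.M.finsum_closed M.smult_closed \<alpha>_closed)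
  have hom: "\<eta> M \<in> module_homs A (Go (Fo M)) M"
  proof (rule module_homsI)
    show "\<eta> M \<in> extensional (carrier (Go (Fo M)))" by (simp add: \<eta>_def)
    fix y assume "y \<in> carrier (Go (Fo M))"
    then obtain x where x: "x \<in> tuples (Fo M)" "y = enc x" by auto
    show "\<eta> M y \<in> carrier M" using \<eta>_closed x by simp
    note xM = tuples_Fo[OF x(1)]
    show "\<eta> M (a \<odot>\<^bsub>Go (Fo M)\<^esub> y) = a \<odot>\<^bsub>M\<^esub> \<eta> M y" if a: "a \<in> carrier A" for a
    proof -
      have "\<eta> M (a \<odot>\<^bsub>Go (Fo M)\<^esub> y) = \<eta> M (enc (act (Fo M) a x))" using x by (simp add: tuplesD)
      also have "\<dots> = (\<Oplus>\<^bsub>M\<^esub>i\<in>{..<n}. \<alpha> i \<odot>\<^bsub>M\<^esub> act (Fo M) a x i)"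
        by (rule \<eta>_enc[OF act_tuples[OF Fo_module[OF M] a tuplesD(1)[OF x(1)]]])
      also have "\<dots> = (\<Oplus>\<^bsub>M\<^esub>i\<in>{..<n}. \<alpha> i \<odot>\<^bsub>M\<^esub> (\<Oplus>\<^bsub>M\<^esub>j\<in>{..<n}. \<phi> (t i a j) \<odot>\<^bsub>M\<^esub> x j))"
        using xM by (intro M.M.finsum_cong') (auto simp: act_Fo[OF M a x(1)] intro!: M.smult_closed M.M.finsum_closed \<alpha>_closed \<phi>_closed t_closed a)
      also have "\<dots> = (\<Oplus>\<^bsub>M\<^esub>j\<in>{..<n}. (\<Oplus>\<^bsub>A\<^esub>i\<in>{..<n}. \<alpha> i \<otimes>\<^bsub>A\<^esub> \<phi> (t i a j)) \<odot>\<^bsub>M\<^esub> x j)"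
        using xM by (intro M.smult_double_sum) (auto intro!: \<alpha>_closed \<phi>_closed t_closed a)
      also have "\<dots> = (\<Oplus>\<^bsub>M\<^esub>j\<in>{..<n}. a \<odot>\<^bsub>M\<^esub> (\<alpha> j \<odot>\<^bsub>M\<^esub> x j))"
      proof (rule M.M.finsum_cong'[OF refl])
        fix j assume j: "j \<in> {..<n}"
        have "(\<Oplus>\<^bsub>A\<^esub>i\<in>{..<n}. \<alpha> i \<otimes>\<^bsub>A\<^esub> \<phi> (t i a j)) = (\<Oplus>\<^bsub>A\<^esub>i\<in>{..<n}. (\<one>\<^bsub>A\<^esub> \<otimes>\<^bsub>A\<^esub> \<alpha> i) \<otimes>\<^bsub>A\<^esub> (\<beta> i \<otimes>\<^bsub>A\<^esub> (a \<otimes>\<^bsub>A\<^esub> \<alpha> j)))"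
          using j a \<alpha>_closed \<beta>_closed by (intro A.finsum_cong') (auto simp: \<phi>_t A.m_assoc)
        also have "\<dots> = a \<otimes>\<^bsub>A\<^esub> \<alpha> j" using j a \<alpha>_closed by (subst resolution) auto
        finally show "(\<Oplus>\<^bsub>A\<^esub>i\<in>{..<n}. \<alpha> i \<otimes>\<^bsub>A\<^esub> \<phi> (t i a j)) \<odot>\<^bsub>M\<^esub> x j = a \<odot>\<^bsub>M\<^esub> (\<alpha> j \<odot>\<^bsub>M\<^esub> x j)"
          using j a \<alpha>_closed xM by (simp add: M.smult_assoc)
      qed (use a \<alpha>_closed xM in \<open>auto intro!: M.smult_closed\<close>)
      also have "\<dots> = a \<odot>\<^bsub>M\<^esub> \<eta> M y"
        unfolding x(2) \<eta>_enc[OF x(1)] using xM by (intro M.smult_finsum[symmetric] a) (auto intro!: M.smult_closed \<alpha>_closed)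
      finally show ?thesis .
    qed
    fix z assume "z \<in> carrier (Go (Fo M))"
    then obtain w where w: "w \<in> tuples (Fo M)" "z = enc w" by auto
    note wM = tuples_Fo[OF w(1)]
    have "\<eta> M (y \<oplus>\<^bsub>Go (Fo M)\<^esub> z) = \<eta> M (enc (tuple_add (Fo M) x w))" using x w by (simp add: tuplesD)
    also have "\<dots> = (\<Oplus>\<^bsub>M\<^esub>i\<in>{..<n}. \<alpha> i \<odot>\<^bsub>M\<^esub> tuple_add (Fo M) x w i)"
      by (rule \<eta>_enc[OF tuple_add_tuples[OF Fo_module[OF M] x(1) w(1)]])
    also have "\<dots> = (\<Oplus>\<^bsub>M\<^esub>i\<in>{..<n}. \<alpha> i \<odot>\<^bsub>M\<^esub> x i \<oplus>\<^bsub>M\<^esub> \<alpha> i \<odot>\<^bsub>M\<^esub> w i)"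
      using xM wM by (intro M.M.finsum_cong') (auto simp: tuple_add_def M.smult_r_distr \<alpha>_closed intro!: M.smult_closed)
    also have "\<dots> = \<eta> M y \<oplus>\<^bsub>M\<^esub> \<eta> M z"
      unfolding x(2) \<eta>_enc[OF x(1)] w(2) \<eta>_enc[OF w(1)] using xM wM
      by (intro M.M.finsum_addf) (auto intro!: M.smult_closed \<alpha>_closed)
    finally show "\<eta> M (y \<oplus>\<^bsub>Go (Fo M)\<^esub> z) = \<eta> M y \<oplus>\<^bsub>M\<^esub> \<eta> M z" .
  qed
  \<comment> \<open>The inverse sends \<open>m\<close> to the tuple of the \<open>\<beta> i\<close>
    applied to \<open>m\<close>. One composite is the identity by \<open>full\<close>; the other
    multiplies a tuple by the matrix of 1, which fixes it.\<close>
  let ?g = "\<lambda>m. \<lambda>i\<in>{..<n}. \<beta> i \<odot>\<^bsub>M\<^esub> m"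
  have g_tuples: "?g m \<in> tuples (Fo M)" if m: "m \<in> carrier M" for m
  proof -
    have c: "\<beta> i \<odot>\<^bsub>M\<^esub> m \<in> carrier (Fo M)" if "i < n" for i
      using that m e_closed \<beta>_closed M.smult_assoc[OF e_closed \<beta>_closed m, symmetric] \<beta>_corner
      by (simp add: M.smult_closed)
    have "act (Fo M) \<one>\<^bsub>A\<^esub> (?g m) = ?g m"
    proof (rule extensionalityI[of _ "{..<n}"])
      fix i assume i: "i \<in> {..<n}"
      have "act (Fo M) \<one>\<^bsub>A\<^esub> (?g m) i = (\<Oplus>\<^bsub>Fo M\<^esub>j\<in>{..<n}. t i \<one>\<^bsub>A\<^esub> j \<odot>\<^bsub>Fo M\<^esub> (\<beta> j \<odot>\<^bsub>M\<^esub> m))"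
        using i c unfolding act_def by (simp del: Fo_simps, intro F.M.finsum_cong') (auto simp del: Fo_simps intro!: F.smult_closed t_closed)
      also have "\<dots> = (\<Oplus>\<^bsub>M\<^esub>j\<in>{..<n}. t i \<one>\<^bsub>A\<^esub> j \<odot>\<^bsub>Fo M\<^esub> (\<beta> j \<odot>\<^bsub>M\<^esub> m))"
        using i c by (intro finsum_Fo M) (auto simp del: Fo_simps intro!: F.smult_closed t_closed)
      also have "\<dots> = (\<Oplus>\<^bsub>M\<^esub>j\<in>{..<n}. \<phi> (t i \<one>\<^bsub>A\<^esub> j) \<odot>\<^bsub>M\<^esub> (\<beta> j \<odot>\<^bsub>M\<^esub> m))" by simp
      also have "\<dots> = (\<Oplus>\<^bsub>A\<^esub>j\<in>{..<n}. \<phi> (t i \<one>\<^bsub>A\<^esub> j) \<otimes>\<^bsub>A\<^esub> \<beta> j) \<odot>\<^bsub>M\<^esub> m"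
        using i m by (intro M.smult_sum_smult) (auto intro!: \<phi>_closed t_closed \<beta>_closed)
      also have "(\<Oplus>\<^bsub>A\<^esub>j\<in>{..<n}. \<phi> (t i \<one>\<^bsub>A\<^esub> j) \<otimes>\<^bsub>A\<^esub> \<beta> j) = (\<Oplus>\<^bsub>A\<^esub>j\<in>{..<n}. (\<beta> i \<otimes>\<^bsub>A\<^esub> \<alpha> j) \<otimes>\<^bsub>A\<^esub> (\<beta> j \<otimes>\<^bsub>A\<^esub> \<one>\<^bsub>A\<^esub>))"
        using i \<alpha>_closed \<beta>_closed by (intro A.finsum_cong') (auto simp: \<phi>_t)
      also have "\<dots> = \<beta> i" using i \<beta>_closed by (subst resolution) auto
      finally show "act (Fo M) \<one>\<^bsub>A\<^esub> (?g m) i = ?g m i" by (simp only: restrict_apply'[OF i])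
    qed simp_all
    then show ?thesis unfolding tuples_def using c by (auto simp del: Fo_simps)
  qed
  have "bij_betw (\<eta> M) (carrier (Go (Fo M))) (carrier M)"
  proof (rule bij_betw_byWitness[where f' = "\<lambda>m. enc (?g m)"])
    show "\<forall>y\<in>carrier (Go (Fo M)). enc (?g (\<eta> M y)) = y"
    proof
      fix y assume "y \<in> carrier (Go (Fo M))"
      then obtain x where x: "x \<in> tuples (Fo M)" "y = enc x" by auto
      note xM = tuples_Fo[OF x(1)]
      have "?g (\<eta> M y) = act (Fo M) \<one>\<^bsub>A\<^esub> x"
      proof (rule extensionalityI[of _ "{..<n}"])
        fix i assume i: "i \<in> {..<n}"
        have "?g (\<eta> M y) i = \<beta> i \<odot>\<^bsub>M\<^esub> (\<Oplus>\<^bsub>M\<^esub>j\<in>{..<n}. \<alpha> j \<odot>\<^bsub>M\<^esub> x j)" using i x \<eta>_enc[OF x(1)] by simp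
        also have "\<dots> = (\<Oplus>\<^bsub>M\<^esub>j\<in>{..<n}. \<beta> i \<odot>\<^bsub>M\<^esub> (\<alpha> j \<odot>\<^bsub>M\<^esub> x j))"
          using i xM by (intro M.smult_finsum) (auto intro!: M.smult_closed \<alpha>_closed \<beta>_closed)
        also have "\<dots> = (\<Oplus>\<^bsub>M\<^esub>j\<in>{..<n}. \<phi> (t i \<one>\<^bsub>A\<^esub> j) \<odot>\<^bsub>M\<^esub> x j)"
          using i xM \<alpha>_closed \<beta>_closed by (intro M.M.finsum_cong') (auto simp: \<phi>_t M.smult_assoc intro!: M.smult_closed)
        also have "\<dots> = act (Fo M) \<one>\<^bsub>A\<^esub> x i" using i act_Fo[OF M _ x(1)] by simp
        finally show "?g (\<eta> M y) i = act (Fo M) \<one>\<^bsub>A\<^esub> x i" .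
      qed simp_all
      then show "enc (?g (\<eta> M y)) = y" using x(2) tuplesD(2)[OF x(1)] by simp
    qed
    show "\<forall>m\<in>carrier M. \<eta> M (enc (?g m)) = m"
    proof
      fix m assume m: "m \<in> carrier M"
      have "\<eta> M (enc (?g m)) = (\<Oplus>\<^bsub>M\<^esub>i\<in>{..<n}. \<alpha> i \<odot>\<^bsub>M\<^esub> (\<beta> i \<odot>\<^bsub>M\<^esub> m))"
        unfolding \<eta>_enc[OF g_tuples[OF m]] using m \<alpha>_closed \<beta>_closed by (intro M.M.finsum_cong') (auto intro!: M.smult_closed)
      also have "\<dots> = (\<Oplus>\<^bsub>A\<^esub>i\<in>{..<n}. \<alpha> i \<otimes>\<^bsub>A\<^esub> \<beta> i) \<odot>\<^bsub>M\<^esub> m"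
        using m by (intro M.smult_sum_smult) (auto intro!: \<alpha>_closed \<beta>_closed)
      finally show "\<eta> M (enc (?g m)) = m" using m by (simp add: full M.smult_one)
    qed
    show "\<eta> M ` carrier (Go (Fo M)) \<subseteq> carrier M" using \<eta>_closed by auto
    show "(\<lambda>m. enc (?g m)) ` carrier M \<subseteq> carrier (Go (Fo M))" using g_tuples by auto
  qed
  then show ?thesis using hom by (simp add: module_isos_def)
qed

lemma Fo_Go_carrier:
  assumes "y \<in> carrier (Fo (Go N))"
  obtains x where "x \<in> tuples N" and "y = enc x" and "act N e x = x"
proof -
  obtain x where x: "x \<in> tuples N" "y = enc x" "e \<odot>\<^bsub>Go N\<^esub> y = y" using assms by auto
  then have "enc (act N e x) = enc x" by (simp add: tuplesD)
  then have "act N e x = x" by (rule enc_eqD[OF _ act_extensional tuplesD(3)[OF x(1)]])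
  then show ?thesis using that x by blast
qed

lemma \<epsilon>_enc:
  assumes "x \<in> tuples N" and "act N e x = x"
  shows "enc x \<in> carrier (Fo (Go N))"
    and "\<epsilon> N (enc x) = (\<Oplus>\<^bsub>N\<^esub>i\<in>{..<n}. \<theta> (e \<otimes>\<^bsub>A\<^esub> \<alpha> i) \<odot>\<^bsub>N\<^esub> x i)"
proof -
  show c: "enc x \<in> carrier (Fo (Go N))" using assms by (simp add: tuplesD)
  show "\<epsilon> N (enc x) = (\<Oplus>\<^bsub>N\<^esub>i\<in>{..<n}. \<theta> (e \<otimes>\<^bsub>A\<^esub> \<alpha> i) \<odot>\<^bsub>N\<^esub> x i)"
    unfolding \<epsilon>_def restrict_apply'[OF c] using assms by (simp add: tuplesD)
qed

lemma \<epsilon>_iso: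
  assumes N: "left_module B N"
  shows "\<epsilon> N \<in> module_isos B (Fo (Go N)) N"
proof -
  interpret N: left_module B N by (rule N)
  interpret FG: left_module B "Fo (Go N)" by (rule Fo_module[OF Go_module[OF N]])
  \<comment> \<open>A row and a column over \<open>B\<close> that pass between \<open>N\<close> and
    the tuples: the products \<open>?s i\<close> times \<open>?r i\<close> sum to 1, and
    \<open>?r i\<close> times \<open>?s j\<close> is \<open>t i e j\<close>, an entry of the matrix
    of \<open>e\<close>.\<close>
  let ?s = "\<lambda>i. \<theta> (e \<otimes>\<^bsub>A\<^esub> \<alpha> i)" and ?r = "\<lambda>i. \<theta> (\<beta> i \<otimes>\<^bsub>A\<^esub> e)"
  have \<epsilon>_closed: "\<epsilon> N (enc x) \<in> carrier N" if "x \<in> tuples N" "act N e x = x" for x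
    unfolding \<epsilon>_enc[OF that] using tuplesD(4)[OF that(1)] by (auto intro!: N.M.finsum_closed N.smult_closed \<theta>_\<alpha>)
  have hom: "\<epsilon> N \<in> module_homs B (Fo (Go N)) N"
  proof (rule module_homsI)
    show "\<epsilon> N \<in> extensional (carrier (Fo (Go N)))" by (simp only: \<epsilon>_def restrict_extensional)
    fix y assume y: "y \<in> carrier (Fo (Go N))"
    then obtain x where x: "x \<in> tuples N" "y = enc x" "act N e x = x" by (rule Fo_Go_carrier)
    note xN = tuplesD(4)[OF x(1)]
    show "\<epsilon> N y \<in> carrier N" using \<epsilon>_closed x by simp
    show "\<epsilon> N (b \<odot>\<^bsub>Fo (Go N)\<^esub> y) = b \<odot>\<^bsub>N\<^esub> \<epsilon> N y" if b: "b \<in> carrier B" for b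
    proof -
      note pb = \<phi>_closed[OF b]
      have ax: "act N (\<phi> b) x \<in> tuples N" by (rule act_tuples[OF N pb tuplesD(1)[OF x(1)]])
      have eax: "act N e (act N (\<phi> b) x) = act N (\<phi> b) x"
        using act_mult[OF N e_closed pb tuplesD(1)[OF x(1)]] \<phi>_e(2)[OF b] by simp
      have "\<epsilon> N (b \<odot>\<^bsub>Fo (Go N)\<^esub> y) = \<epsilon> N (enc (act N (\<phi> b) x))" using x by (simp add: tuplesD)
      also have "\<dots> = (\<Oplus>\<^bsub>N\<^esub>i\<in>{..<n}. ?s i \<odot>\<^bsub>N\<^esub> act N (\<phi> b) x i)" by (rule \<epsilon>_enc(2)[OF ax eax])
      also have "\<dots> = (\<Oplus>\<^bsub>N\<^esub>i\<in>{..<n}. ?s i \<odot>\<^bsub>N\<^esub> (\<Oplus>\<^bsub>N\<^esub>j\<in>{..<n}. t i (\<phi> b) j \<odot>\<^bsub>N\<^esub> x j))"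
        using xN by (intro N.M.finsum_cong') (auto simp: act_def intro!: N.smult_closed N.M.finsum_closed \<theta>_\<alpha> t_closed pb)
      also have "\<dots> = (\<Oplus>\<^bsub>N\<^esub>j\<in>{..<n}. (\<Oplus>\<^bsub>B\<^esub>i\<in>{..<n}. ?s i \<otimes>\<^bsub>B\<^esub> t i (\<phi> b) j) \<odot>\<^bsub>N\<^esub> x j)"
        using xN by (intro N.smult_double_sum) (auto intro!: \<theta>_\<alpha> t_closed pb)
      also have "\<dots> = (\<Oplus>\<^bsub>N\<^esub>j\<in>{..<n}. b \<odot>\<^bsub>N\<^esub> (?s j \<odot>\<^bsub>N\<^esub> x j))"
      proof (rule N.M.finsum_cong'[OF refl])
        fix j assume j: "j \<in> {..<n}"
        have c: "(\<lambda>i. ?s i \<otimes>\<^bsub>B\<^esub> t i (\<phi> b) j) \<in> {..<n} \<rightarrow> carrier B" using j by (auto intro!: \<theta>_\<alpha> t_closed pb)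
        have "(\<Oplus>\<^bsub>B\<^esub>i\<in>{..<n}. ?s i \<otimes>\<^bsub>B\<^esub> t i (\<phi> b) j) = b \<otimes>\<^bsub>B\<^esub> ?s j"
        proof (rule \<phi>_eqI)
          show "(\<Oplus>\<^bsub>B\<^esub>i\<in>{..<n}. ?s i \<otimes>\<^bsub>B\<^esub> t i (\<phi> b) j) \<in> carrier B" using c by (rule B.finsum_closed)
          show "b \<otimes>\<^bsub>B\<^esub> ?s j \<in> carrier B" using b j \<theta>_\<alpha> by simp
          have "\<phi> (\<Oplus>\<^bsub>B\<^esub>i\<in>{..<n}. ?s i \<otimes>\<^bsub>B\<^esub> t i (\<phi> b) j) = (\<Oplus>\<^bsub>A\<^esub>i\<in>{..<n}. \<phi> (?s i \<otimes>\<^bsub>B\<^esub> t i (\<phi> b) j))"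
            by (rule \<phi>_finsum[OF _ c]) simp
          also have "\<dots> = (\<Oplus>\<^bsub>A\<^esub>i\<in>{..<n}. (e \<otimes>\<^bsub>A\<^esub> \<alpha> i) \<otimes>\<^bsub>A\<^esub> (\<beta> i \<otimes>\<^bsub>A\<^esub> (\<phi> b \<otimes>\<^bsub>A\<^esub> \<alpha> j)))"
            using j pb \<alpha>_closed \<beta>_closed e_closed
            by (intro A.finsum_cong') (auto simp: \<phi>_mult \<theta>_\<alpha> t_closed \<phi>_t A.m_assoc)
          also have "\<dots> = e \<otimes>\<^bsub>A\<^esub> (\<phi> b \<otimes>\<^bsub>A\<^esub> \<alpha> j)" using j pb \<alpha>_closed e_closed by (subst resolution) auto
          also have "\<dots> = \<phi> b \<otimes>\<^bsub>A\<^esub> \<alpha> j" using j pb \<alpha>_closed e_closed \<phi>_e(2)[OF b] by (simp flip: A.m_assoc)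
          also have "\<dots> = \<phi> b \<otimes>\<^bsub>A\<^esub> (e \<otimes>\<^bsub>A\<^esub> \<alpha> j)" using j pb \<alpha>_closed e_closed \<phi>_e(1)[OF b] by (simp flip: A.m_assoc)
          also have "\<dots> = \<phi> (b \<otimes>\<^bsub>B\<^esub> ?s j)" using j b \<theta>_\<alpha> by (simp add: \<phi>_mult)
          finally show "\<phi> (\<Oplus>\<^bsub>B\<^esub>i\<in>{..<n}. ?s i \<otimes>\<^bsub>B\<^esub> t i (\<phi> b) j) = \<phi> (b \<otimes>\<^bsub>B\<^esub> ?s j)" .
        qed
        then show "(\<Oplus>\<^bsub>B\<^esub>i\<in>{..<n}. ?s i \<otimes>\<^bsub>B\<^esub> t i (\<phi> b) j) \<odot>\<^bsub>N\<^esub> x j = b \<odot>\<^bsub>N\<^esub> (?s j \<odot>\<^bsub>N\<^esub> x j)"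
          using j b \<theta>_\<alpha> xN by (simp add: N.smult_assoc)
      qed (use b \<theta>_\<alpha> xN in \<open>auto intro!: N.smult_closed\<close>)
      also have "\<dots> = b \<odot>\<^bsub>N\<^esub> \<epsilon> N y"
        unfolding x(2) \<epsilon>_enc(2)[OF x(1,3)] using xN by (intro N.smult_finsum[symmetric] b) (auto intro!: N.smult_closed \<theta>_\<alpha>)
      finally show ?thesis .
    qed
    fix z assume z: "z \<in> carrier (Fo (Go N))"
    then obtain w where w: "w \<in> tuples N" "z = enc w" "act N e w = w" by (rule Fo_Go_carrier)
    note wN = tuplesD(4)[OF w(1)]
    have "act N e (tuple_add N x w) = tuple_add N x w"
      using act_tuple_add[OF N e_closed tuplesD(1)[OF x(1)] tuplesD(1)[OF w(1)]] x w by simp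
    note \<epsilon>_add = \<epsilon>_enc(2)[OF tuple_add_tuples[OF N x(1) w(1)] this]
    have "\<epsilon> N (y \<oplus>\<^bsub>Fo (Go N)\<^esub> z) = \<epsilon> N (enc (tuple_add N x w))" using x w by (simp add: tuplesD)
    also have "\<dots> = (\<Oplus>\<^bsub>N\<^esub>i\<in>{..<n}. ?s i \<odot>\<^bsub>N\<^esub> x i \<oplus>\<^bsub>N\<^esub> ?s i \<odot>\<^bsub>N\<^esub> w i)"
      unfolding \<epsilon>_add
      using xN wN by (intro N.M.finsum_cong') (auto simp: tuple_add_def N.smult_r_distr \<theta>_\<alpha> intro!: N.smult_closed)
    also have "\<dots> = \<epsilon> N y \<oplus>\<^bsub>N\<^esub> \<epsilon> N z"
      unfolding x(2) \<epsilon>_enc(2)[OF x(1,3)] w(2) \<epsilon>_enc(2)[OF w(1,3)] using xN wN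
      by (intro N.M.finsum_addf) (auto intro!: N.smult_closed \<theta>_\<alpha>)
    finally show "\<epsilon> N (y \<oplus>\<^bsub>Fo (Go N)\<^esub> z) = \<epsilon> N y \<oplus>\<^bsub>N\<^esub> \<epsilon> N z" .
  qed
  let ?g = "\<lambda>m. \<lambda>i\<in>{..<n}. ?r i \<odot>\<^bsub>N\<^esub> m"
  \<comment> \<open>The condition on \<open>a\<close> is met by 1 and by \<open>e\<close>. The first
    shows that \<open>?g m\<close> belongs to \<open>tuples N\<close>, the second that it is fixed
    by \<open>e\<close>.\<close>
  have act_g: "act N a (?g m) i = \<theta> (\<beta> i \<otimes>\<^bsub>A\<^esub> e) \<odot>\<^bsub>N\<^esub> m"
    if m: "m \<in> carrier N" and a: "a \<in> carrier A" "a \<otimes>\<^bsub>A\<^esub> e = e" and i: "i < n" for m a i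
  proof -
    have "act N a (?g m) i = (\<Oplus>\<^bsub>N\<^esub>j\<in>{..<n}. t i a j \<odot>\<^bsub>N\<^esub> (?r j \<odot>\<^bsub>N\<^esub> m))"
      using i m unfolding act_def by (simp, intro N.M.finsum_cong') (auto intro!: N.smult_closed t_closed \<theta>_\<beta> a)
    also have "\<dots> = (\<Oplus>\<^bsub>B\<^esub>j\<in>{..<n}. t i a j \<otimes>\<^bsub>B\<^esub> ?r j) \<odot>\<^bsub>N\<^esub> m"
      using i m by (intro N.smult_sum_smult) (auto intro!: t_closed \<theta>_\<beta> a)
    also have "(\<Oplus>\<^bsub>B\<^esub>j\<in>{..<n}. t i a j \<otimes>\<^bsub>B\<^esub> ?r j) = ?r i"
    proof (rule \<phi>_eqI)
      have c: "(\<lambda>j. t i a j \<otimes>\<^bsub>B\<^esub> ?r j) \<in> {..<n} \<rightarrow> carrier B" using i by (auto intro!: \<theta>_\<beta> t_closed a)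
      then show "(\<Oplus>\<^bsub>B\<^esub>j\<in>{..<n}. t i a j \<otimes>\<^bsub>B\<^esub> ?r j) \<in> carrier B" by (rule B.finsum_closed)
      have "\<phi> (\<Oplus>\<^bsub>B\<^esub>j\<in>{..<n}. t i a j \<otimes>\<^bsub>B\<^esub> ?r j) = (\<Oplus>\<^bsub>A\<^esub>j\<in>{..<n}. \<phi> (t i a j \<otimes>\<^bsub>B\<^esub> ?r j))"
        by (rule \<phi>_finsum[OF _ c]) simp
      also have "\<dots> = (\<Oplus>\<^bsub>A\<^esub>j\<in>{..<n}. (\<beta> i \<otimes>\<^bsub>A\<^esub> a \<otimes>\<^bsub>A\<^esub> \<alpha> j) \<otimes>\<^bsub>A\<^esub> (\<beta> j \<otimes>\<^bsub>A\<^esub> e))"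
        using i a \<alpha>_closed \<beta>_closed e_closed by (intro A.finsum_cong') (auto simp: \<phi>_mult \<theta>_\<beta> t_closed \<phi>_t)
      also have "\<dots> = \<phi> (?r i)" using i a \<beta>_closed e_closed by (subst resolution) (auto simp: A.m_assoc \<theta>_\<beta>)
      finally show "\<phi> (\<Oplus>\<^bsub>B\<^esub>j\<in>{..<n}. t i a j \<otimes>\<^bsub>B\<^esub> ?r j) = \<phi> (?r i)" .
    qed (use i \<theta>_\<beta> in auto)
    finally show ?thesis .
  qed
  have g_tuples: "?g m \<in> tuples N" "act N e (?g m) = ?g m" if m: "m \<in> carrier N" for m
  proof -
    have "act N \<one>\<^bsub>A\<^esub> (?g m) = ?g m"
      by (rule extensionalityI[of _ "{..<n}"]) (use act_g[OF m A.one_closed] e_closed in auto)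
    then show "?g m \<in> tuples N" using m \<theta>_\<beta> by (auto simp: tuples_def intro!: N.smult_closed)
    show "act N e (?g m) = ?g m"
      by (rule extensionalityI[of _ "{..<n}"]) (use act_g[OF m e_closed] \<phi>_e(1)[OF B.one_closed] in auto)
  qed
  have "bij_betw (\<epsilon> N) (carrier (Fo (Go N))) (carrier N)"
  proof (rule bij_betw_byWitness[where f' = "\<lambda>m. enc (?g m)"])
    show "\<forall>y\<in>carrier (Fo (Go N)). enc (?g (\<epsilon> N y)) = y"
    proof
      fix y assume "y \<in> carrier (Fo (Go N))"
      then obtain x where x: "x \<in> tuples N" "y = enc x" "act N e x = x" by (rule Fo_Go_carrier)
      note xN = tuplesD(4)[OF x(1)]
      have "?g (\<epsilon> N y) = act N e x"
      proof (rule extensionalityI[of _ "{..<n}"])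
        fix i assume i: "i \<in> {..<n}"
        have "?g (\<epsilon> N y) i = ?r i \<odot>\<^bsub>N\<^esub> (\<Oplus>\<^bsub>N\<^esub>j\<in>{..<n}. ?s j \<odot>\<^bsub>N\<^esub> x j)" using i x(2) \<epsilon>_enc(2)[OF x(1,3)] by simp
        also have "\<dots> = (\<Oplus>\<^bsub>N\<^esub>j\<in>{..<n}. ?r i \<odot>\<^bsub>N\<^esub> (?s j \<odot>\<^bsub>N\<^esub> x j))"
          using i xN by (intro N.smult_finsum) (auto intro!: N.smult_closed \<theta>_\<alpha> \<theta>_\<beta>)
        also have "\<dots> = (\<Oplus>\<^bsub>N\<^esub>j\<in>{..<n}. t i e j \<odot>\<^bsub>N\<^esub> x j)"
        proof (rule N.M.finsum_cong'[OF refl])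
          fix j assume j: "j \<in> {..<n}"
          have "?r i \<otimes>\<^bsub>B\<^esub> ?s j = t i e j"
          proof (rule \<phi>_eqI)
            have "\<phi> (?r i \<otimes>\<^bsub>B\<^esub> ?s j) = \<beta> i \<otimes>\<^bsub>A\<^esub> (e \<otimes>\<^bsub>A\<^esub> e) \<otimes>\<^bsub>A\<^esub> \<alpha> j"
              using i j \<alpha>_closed \<beta>_closed e_closed by (simp add: \<phi>_mult \<theta>_\<alpha> \<theta>_\<beta> A.m_assoc)
            then show "\<phi> (?r i \<otimes>\<^bsub>B\<^esub> ?s j) = \<phi> (t i e j)"
              using i j \<phi>_e(1)[OF B.one_closed] e_closed by (simp add: \<phi>_t)
          qed (use i j \<theta>_\<alpha> \<theta>_\<beta> t_closed e_closed in auto)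
          then show "?r i \<odot>\<^bsub>N\<^esub> (?s j \<odot>\<^bsub>N\<^esub> x j) = t i e j \<odot>\<^bsub>N\<^esub> x j"
            using i j xN \<theta>_\<alpha> \<theta>_\<beta> by (simp flip: N.smult_assoc)
        qed (use i xN e_closed in \<open>auto intro!: N.smult_closed t_closed\<close>)
        also have "\<dots> = act N e x i" using i by (simp add: act_def)
        finally show "?g (\<epsilon> N y) i = act N e x i" .
      qed simp_all
      then show "enc (?g (\<epsilon> N y)) = y" using x by simp
    qed
    show "\<forall>m\<in>carrier N. \<epsilon> N (enc (?g m)) = m"
    proof
      fix m assume m: "m \<in> carrier N"
      have "\<epsilon> N (enc (?g m)) = (\<Oplus>\<^bsub>N\<^esub>i\<in>{..<n}. ?s i \<odot>\<^bsub>N\<^esub> (?r i \<odot>\<^bsub>N\<^esub> m))"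
        unfolding \<epsilon>_enc(2)[OF g_tuples[OF m]] using m by (intro N.M.finsum_cong') (auto intro!: N.smult_closed \<theta>_\<alpha> \<theta>_\<beta>)
      also have "\<dots> = (\<Oplus>\<^bsub>B\<^esub>i\<in>{..<n}. ?s i \<otimes>\<^bsub>B\<^esub> ?r i) \<odot>\<^bsub>N\<^esub> m"
        using m by (intro N.smult_sum_smult) (auto intro!: \<theta>_\<alpha> \<theta>_\<beta>)
      also have "(\<Oplus>\<^bsub>B\<^esub>i\<in>{..<n}. ?s i \<otimes>\<^bsub>B\<^esub> ?r i) = \<one>\<^bsub>B\<^esub>"
      proof (rule \<phi>_eqI)
        have c: "(\<lambda>i. ?s i \<otimes>\<^bsub>B\<^esub> ?r i) \<in> {..<n} \<rightarrow> carrier B" by (auto intro!: \<theta>_\<alpha> \<theta>_\<beta>)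
        then show "(\<Oplus>\<^bsub>B\<^esub>i\<in>{..<n}. ?s i \<otimes>\<^bsub>B\<^esub> ?r i) \<in> carrier B" by (rule B.finsum_closed)
        have "\<phi> (\<Oplus>\<^bsub>B\<^esub>i\<in>{..<n}. ?s i \<otimes>\<^bsub>B\<^esub> ?r i) = (\<Oplus>\<^bsub>A\<^esub>i\<in>{..<n}. \<phi> (?s i \<otimes>\<^bsub>B\<^esub> ?r i))"
          by (rule \<phi>_finsum[OF _ c]) simp
        also have "\<dots> = (\<Oplus>\<^bsub>A\<^esub>i\<in>{..<n}. (e \<otimes>\<^bsub>A\<^esub> \<alpha> i) \<otimes>\<^bsub>A\<^esub> (\<beta> i \<otimes>\<^bsub>A\<^esub> e))"
          using \<alpha>_closed \<beta>_closed e_closed by (intro A.finsum_cong') (auto simp: \<phi>_mult \<theta>_\<alpha> \<theta>_\<beta>)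
        also have "\<dots> = \<phi> \<one>\<^bsub>B\<^esub>" using e_closed \<phi>_e(1)[OF B.one_closed] by (subst resolution) auto
        finally show "\<phi> (\<Oplus>\<^bsub>B\<^esub>i\<in>{..<n}. ?s i \<otimes>\<^bsub>B\<^esub> ?r i) = \<phi> \<one>\<^bsub>B\<^esub>" .
      qed simp
      finally show "\<epsilon> N (enc (?g m)) = m" by (simp only: N.smult_one[OF m])
    qed
    show "\<epsilon> N ` carrier (Fo (Go N)) \<subseteq> carrier N" using module_homsD(1)[OF hom] by blast
    show "(\<lambda>m. enc (?g m)) ` carrier N \<subseteq> carrier (Fo (Go N))" using \<epsilon>_enc(1)[OF g_tuples] by blast
  qed
  then show ?thesis using hom by (simp add: module_isos_def)
qed

lemma \<eta>_natural:
  assumes M: "left_module A M" and N: "left_module A N" and f: "f \<in> module_homs A M N"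
  shows "compose (carrier (Go (Fo M))) (\<eta> N) (Gm (Fo M) (Fo N) (Fm M N f)) = compose (carrier (Go (Fo M))) f (\<eta> M)"
proof (rule extensionalityI[of _ "carrier (Go (Fo M))"])
  interpret M: left_module A M by (rule M)
  interpret N: left_module A N by (rule N)
  fix y assume y: "y \<in> carrier (Go (Fo M))"
  then obtain x where x: "x \<in> tuples (Fo M)" "y = enc x" by auto
  note xM = tuples_Fo[OF x(1)]
  have fx: "(\<lambda>i\<in>{..<n}. Fm M N f (x i)) \<in> tuples (Fo N)"
    by (rule hom_tuples[OF Fo_module[OF M] Fo_module[OF N] Fm_hom[OF M f] x(1)])
  have "\<eta> N (Gm (Fo M) (Fo N) (Fm M N f) y) = \<eta> N (enc (\<lambda>i\<in>{..<n}. Fm M N f (x i)))"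
    using x by (simp add: Gm_enc)
  also have "\<dots> = (\<Oplus>\<^bsub>N\<^esub>i\<in>{..<n}. \<alpha> i \<odot>\<^bsub>N\<^esub> f (x i))"
    using fx xM module_homsD(1)[OF f] \<alpha>_closed unfolding \<eta>_def
    by (simp, intro N.M.finsum_cong') (auto simp: Fm_def intro!: N.smult_closed)
  also have "\<dots> = (\<Oplus>\<^bsub>N\<^esub>i\<in>{..<n}. f (\<alpha> i \<odot>\<^bsub>M\<^esub> x i))"
    using xM module_homsD[OF f] \<alpha>_closed by (intro N.M.finsum_cong') (auto intro!: M.smult_closed N.smult_closed)
  also have "\<dots> = f (\<Oplus>\<^bsub>M\<^esub>i\<in>{..<n}. \<alpha> i \<odot>\<^bsub>M\<^esub> x i)"
    using xM \<alpha>_closed by (intro module_homs_finsum[OF M N f, symmetric]) (auto intro!: M.smult_closed)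
  also have "\<dots> = f (\<eta> M y)" using x by (simp add: \<eta>_def tuplesD)
  finally show "compose (carrier (Go (Fo M))) (\<eta> N) (Gm (Fo M) (Fo N) (Fm M N f)) y = compose (carrier (Go (Fo M))) f (\<eta> M) y"
    using y by (simp only: compose_eq)
qed (simp_all only: compose_extensional)

lemma \<epsilon>_natural:
  assumes N: "left_module B N" and P: "left_module B P" and f: "f \<in> module_homs B N P"
  shows "compose (carrier (Fo (Go N))) (\<epsilon> P) (Fm (Go N) (Go P) (Gm N P f)) = compose (carrier (Fo (Go N))) f (\<epsilon> N)"
proof (rule extensionalityI[of _ "carrier (Fo (Go N))"])
  interpret N: left_module B N by (rule N)
  interpret P: left_module B P by (rule P)
  fix y assume y: "y \<in> carrier (Fo (Go N))"
  then obtain x where x: "x \<in> tuples N" "y = enc x" "act N e x = x" by (rule Fo_Go_carrier)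
  note xN = tuplesD(4)[OF x(1)]
  have fx: "(\<lambda>i\<in>{..<n}. f (x i)) \<in> tuples P" by (rule hom_tuples[OF N P f x(1)])
  have efx: "act P e (\<lambda>i\<in>{..<n}. f (x i)) = (\<lambda>i\<in>{..<n}. f (x i))"
    using act_hom[OF N P f e_closed tuplesD(1)[OF x(1)]] x(3) by simp
  have "Fm (Go N) (Go P) (Gm N P f) y = Gm N P f y" unfolding Fm_def using y by (rule restrict_apply')
  then have "\<epsilon> P (Fm (Go N) (Go P) (Gm N P f) y) = \<epsilon> P (enc (\<lambda>i\<in>{..<n}. f (x i)))"
    using x by (simp add: Gm_enc)
  also have "\<dots> = (\<Oplus>\<^bsub>P\<^esub>i\<in>{..<n}. \<theta> (e \<otimes>\<^bsub>A\<^esub> \<alpha> i) \<odot>\<^bsub>P\<^esub> f (x i))"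
    unfolding \<epsilon>_enc(2)[OF fx efx] using xN module_homsD(1)[OF f] \<theta>_\<alpha>
    by (intro P.M.finsum_cong') (auto intro!: P.smult_closed)
  also have "\<dots> = (\<Oplus>\<^bsub>P\<^esub>i\<in>{..<n}. f (\<theta> (e \<otimes>\<^bsub>A\<^esub> \<alpha> i) \<odot>\<^bsub>N\<^esub> x i))"
    using xN module_homsD[OF f] \<theta>_\<alpha> by (intro P.M.finsum_cong') (auto intro!: N.smult_closed P.smult_closed)
  also have "\<dots> = f (\<Oplus>\<^bsub>N\<^esub>i\<in>{..<n}. \<theta> (e \<otimes>\<^bsub>A\<^esub> \<alpha> i) \<odot>\<^bsub>N\<^esub> x i)"
    using xN \<theta>_\<alpha> by (intro module_homs_finsum[OF N P f, symmetric]) (auto intro!: N.smult_closed)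
  also have "\<dots> = f (\<epsilon> N y)" using x \<epsilon>_enc(2)[OF x(1,3)] by simp
  finally show "compose (carrier (Fo (Go N))) (\<epsilon> P) (Fm (Go N) (Go P) (Gm N P f)) y = compose (carrier (Fo (Go N))) f (\<epsilon> N) y"
    using y by (simp only: compose_eq)
qed (simp_all only: compose_extensional)

end

text \<open>An infinite set has as many elements as its square, so the coordinates can be absorbed
  one at a time.\<close>

lemma ex_inj_tuples:
  assumes "infinite (UNIV :: 'u set)"
  shows "\<exists>enc :: (nat \<Rightarrow> 'u) \<Rightarrow> 'u. inj_on enc ({..<n} \<rightarrow>\<^sub>E UNIV)"
proof (induction n)
  case 0
  show ?case by (rule exI[of _ "\<lambda>_. undefined"]) (simp add: inj_on_def)
next
  case (Suc n)
  then obtain enc :: "(nat \<Rightarrow> 'u) \<Rightarrow> 'u" where enc: "inj_on enc ({..<n} \<rightarrow>\<^sub>E UNIV)" by blast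
  obtain p :: "'u \<times> 'u \<Rightarrow> 'u" where bp: "bij_betw p (UNIV \<times> UNIV) UNIV"
    using card_of_Times_same_infinite[OF assms] card_of_ordIso by blast
  then have p: "p x = p y \<Longrightarrow> x = y" for x y
    using inj_onD[OF bij_betw_imp_inj_on[OF bp]] by simp
  have "inj_on (\<lambda>x. p (x n, enc (restrict x {..<n}))) ({..<Suc n} \<rightarrow>\<^sub>E UNIV)"
  proof (rule inj_onI)
    fix x y :: "nat \<Rightarrow> 'u"
    assume x: "x \<in> {..<Suc n} \<rightarrow>\<^sub>E UNIV" and y: "y \<in> {..<Suc n} \<rightarrow>\<^sub>E UNIV"
      and "p (x n, enc (restrict x {..<n})) = p (y n, enc (restrict y {..<n}))"
    then have n: "x n = y n" and "enc (restrict x {..<n}) = enc (restrict y {..<n})" using p[of "(x n, enc (restrict x {..<n}))" "(y n, enc (restrict y {..<n}))"] by simp_all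
    then have r: "restrict x {..<n} = restrict y {..<n}" by (intro inj_onD[OF enc]) auto
    show "x = y"
    proof (rule PiE_ext[OF x y])
      fix i assume "i \<in> {..<Suc n}"
      then show "x i = y i" using n fun_cong[OF r, of i] by (cases "i = n") auto
    qed
  qed
  then show ?case by blast
qed

section \<open>Functoriality and linearity over the base ring\<close>

context full_corner
begin

lemma Fm_apply: "x \<in> carrier (Fo M) \<Longrightarrow> Fm M N f x = f x"
  unfolding Fm_def by (rule restrict_apply')

lemma Fm_extensional: "Fm M N f \<in> extensional (carrier (Fo M))"
  unfolding Fm_def by (rule restrict_extensional)

lemma Fm_ident: "Fm M M (\<lambda>x\<in>carrier M. x) = (\<lambda>x\<in>carrier (Fo M). x)"
  unfolding Fm_def by (rule restrict_ext) simp

lemma Fm_add: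
  "Fm M N (\<lambda>x\<in>carrier M. f x \<oplus>\<^bsub>N\<^esub> g x) = (\<lambda>x\<in>carrier (Fo M). Fm M N f x \<oplus>\<^bsub>Fo N\<^esub> Fm M N g x)"
  unfolding Fm_def by (rule restrict_ext) simp

lemma Fm_compose:
  assumes M: "left_module A M" and f: "f \<in> module_homs A M N"
  shows "Fm M P (compose (carrier M) g f) = compose (carrier (Fo M)) (Fm N P g) (Fm M N f)"
proof (rule extensionalityI[OF Fm_extensional compose_extensional])
  fix x assume x: "x \<in> carrier (Fo M)"
  have "f x \<in> carrier (Fo N)" using module_homsD(1)[OF Fm_hom[OF M f] x] by (simp only: Fm_apply[OF x])
  moreover have "x \<in> carrier M" using x by simp
  ultimately show "Fm M P (compose (carrier M) g f) x = compose (carrier (Fo M)) (Fm N P g) (Fm M N f) x"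
    by (simp only: compose_eq[OF x] Fm_apply[OF x] Fm_apply compose_eq)
qed

lemma linear_Fo:
  assumes kA: "assoc_algebra k A" and kB: "assoc_algebra k B"
    and \<phi>_smult: "\<And>c x. c \<in> carrier k \<Longrightarrow> x \<in> carrier B \<Longrightarrow> \<phi> (c \<odot>\<^bsub>B\<^esub> x) = c \<odot>\<^bsub>A\<^esub> \<phi> x"
  shows "linear_module_functor k A B Fo Fm"
proof (intro linear_module_functor.intro Fo_module Fm_hom Fm_ident Fm_add Fm_compose)
  interpret kA: assoc_algebra k A by (rule kA)
  fix M N :: "('a, 'u) module" and f c
  assume M: "left_module A M" and N: "left_module A N" and f: "f \<in> module_homs A M N" and c: "c \<in> carrier k"
  interpret N: left_module A N by (rule N)
  show "Fm M N (\<lambda>x\<in>carrier M. (c \<odot>\<^bsub>A\<^esub> \<one>\<^bsub>A\<^esub>) \<odot>\<^bsub>N\<^esub> f x) =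
        (\<lambda>x\<in>carrier (Fo M). (c \<odot>\<^bsub>B\<^esub> \<one>\<^bsub>B\<^esub>) \<odot>\<^bsub>Fo N\<^esub> Fm M N f x)"
  proof (rule extensionalityI[OF Fm_extensional restrict_extensional])
    fix x assume x: "x \<in> carrier (Fo M)"
    have fx: "f x \<in> carrier N" "e \<odot>\<^bsub>N\<^esub> f x = f x"
      using module_homsD(1)[OF Fm_hom[OF M f] x] unfolding Fm_apply[OF x] by auto
    have c1: "c \<odot>\<^bsub>A\<^esub> \<one>\<^bsub>A\<^esub> \<in> carrier A" by (rule kA.smult_closed[OF c A.one_closed])
    \<comment> \<open>A scalar acts on the corner module through its multiple of \<open>e\<close>,
      and \<open>e\<close> fixes \<open>f x\<close>.\<close>
    have "\<phi> (c \<odot>\<^bsub>B\<^esub> \<one>\<^bsub>B\<^esub>) = (c \<odot>\<^bsub>A\<^esub> \<one>\<^bsub>A\<^esub>) \<otimes>\<^bsub>A\<^esub> e"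
      unfolding \<phi>_smult[OF c B.one_closed] kA.smult_mult_left[OF c A.one_closed e_closed] A.l_one[OF e_closed] ..
    then have "\<phi> (c \<odot>\<^bsub>B\<^esub> \<one>\<^bsub>B\<^esub>) \<odot>\<^bsub>N\<^esub> f x = (c \<odot>\<^bsub>A\<^esub> \<one>\<^bsub>A\<^esub>) \<odot>\<^bsub>N\<^esub> f x"
      by (simp only: fx(2) N.smult_assoc[OF c1 e_closed fx(1)])
    moreover have "x \<in> carrier M" using x by simp
    ultimately show "Fm M N (\<lambda>x\<in>carrier M. (c \<odot>\<^bsub>A\<^esub> \<one>\<^bsub>A\<^esub>) \<odot>\<^bsub>N\<^esub> f x) x =
        (\<lambda>x\<in>carrier (Fo M). (c \<odot>\<^bsub>B\<^esub> \<one>\<^bsub>B\<^esub>) \<odot>\<^bsub>Fo N\<^esub> Fm M N f x) x"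
      by (simp only: Fm_apply[OF x] restrict_apply'[OF x] restrict_apply' Fo_simps(4))
  qed
qed

text \<open>The matrix of a scalar multiple of 1 is that multiple of the matrix of 1, and the latter
  fixes \<open>z\<close>; so the scalar passes to each coordinate. This is the linearity of
  \<open>Go\<close>.\<close>

lemma act_scalar:
  assumes kA: "assoc_algebra k A" and kB: "assoc_algebra k B"
    and \<phi>_smult: "\<And>c x. c \<in> carrier k \<Longrightarrow> x \<in> carrier B \<Longrightarrow> \<phi> (c \<odot>\<^bsub>B\<^esub> x) = c \<odot>\<^bsub>A\<^esub> \<phi> x"
    and N: "left_module B N" and c: "c \<in> carrier k" and z: "z \<in> tuples N"
  shows "act N (c \<odot>\<^bsub>A\<^esub> \<one>\<^bsub>A\<^esub>) z = (\<lambda>i\<in>{..<n}. (c \<odot>\<^bsub>B\<^esub> \<one>\<^bsub>B\<^esub>) \<odot>\<^bsub>N\<^esub> z i)"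
proof (rule extensionalityI[of _ "{..<n}"])
  interpret kA: assoc_algebra k A by (rule kA)
  interpret kB: assoc_algebra k B by (rule kB)
  interpret N: left_module B N by (rule N)
  fix i assume i: "i \<in> {..<n}"
  then have i': "i < n" by simp
  note zc = tuplesD(4)[OF z]
  have c1: "c \<odot>\<^bsub>A\<^esub> \<one>\<^bsub>A\<^esub> \<in> carrier A" "c \<odot>\<^bsub>B\<^esub> \<one>\<^bsub>B\<^esub> \<in> carrier B"
    using c by (simp_all add: kA.smult_closed kB.smult_closed)
  have tc: "t i (c \<odot>\<^bsub>A\<^esub> \<one>\<^bsub>A\<^esub>) j = (c \<odot>\<^bsub>B\<^esub> \<one>\<^bsub>B\<^esub>) \<otimes>\<^bsub>B\<^esub> t i \<one>\<^bsub>A\<^esub> j" if j: "j < n" for j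
  proof (rule \<phi>_eqI)
    note ab = \<alpha>_closed[OF j] \<beta>_closed[OF i']
    have "\<phi> ((c \<odot>\<^bsub>B\<^esub> \<one>\<^bsub>B\<^esub>) \<otimes>\<^bsub>B\<^esub> t i \<one>\<^bsub>A\<^esub> j) = (c \<odot>\<^bsub>A\<^esub> e) \<otimes>\<^bsub>A\<^esub> (\<beta> i \<otimes>\<^bsub>A\<^esub> \<alpha> j)"
      using i' j c c1 ab by (simp add: \<phi>_mult t_closed \<phi>_t \<phi>_smult)
    also have "\<dots> = c \<odot>\<^bsub>A\<^esub> (e \<otimes>\<^bsub>A\<^esub> (\<beta> i \<otimes>\<^bsub>A\<^esub> \<alpha> j))" using c ab e_closed by (simp add: kA.smult_mult_left)
    also have "\<dots> = c \<odot>\<^bsub>A\<^esub> (\<beta> i \<otimes>\<^bsub>A\<^esub> \<alpha> j)" using ab e_closed \<beta>_corner[OF i'] by (simp flip: A.m_assoc)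
    also have "\<dots> = \<phi> (t i (c \<odot>\<^bsub>A\<^esub> \<one>\<^bsub>A\<^esub>) j)"
      using i' j c c1 ab by (simp add: \<phi>_t kA.smult_mult_left kA.smult_mult_right)
    finally show "\<phi> (t i (c \<odot>\<^bsub>A\<^esub> \<one>\<^bsub>A\<^esub>) j) = \<phi> ((c \<odot>\<^bsub>B\<^esub> \<one>\<^bsub>B\<^esub>) \<otimes>\<^bsub>B\<^esub> t i \<one>\<^bsub>A\<^esub> j)" ..
  qed (use i' j c1 t_closed in auto)
  have tcl: "t i \<one>\<^bsub>A\<^esub> j \<in> carrier B" if "j < n" for j using t_closed[OF i' that A.one_closed] .
  have "(c \<odot>\<^bsub>B\<^esub> \<one>\<^bsub>B\<^esub>) \<odot>\<^bsub>N\<^esub> z i = (c \<odot>\<^bsub>B\<^esub> \<one>\<^bsub>B\<^esub>) \<odot>\<^bsub>N\<^esub> act N \<one>\<^bsub>A\<^esub> z i" by (simp only: tuplesD(2)[OF z])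
  also have "\<dots> = (c \<odot>\<^bsub>B\<^esub> \<one>\<^bsub>B\<^esub>) \<odot>\<^bsub>N\<^esub> (\<Oplus>\<^bsub>N\<^esub>j\<in>{..<n}. t i \<one>\<^bsub>A\<^esub> j \<odot>\<^bsub>N\<^esub> z j)"
    unfolding act_def restrict_apply'[OF i] ..
  also have "\<dots> = (\<Oplus>\<^bsub>N\<^esub>j\<in>{..<n}. (c \<odot>\<^bsub>B\<^esub> \<one>\<^bsub>B\<^esub>) \<odot>\<^bsub>N\<^esub> (t i \<one>\<^bsub>A\<^esub> j \<odot>\<^bsub>N\<^esub> z j))"
    by (rule N.smult_finsum[OF c1(2) finite_lessThan]) (use N.smult_closed[OF tcl zc] in auto)
  also have "\<dots> = (\<Oplus>\<^bsub>N\<^esub>j\<in>{..<n}. t i (c \<odot>\<^bsub>A\<^esub> \<one>\<^bsub>A\<^esub>) j \<odot>\<^bsub>N\<^esub> z j)"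
    by (rule N.M.finsum_cong'[OF refl])
      (use N.smult_closed[OF t_closed[OF i' _ c1(1)] zc] tc N.smult_assoc[OF c1(2) tcl zc] in auto)
  finally show "act N (c \<odot>\<^bsub>A\<^esub> \<one>\<^bsub>A\<^esub>) z i = (\<lambda>i\<in>{..<n}. (c \<odot>\<^bsub>B\<^esub> \<one>\<^bsub>B\<^esub>) \<odot>\<^bsub>N\<^esub> z i) i"
    unfolding act_def restrict_apply'[OF i] by (rule sym)
qed simp_all

lemma Go_eqI:
  assumes "\<And>x. x \<in> tuples M \<Longrightarrow> f (enc x) = g (enc x)"
    and "f \<in> extensional (carrier (Go M))" and "g \<in> extensional (carrier (Go M))"
  shows "f = g"
proof (rule extensionalityI[OF assms(2,3)])
  fix y assume "y \<in> carrier (Go M)"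
  then obtain x where "x \<in> tuples M" "y = enc x" by auto
  then show "f y = g y" using assms(1) by simp
qed

lemma enc_carrier: "x \<in> tuples M \<Longrightarrow> enc x \<in> carrier (Go M)"
  by simp

lemma Gm_extensional: "Gm M N f \<in> extensional (carrier (Go M))"
  unfolding Gm_def by (rule restrict_extensional)

lemma Gm_ident: "Gm M M (\<lambda>x\<in>carrier M. x) = (\<lambda>x\<in>carrier (Go M). x)"
proof (rule Go_eqI)
  fix x assume x: "x \<in> tuples M"
  have "(\<lambda>i\<in>{..<n}. (\<lambda>x\<in>carrier M. x) (x i)) = x"
    by (rule extensionalityI[of _ "{..<n}"]) (use x in \<open>auto simp: tuplesD\<close>)
  then show "Gm M M (\<lambda>x\<in>carrier M. x) (enc x) = (\<lambda>x\<in>carrier (Go M). x) (enc x)"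
    by (simp only: Gm_enc[OF x] restrict_apply'[OF enc_carrier[OF x]])
qed (rule Gm_extensional restrict_extensional)+

lemma Gm_add:
  "Gm M N (\<lambda>x\<in>carrier M. f x \<oplus>\<^bsub>N\<^esub> g x) = (\<lambda>x\<in>carrier (Go M). Gm M N f x \<oplus>\<^bsub>Go N\<^esub> Gm M N g x)"
proof (rule Go_eqI)
  fix x assume x: "x \<in> tuples M"
  have "(\<lambda>i\<in>{..<n}. (\<lambda>x\<in>carrier M. f x \<oplus>\<^bsub>N\<^esub> g x) (x i)) = tuple_add N (\<lambda>i\<in>{..<n}. f (x i)) (\<lambda>i\<in>{..<n}. g (x i))"
    unfolding tuple_add_def by (rule restrict_ext) (use x in \<open>simp add: tuplesD\<close>)
  then show "Gm M N (\<lambda>x\<in>carrier M. f x \<oplus>\<^bsub>N\<^esub> g x) (enc x) =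
      (\<lambda>x\<in>carrier (Go M). Gm M N f x \<oplus>\<^bsub>Go N\<^esub> Gm M N g x) (enc x)"
    by (simp only: Gm_enc[OF x] restrict_apply'[OF enc_carrier[OF x]] Go_simps(3)[OF restrict_extensional restrict_extensional])
qed (rule Gm_extensional restrict_extensional)+

lemma Gm_compose:
  assumes M: "left_module B M" and N: "left_module B N" and f: "f \<in> module_homs B M N"
  shows "Gm M P (compose (carrier M) g f) = compose (carrier (Go M)) (Gm N P g) (Gm M N f)"
proof (rule Go_eqI)
  fix x assume x: "x \<in> tuples M"
  have "(\<lambda>i\<in>{..<n}. compose (carrier M) g f (x i)) = (\<lambda>i\<in>{..<n}. g ((\<lambda>i\<in>{..<n}. f (x i)) i))"
    by (rule restrict_ext) (use x in \<open>simp add: tuplesD compose_eq\<close>)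
  then show "Gm M P (compose (carrier M) g f) (enc x) = compose (carrier (Go M)) (Gm N P g) (Gm M N f) (enc x)"
    by (simp only: compose_eq[OF enc_carrier[OF x]] Gm_enc[OF x] Gm_enc[OF hom_tuples[OF M N f x]])
qed (rule Gm_extensional compose_extensional)+

lemma linear_Go:
  assumes kA: "assoc_algebra k A" and kB: "assoc_algebra k B"
    and \<phi>_smult: "\<And>c x. c \<in> carrier k \<Longrightarrow> x \<in> carrier B \<Longrightarrow> \<phi> (c \<odot>\<^bsub>B\<^esub> x) = c \<odot>\<^bsub>A\<^esub> \<phi> x"
  shows "linear_module_functor k B A Go Gm"
proof (intro linear_module_functor.intro Go_module Gm_hom Gm_ident Gm_add Gm_compose)
  fix M N :: "('b, 'u) module" and f c
  assume M: "left_module B M" and N: "left_module B N" and f: "f \<in> module_homs B M N" and c: "c \<in> carrier k"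
  show "Gm M N (\<lambda>x\<in>carrier M. (c \<odot>\<^bsub>B\<^esub> \<one>\<^bsub>B\<^esub>) \<odot>\<^bsub>N\<^esub> f x) =
        (\<lambda>x\<in>carrier (Go M). (c \<odot>\<^bsub>A\<^esub> \<one>\<^bsub>A\<^esub>) \<odot>\<^bsub>Go N\<^esub> Gm M N f x)"
  proof (rule Go_eqI)
    fix x assume x: "x \<in> tuples M"
    note fx = hom_tuples[OF M N f x]
    have as: "act N (c \<odot>\<^bsub>A\<^esub> \<one>\<^bsub>A\<^esub>) (\<lambda>i\<in>{..<n}. f (x i)) =
        (\<lambda>i\<in>{..<n}. (c \<odot>\<^bsub>B\<^esub> \<one>\<^bsub>B\<^esub>) \<odot>\<^bsub>N\<^esub> (\<lambda>i\<in>{..<n}. f (x i)) i)"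
      by (rule act_scalar[OF kA kB _ N c fx]) (rule \<phi>_smult)
    have "(\<lambda>i\<in>{..<n}. (\<lambda>x\<in>carrier M. (c \<odot>\<^bsub>B\<^esub> \<one>\<^bsub>B\<^esub>) \<odot>\<^bsub>N\<^esub> f x) (x i)) = act N (c \<odot>\<^bsub>A\<^esub> \<one>\<^bsub>A\<^esub>) (\<lambda>i\<in>{..<n}. f (x i))"
      unfolding as by (rule restrict_ext) (use x in \<open>simp add: tuplesD\<close>)
    then show "Gm M N (\<lambda>x\<in>carrier M. (c \<odot>\<^bsub>B\<^esub> \<one>\<^bsub>B\<^esub>) \<odot>\<^bsub>N\<^esub> f x) (enc x) =
        (\<lambda>x\<in>carrier (Go M). (c \<odot>\<^bsub>A\<^esub> \<one>\<^bsub>A\<^esub>) \<odot>\<^bsub>Go N\<^esub> Gm M N f x) (enc x)"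
      by (simp only: Gm_enc[OF x] restrict_apply'[OF enc_carrier[OF x]] Go_simps(4)[OF restrict_extensional])
  qed (rule Gm_extensional restrict_extensional)+
qed

lemma natural_iso_Go_Fo:
  "natural_iso_to_identity A (Go \<circ> Fo) (\<lambda>M N f. Gm (Fo M) (Fo N) (Fm M N f)) \<eta>"
  unfolding natural_iso_to_identity_def comp_apply
proof (intro conjI allI impI)
  show "\<eta> M \<in> module_isos A (Go (Fo M)) M" if "left_module A M" for M by (rule \<eta>_iso[OF that])
  show "compose (carrier (Go (Fo M))) (\<eta> N) (Gm (Fo M) (Fo N) (Fm M N f)) = compose (carrier (Go (Fo M))) f (\<eta> M)"
    if "left_module A M \<and> left_module A N \<and> f \<in> module_homs A M N" for M N f
    using that by (elim conjE) (rule \<eta>_natural)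
qed

lemma natural_iso_Fo_Go:
  "natural_iso_to_identity B (Fo \<circ> Go) (\<lambda>M N f. Fm (Go M) (Go N) (Gm M N f)) \<epsilon>"
  unfolding natural_iso_to_identity_def comp_apply
proof (intro conjI allI impI)
  show "\<epsilon> N \<in> module_isos B (Fo (Go N)) N" if "left_module B N" for N by (rule \<epsilon>_iso[OF that])
  show "compose (carrier (Fo (Go N))) (\<epsilon> P) (Fm (Go N) (Go P) (Gm N P f)) = compose (carrier (Fo (Go N))) f (\<epsilon> N)"
    if "left_module B N \<and> left_module B P \<and> f \<in> module_homs B N P" for N P f
    using that by (elim conjE) (rule \<epsilon>_natural)
qed

end

text \<open>Frees the corner criterion from the numbering of generators and from the encoding of
  tuples: a finite index set can be numbered, and an infinite universe has room for its own
  tuples.\<close>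

theorem morita_equivalentI:
  fixes A :: "('k, 'a) module" and B :: "('k, 'b) module" and k :: "('k, 'm) ring_scheme"
  assumes kA: "assoc_algebra k A" and kB: "assoc_algebra k B"
    and "\<And>x. x \<in> carrier B \<Longrightarrow> \<phi> x \<in> carrier A"
    and "\<And>x y. x \<in> carrier B \<Longrightarrow> y \<in> carrier B \<Longrightarrow> \<phi> (x \<oplus>\<^bsub>B\<^esub> y) = \<phi> x \<oplus>\<^bsub>A\<^esub> \<phi> y"
    and "\<And>x y. x \<in> carrier B \<Longrightarrow> y \<in> carrier B \<Longrightarrow> \<phi> (x \<otimes>\<^bsub>B\<^esub> y) = \<phi> x \<otimes>\<^bsub>A\<^esub> \<phi> y"
    and \<phi>_smult: "\<And>c x. c \<in> carrier k \<Longrightarrow> x \<in> carrier B \<Longrightarrow> \<phi> (c \<odot>\<^bsub>B\<^esub> x) = c \<odot>\<^bsub>A\<^esub> \<phi> x"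
    and "inj_on \<phi> (carrier B)"
    and "\<And>a. a \<in> carrier A \<Longrightarrow> \<phi> \<one>\<^bsub>B\<^esub> \<otimes>\<^bsub>A\<^esub> a \<otimes>\<^bsub>A\<^esub> \<phi> \<one>\<^bsub>B\<^esub> \<in> \<phi> ` carrier B"
    and I: "finite I"
    and \<alpha>: "\<And>i. i \<in> I \<Longrightarrow> \<alpha> i \<in> carrier A" and \<beta>: "\<And>i. i \<in> I \<Longrightarrow> \<beta> i \<in> carrier A"
    and "\<And>i. i \<in> I \<Longrightarrow> \<alpha> i \<otimes>\<^bsub>A\<^esub> \<phi> \<one>\<^bsub>B\<^esub> = \<alpha> i"
    and "\<And>i. i \<in> I \<Longrightarrow> \<phi> \<one>\<^bsub>B\<^esub> \<otimes>\<^bsub>A\<^esub> \<beta> i = \<beta> i"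
    and full: "(\<Oplus>\<^bsub>A\<^esub>i\<in>I. \<alpha> i \<otimes>\<^bsub>A\<^esub> \<beta> i) = \<one>\<^bsub>A\<^esub>"
  shows "morita_equivalent TYPE('u::infinite) k A B"
proof -
  interpret kA: assoc_algebra k A by (rule kA)
  interpret kB: assoc_algebra k B by (rule kB)
  obtain h where h: "bij_betw h {..<card I} I"
    using ex_bij_betw_nat_finite[OF I] by (auto simp: atLeast0LessThan)
  have hI: "h i \<in> I" if "i < card I" for i using bij_betwE[OF h] that by blast
  have "(\<Oplus>\<^bsub>A\<^esub>i\<in>{..<card I}. \<alpha> (h i) \<otimes>\<^bsub>A\<^esub> \<beta> (h i)) = (\<Oplus>\<^bsub>A\<^esub>i\<in>h ` {..<card I}. \<alpha> i \<otimes>\<^bsub>A\<^esub> \<beta> i)"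
    using h \<alpha> \<beta> by (intro kA.M.finsum_reindex[symmetric]) (auto simp: bij_betw_def)
  also have "\<dots> = \<one>\<^bsub>A\<^esub>" using full h by (simp add: bij_betw_def)
  finally have full': "(\<Oplus>\<^bsub>A\<^esub>i\<in>{..<card I}. \<alpha> (h i) \<otimes>\<^bsub>A\<^esub> \<beta> (h i)) = \<one>\<^bsub>A\<^esub>" .
  obtain enc :: "(nat \<Rightarrow> 'u) \<Rightarrow> 'u" where "inj_on enc ({..<card I} \<rightarrow>\<^sub>E UNIV)"
    using ex_inj_tuples[OF infinite_UNIV] by blast
  then interpret full_corner A B \<phi> "card I" "\<lambda>i. \<alpha> (h i)" "\<lambda>i. \<beta> (h i)" enc
    by unfold_locales (use assms hI full' in auto)
  have F: "linear_module_functor k A B Fo Fm" by (rule linear_Fo[OF kA kB]) (rule \<phi>_smult)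
  have G: "linear_module_functor k B A Go Gm" by (rule linear_Go[OF kA kB]) (rule \<phi>_smult)
  show ?thesis
    unfolding morita_equivalent_def
    using kA kB F G natural_iso_Go_Fo natural_iso_Fo_Go by blast
qed

section \<open>Algebras with a monomial basis\<close>

context cring
begin

lemma finsum_fibers:
  assumes Z: "finite Z" and H: "finite H" and \<phi>: "\<And>z. z \<in> Z \<Longrightarrow> \<phi> z \<in> H" and g: "\<And>z. z \<in> Z \<Longrightarrow> g z \<in> carrier R"
  shows "(\<Oplus>h\<in>H. \<Oplus>z\<in>{z\<in>Z. \<phi> z = h}. g z) = (\<Oplus>z\<in>Z. g z)"
proof -
  have "finsum R g (\<Union>h\<in>H. {z\<in>Z. \<phi> z = h}) = (\<Oplus>h\<in>H. finsum R g {z\<in>Z. \<phi> z = h})"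
    by (rule add.finprod_UN_disjoint) (use assms in \<open>auto simp: pairwise_def disjnt_def\<close>)
  moreover have "(\<Union>h\<in>H. {z\<in>Z. \<phi> z = h}) = Z" using \<phi> by auto
  ultimately show ?thesis by simp
qed

lemma finsum_product:
  assumes X: "finite X" and Y: "finite Y" and g: "\<And>x y. x \<in> X \<Longrightarrow> y \<in> Y \<Longrightarrow> g x y \<in> carrier R"
  shows "(\<Oplus>z\<in>X \<times> Y. case z of (x, y) \<Rightarrow> g x y) = (\<Oplus>x\<in>X. \<Oplus>y\<in>Y. g x y)"
proof -
  have "(\<Oplus>z\<in>X \<times> Y. case z of (x, y) \<Rightarrow> g x y) = (\<Oplus>x\<in>X. \<Oplus>z\<in>{z\<in>X \<times> Y. fst z = x}. case z of (x, y) \<Rightarrow> g x y)"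
    by (rule finsum_fibers[symmetric]) (use assms in auto)
  also have "\<dots> = (\<Oplus>x\<in>X. \<Oplus>y\<in>Y. g x y)"
  proof (rule finsum_cong'[OF refl])
    fix x assume x: "x \<in> X"
    have "{z\<in>X \<times> Y. fst z = x} = Pair x ` Y" using x by auto
    moreover have "(\<Oplus>z\<in>Pair x ` Y. case z of (x, y) \<Rightarrow> g x y) = (\<Oplus>y\<in>Y. case (x, y) of (x, y) \<Rightarrow> g x y)"
      by (rule finsum_reindex) (use x g in \<open>auto simp: inj_on_def\<close>)
    ultimately show "(\<Oplus>z\<in>{z\<in>X \<times> Y. fst z = x}. case z of (x, y) \<Rightarrow> g x y) = (\<Oplus>y\<in>Y. g x y)" by simp
  qed (use g in \<open>auto intro!: finsum_closed\<close>)
  finally show ?thesis .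
qed

text \<open>It plays two roles: the pairing of a family of coefficients with a function on the
  basis, and the product of a row with a column, so that matrices can be plain functions of two
  basis elements.\<close>

definition dot :: "'x set \<Rightarrow> ('x \<Rightarrow> 'a) \<Rightarrow> ('x \<Rightarrow> 'a) \<Rightarrow> 'a" where
  "dot X a F = (\<Oplus>x\<in>X. a x \<otimes> F x)"

lemma dot_closed: "(\<And>x. x \<in> X \<Longrightarrow> a x \<in> carrier R) \<Longrightarrow> (\<And>x. x \<in> X \<Longrightarrow> F x \<in> carrier R) \<Longrightarrow> dot X a F \<in> carrier R"
  unfolding dot_def by (intro finsum_closed) auto

lemma dot_cong:
  assumes "\<And>x. x \<in> X \<Longrightarrow> a x \<otimes> F x = b x \<otimes> G x" and "\<And>x. x \<in> X \<Longrightarrow> b x \<in> carrier R" and "\<And>x. x \<in> X \<Longrightarrow> G x \<in> carrier R"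
  shows "dot X a F = dot X b G"
  unfolding dot_def by (intro finsum_cong') (use assms in auto)

lemma dot_cong_right:
  assumes "\<And>x. x \<in> X \<Longrightarrow> F x = G x" and "\<And>x. x \<in> X \<Longrightarrow> a x \<in> carrier R" and "\<And>x. x \<in> X \<Longrightarrow> G x \<in> carrier R"
  shows "dot X a F = dot X a G"
  by (rule dot_cong) (use assms in auto)

lemma dot_add_left:
  assumes "\<And>x. x \<in> X \<Longrightarrow> a x \<in> carrier R" "\<And>x. x \<in> X \<Longrightarrow> b x \<in> carrier R" "\<And>x. x \<in> X \<Longrightarrow> F x \<in> carrier R"
    and "\<And>x. x \<in> X \<Longrightarrow> c x = a x \<oplus> b x"
  shows "dot X c F = dot X a F \<oplus> dot X b F"
proof -
  have "dot X c F = (\<Oplus>x\<in>X. a x \<otimes> F x \<oplus> b x \<otimes> F x)"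
    unfolding dot_def by (intro finsum_cong') (use assms in \<open>auto simp: l_distr\<close>)
  also have "\<dots> = dot X a F \<oplus> dot X b F" unfolding dot_def by (intro finsum_addf) (use assms in auto)
  finally show ?thesis .
qed

lemma dot_add_right:
  assumes "\<And>x. x \<in> X \<Longrightarrow> a x \<in> carrier R" "\<And>x. x \<in> X \<Longrightarrow> F x \<in> carrier R" "\<And>x. x \<in> X \<Longrightarrow> G x \<in> carrier R"
  shows "dot X a (\<lambda>x. F x \<oplus> G x) = dot X a F \<oplus> dot X a G"
proof -
  have "dot X a (\<lambda>x. F x \<oplus> G x) = (\<Oplus>x\<in>X. a x \<otimes> F x \<oplus> a x \<otimes> G x)"
    unfolding dot_def by (intro finsum_cong') (use assms in \<open>auto simp: r_distr\<close>)
  also have "\<dots> = dot X a F \<oplus> dot X a G" unfolding dot_def by (intro finsum_addf) (use assms in auto)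
  finally show ?thesis .
qed

lemma dot_smult_left:
  assumes X: "finite X" and "c \<in> carrier R" "\<And>x. x \<in> X \<Longrightarrow> a x \<in> carrier R" "\<And>x. x \<in> X \<Longrightarrow> F x \<in> carrier R"
    and "\<And>x. x \<in> X \<Longrightarrow> b x = c \<otimes> a x"
  shows "dot X b F = c \<otimes> dot X a F"
  unfolding dot_def by (subst finsum_rdistr, use assms in auto, intro finsum_cong') (use assms in \<open>auto simp: m_assoc\<close>)

lemma dot_smult_right:
  assumes X: "finite X" and "c \<in> carrier R" "\<And>x. x \<in> X \<Longrightarrow> a x \<in> carrier R" "\<And>x. x \<in> X \<Longrightarrow> F x \<in> carrier R"
  shows "dot X a (\<lambda>x. c \<otimes> F x) = c \<otimes> dot X a F"
  unfolding dot_def by (subst finsum_rdistr, use assms in auto, intro finsum_cong') (use assms in \<open>auto simp: m_lcomm\<close>)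

lemma dot_swap:
  assumes X: "finite X" and Y: "finite Y"
    and a: "\<And>x. x \<in> X \<Longrightarrow> a x \<in> carrier R" and b: "\<And>y. y \<in> Y \<Longrightarrow> b y \<in> carrier R"
    and K: "\<And>x y. x \<in> X \<Longrightarrow> y \<in> Y \<Longrightarrow> K x y \<in> carrier R"
  shows "dot X a (\<lambda>x. dot Y b (\<lambda>y. K x y)) = dot Y b (\<lambda>y. dot X a (\<lambda>x. K x y))"
proof -
  have "dot X a (\<lambda>x. dot Y b (\<lambda>y. K x y)) = (\<Oplus>x\<in>X. \<Oplus>y\<in>Y. a x \<otimes> (b y \<otimes> K x y))"
    unfolding dot_def using a b K Y by (intro finsum_cong') (auto intro!: finsum_rdistr finsum_closed)
  also have "\<dots> = (\<Oplus>y\<in>Y. \<Oplus>x\<in>X. a x \<otimes> (b y \<otimes> K x y))"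
    using a b K by (intro finsum_swap X Y) auto
  also have "\<dots> = (\<Oplus>y\<in>Y. \<Oplus>x\<in>X. b y \<otimes> (a x \<otimes> K x y))"
    using a b K by (intro finsum_cong') (auto intro!: finsum_closed simp: m_lcomm)
  also have "\<dots> = dot Y b (\<lambda>y. dot X a (\<lambda>x. K x y))"
    unfolding dot_def using a b K X by (intro finsum_cong') (auto intro!: finsum_rdistr[symmetric] finsum_closed)
  finally show ?thesis .
qed

lemma dot_delta:
  assumes X: "finite X" and x: "x \<in> X" and a: "\<And>y. y \<in> X \<Longrightarrow> a y \<in> carrier R" and c: "c \<in> carrier R"
  shows "dot X a (\<lambda>y. if y = x then c else \<zero>) = a x \<otimes> c"
proof -
  have "dot X a (\<lambda>y. if y = x then c else \<zero>) = (\<Oplus>y\<in>X. if x = y then a y \<otimes> c else \<zero>)"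
    unfolding dot_def using a c by (intro finsum_cong') auto
  also have "\<dots> = a x \<otimes> c" using finsum_singleton[OF x X, of "\<lambda>y. a y \<otimes> c"] a c by simp
  finally show ?thesis .
qed

lemma dot_zero: "(\<And>x. x \<in> X \<Longrightarrow> a x \<otimes> F x = \<zero>) \<Longrightarrow> dot X a F = \<zero>"
  unfolding dot_def by (rule add.finprod_one_eqI) simp

lemma dot_mono_neutral:
  assumes "finite X" and "Y \<subseteq> X" and "\<And>x. x \<in> X - Y \<Longrightarrow> a x \<otimes> F x = \<zero>"
    and "\<And>x. x \<in> X \<Longrightarrow> a x \<in> carrier R" "\<And>x. x \<in> X \<Longrightarrow> F x \<in> carrier R"
  shows "dot X a F = dot Y a F"
  unfolding dot_def by (rule add.finprod_mono_neutral_cong_right) (use assms in auto)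

lemma dot_reindex:
  assumes "bij_betw h X Y" and "\<And>y. y \<in> Y \<Longrightarrow> a y \<in> carrier R" "\<And>y. y \<in> Y \<Longrightarrow> F y \<in> carrier R"
  shows "dot Y a F = dot X (\<lambda>x. a (h x)) (\<lambda>x. F (h x))"
proof -
  have "Y = h ` X" "inj_on h X" using assms(1) by (auto simp: bij_betw_def)
  then show ?thesis unfolding dot_def using assms(2,3) by (subst finsum_reindex[symmetric]) auto
qed

end

text \<open>Twisted monoid algebras: a finite monoid with weights that satisfy a cocycle identity.
  The Brauer algebra, with powers of \<open>\<delta>\<close> as weights, and the group algebras,
  with weight 1, are both of this kind, so the ring axioms are checked once for all. The product
  formula is demanded on the carrier only, since for group algebras the factor 1 can be inserted
  only where the coefficients lie in the base ring.\<close>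

locale monomial_algebra = cring k for k (structure) +
  fixes A :: "('a, 'x \<Rightarrow> 'a) module" and X :: "'x set" and op :: "'x \<Rightarrow> 'x \<Rightarrow> 'x"
    and wt :: "'x \<Rightarrow> 'x \<Rightarrow> 'a" and u :: 'x
  assumes finite_X: "finite X"
    and op_closed: "x \<in> X \<Longrightarrow> y \<in> X \<Longrightarrow> op x y \<in> X"
    and wt_closed: "x \<in> X \<Longrightarrow> y \<in> X \<Longrightarrow> wt x y \<in> carrier k"
    and op_assoc: "x \<in> X \<Longrightarrow> y \<in> X \<Longrightarrow> z \<in> X \<Longrightarrow> op (op x y) z = op x (op y z)"
    and wt_cocycle: "x \<in> X \<Longrightarrow> y \<in> X \<Longrightarrow> z \<in> X \<Longrightarrow> wt x y \<otimes> wt (op x y) z = wt y z \<otimes> wt x (op y z)"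
    and unit: "u \<in> X" "x \<in> X \<Longrightarrow> op u x = x" "x \<in> X \<Longrightarrow> op x u = x"
      "x \<in> X \<Longrightarrow> wt u x = \<one>" "x \<in> X \<Longrightarrow> wt x u = \<one>"
    and carrier_A: "carrier A = X \<rightarrow>\<^sub>E carrier k"
    and mult_A: "a \<in> carrier A \<Longrightarrow> b \<in> carrier A \<Longrightarrow> a \<otimes>\<^bsub>A\<^esub> b =
      (\<lambda>h\<in>X. finsum k (\<lambda>(x, y). (a x \<otimes> b y) \<otimes> wt x y) {(x, y) \<in> X \<times> X. op x y = h})"
    and one_A: "\<one>\<^bsub>A\<^esub> = (\<lambda>h\<in>X. if h = u then \<one> else \<zero>)"
    and zero_A: "\<zero>\<^bsub>A\<^esub> = (\<lambda>h\<in>X. \<zero>)"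
    and add_A: "a \<oplus>\<^bsub>A\<^esub> b = (\<lambda>h\<in>X. a h \<oplus> b h)"
    and smult_A: "c \<odot>\<^bsub>A\<^esub> a = (\<lambda>h\<in>X. c \<otimes> a h)"
begin

lemma coeff_closed: "a \<in> carrier A \<Longrightarrow> x \<in> X \<Longrightarrow> a x \<in> carrier k"
  unfolding carrier_A by (rule PiE_mem)

lemma coeff_eqI: "a \<in> carrier A \<Longrightarrow> b \<in> carrier A \<Longrightarrow> (\<And>x. x \<in> X \<Longrightarrow> a x = b x) \<Longrightarrow> a = b"
  unfolding carrier_A by (rule PiE_ext)

lemma mult_closed:
  assumes "a \<in> carrier A" and "b \<in> carrier A"
  shows "a \<otimes>\<^bsub>A\<^esub> b \<in> carrier A"
proof -
  have "(\<lambda>(x, y). (a x \<otimes> b y) \<otimes> wt x y) \<in> {(x, y) \<in> X \<times> X. op x y = h} \<rightarrow> carrier k" for h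
    using coeff_closed assms wt_closed by auto
  then show ?thesis unfolding mult_A[OF assms] carrier_A by (auto intro!: finsum_closed)
qed

lemma add_closed: "a \<in> carrier A \<Longrightarrow> b \<in> carrier A \<Longrightarrow> a \<oplus>\<^bsub>A\<^esub> b \<in> carrier A"
  using coeff_closed[of a] coeff_closed[of b] unfolding add_A by (auto simp: carrier_A)

lemma smult_closed: "c \<in> carrier k \<Longrightarrow> a \<in> carrier A \<Longrightarrow> c \<odot>\<^bsub>A\<^esub> a \<in> carrier A"
  using coeff_closed[of a] unfolding smult_A by (auto simp: carrier_A)

lemma one_closed': "\<one>\<^bsub>A\<^esub> \<in> carrier A"
  unfolding one_A carrier_A by auto

lemma zero_closed': "\<zero>\<^bsub>A\<^esub> \<in> carrier A"
  unfolding zero_A carrier_A by auto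

text \<open>Extend \<open>F\<close> linearly to the algebra. Its value on a product is a double sum
  over basis elements because the fibres of \<open>op\<close> partition the pairs.\<close>

lemma dot_mult:
  assumes a: "a \<in> carrier A" and b: "b \<in> carrier A" and F: "\<And>x. x \<in> X \<Longrightarrow> F x \<in> carrier k"
  shows "dot X (a \<otimes>\<^bsub>A\<^esub> b) F = dot X a (\<lambda>x. dot X b (\<lambda>y. wt x y \<otimes> F (op x y)))"
proof -
  let ?g = "\<lambda>(x, y). ((a x \<otimes> b y) \<otimes> wt x y) \<otimes> F (op x y)"
  note c = coeff_closed[OF a] coeff_closed[OF b] wt_closed op_closed F
  have "dot X (a \<otimes>\<^bsub>A\<^esub> b) F = (\<Oplus>h\<in>X. \<Oplus>z\<in>{z\<in>X \<times> X. (case z of (x, y) \<Rightarrow> op x y) = h}. ?g z)"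
    unfolding dot_def
  proof (rule finsum_cong'[OF refl])
    fix h assume h: "h \<in> X"
    let ?S = "{(x, y) \<in> X \<times> X. op x y = h}"
    have "(a \<otimes>\<^bsub>A\<^esub> b) h \<otimes> F h = finsum k (\<lambda>(x, y). (a x \<otimes> b y) \<otimes> wt x y) ?S \<otimes> F h"
      unfolding mult_A[OF a b] using h by simp
    also have "\<dots> = (\<Oplus>z\<in>?S. (case z of (x, y) \<Rightarrow> (a x \<otimes> b y) \<otimes> wt x y) \<otimes> F h)"
    proof (rule finsum_ldistr)
      show "finite ?S" by (rule finite_subset[of _ "X \<times> X"]) (use finite_X in auto)
    qed (use c h in auto)
    also have "\<dots> = (\<Oplus>z\<in>{z\<in>X \<times> X. (case z of (x, y) \<Rightarrow> op x y) = h}. ?g z)"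
      using c by (intro finsum_cong') auto
    finally show "(a \<otimes>\<^bsub>A\<^esub> b) h \<otimes> F h = (\<Oplus>z\<in>{z\<in>X \<times> X. (case z of (x, y) \<Rightarrow> op x y) = h}. ?g z)" .
  qed (use c in \<open>auto intro!: finsum_closed\<close>)
  also have "\<dots> = (\<Oplus>z\<in>X \<times> X. ?g z)"
    by (rule finsum_fibers) (use finite_X c in auto)
  also have "\<dots> = (\<Oplus>x\<in>X. \<Oplus>y\<in>X. ((a x \<otimes> b y) \<otimes> wt x y) \<otimes> F (op x y))"
    by (rule finsum_product) (use finite_X c in auto)
  also have "\<dots> = dot X a (\<lambda>x. dot X b (\<lambda>y. wt x y \<otimes> F (op x y)))"
    unfolding dot_def
  proof (rule finsum_cong'[OF refl])
    fix x assume x: "x \<in> X"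
    have "a x \<otimes> (\<Oplus>y\<in>X. b y \<otimes> (wt x y \<otimes> F (op x y))) = (\<Oplus>y\<in>X. a x \<otimes> (b y \<otimes> (wt x y \<otimes> F (op x y))))"
      by (rule finsum_rdistr) (use finite_X c x in auto)
    also have "\<dots> = (\<Oplus>y\<in>X. ((a x \<otimes> b y) \<otimes> wt x y) \<otimes> F (op x y))"
      by (rule finsum_cong') (use c x in \<open>auto simp: m_assoc\<close>)
    finally show "(\<Oplus>y\<in>X. ((a x \<otimes> b y) \<otimes> wt x y) \<otimes> F (op x y)) = a x \<otimes> (\<Oplus>y\<in>X. b y \<otimes> (wt x y \<otimes> F (op x y)))" ..
  qed (use c in \<open>auto intro!: finsum_closed\<close>)
  finally show ?thesis .
qed

text \<open>Indicator functions are among the \<open>F\<close>, so elements can be compared by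
  pairing with arbitrary functions. Together with \<open>dot_mult\<close> this proves identities
  between products without handling convolution sums.\<close>

lemma dot_eqI:
  assumes a: "a \<in> carrier A" and b: "b \<in> carrier A"
    and eq: "\<And>F. (\<And>x. x \<in> X \<Longrightarrow> F x \<in> carrier k) \<Longrightarrow> dot X a F = dot X b F"
  shows "a = b"
proof (rule coeff_eqI[OF a b])
  fix x assume x: "x \<in> X"
  have "dot X a (\<lambda>y. if y = x then \<one> else \<zero>) = dot X b (\<lambda>y. if y = x then \<one> else \<zero>)" by (rule eq) auto
  then show "a x = b x"
    using dot_delta[OF finite_X x, of a \<one>] dot_delta[OF finite_X x, of b \<one>] coeff_closed a b x by simp
qed

lemma dot_add: "a \<in> carrier A \<Longrightarrow> b \<in> carrier A \<Longrightarrow> (\<And>x. x \<in> X \<Longrightarrow> F x \<in> carrier k) \<Longrightarrow>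
    dot X (a \<oplus>\<^bsub>A\<^esub> b) F = dot X a F \<oplus> dot X b F"
  by (rule dot_add_left) (auto simp: coeff_closed add_A)

lemma dot_smult: "c \<in> carrier k \<Longrightarrow> a \<in> carrier A \<Longrightarrow> (\<And>x. x \<in> X \<Longrightarrow> F x \<in> carrier k) \<Longrightarrow>
    dot X (c \<odot>\<^bsub>A\<^esub> a) F = c \<otimes> dot X a F"
  by (rule dot_smult_left) (auto simp: coeff_closed smult_A finite_X)

lemma dot_one:
  assumes F: "\<And>x. x \<in> X \<Longrightarrow> F x \<in> carrier k"
  shows "dot X \<one>\<^bsub>A\<^esub> F = F u"
proof -
  have "dot X \<one>\<^bsub>A\<^esub> F = dot X F (\<lambda>h. if h = u then \<one> else \<zero>)"
    by (rule dot_cong) (use F in \<open>auto simp: one_A\<close>)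
  then show ?thesis using dot_delta[OF finite_X unit(1), of F \<one>] F unit(1) by simp
qed

lemma dot_closed_A: "a \<in> carrier A \<Longrightarrow> (\<And>x. x \<in> X \<Longrightarrow> F x \<in> carrier k) \<Longrightarrow> dot X a F \<in> carrier k"
  by (rule dot_closed) (auto simp: coeff_closed)

lemma assoc_algebra: "assoc_algebra k A"
proof -
  have ag: "abelian_group A"
  proof (rule abelian_groupI)
    fix a b assume a: "a \<in> carrier A" and b: "b \<in> carrier A"
    show "a \<oplus>\<^bsub>A\<^esub> b \<in> carrier A" by (rule add_closed[OF a b])
    show "a \<oplus>\<^bsub>A\<^esub> b = b \<oplus>\<^bsub>A\<^esub> a" unfolding add_A by (rule restrict_ext) (simp add: a_comm coeff_closed a b)
    show "\<zero>\<^bsub>A\<^esub> \<oplus>\<^bsub>A\<^esub> a = a"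
      by (rule coeff_eqI[OF add_closed[OF zero_closed' a] a]) (simp add: add_A zero_A coeff_closed a)
    have m: "(\<lambda>h\<in>X. \<ominus> a h) \<in> carrier A" using coeff_closed[OF a] by (auto simp: carrier_A)
    moreover have "(\<lambda>h\<in>X. \<ominus> a h) \<oplus>\<^bsub>A\<^esub> a = \<zero>\<^bsub>A\<^esub>"
      by (rule coeff_eqI[OF add_closed[OF m a] zero_closed']) (simp add: add_A zero_A coeff_closed a l_neg)
    ultimately show "\<exists>y\<in>carrier A. y \<oplus>\<^bsub>A\<^esub> a = \<zero>\<^bsub>A\<^esub>" by blast
    fix c assume c: "c \<in> carrier A"
    show "a \<oplus>\<^bsub>A\<^esub> b \<oplus>\<^bsub>A\<^esub> c = a \<oplus>\<^bsub>A\<^esub> (b \<oplus>\<^bsub>A\<^esub> c)"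
      unfolding add_A by (rule restrict_ext) (simp add: a_assoc coeff_closed a b c)
  qed (rule zero_closed')
  have mon: "Group.monoid A"
  proof (rule Group.monoidI)
    fix a b assume a: "a \<in> carrier A" and b: "b \<in> carrier A"
    show "a \<otimes>\<^bsub>A\<^esub> b \<in> carrier A" by (rule mult_closed[OF a b])
    note ca = coeff_closed[OF a]
    show "\<one>\<^bsub>A\<^esub> \<otimes>\<^bsub>A\<^esub> a = a"
    proof (rule dot_eqI[OF mult_closed[OF one_closed' a] a])
      fix F assume F: "\<And>x. x \<in> X \<Longrightarrow> F x \<in> carrier k"
      have "dot X (\<one>\<^bsub>A\<^esub> \<otimes>\<^bsub>A\<^esub> a) F = dot X \<one>\<^bsub>A\<^esub> (\<lambda>x. dot X a (\<lambda>y. wt x y \<otimes> F (op x y)))"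
        by (rule dot_mult[OF one_closed' a F])
      also have "\<dots> = dot X a (\<lambda>y. wt u y \<otimes> F (op u y))"
        by (rule dot_one) (auto intro!: dot_closed ca wt_closed F op_closed)
      also have "\<dots> = dot X a F"
        by (rule dot_cong_right) (use F ca unit in auto)
      finally show "dot X (\<one>\<^bsub>A\<^esub> \<otimes>\<^bsub>A\<^esub> a) F = dot X a F" .
    qed
    show "a \<otimes>\<^bsub>A\<^esub> \<one>\<^bsub>A\<^esub> = a"
    proof (rule dot_eqI[OF mult_closed[OF a one_closed'] a])
      fix F assume F: "\<And>x. x \<in> X \<Longrightarrow> F x \<in> carrier k"
      have "dot X (a \<otimes>\<^bsub>A\<^esub> \<one>\<^bsub>A\<^esub>) F = dot X a (\<lambda>x. dot X \<one>\<^bsub>A\<^esub> (\<lambda>y. wt x y \<otimes> F (op x y)))"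
        by (rule dot_mult[OF a one_closed' F])
      also have "\<dots> = dot X a F"
        by (rule dot_cong_right) (use F ca unit wt_closed op_closed in \<open>auto simp: dot_one\<close>)
      finally show "dot X (a \<otimes>\<^bsub>A\<^esub> \<one>\<^bsub>A\<^esub>) F = dot X a F" .
    qed
    fix c assume c: "c \<in> carrier A"
    note cb = coeff_closed[OF b] and cc = coeff_closed[OF c]
    show "a \<otimes>\<^bsub>A\<^esub> b \<otimes>\<^bsub>A\<^esub> c = a \<otimes>\<^bsub>A\<^esub> (b \<otimes>\<^bsub>A\<^esub> c)"
    proof (rule dot_eqI[OF mult_closed[OF mult_closed[OF a b] c] mult_closed[OF a mult_closed[OF b c]]])
      fix F assume F: "\<And>x. x \<in> X \<Longrightarrow> F x \<in> carrier k"
      have "dot X (a \<otimes>\<^bsub>A\<^esub> b \<otimes>\<^bsub>A\<^esub> c) F = dot X (a \<otimes>\<^bsub>A\<^esub> b) (\<lambda>x. dot X c (\<lambda>z. wt x z \<otimes> F (op x z)))"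
        by (rule dot_mult[OF mult_closed[OF a b] c F])
      also have "\<dots> = dot X a (\<lambda>x. dot X b (\<lambda>y. wt x y \<otimes> dot X c (\<lambda>z. wt (op x y) z \<otimes> F (op (op x y) z))))"
        by (rule dot_mult[OF a b]) (auto intro!: dot_closed cc wt_closed F op_closed)
      also have "\<dots> = dot X a (\<lambda>x. dot X b (\<lambda>y. dot X c (\<lambda>z. wt y z \<otimes> (wt x (op y z) \<otimes> F (op x (op y z))))))"
      proof (intro dot_cong_right)
        fix x y assume x: "x \<in> X" and y: "y \<in> X"
        have "wt x y \<otimes> dot X c (\<lambda>z. wt (op x y) z \<otimes> F (op (op x y) z))
            = dot X c (\<lambda>z. wt x y \<otimes> (wt (op x y) z \<otimes> F (op (op x y) z)))"
          by (rule dot_smult_right[symmetric]) (auto intro!: finite_X cc wt_closed F op_closed x y)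
        also have "\<dots> = dot X c (\<lambda>z. wt y z \<otimes> (wt x (op y z) \<otimes> F (op x (op y z))))"
        proof (rule dot_cong_right)
          fix z assume z: "z \<in> X"
          have "wt x y \<otimes> (wt (op x y) z \<otimes> F (op (op x y) z)) = (wt x y \<otimes> wt (op x y) z) \<otimes> F (op (op x y) z)"
            using x y z F wt_closed op_closed by (simp add: m_assoc)
          also have "\<dots> = (wt y z \<otimes> wt x (op y z)) \<otimes> F (op x (op y z))"
            unfolding wt_cocycle[OF x y z] op_assoc[OF x y z] ..
          also have "\<dots> = wt y z \<otimes> (wt x (op y z) \<otimes> F (op x (op y z)))"
            using x y z F wt_closed op_closed by (simp add: m_assoc)
          finally show "wt x y \<otimes> (wt (op x y) z \<otimes> F (op (op x y) z)) = wt y z \<otimes> (wt x (op y z) \<otimes> F (op x (op y z)))" .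
        qed (auto intro!: cc wt_closed F op_closed x y)
        finally show "wt x y \<otimes> dot X c (\<lambda>z. wt (op x y) z \<otimes> F (op (op x y) z)) =
            dot X c (\<lambda>z. wt y z \<otimes> (wt x (op y z) \<otimes> F (op x (op y z))))" .
      qed (auto intro!: dot_closed ca cb cc wt_closed F op_closed)
      also have "\<dots> = dot X a (\<lambda>x. dot X (b \<otimes>\<^bsub>A\<^esub> c) (\<lambda>y. wt x y \<otimes> F (op x y)))"
      proof (rule dot_cong_right)
        fix x assume x: "x \<in> X"
        show "dot X b (\<lambda>y. dot X c (\<lambda>z. wt y z \<otimes> (wt x (op y z) \<otimes> F (op x (op y z))))) = dot X (b \<otimes>\<^bsub>A\<^esub> c) (\<lambda>y. wt x y \<otimes> F (op x y))"
          by (rule dot_mult[OF b c, symmetric]) (auto intro!: wt_closed F op_closed x)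
      qed (auto intro!: dot_closed_A mult_closed ca b c wt_closed F op_closed)
      also have "\<dots> = dot X (a \<otimes>\<^bsub>A\<^esub> (b \<otimes>\<^bsub>A\<^esub> c)) F"
        by (rule dot_mult[OF a mult_closed[OF b c] F, symmetric])
      finally show "dot X (a \<otimes>\<^bsub>A\<^esub> b \<otimes>\<^bsub>A\<^esub> c) F = dot X (a \<otimes>\<^bsub>A\<^esub> (b \<otimes>\<^bsub>A\<^esub> c)) F" .
    qed
  qed (rule one_closed')
  have rA: "ring A"
  proof (rule ringI[OF ag mon])
    fix a b c assume abc: "a \<in> carrier A" "b \<in> carrier A" "c \<in> carrier A"
    note cl = add_closed mult_closed abc dot_mult dot_add
    show "(a \<oplus>\<^bsub>A\<^esub> b) \<otimes>\<^bsub>A\<^esub> c = a \<otimes>\<^bsub>A\<^esub> c \<oplus>\<^bsub>A\<^esub> b \<otimes>\<^bsub>A\<^esub> c"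
    proof (rule dot_eqI)
      fix F assume F: "\<And>x. x \<in> X \<Longrightarrow> F x \<in> carrier k"
      show "dot X ((a \<oplus>\<^bsub>A\<^esub> b) \<otimes>\<^bsub>A\<^esub> c) F = dot X (a \<otimes>\<^bsub>A\<^esub> c \<oplus>\<^bsub>A\<^esub> b \<otimes>\<^bsub>A\<^esub> c) F"
        using F op_closed wt_closed by (simp add: cl dot_closed_A)
    qed (use cl in auto)
    show "c \<otimes>\<^bsub>A\<^esub> (a \<oplus>\<^bsub>A\<^esub> b) = c \<otimes>\<^bsub>A\<^esub> a \<oplus>\<^bsub>A\<^esub> c \<otimes>\<^bsub>A\<^esub> b"
    proof (rule dot_eqI)
      fix F assume F: "\<And>x. x \<in> X \<Longrightarrow> F x \<in> carrier k"
      have "dot X (c \<otimes>\<^bsub>A\<^esub> (a \<oplus>\<^bsub>A\<^esub> b)) F = dot X c (\<lambda>x. dot X (a \<oplus>\<^bsub>A\<^esub> b) (\<lambda>y. wt x y \<otimes> F (op x y)))"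
        by (rule dot_mult[OF abc(3) add_closed[OF abc(1,2)]]) (rule F)
      also have "\<dots> = dot X c (\<lambda>x. dot X a (\<lambda>y. wt x y \<otimes> F (op x y)) \<oplus> dot X b (\<lambda>y. wt x y \<otimes> F (op x y)))"
        by (rule dot_cong_right) (use F op_closed wt_closed in \<open>auto simp: cl dot_closed_A coeff_closed\<close>)
      also have "\<dots> = dot X (c \<otimes>\<^bsub>A\<^esub> a \<oplus>\<^bsub>A\<^esub> c \<otimes>\<^bsub>A\<^esub> b) F"
        using F op_closed wt_closed by (simp add: cl dot_closed_A coeff_closed dot_add_right)
      finally show "dot X (c \<otimes>\<^bsub>A\<^esub> (a \<oplus>\<^bsub>A\<^esub> b)) F = dot X (c \<otimes>\<^bsub>A\<^esub> a \<oplus>\<^bsub>A\<^esub> c \<otimes>\<^bsub>A\<^esub> b) F" .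
    qed (use cl in auto)
  qed
  have modA: "module k A"
  proof (rule module.intro[OF cring_axioms ag], unfold_locales)
    fix c d a b assume cd: "c \<in> carrier k" "d \<in> carrier k" and ab: "a \<in> carrier A" "b \<in> carrier A"
    show "(c \<oplus> d) \<odot>\<^bsub>A\<^esub> a = c \<odot>\<^bsub>A\<^esub> a \<oplus>\<^bsub>A\<^esub> d \<odot>\<^bsub>A\<^esub> a"
      unfolding add_A smult_A by (rule restrict_ext) (simp add: l_distr coeff_closed cd ab)
    show "c \<odot>\<^bsub>A\<^esub> (a \<oplus>\<^bsub>A\<^esub> b) = c \<odot>\<^bsub>A\<^esub> a \<oplus>\<^bsub>A\<^esub> c \<odot>\<^bsub>A\<^esub> b"
      unfolding add_A smult_A by (rule restrict_ext) (simp add: r_distr coeff_closed cd ab)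
    show "(c \<otimes> d) \<odot>\<^bsub>A\<^esub> a = c \<odot>\<^bsub>A\<^esub> (d \<odot>\<^bsub>A\<^esub> a)"
      unfolding smult_A by (rule restrict_ext) (simp add: m_assoc coeff_closed cd ab)
  next
    show "\<one> \<odot>\<^bsub>A\<^esub> a = a" if "a \<in> carrier A" for a
      by (rule coeff_eqI[OF smult_closed that]) (simp_all add: that smult_A coeff_closed)
  qed (rule smult_closed)
  show ?thesis
  proof (rule assoc_algebra.intro[OF modA rA], unfold_locales)
    fix c a b assume c: "c \<in> carrier k" and a: "a \<in> carrier A" and b: "b \<in> carrier A"
    note cl = mult_closed smult_closed a b c
    show "(c \<odot>\<^bsub>A\<^esub> a) \<otimes>\<^bsub>A\<^esub> b = c \<odot>\<^bsub>A\<^esub> (a \<otimes>\<^bsub>A\<^esub> b)"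
    proof (rule dot_eqI)
      fix F assume F: "\<And>x. x \<in> X \<Longrightarrow> F x \<in> carrier k"
      show "dot X ((c \<odot>\<^bsub>A\<^esub> a) \<otimes>\<^bsub>A\<^esub> b) F = dot X (c \<odot>\<^bsub>A\<^esub> (a \<otimes>\<^bsub>A\<^esub> b)) F"
        using F op_closed wt_closed by (simp add: cl dot_mult dot_smult dot_closed_A)
    qed (use cl in auto)
    show "a \<otimes>\<^bsub>A\<^esub> (c \<odot>\<^bsub>A\<^esub> b) = c \<odot>\<^bsub>A\<^esub> (a \<otimes>\<^bsub>A\<^esub> b)"
    proof (rule dot_eqI)
      fix F assume F: "\<And>x. x \<in> X \<Longrightarrow> F x \<in> carrier k"
      have "dot X (a \<otimes>\<^bsub>A\<^esub> (c \<odot>\<^bsub>A\<^esub> b)) F = dot X a (\<lambda>x. dot X (c \<odot>\<^bsub>A\<^esub> b) (\<lambda>y. wt x y \<otimes> F (op x y)))"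
        by (rule dot_mult[OF a smult_closed[OF c b]]) (rule F)
      also have "\<dots> = dot X a (\<lambda>x. c \<otimes> dot X b (\<lambda>y. wt x y \<otimes> F (op x y)))"
        by (rule dot_cong_right) (use F op_closed wt_closed in \<open>auto simp: cl dot_smult dot_closed_A coeff_closed\<close>)
      also have "\<dots> = c \<otimes> dot X a (\<lambda>x. dot X b (\<lambda>y. wt x y \<otimes> F (op x y)))"
        by (rule dot_smult_right) (use F op_closed wt_closed in \<open>auto simp: cl dot_closed_A coeff_closed finite_X\<close>)
      also have "\<dots> = dot X (c \<odot>\<^bsub>A\<^esub> (a \<otimes>\<^bsub>A\<^esub> b)) F" using F by (simp add: cl dot_smult dot_mult)
      finally show "dot X (a \<otimes>\<^bsub>A\<^esub> (c \<odot>\<^bsub>A\<^esub> b)) F = dot X (c \<odot>\<^bsub>A\<^esub> (a \<otimes>\<^bsub>A\<^esub> b)) F" .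
    qed (use cl in auto)
  qed
qed

end

section \<open>The Brauer algebra, the group algebras and their direct sum\<close>

lemma finite_brauer_diagrams [simp]: "finite (brauer_diagrams p q)"
proof (rule finite_subset)
  show "brauer_diagrams p q \<subseteq> Pow (Pow (brauer_points p q))" using brauer_diagramsD(1) by blast
  show "finite (Pow (Pow (brauer_points p q)))" by (simp add: brauer_points_def)
qed

lemma finite_upward_diagrams [simp]: "finite (upward_diagrams p q)"
  by (rule finite_subset[of _ "brauer_diagrams p q"]) (auto simp: upward_diagrams_def)

lemma loop_count_perm_left: "\<sigma> permutes {1..q} \<Longrightarrow> g \<in> brauer_diagrams p q \<Longrightarrow> loop_count (perm_diagram q \<sigma>) g = 0"
  by (rule loop_count_upward_left[OF perm_diagram_upward])

lemma loop_count_perm_right: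
  assumes \<sigma>: "\<sigma> permutes {1..p}" and f: "f \<in> brauer_diagrams p q"
  shows "loop_count f (perm_diagram p \<sigma>) = 0"
proof -
  have "loop_count f (flip_diagram (perm_diagram p (inv' \<sigma>))) = 0"
    by (rule loop_count_flip_upward_right[OF f perm_diagram_upward[OF permutes_inv[OF \<sigma>]]])
  then show ?thesis using flip_perm_diagram[OF permutes_inv[OF \<sigma>]] permutes_inv_inv[OF \<sigma>] by simp
qed

lemma monomial_brauer_algebra:
  assumes k: "cring k" and \<delta>: "\<delta> \<in> carrier k"
  shows "monomial_algebra k (brauer_algebra k \<delta> r) (brauer_diagrams r r) diagram_comp
    (\<lambda>f g. \<delta> [^]\<^bsub>k\<^esub> loop_count f g) (perm_diagram r id)"
proof -
  interpret cring k by (rule k)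
  show ?thesis
  proof (rule monomial_algebra.intro[OF k], rule monomial_algebra_axioms.intro)
    show "\<delta> [^]\<^bsub>k\<^esub> loop_count x y \<otimes>\<^bsub>k\<^esub> \<delta> [^]\<^bsub>k\<^esub> loop_count (diagram_comp x y) z =
        \<delta> [^]\<^bsub>k\<^esub> loop_count y z \<otimes>\<^bsub>k\<^esub> \<delta> [^]\<^bsub>k\<^esub> loop_count x (diagram_comp y z)"
      if "x \<in> brauer_diagrams r r" "y \<in> brauer_diagrams r r" "z \<in> brauer_diagrams r r" for x y z
      using loop_count_assoc[OF that] \<delta> by (simp add: nat_pow_mult)
  qed (simp_all add: \<delta> diagram_comp_closed diagram_comp_assoc perm_diagram_closed permutes_id
      comp_identity_left comp_identity_right loop_count_perm_left loop_count_perm_right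
      brauer_algebra_def identity_diagram_eq)
qed

lemma monomial_group_algebra:
  assumes k: "cring k"
  shows "monomial_algebra k (group_algebra k (sym_group q)) (carrier (sym_group q)) (\<circ>) (\<lambda>_ _. \<one>\<^bsub>k\<^esub>) id"
proof -
  interpret cring k by (rule k)
  show ?thesis
  proof (rule monomial_algebra.intro[OF k], rule monomial_algebra_axioms.intro)
    show "finite (carrier (sym_group q))" by (simp add: sym_group_def finite_permutations)
    fix a b assume "a \<in> carrier (group_algebra k (sym_group q))" "b \<in> carrier (group_algebra k (sym_group q))"
    then have "a x \<in> carrier k" "b x \<in> carrier k" if "x \<in> carrier (sym_group q)" for x
      using that by (auto simp: group_algebra_def)
    then have "finsum k (\<lambda>(x, y). a x \<otimes>\<^bsub>k\<^esub> b y) {(x, y). (x \<in> carrier (sym_group q) \<and> y \<in> carrier (sym_group q)) \<and> x \<circ> y = h} =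
       finsum k (\<lambda>(x, y). (a x \<otimes>\<^bsub>k\<^esub> b y) \<otimes>\<^bsub>k\<^esub> \<one>\<^bsub>k\<^esub>) {(x, y). (x \<in> carrier (sym_group q) \<and> y \<in> carrier (sym_group q)) \<and> x \<circ> y = h}" for h
      by (intro finsum_cong') auto
    then show "a \<otimes>\<^bsub>group_algebra k (sym_group q)\<^esub> b = (\<lambda>h\<in>carrier (sym_group q). finsum k (\<lambda>(x, y). (a x \<otimes>\<^bsub>k\<^esub> b y) \<otimes>\<^bsub>k\<^esub> \<one>\<^bsub>k\<^esub>)
       {(x, y) \<in> carrier (sym_group q) \<times> carrier (sym_group q). x \<circ> y = h})"
      by (simp add: group_algebra_def sym_group_mult cong: restrict_cong)
  qed (auto simp: sym_group_def permutes_compose permutes_id group_algebra_def comp_assoc)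
qed

lemma assoc_direct_sum_algebra:
  assumes A: "\<And>i. i \<in> I \<Longrightarrow> assoc_algebra k (A i)" and k: "cring k"
  shows "assoc_algebra k (direct_sum_algebra I A)"
proof -
  let ?S = "direct_sum_algebra I A"
  note d = direct_sum_algebra_def
  have a: "module k (A i)" "ring (A i)" "abelian_group (A i)" "Group.monoid (A i)" if "i \<in> I" for i
    using A[OF that] by (auto simp: assoc_algebra_def module_def ring_def)
  have mod: "x \<in> carrier (A i) \<Longrightarrow> c \<in> carrier k \<Longrightarrow> c \<odot>\<^bsub>A i\<^esub> x \<in> carrier (A i)" if "i \<in> I" for i c x
    using module.smult_closed[OF a(1)[OF that]] by blast
  have ag: "abelian_group ?S"
  proof (rule abelian_groupI)
    fix x y z assume xyz: "x \<in> carrier ?S" "y \<in> carrier ?S" "z \<in> carrier ?S"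
    then have c: "x i \<in> carrier (A i)" "y i \<in> carrier (A i)" "z i \<in> carrier (A i)" if "i \<in> I" for i
      using that by (auto simp: d)
    show "x \<oplus>\<^bsub>?S\<^esub> y \<in> carrier ?S" using c a(3) by (auto simp: d abelian_group.axioms abelian_monoid.a_closed)
    show "x \<oplus>\<^bsub>?S\<^esub> y \<oplus>\<^bsub>?S\<^esub> z = x \<oplus>\<^bsub>?S\<^esub> (y \<oplus>\<^bsub>?S\<^esub> z)"
      by (auto simp: d fun_eq_iff restrict_def c abelian_monoid.a_assoc[OF abelian_group.axioms(1)[OF a(3)]])
    show "x \<oplus>\<^bsub>?S\<^esub> y = y \<oplus>\<^bsub>?S\<^esub> x"
      by (auto simp: d fun_eq_iff restrict_def c abelian_monoid.a_comm[OF abelian_group.axioms(1)[OF a(3)]])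
  next
    show "\<zero>\<^bsub>?S\<^esub> \<in> carrier ?S" using a(3) by (auto simp: d abelian_monoid.zero_closed abelian_group.axioms)
  next
    fix x assume x: "x \<in> carrier ?S"
    then have c: "x i \<in> carrier (A i)" if "i \<in> I" for i using that by (auto simp: d)
    show "\<zero>\<^bsub>?S\<^esub> \<oplus>\<^bsub>?S\<^esub> x = x"
      using x by (auto simp: d fun_eq_iff restrict_def PiE_def extensional_def c abelian_monoid.l_zero[OF abelian_group.axioms(1)[OF a(3)]])
    have "(\<lambda>i\<in>I. \<ominus>\<^bsub>A i\<^esub> x i) \<in> carrier ?S" using c a(3) by (auto simp: d abelian_group.a_inv_closed)
    moreover have "(\<lambda>i\<in>I. \<ominus>\<^bsub>A i\<^esub> x i) \<oplus>\<^bsub>?S\<^esub> x = \<zero>\<^bsub>?S\<^esub>"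
      by (auto simp: d fun_eq_iff restrict_def c abelian_group.l_neg[OF a(3)])
    ultimately show "\<exists>y\<in>carrier ?S. y \<oplus>\<^bsub>?S\<^esub> x = \<zero>\<^bsub>?S\<^esub>" by blast
  qed
  have mon: "Group.monoid ?S"
  proof (rule Group.monoidI)
    fix x y z assume xyz: "x \<in> carrier ?S" "y \<in> carrier ?S" "z \<in> carrier ?S"
    then have c: "x i \<in> carrier (A i)" "y i \<in> carrier (A i)" "z i \<in> carrier (A i)" if "i \<in> I" for i
      using that by (auto simp: d)
    show "x \<otimes>\<^bsub>?S\<^esub> y \<in> carrier ?S" using c by (auto simp: d monoid.m_closed[OF a(4)])
    show "x \<otimes>\<^bsub>?S\<^esub> y \<otimes>\<^bsub>?S\<^esub> z = x \<otimes>\<^bsub>?S\<^esub> (y \<otimes>\<^bsub>?S\<^esub> z)"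
      by (auto simp: d fun_eq_iff restrict_def c monoid.m_assoc[OF a(4)])
  next
    show "\<one>\<^bsub>?S\<^esub> \<in> carrier ?S" by (auto simp: d monoid.one_closed[OF a(4)])
  next
    fix x assume x: "x \<in> carrier ?S"
    then have c: "x i \<in> carrier (A i)" if "i \<in> I" for i using that by (auto simp: d)
    show "\<one>\<^bsub>?S\<^esub> \<otimes>\<^bsub>?S\<^esub> x = x"
      using x by (auto simp: d fun_eq_iff restrict_def PiE_def extensional_def c monoid.l_one[OF a(4)])
    show "x \<otimes>\<^bsub>?S\<^esub> \<one>\<^bsub>?S\<^esub> = x"
      using x by (auto simp: d fun_eq_iff restrict_def PiE_def extensional_def c monoid.r_one[OF a(4)])
  qed
  have sr: "semiring (A i)" if "i \<in> I" for i
  proof -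
    interpret ring "A i" by (rule a(2)[OF that])
    show ?thesis by unfold_locales
  qed
  have rS: "ring ?S"
  proof (rule ringI[OF ag mon])
    fix x y z assume xyz: "x \<in> carrier ?S" "y \<in> carrier ?S" "z \<in> carrier ?S"
    then have c: "x i \<in> carrier (A i)" "y i \<in> carrier (A i)" "z i \<in> carrier (A i)" if "i \<in> I" for i
      using that by (auto simp: d)
    show "(x \<oplus>\<^bsub>?S\<^esub> y) \<otimes>\<^bsub>?S\<^esub> z = x \<otimes>\<^bsub>?S\<^esub> z \<oplus>\<^bsub>?S\<^esub> y \<otimes>\<^bsub>?S\<^esub> z"
      by (auto simp: d fun_eq_iff restrict_def c semiring.l_distr[OF sr])
    show "z \<otimes>\<^bsub>?S\<^esub> (x \<oplus>\<^bsub>?S\<^esub> y) = z \<otimes>\<^bsub>?S\<^esub> x \<oplus>\<^bsub>?S\<^esub> z \<otimes>\<^bsub>?S\<^esub> y"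
      by (auto simp: d fun_eq_iff restrict_def c semiring.r_distr[OF sr])
  qed
  have mS: "module k ?S"
  proof (rule module.intro[OF k ag], rule module_axioms.intro)
    fix s t x y assume s: "s \<in> carrier k" and x: "x \<in> carrier ?S"
    then have c: "x i \<in> carrier (A i)" if "i \<in> I" for i using that by (auto simp: d)
    show "s \<odot>\<^bsub>?S\<^esub> x \<in> carrier ?S" using s c mod by (auto simp: d)
    show "(s \<oplus>\<^bsub>k\<^esub> t) \<odot>\<^bsub>?S\<^esub> x = s \<odot>\<^bsub>?S\<^esub> x \<oplus>\<^bsub>?S\<^esub> t \<odot>\<^bsub>?S\<^esub> x" if "t \<in> carrier k"
      by (auto simp: d fun_eq_iff restrict_def c s that module.smult_l_distr[OF a(1)])
    show "(s \<otimes>\<^bsub>k\<^esub> t) \<odot>\<^bsub>?S\<^esub> x = s \<odot>\<^bsub>?S\<^esub> (t \<odot>\<^bsub>?S\<^esub> x)" if "t \<in> carrier k"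
      by (auto simp: d fun_eq_iff restrict_def c s that module.smult_assoc1[OF a(1)])
    assume y: "y \<in> carrier ?S"
    then have c': "y i \<in> carrier (A i)" if "i \<in> I" for i using that by (auto simp: d)
    show "s \<odot>\<^bsub>?S\<^esub> (x \<oplus>\<^bsub>?S\<^esub> y) = s \<odot>\<^bsub>?S\<^esub> x \<oplus>\<^bsub>?S\<^esub> s \<odot>\<^bsub>?S\<^esub> y"
      by (auto simp: d fun_eq_iff restrict_def c c' s module.smult_r_distr[OF a(1)])
  next
    fix x assume x: "x \<in> carrier ?S"
    then have c: "x i \<in> carrier (A i)" if "i \<in> I" for i using that by (auto simp: d)
    show "\<one>\<^bsub>k\<^esub> \<odot>\<^bsub>?S\<^esub> x = x"
      using x by (auto simp: d fun_eq_iff restrict_def PiE_def extensional_def c module.smult_one[OF a(1)])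
  qed
  show ?thesis
  proof (rule assoc_algebra.intro[OF mS rS], rule assoc_algebra_axioms.intro)
    fix s x y assume s: "s \<in> carrier k" and xy: "x \<in> carrier ?S" "y \<in> carrier ?S"
    then have c: "x i \<in> carrier (A i)" "y i \<in> carrier (A i)" if "i \<in> I" for i using that by (auto simp: d)
    show "(s \<odot>\<^bsub>?S\<^esub> x) \<otimes>\<^bsub>?S\<^esub> y = s \<odot>\<^bsub>?S\<^esub> (x \<otimes>\<^bsub>?S\<^esub> y)"
      by (auto simp: d fun_eq_iff restrict_def c s assoc_algebra.smult_mult_left[OF A])
    show "x \<otimes>\<^bsub>?S\<^esub> (s \<odot>\<^bsub>?S\<^esub> y) = s \<odot>\<^bsub>?S\<^esub> (x \<otimes>\<^bsub>?S\<^esub> y)"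
      by (auto simp: d fun_eq_iff restrict_def c s assoc_algebra.smult_mult_right[OF A])
  qed
qed

section \<open>Evaluation of integer polynomials at the parameter\<close>

context cring
begin

context
  fixes \<delta> :: 'a assumes \<delta>: "\<delta> \<in> carrier R"
begin

abbreviation "ev \<equiv> eval_int_poly R \<delta>"

lemma add_pow_int_0: "[(0::int)] \<cdot> x = \<zero>"
  by (simp add: add_pow_def)

lemma ev_term_closed: "[(c::int)] \<cdot> (\<delta> [^] (i::nat)) \<in> carrier R"
  using \<delta> by (simp add: add.int_pow_closed)

text \<open>Terms above the degree vanish. The freedom in the bound gives polynomials of different
  degrees a common range of summation.\<close>

lemma ev_eq_sum:
  assumes "degree P \<le> n"
  shows "ev P = (\<Oplus>i\<in>{..n}. [Polynomial.coeff P i] \<cdot> (\<delta> [^] i))"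
  unfolding eval_int_poly_def
  by (rule add.finprod_mono_neutral_cong_left) (use assms ev_term_closed in \<open>auto simp: coeff_eq_0 not_le add_pow_int_0\<close>)

lemma ev_closed: "ev P \<in> carrier R"
  unfolding eval_int_poly_def using ev_term_closed by (intro finsum_closed) auto

lemma ev_0: "ev 0 = \<zero>"
  using \<delta> by (simp add: eval_int_poly_def add_pow_int_0)

lemma ev_1: "ev 1 = \<one>"
  using \<delta> by (simp add: eval_int_poly_def)

lemma ev_add: "ev (P + Q) = ev P \<oplus> ev Q"
proof -
  let ?n = "max (degree P) (degree Q)"
  have "ev (P + Q) = (\<Oplus>i\<in>{..?n}. [Polynomial.coeff P i] \<cdot> (\<delta> [^] i) \<oplus> [Polynomial.coeff Q i] \<cdot> (\<delta> [^] i))"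
    unfolding ev_eq_sum[OF degree_add_le_max] using \<delta>
    by (intro finsum_cong') (auto simp: add.int_pow_mult add.int_pow_closed)
  also have "\<dots> = ev P \<oplus> ev Q"
    unfolding ev_eq_sum[of P ?n, OF max.cobounded1] ev_eq_sum[of Q ?n, OF max.cobounded2]
    using ev_term_closed by (intro finsum_addf) auto
  finally show ?thesis .
qed

lemma ev_smult: "ev (Polynomial.smult c P) = [c] \<cdot> \<one> \<otimes> ev P"
proof -
  have "ev (Polynomial.smult c P) = (\<Oplus>i\<in>{..degree P}. [c] \<cdot> \<one> \<otimes> ([Polynomial.coeff P i] \<cdot> (\<delta> [^] i)))"
    unfolding ev_eq_sum[OF degree_smult_le]
  proof (rule finsum_cong'[OF refl])
    fix i
    have "[(c * Polynomial.coeff P i)] \<cdot> (\<delta> [^] i) = [c] \<cdot> ([Polynomial.coeff P i] \<cdot> (\<delta> [^] i))"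
      using \<delta> add.int_pow_pow[of "\<delta> [^] i"] by (simp add: mult.commute)
    also have "\<dots> = [c] \<cdot> (\<one> \<otimes> ([Polynomial.coeff P i] \<cdot> (\<delta> [^] i)))" using ev_term_closed by simp
    also have "\<dots> = [c] \<cdot> \<one> \<otimes> ([Polynomial.coeff P i] \<cdot> (\<delta> [^] i))"
      using ev_term_closed by (intro add_pow_ldistr_int[symmetric]) auto
    finally show "[Polynomial.coeff (Polynomial.smult c P) i] \<cdot> (\<delta> [^] i) = [c] \<cdot> \<one> \<otimes> ([Polynomial.coeff P i] \<cdot> (\<delta> [^] i))" by simp
  qed (use ev_term_closed in \<open>auto simp: add.int_pow_closed\<close>)
  also have "\<dots> = [c] \<cdot> \<one> \<otimes> ev P"
    unfolding eval_int_poly_def using ev_term_closed by (intro finsum_rdistr[symmetric]) (auto simp: add.int_pow_closed)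
  finally show ?thesis .
qed

lemma ev_shift: "ev (pCons 0 P) = \<delta> \<otimes> ev P"
proof -
  have "ev (pCons 0 P) = (\<Oplus>i\<in>{..Suc (degree P)}. [Polynomial.coeff (pCons 0 P) i] \<cdot> (\<delta> [^] i))"
    by (rule ev_eq_sum) (rule degree_pCons_le)
  also have "\<dots> = (\<Oplus>i\<in>{..degree P}. [Polynomial.coeff (pCons 0 P) (Suc i)] \<cdot> (\<delta> [^] (Suc i))) \<oplus> [Polynomial.coeff (pCons 0 P) 0] \<cdot> (\<delta> [^] (0::nat))"
    by (rule finsum_Suc2) (use ev_term_closed in auto)
  also have "\<dots> = (\<Oplus>i\<in>{..degree P}. \<delta> \<otimes> ([Polynomial.coeff P i] \<cdot> (\<delta> [^] i)))"
    using \<delta> ev_term_closed by (simp add: add_pow_rdistr_int m_comm add.int_pow_closed add_pow_int_0)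
  also have "\<dots> = \<delta> \<otimes> ev P"
    unfolding eval_int_poly_def using ev_term_closed \<delta> by (intro finsum_rdistr[symmetric]) auto
  finally show ?thesis .
qed

lemma ev_const: "ev [:c:] = [c] \<cdot> \<one>"
  by (simp add: eval_int_poly_def \<delta> add.int_pow_closed)

lemma ev_mult: "ev (P * Q) = ev P \<otimes> ev Q"
proof (induction P)
  case 0
  show ?case using ev_closed by (simp add: ev_0)
next
  case (pCons c P)
  have c1: "[c] \<cdot> \<one> \<in> carrier R" by (simp add: add.int_pow_closed)
  have "pCons c P = [:c:] + pCons 0 P" by simp
  then have P: "ev (pCons c P) = [c] \<cdot> \<one> \<oplus> \<delta> \<otimes> ev P" using ev_add[of "[:c:]" "pCons 0 P"] by (simp add: ev_const ev_shift)
  have "ev (pCons c P * Q) = [c] \<cdot> \<one> \<otimes> ev Q \<oplus> \<delta> \<otimes> (ev P \<otimes> ev Q)"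
    by (simp add: ev_add ev_smult ev_shift pCons)
  also have "\<dots> = ev (pCons c P) \<otimes> ev Q"
    unfolding P using c1 \<delta> ev_closed by (simp add: l_distr m_assoc)
  finally show ?case .
qed

lemma ev_X_power: "ev ([:0, 1:] ^ n) = \<delta> [^] n"
proof (induction n)
  case (Suc n)
  have "ev [:0, 1:] = \<delta>" using ev_shift[of 1] ev_1 \<delta> by (simp add: one_pCons)
  then have "ev ([:0, 1:] ^ Suc n) = \<delta> \<otimes> \<delta> [^] n" unfolding power_Suc ev_mult Suc.IH by simp
  then show ?case using \<delta> by (simp add: m_comm)
qed (simp add: ev_1)

lemma ev_sum: "finite I \<Longrightarrow> ev (\<Sum>i\<in>I. f i) = (\<Oplus>i\<in>I. ev (f i))"
proof (induction I rule: finite_induct)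
  case (insert i I)
  then show ?case using ev_closed by (simp add: ev_add)
qed (simp add: ev_0)

end

end

section \<open>Gram matrices\<close>

context cring
begin

lemma dot_commute:
  assumes "\<And>x. x \<in> X \<Longrightarrow> a x \<in> carrier R" "\<And>x. x \<in> X \<Longrightarrow> F x \<in> carrier R"
  shows "dot X a F = dot X F a"
  unfolding dot_def by (intro finsum_cong') (use assms in \<open>auto simp: m_comm\<close>)

lemma dot_assoc:
  assumes X: "finite X" and Y: "finite Y" and a: "\<And>x. x \<in> X \<Longrightarrow> a x \<in> carrier R"
    and K: "\<And>x y. x \<in> X \<Longrightarrow> y \<in> Y \<Longrightarrow> K x y \<in> carrier R" and b: "\<And>y. y \<in> Y \<Longrightarrow> b y \<in> carrier R"
  shows "dot X a (\<lambda>x. dot Y (K x) b) = dot Y (\<lambda>y. dot X a (\<lambda>x. K x y)) b"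
proof -
  have "dot X a (\<lambda>x. dot Y (K x) b) = dot X a (\<lambda>x. dot Y b (K x))"
    by (intro dot_cong_right dot_commute dot_closed) (use assms in auto)
  also have "\<dots> = dot Y b (\<lambda>y. dot X a (\<lambda>x. K x y))"
    by (rule dot_swap[OF X Y]) (use assms in auto)
  also have "\<dots> = dot Y (\<lambda>y. dot X a (\<lambda>x. K x y)) b"
    by (intro dot_commute dot_closed) (use assms in auto)
  finally show ?thesis .
qed

text \<open>Both one-sided identities are kept: \<open>G\<close> times \<open>D\<close> cancels the
  Gram matrix in \<open>rep_eq_zero\<close>, and \<open>D\<close> times \<open>G\<close> in
  \<open>rep_surj_stratum\<close>.\<close>

definition inverse_matrices :: "'x set \<Rightarrow> ('x \<Rightarrow> 'x \<Rightarrow> 'a) \<Rightarrow> ('x \<Rightarrow> 'x \<Rightarrow> 'a) \<Rightarrow> bool" where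
  "inverse_matrices U G D \<longleftrightarrow> (\<forall>v\<in>U. \<forall>u\<in>U. G v u \<in> carrier R \<and> D v u \<in> carrier R \<and>
     dot U (G v) (\<lambda>w. D w u) = (if v = u then \<one> else \<zero>) \<and>
     dot U (D v) (\<lambda>w. G w u) = (if v = u then \<one> else \<zero>))"

text \<open>Transporting \<open>D\<close> along \<open>\<pi>\<close> gives another right inverse of
  \<open>G\<close>, because \<open>G\<close> is invariant, and a right inverse of an invertible
  matrix is unique. In this way the inverse of a scalar Gram matrix is again a matrix over the group
  ring.\<close>

lemma inverse_matrices_equivariant:
  assumes U: "finite U" and inv: "inverse_matrices U G D" and \<pi>: "bij_betw \<pi> U U"
    and G: "\<And>v u. v \<in> U \<Longrightarrow> u \<in> U \<Longrightarrow> G (\<pi> v) (\<pi> u) = G v u" and v: "v \<in> U" and u: "u \<in> U"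
  shows "D (\<pi> v) (\<pi> u) = D v u"
proof -
  have c: "G v u \<in> carrier R" "D v u \<in> carrier R" if "v \<in> U" "u \<in> U" for v u
    using inv that by (auto simp: inverse_matrices_def)
  have \<pi>U: "\<pi> x \<in> U" if "x \<in> U" for x using bij_betwE[OF \<pi>] that by blast
  have 1: "dot U (G w) (\<lambda>z. D (\<pi> z) (\<pi> u)) = (if w = u then \<one> else \<zero>)" if w: "w \<in> U" for w
  proof -
    have "dot U (G w) (\<lambda>z. D (\<pi> z) (\<pi> u)) = dot U (\<lambda>z. G (\<pi> w) (\<pi> z)) (\<lambda>z. D (\<pi> z) (\<pi> u))"
      by (rule dot_cong) (use w u G c \<pi>U in auto)
    also have "\<dots> = dot U (G (\<pi> w)) (\<lambda>z. D z (\<pi> u))"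
      by (rule dot_reindex[OF \<pi>, symmetric]) (use w u c \<pi>U in auto)
    also have "\<dots> = (if \<pi> w = \<pi> u then \<one> else \<zero>)" using inv \<pi>U w u by (simp add: inverse_matrices_def)
    finally show ?thesis using inj_on_eq_iff[OF bij_betw_imp_inj_on[OF \<pi>] w u] by simp
  qed
  have "D v u = D v u \<otimes> \<one>" using c v u by simp
  also have "\<dots> = dot U (D v) (\<lambda>w. if w = u then \<one> else \<zero>)"
    by (rule dot_delta[OF U u, symmetric]) (use c v in auto)
  also have "\<dots> = dot U (D v) (\<lambda>w. dot U (G w) (\<lambda>z. D (\<pi> z) (\<pi> u)))"
    by (rule dot_cong_right) (use 1 c v u \<pi>U in \<open>auto intro!: dot_closed\<close>)
  also have "\<dots> = dot U (\<lambda>z. dot U (D v) (\<lambda>w. G w z)) (\<lambda>z. D (\<pi> z) (\<pi> u))"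
    by (rule dot_assoc[OF U U]) (use c v u \<pi>U in auto)
  also have "\<dots> = dot U (\<lambda>z. D (\<pi> z) (\<pi> u)) (\<lambda>z. if z = v then \<one> else \<zero>)"
    by (subst dot_commute; (rule dot_cong_right)?) (use inv c v u \<pi>U in \<open>auto simp: inverse_matrices_def intro!: dot_closed\<close>)
  also have "\<dots> = D (\<pi> v) (\<pi> u) \<otimes> \<one>"
    by (rule dot_delta[OF U v]) (use c u \<pi>U in auto)
  finally show ?thesis using c v u \<pi>U by simp
qed

text \<open>The coefficient at the identity of the flip of \<open>w\<close> composed with
  \<open>u\<close>. If \<open>w\<close> is \<open>f\<close> times \<open>\<sigma>\<close> and
  \<open>u\<close> is \<open>g\<close> times \<open>\<tau>\<close> with \<open>f\<close> and
  \<open>g\<close> monotone, it is the value at \<open>\<delta>\<close> of the coefficient of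
  \<open>gram_entry q f g\<close> at \<open>\<sigma>\<close> times the inverse of
  \<open>\<tau>\<close>, that is, the entry of the Gram matrix at these two indices.\<close>

definition gram :: "'a \<Rightarrow> nat \<Rightarrow> point set set \<Rightarrow> point set set \<Rightarrow> 'a" where
  "gram \<delta> q w u = (if diagram_comp (flip_diagram w) u = perm_diagram q id
     then \<delta> [^] loop_count (flip_diagram w) u else \<zero>)"

end

text \<open>The right action of the symmetric group, which commutes with composition by diagrams
  placed below.\<close>

definition permute_top :: "nat \<Rightarrow> point set set \<Rightarrow> (nat \<Rightarrow> nat) \<Rightarrow> point set set" where
  "permute_top q u \<sigma> = diagram_comp u (perm_diagram q \<sigma>)"

lemma permute_top_closed: "u \<in> brauer_diagrams q r \<Longrightarrow> \<sigma> permutes {1..q} \<Longrightarrow> permute_top q u \<sigma> \<in> brauer_diagrams q r"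
  unfolding permute_top_def by (rule diagram_comp_closed[OF _ perm_diagram_closed])

lemma permute_top_upward: "u \<in> upward_diagrams q r \<Longrightarrow> \<sigma> permutes {1..q} \<Longrightarrow> permute_top q u \<sigma> \<in> upward_diagrams q r"
  unfolding permute_top_def by (rule upward_comp[OF _ perm_diagram_upward])

lemma permute_top_comp:
  assumes "u \<in> brauer_diagrams q r" and "\<sigma> permutes {1..q}" and "\<tau> permutes {1..q}"
  shows "permute_top q (permute_top q u \<sigma>) \<tau> = permute_top q u (\<sigma> \<circ> \<tau>)"
  unfolding permute_top_def using assms
  by (simp add: diagram_comp_assoc[OF _ perm_diagram_closed perm_diagram_closed] perm_diagram_comp)

lemma permute_top_id: "u \<in> brauer_diagrams q r \<Longrightarrow> permute_top q u id = u"
  unfolding permute_top_def by (rule comp_identity_right)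

lemma permute_top_inv:
  assumes "u \<in> brauer_diagrams q r" and "\<sigma> permutes {1..q}"
  shows "permute_top q (permute_top q u \<sigma>) (inv' \<sigma>) = u" and "permute_top q (permute_top q u (inv' \<sigma>)) \<sigma> = u"
  using assms by (simp_all add: permute_top_comp permutes_inv permutes_inv_o permute_top_id)

lemma permute_top_left:
  assumes "h \<in> brauer_diagrams r s" and "u \<in> brauer_diagrams q r" and "\<sigma> permutes {1..q}"
  shows "diagram_comp h (permute_top q u \<sigma>) = permute_top q (diagram_comp h u) \<sigma>"
    and "loop_count h (permute_top q u \<sigma>) = loop_count h u"
proof -
  note pc = perm_diagram_closed[OF assms(3)]
  show "diagram_comp h (permute_top q u \<sigma>) = permute_top q (diagram_comp h u) \<sigma>"
    unfolding permute_top_def by (rule diagram_comp_assoc[OF assms(1,2) pc, symmetric])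
  show "loop_count h (permute_top q u \<sigma>) = loop_count h u"
    using loop_count_assoc[OF assms(1,2) pc] loop_count_perm_right[OF assms(3)] assms(2)
      diagram_comp_closed[OF assms(1,2)] by (simp add: permute_top_def)
qed

lemma permute_top_eq_iff:
  assumes "u \<in> brauer_diagrams q r" "v \<in> brauer_diagrams q r" and "\<sigma> permutes {1..q}"
  shows "permute_top q u \<sigma> = permute_top q v \<sigma> \<longleftrightarrow> u = v"
  using permute_top_inv(1)[OF assms(1,3)] permute_top_inv(1)[OF assms(2,3)] by metis

lemma permute_top_bij:
  assumes "\<sigma> permutes {1..q}"
  shows "bij_betw (\<lambda>u. permute_top q u \<sigma>) (upward_diagrams q r) (upward_diagrams q r)"
proof (rule bij_betw_byWitness[where f' = "\<lambda>u. permute_top q u (inv' \<sigma>)"])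
  show "\<forall>u\<in>upward_diagrams q r. permute_top q (permute_top q u \<sigma>) (inv' \<sigma>) = u"
    using permute_top_inv(1)[OF upward_diagramsD assms] by blast
  show "\<forall>u\<in>upward_diagrams q r. permute_top q (permute_top q u (inv' \<sigma>)) \<sigma> = u"
    using permute_top_inv(2)[OF upward_diagramsD assms] by blast
qed (use permute_top_upward assms permutes_inv[OF assms] in blast)+

text \<open>Reflection turns the permutation into its inverse on the other side, and in the second
  part the two cancel. Hence \<open>u\<close> composed with the flip of \<open>w\<close> depends
  only on the pair up to a common permutation.\<close>

lemma flip_permute_top:
  assumes w: "w \<in> brauer_diagrams q r" and u: "u \<in> brauer_diagrams q s" and \<sigma>: "\<sigma> permutes {1..q}"
  shows "flip_diagram (permute_top q w \<sigma>) = diagram_comp (perm_diagram q (inv' \<sigma>)) (flip_diagram w)"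
    and "diagram_comp (permute_top q u \<sigma>) (flip_diagram (permute_top q w \<sigma>)) = diagram_comp u (flip_diagram w)"
proof -
  note pc = perm_diagram_closed[OF \<sigma>] perm_diagram_closed[OF permutes_inv[OF \<sigma>]]
  show 1: "flip_diagram (permute_top q w \<sigma>) = diagram_comp (perm_diagram q (inv' \<sigma>)) (flip_diagram w)"
    unfolding permute_top_def by (simp add: flip_diagram_comp[OF w pc(1)] flip_perm_diagram[OF \<sigma>])
  note fw = flip_diagram_closed[OF w]
  have "diagram_comp (permute_top q u \<sigma>) (flip_diagram (permute_top q w \<sigma>)) =
      diagram_comp (diagram_comp (permute_top q u \<sigma>) (perm_diagram q (inv' \<sigma>))) (flip_diagram w)"
    unfolding 1 by (rule diagram_comp_assoc[OF permute_top_closed[OF u \<sigma>] pc(2) fw, symmetric])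
  also have "diagram_comp (permute_top q u \<sigma>) (perm_diagram q (inv' \<sigma>)) = u"
    using permute_top_inv(1)[OF u \<sigma>] by (simp add: permute_top_def)
  finally show "diagram_comp (permute_top q u \<sigma>) (flip_diagram (permute_top q w \<sigma>)) = diagram_comp u (flip_diagram w)" .
qed

lemma perm_diagram_conj_iff:
  assumes d: "d \<in> brauer_diagrams q q" and \<sigma>: "\<sigma> permutes {1..q}" and \<tau>: "\<tau> permutes {1..q}"
  shows "diagram_comp (perm_diagram q (inv' \<sigma>)) (diagram_comp d (perm_diagram q \<tau>)) = perm_diagram q id
    \<longleftrightarrow> d = perm_diagram q (\<sigma> \<circ> inv' \<tau>)"
proof
  note p = perm_diagram_closed
  note i = permutes_inv
  let ?m = "diagram_comp" and ?p = "perm_diagram q"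
  have dt: "?m d (?p \<tau>) \<in> brauer_diagrams q q" by (rule diagram_comp_closed[OF d p[OF \<tau>]])
  assume "?m (?p (inv' \<sigma>)) (?m d (?p \<tau>)) = ?p id"
  then have "?m (?p \<sigma>) (?m (?p (inv' \<sigma>)) (?m d (?p \<tau>))) = ?m (?p \<sigma>) (?p id)" by simp
  then have "?m d (?p \<tau>) = ?p \<sigma>"
    unfolding diagram_comp_assoc[OF p[OF \<sigma>] p[OF i[OF \<sigma>]] dt, symmetric] perm_diagram_comp[OF \<sigma> i[OF \<sigma>]]
      permutes_inv_o(1)[OF \<sigma>] comp_identity_left[OF dt] comp_identity_right[OF p[OF \<sigma>]] .
  then have "?m (?m d (?p \<tau>)) (?p (inv' \<tau>)) = ?m (?p \<sigma>) (?p (inv' \<tau>))" by simp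
  then show "d = ?p (\<sigma> \<circ> inv' \<tau>)"
    unfolding diagram_comp_assoc[OF d p[OF \<tau>] p[OF i[OF \<tau>]]] perm_diagram_comp[OF \<tau> i[OF \<tau>]]
      permutes_inv_o(1)[OF \<tau>] comp_identity_right[OF d] perm_diagram_comp[OF \<sigma> i[OF \<tau>]] .
next
  assume d: "d = perm_diagram q (\<sigma> \<circ> inv' \<tau>)"
  have 1: "\<sigma> \<circ> inv' \<tau> \<circ> \<tau> = \<sigma>" using permutes_inv_o(2)[OF \<tau>] by (simp add: comp_assoc)
  show "diagram_comp (perm_diagram q (inv' \<sigma>)) (diagram_comp d (perm_diagram q \<tau>)) = perm_diagram q id"
    unfolding d perm_diagram_comp[OF permutes_compose[OF permutes_inv[OF \<tau>] \<sigma>] \<tau>] 1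
      perm_diagram_comp[OF permutes_inv[OF \<sigma>] \<sigma>] permutes_inv_o(2)[OF \<sigma>] ..
qed

text \<open>The permutations move to the two outer sides, where they neither create nor destroy
  loops. The combination \<open>\<sigma> \<circ> inv' \<tau>\<close> is the argument that appears in
  \<open>left_regular\<close>, which identifies \<open>gram\<close> with the evaluated entries of
  \<open>gram_matrix\<close>.\<close>

lemma flip_permute_top_pairing:
  assumes f: "f \<in> brauer_diagrams q r" and g: "g \<in> brauer_diagrams q r"
    and \<sigma>: "\<sigma> permutes {1..q}" and \<tau>: "\<tau> permutes {1..q}"
  shows "diagram_comp (flip_diagram (permute_top q f \<sigma>)) (permute_top q g \<tau>) = perm_diagram q id \<longleftrightarrow>
      diagram_comp (flip_diagram f) g = perm_diagram q (\<sigma> \<circ> inv' \<tau>)"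
    and "loop_count (flip_diagram (permute_top q f \<sigma>)) (permute_top q g \<tau>) = loop_count (flip_diagram f) g"
proof -
  note pc = perm_diagram_closed[OF permutes_inv[OF \<sigma>]] and ff = flip_diagram_closed[OF f]
  note gt = permute_top_closed[OF g \<tau>]
  note F = flip_permute_top(1)[OF f g \<sigma>]
  have "diagram_comp (flip_diagram (permute_top q f \<sigma>)) (permute_top q g \<tau>) =
      diagram_comp (perm_diagram q (inv' \<sigma>)) (diagram_comp (diagram_comp (flip_diagram f) g) (perm_diagram q \<tau>))"
    unfolding F diagram_comp_assoc[OF pc ff gt] permute_top_left(1)[OF ff g \<tau>] by (simp add: permute_top_def)
  then show "diagram_comp (flip_diagram (permute_top q f \<sigma>)) (permute_top q g \<tau>) = perm_diagram q id \<longleftrightarrow>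
      diagram_comp (flip_diagram f) g = perm_diagram q (\<sigma> \<circ> inv' \<tau>)"
    using perm_diagram_conj_iff[OF diagram_comp_closed[OF ff g] \<sigma> \<tau>] by simp
  have "loop_count (perm_diagram q (inv' \<sigma>)) (flip_diagram f) + loop_count (flip_diagram (permute_top q f \<sigma>)) (permute_top q g \<tau>) =
      loop_count (flip_diagram f) (permute_top q g \<tau>) + loop_count (perm_diagram q (inv' \<sigma>)) (diagram_comp (flip_diagram f) (permute_top q g \<tau>))"
    unfolding F by (rule loop_count_assoc[OF pc ff gt])
  then show "loop_count (flip_diagram (permute_top q f \<sigma>)) (permute_top q g \<tau>) = loop_count (flip_diagram f) g"
    using loop_count_perm_left[OF permutes_inv[OF \<sigma>] ff] loop_count_perm_left[OF permutes_inv[OF \<sigma>] diagram_comp_closed[OF ff gt]]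
      permute_top_left(2)[OF ff g \<tau>] by simp
qed

lemma level_perm_diagram: "level (perm_diagram p \<sigma>)"
  unfolding level_def perm_diagram_def by blast

context cring
begin

lemma gram_closed: "\<delta> \<in> carrier R \<Longrightarrow> gram \<delta> q w u \<in> carrier R"
  by (simp add: gram_def)

lemma gram_equivariant:
  assumes "w \<in> brauer_diagrams q r" "u \<in> brauer_diagrams q r" and "\<sigma> permutes {1..q}"
  shows "gram \<delta> q (permute_top q w \<sigma>) (permute_top q u \<sigma>) = gram \<delta> q w u"
  unfolding gram_def flip_permute_top_pairing[OF assms(1,2,3,3)] permutes_inv_o(1)[OF assms(3)] ..

lemma eval_left_regular:
  assumes \<delta>: "\<delta> \<in> carrier R" and "f \<in> brauer_diagrams q r" "g \<in> brauer_diagrams q r"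
    and "\<sigma> permutes {1..q}" "\<tau> permutes {1..q}"
  shows "eval_int_poly R \<delta> (left_regular (gram_entry q f g) \<sigma> \<tau>) = gram \<delta> q (permute_top q f \<sigma>) (permute_top q g \<tau>)"
  unfolding left_regular_def gram_entry_def Let_def gram_def flip_permute_top_pairing[OF assms(2-5)]
  by (simp add: ev_X_power[OF \<delta>] ev_0[OF \<delta>] level_perm_diagram)

text \<open>Cramer's rule: the adjugate identity over integer polynomials is evaluated entry by
  entry at \<open>\<delta>\<close> and divided by the evaluated determinant, which is a unit. No
  determinant over \<open>R\<close> itself occurs.\<close>

lemma ex_gram_inverse:
  assumes \<delta>: "\<delta> \<in> carrier R" and det: "eval_int_poly R \<delta> (gram_det q r) \<in> Units R"
  shows "\<exists>D. inverse_matrices (upward_diagrams q r) (gram \<delta> q) D"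
proof -
  let ?U = "upward_diagrams q r" and ?W = "upward_monotone_diagrams q r" and ?S = "carrier (sym_group q)"
  let ?ev = "eval_int_poly R \<delta>"
  define es where "es = gram_indices q r"
  define n where "n = length es"
  define M where "M = gram_matrix q r"
  have "finite (?W \<times> ?S)"
    using bij_betw_finite[OF bij_betw_upward_monotone[of q r]] by simp
  then have "\<exists>es. distinct es \<and> set es = ?W \<times> ?S" using finite_distinct_list by blast
  then have es: "distinct es" "set es = ?W \<times> ?S"
    unfolding es_def gram_indices_def by (rule someI2_ex; simp)+
  \<comment> \<open>A row of \<open>gram_matrix\<close> belongs to a monotone diagram and a
    permutation, hence to one upward diagram. Passing through this bijection makes the order chosen
    in \<open>gram_indices\<close> immaterial.\<close>
  define idx where "idx i = (case es ! i of (f, \<sigma>) \<Rightarrow> permute_top q f \<sigma>)" for i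
  have "bij_betw (\<lambda>i. es ! i) {..<n} (?W \<times> ?S)"
    using bij_betw_nth[OF es(1)] es(2) by (simp add: n_def)
  from bij_betw_trans[OF this bij_betw_upward_monotone]
  have idx: "bij_betw idx {..<n} ?U"
    by (rule bij_betw_cong[THEN iffD1, rotated]) (simp add: idx_def permute_top_def case_prod_beta)
  have idxU: "idx i \<in> ?U" if "i < n" for i using bij_betwE[OF idx] that by blast
  have M: "M \<in> carrier_mat n n" by (simp add: M_def gram_matrix_def Let_def n_def es_def)
  have evM: "?ev (M $$ (i, j)) = gram \<delta> q (idx i) (idx j)" if ij: "i < n" "j < n" for i j
  proof -
    obtain f \<sigma> g \<tau> where fg: "es ! i = (f, \<sigma>)" "es ! j = (g, \<tau>)" by (cases "es ! i"; cases "es ! j") auto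
    have "(f, \<sigma>) \<in> set es" "(g, \<tau>) \<in> set es" using fg ij n_def nth_mem by metis+
    then have "f \<in> brauer_diagrams q r" "g \<in> brauer_diagrams q r" "\<sigma> permutes {1..q}" "\<tau> permutes {1..q}"
      unfolding es(2) by (auto simp: upward_monotone_diagrams_def sym_group_carrier)
    then show ?thesis using eval_left_regular[OF \<delta>] ij fg
      by (simp add: M_def gram_matrix_def Let_def n_def es_def idx_def)
  qed
  obtain c where c: "c \<in> carrier R" "c \<otimes> ?ev (det M) = \<one>"
    using det unfolding gram_det_def M_def Units_def by auto
  note evc = ev_closed[OF \<delta>]
  have ev_mat: "?ev ((A * B) $$ (i, j)) = dot {..<n} (\<lambda>l. ?ev (A $$ (i, l))) (\<lambda>l. ?ev (B $$ (l, j)))"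
    if "A \<in> carrier_mat n n" "B \<in> carrier_mat n n" "i < n" "j < n" for A B i j
  proof -
    have "(A * B) $$ (i, j) = (\<Sum>l\<in>{..<n}. A $$ (i, l) * B $$ (l, j))"
      using that by (auto simp: scalar_prod_def atLeast0LessThan intro!: sum.cong)
    then show ?thesis unfolding dot_def using evc
      by (simp add: ev_sum[OF \<delta>] ev_mult[OF \<delta>])
  qed
  have adj: "adj_mat M \<in> carrier_mat n n" "M * adj_mat M = det M \<cdot>\<^sub>m 1\<^sub>m n" "adj_mat M * M = det M \<cdot>\<^sub>m 1\<^sub>m n"
    using adj_mat[OF M] by auto
  have ev_one: "?ev ((det M \<cdot>\<^sub>m 1\<^sub>m n) $$ (i, j)) = (if i = j then ?ev (det M) else \<zero>)" if "i < n" "j < n" for i j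
    using that by (simp add: ev_0[OF \<delta>])
  define ix where "ix = inv_into {..<n} idx"
  have ix: "ix u < n" "idx (ix u) = u" if "u \<in> ?U" for u
    using that bij_betw_imp_surj_on[OF idx] inv_into_into[of u idx "{..<n}"] f_inv_into_f[of u idx "{..<n}"]
    by (auto simp: ix_def)
  have ix_idx: "ix (idx i) = i" if "i < n" for i
    unfolding ix_def using bij_betw_imp_inj_on[OF idx] that by (simp add: inv_into_f_f)
  define D where "D v u = c \<otimes> ?ev (adj_mat M $$ (ix v, ix u))" for v u
  have Dc: "D v u \<in> carrier R" for v u using c evc by (simp add: D_def)
  have gc: "gram \<delta> q v u \<in> carrier R" for v u by (rule gram_closed[OF \<delta>])
  have "inverse_matrices ?U (gram \<delta> q) D"
    unfolding inverse_matrices_def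
  proof (intro ballI conjI Dc gc)
    fix v u assume v: "v \<in> ?U" and u: "u \<in> ?U"
    have eq: "v = u \<longleftrightarrow> ix v = ix u" using ix(2)[OF u] ix(2)[OF v] by metis
    have "dot ?U (gram \<delta> q v) (\<lambda>w. D w u) = dot {..<n} (\<lambda>l. gram \<delta> q v (idx l)) (\<lambda>l. D (idx l) u)"
      by (rule dot_reindex[OF idx]) (use Dc gc in auto)
    also have "\<dots> = dot {..<n} (\<lambda>l. ?ev (M $$ (ix v, l))) (\<lambda>l. c \<otimes> ?ev (adj_mat M $$ (l, ix u)))"
    proof (rule dot_cong)
      fix l assume l: "l \<in> {..<n}"
      have "gram \<delta> q v (idx l) = ?ev (M $$ (ix v, l))" using evM[of "ix v" l] l ix[OF v] by simp
      then show "gram \<delta> q v (idx l) \<otimes> D (idx l) u = ?ev (M $$ (ix v, l)) \<otimes> (c \<otimes> ?ev (adj_mat M $$ (l, ix u)))"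
        using l ix_idx[of l] by (simp add: D_def)
    qed (use evc c in auto)
    also have "\<dots> = c \<otimes> dot {..<n} (\<lambda>l. ?ev (M $$ (ix v, l))) (\<lambda>l. ?ev (adj_mat M $$ (l, ix u)))"
      by (rule dot_smult_right) (use evc c in auto)
    also have "\<dots> = c \<otimes> (if ix v = ix u then ?ev (det M) else \<zero>)"
      using ev_mat[OF M adj(1) ix(1)[OF v] ix(1)[OF u]] ev_one[OF ix(1)[OF v] ix(1)[OF u]] by (simp add: adj(2))
    also have "\<dots> = (if v = u then \<one> else \<zero>)" using c eq by simp
    finally show "dot ?U (gram \<delta> q v) (\<lambda>w. D w u) = (if v = u then \<one> else \<zero>)" .
    have "dot ?U (D v) (\<lambda>w. gram \<delta> q w u) = dot {..<n} (\<lambda>l. D v (idx l)) (\<lambda>l. gram \<delta> q (idx l) u)"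
      by (rule dot_reindex[OF idx]) (use Dc gc in auto)
    also have "\<dots> = dot {..<n} (\<lambda>l. c \<otimes> ?ev (adj_mat M $$ (ix v, l))) (\<lambda>l. ?ev (M $$ (l, ix u)))"
    proof (rule dot_cong)
      fix l assume l: "l \<in> {..<n}"
      have "gram \<delta> q (idx l) u = ?ev (M $$ (l, ix u))" using evM[of l "ix u"] l ix[OF u] by simp
      then show "D v (idx l) \<otimes> gram \<delta> q (idx l) u = (c \<otimes> ?ev (adj_mat M $$ (ix v, l))) \<otimes> ?ev (M $$ (l, ix u))"
        using l ix_idx[of l] by (simp add: D_def)
    qed (use evc c in auto)
    also have "\<dots> = c \<otimes> dot {..<n} (\<lambda>l. ?ev (adj_mat M $$ (ix v, l))) (\<lambda>l. ?ev (M $$ (l, ix u)))"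
      by (rule dot_smult_left) (use evc c in auto)
    also have "\<dots> = c \<otimes> (if ix v = ix u then ?ev (det M) else \<zero>)"
      using ev_mat[OF adj(1) M ix(1)[OF v] ix(1)[OF u]] ev_one[OF ix(1)[OF v] ix(1)[OF u]] by (simp add: adj(3))
    also have "\<dots> = (if v = u then \<one> else \<zero>)" using c eq by simp
    finally show "dot ?U (D v) (\<lambda>w. gram \<delta> q w u) = (if v = u then \<one> else \<zero>)" .
  qed
  then show ?thesis by blast
qed

end

section \<open>Cell representations\<close>

locale nonsingular_brauer = cring R for R (structure) +
  fixes \<delta> :: 'a and r :: nat
  assumes \<delta>: "\<delta> \<in> carrier R" and nonsingular: "nonsingular_upto R \<delta> r"
begin

sublocale M: monomial_algebra R "brauer_algebra R \<delta> r" "brauer_diagrams r r" diagram_comp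
    "\<lambda>f g. \<delta> [^] loop_count f g" "perm_diagram r id"
  by (rule monomial_brauer_algebra[OF cring_axioms \<delta>])

abbreviation "B \<equiv> brauer_algebra R \<delta> r"
abbreviation "X \<equiv> brauer_diagrams r r"
abbreviation "U q \<equiv> upward_diagrams q r"

definition diagram_act :: "point set set \<Rightarrow> point set set \<Rightarrow> point set set \<Rightarrow> 'a" where
  "diagram_act h u v = (if diagram_comp h u = v then \<delta> [^] loop_count h u else \<zero>)"

text \<open>The matrix of \<open>a\<close> acting by left multiplication on the cell module with basis \<open>U q\<close>, the
  quotient of the span of all diagrams with \<open>q\<close> top points by the diagrams that are not upward.\<close>

definition rep :: "(point set set \<Rightarrow> 'a) \<Rightarrow> point set set \<Rightarrow> point set set \<Rightarrow> 'a" where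
  "rep a v u = dot X a (\<lambda>h. diagram_act h u v)"

lemma diagram_act_closed: "diagram_act h u v \<in> carrier R"
  using \<delta> by (simp add: diagram_act_def)

lemma rep_closed: "a \<in> carrier B \<Longrightarrow> rep a v u \<in> carrier R"
  unfolding rep_def by (rule M.dot_closed_A[OF _ diagram_act_closed])

lemma rep_add: "a \<in> carrier B \<Longrightarrow> b \<in> carrier B \<Longrightarrow> rep (a \<oplus>\<^bsub>B\<^esub> b) v u = rep a v u \<oplus> rep b v u"
  unfolding rep_def by (rule M.dot_add[OF _ _ diagram_act_closed])

lemma rep_smult: "c \<in> carrier R \<Longrightarrow> a \<in> carrier B \<Longrightarrow> rep (c \<odot>\<^bsub>B\<^esub> a) v u = c \<otimes> rep a v u"
  unfolding rep_def by (rule M.dot_smult[OF _ _ diagram_act_closed])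

lemma rep_one:
  assumes u: "u \<in> U q"
  shows "rep \<one>\<^bsub>B\<^esub> v u = (if v = u then \<one> else \<zero>)"
proof -
  have "rep \<one>\<^bsub>B\<^esub> v u = diagram_act (perm_diagram r id) u v"
    unfolding rep_def by (rule M.dot_one[OF diagram_act_closed])
  then show ?thesis
    using comp_identity_left[OF upward_diagramsD[OF u]] loop_count_perm_left[OF permutes_id upward_diagramsD[OF u]]
    by (auto simp: diagram_act_def)
qed

text \<open>If \<open>y\<close> takes \<open>u\<close> to a diagram that is not upward, composing
  with \<open>x\<close> cannot make it upward again, by \<open>upward_comp_right\<close>; so
  dropping the diagrams that are not upward is compatible with the action. In the other case the
  exponents agree by \<open>loop_count_assoc\<close>.\<close>

lemma diagram_act_mult:
  assumes x: "x \<in> X" and y: "y \<in> X" and u: "u \<in> U q" and v: "v \<in> U q"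
  shows "\<delta> [^] loop_count x y \<otimes> diagram_act (diagram_comp x y) u v = dot (U q) (\<lambda>t. diagram_act x t v) (diagram_act y u)"
proof -
  let ?t = "diagram_comp y u"
  note d = upward_diagramsD[OF u]
  have yu: "?t \<in> brauer_diagrams q r" by (rule diagram_comp_closed[OF y d])
  have as: "diagram_comp (diagram_comp x y) u = diagram_comp x ?t" by (rule diagram_comp_assoc[OF x y d])
  have lc: "loop_count x y + loop_count (diagram_comp x y) u = loop_count y u + loop_count x ?t"
    by (rule loop_count_assoc[OF x y d])
  have eq: "diagram_act y u = (\<lambda>t. if t = ?t then \<delta> [^] loop_count y u else \<zero>)"
    by (auto simp: diagram_act_def fun_eq_iff)
  show ?thesis
  proof (cases "?t \<in> U q")
    case True
    have "dot (U q) (\<lambda>t. diagram_act x t v) (diagram_act y u) = diagram_act x ?t v \<otimes> \<delta> [^] loop_count y u"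
      unfolding eq by (rule dot_delta[OF _ True]) (use diagram_act_closed \<delta> in auto)
    also have "\<dots> = \<delta> [^] loop_count x y \<otimes> diagram_act (diagram_comp x y) u v"
      unfolding diagram_act_def as using lc \<delta> by (auto simp: nat_pow_mult add.commute)
    finally show ?thesis ..
  next
    case False
    have "dot (U q) (\<lambda>t. diagram_act x t v) (diagram_act y u) = \<zero>"
      by (rule dot_zero) (use False diagram_act_closed in \<open>auto simp: eq\<close>)
    moreover have "diagram_act (diagram_comp x y) u v = \<zero>"
      using upward_comp_right[OF x yu] v False unfolding diagram_act_def as by auto
    ultimately show ?thesis using \<delta> by simp
  qed
qed

lemma rep_mult:
  assumes a: "a \<in> carrier B" and b: "b \<in> carrier B" and u: "u \<in> U q" and v: "v \<in> U q"
  shows "rep (a \<otimes>\<^bsub>B\<^esub> b) v u = dot (U q) (rep a v) (\<lambda>t. rep b t u)"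
proof -
  note c = M.coeff_closed[OF a] M.coeff_closed[OF b] diagram_act_closed
  have "rep (a \<otimes>\<^bsub>B\<^esub> b) v u = dot X a (\<lambda>x. dot X b (\<lambda>y. \<delta> [^] loop_count x y \<otimes> diagram_act (diagram_comp x y) u v))"
    unfolding rep_def by (rule M.dot_mult[OF a b diagram_act_closed])
  also have "\<dots> = dot X a (\<lambda>x. dot X b (\<lambda>y. dot (U q) (\<lambda>t. diagram_act x t v) (diagram_act y u)))"
    by (intro dot_cong_right diagram_act_mult u v) (auto intro!: dot_closed c)
  also have "\<dots> = dot X a (\<lambda>x. dot (U q) (\<lambda>t. diagram_act x t v) (\<lambda>t. dot X b (\<lambda>y. diagram_act y u t)))"
    by (intro dot_cong_right dot_swap) (auto intro!: dot_closed c)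
  also have "\<dots> = dot (U q) (\<lambda>t. dot X a (\<lambda>x. diagram_act x t v)) (\<lambda>t. dot X b (\<lambda>y. diagram_act y u t))"
    by (rule dot_assoc) (auto intro!: dot_closed c)
  finally show ?thesis unfolding rep_def .
qed

lemma rep_equivariant:
  assumes a: "a \<in> carrier B" and u: "u \<in> U q" and v: "v \<in> U q" and \<sigma>: "\<sigma> permutes {1..q}"
  shows "rep a (permute_top q v \<sigma>) (permute_top q u \<sigma>) = rep a v u"
  unfolding rep_def
proof (rule dot_cong_right)
  fix h assume h: "h \<in> X"
  note d = upward_diagramsD[OF u] upward_diagramsD[OF v]
  show "diagram_act h (permute_top q u \<sigma>) (permute_top q v \<sigma>) = diagram_act h u v"
    unfolding diagram_act_def permute_top_left[OF h d(1) \<sigma>]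
      permute_top_eq_iff[OF diagram_comp_closed[OF h d(1)] d(2) \<sigma>] ..
qed (auto simp: diagram_act_closed M.coeff_closed a)

section \<open>Strata by the number of through strands, and triangularity\<close>

definition factor :: "point set set \<Rightarrow> point set set \<Rightarrow> point set set" where
  "factor u w = diagram_comp u (flip_diagram w)"

definition stratum :: "nat \<Rightarrow> point set set set" where
  "stratum p = {factor u w | u w. u \<in> U p \<and> w \<in> U p}"

lemma factor_closed: "u \<in> U p \<Longrightarrow> w \<in> U p \<Longrightarrow> factor u w \<in> X"
  unfolding factor_def by (rule diagram_comp_closed[OF upward_diagramsD flip_diagram_closed[OF upward_diagramsD]])

lemma ex_stratum:
  assumes "h \<in> X"
  obtains p where "p \<preceq> r" and "h \<in> stratum p"
proof -
  obtain p u w where "u \<in> U p" "w \<in> U p" "h = diagram_comp u (flip_diagram w)"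
    using brauer_factorization[OF assms] by blast
  then show ?thesis using that[OF upward_le] unfolding stratum_def factor_def by blast
qed

text \<open>The action of \<open>h\<close> on \<open>u\<close> passes through the \<open>p\<close>
  middle points of a factorization of \<open>h\<close>. If the result is upward, so is the part of
  the composite down to these points, an upward diagram from \<open>q\<close> to \<open>p\<close>
  points; this forces \<open>q \<le> p\<close>. For \<open>p = q\<close> that part is a permutation,
  which can be absorbed into both halves of \<open>h\<close>, so that the lower half becomes the
  result itself.\<close>

lemma stratum_act:
  assumes h: "h \<in> stratum p" and u: "u \<in> U q" and v: "diagram_comp h u \<in> U q"
  shows "q \<le> p" and "p = q \<Longrightarrow> \<exists>w\<in>U q. h = factor (diagram_comp h u) w"
proof -
  obtain u1 w1 where uw: "u1 \<in> U p" "w1 \<in> U p" "h = factor u1 w1" using h unfolding stratum_def by blast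
  note d = upward_diagramsD[OF u] upward_diagramsD[OF uw(1)] upward_diagramsD[OF uw(2)]
  note fw = flip_diagram_closed[OF d(3)]
  let ?m = "diagram_comp (flip_diagram w1) u"
  have m: "?m \<in> brauer_diagrams q p" by (rule diagram_comp_closed[OF fw d(1)])
  have hu: "diagram_comp h u = diagram_comp u1 ?m"
    unfolding uw(3) factor_def by (rule diagram_comp_assoc[OF d(2) fw d(1)])
  have mu: "?m \<in> upward_diagrams q p"
    by (rule upward_comp_right[OF d(2) m]) (use v hu in simp)
  then show "q \<le> p" using upward_le unfolding parity_le_def by blast
  show "\<exists>w\<in>U q. h = factor (diagram_comp h u) w" if pq: "p = q"
  proof -
    obtain \<sigma> where \<sigma>: "\<sigma> permutes {1..q}" "?m = perm_diagram q \<sigma>" using mu unfolding pq by (rule upward_endo_perm)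
    have "diagram_comp h u = permute_top q u1 \<sigma>" unfolding hu \<sigma>(2) permute_top_def ..
    moreover have "factor (permute_top q u1 \<sigma>) (permute_top q w1 \<sigma>) = h"
      unfolding factor_def uw(3) using flip_permute_top(2)[OF d(3,2)] \<sigma>(1) pq by simp
    ultimately show ?thesis using permute_top_upward[OF _ \<sigma>(1)] uw(2) pq by metis
  qed
qed

lemma factor_eq_iff:
  assumes "u \<in> U p" "w \<in> U p" "u' \<in> U p" "w' \<in> U p"
  shows "factor u w = factor u' w' \<longleftrightarrow> (\<exists>\<sigma>. \<sigma> permutes {1..p} \<and> u' = permute_top p u \<sigma> \<and> w' = permute_top p w \<sigma>)"
  using upward_flip_cancel[OF assms(1,3,2,4)]
    flip_permute_top(2)[OF upward_diagramsD[OF assms(2)] upward_diagramsD[OF assms(1)]]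
  unfolding factor_def permute_top_def by metis

text \<open>Two factorizations with the same first half differ by a permutation that fixes
  \<open>v\<close>, and the action on upward diagrams is free.\<close>

lemma factor_inj:
  assumes v: "v \<in> U p" and "w \<in> U p" "w' \<in> U p" and eq: "factor v w = factor v w'"
  shows "w = w'"
proof -
  obtain \<sigma> where \<sigma>: "\<sigma> permutes {1..p}" "v = permute_top p v \<sigma>" "w' = permute_top p w \<sigma>"
    using factor_eq_iff[OF v assms(2) v assms(3)] eq by blast
  note d = upward_diagramsD[OF v] and pc = perm_diagram_closed[OF \<sigma>(1)]
  have "diagram_comp (flip_diagram v) v = diagram_comp (flip_diagram v) (permute_top p v \<sigma>)" using \<sigma>(2) by simp
  also have "\<dots> = permute_top p (perm_diagram p id) \<sigma>"
    unfolding permute_top_left(1)[OF flip_diagram_closed[OF d] d \<sigma>(1)] flip_upward_comp_self[OF v] ..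
  also have "\<dots> = perm_diagram p \<sigma>" unfolding permute_top_def by (rule comp_identity_left[OF pc])
  finally have "perm_diagram p id = perm_diagram p \<sigma>" unfolding flip_upward_comp_self[OF v] .
  then have "id = \<sigma>" by (rule perm_diagram_inj[OF permutes_id \<sigma>(1)])
  then have "\<sigma> = id" ..
  then show ?thesis using \<sigma>(3) permute_top_id[OF upward_diagramsD[OF assms(2)]] by simp
qed

text \<open>Acting on \<open>u\<close> gives \<open>v\<close> with the flip of \<open>w\<close>
  composed with \<open>u\<close> on top. Cancelling \<open>v\<close> on the left, the result is
  \<open>v\<close> exactly if that middle part is the identity; all loops lie in it, because
  \<open>v\<close> is upward.\<close>

lemma diagram_act_factor:
  assumes v: "v \<in> U q" and w: "w \<in> U q" and u: "u \<in> U q"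
  shows "diagram_act (factor v w) u v = gram \<delta> q w u"
proof -
  note d = upward_diagramsD[OF v] upward_diagramsD[OF w] upward_diagramsD[OF u]
  note fw = flip_diagram_closed[OF d(2)] and fv = flip_diagram_closed[OF d(1)]
  let ?m = "diagram_comp (flip_diagram w) u"
  have m: "?m \<in> brauer_diagrams q q" by (rule diagram_comp_closed[OF fw d(3)])
  have as: "diagram_comp (factor v w) u = diagram_comp v ?m"
    unfolding factor_def by (rule diagram_comp_assoc[OF d(1) fw d(3)])
  have "diagram_comp v ?m = v \<longleftrightarrow> ?m = perm_diagram q id"
  proof
    assume "diagram_comp v ?m = v"
    then have "diagram_comp (diagram_comp (flip_diagram v) v) ?m = diagram_comp (flip_diagram v) v"
      by (simp only: diagram_comp_assoc[OF fv d(1) m])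
    then show "?m = perm_diagram q id"
      unfolding flip_upward_comp_self[OF v] comp_identity_left[OF m] .
  qed (simp add: comp_identity_right[OF d(1)])
  moreover have "loop_count (factor v w) u = loop_count (flip_diagram w) u"
    using loop_count_assoc[OF d(1) fw d(3)] loop_count_upward_left[OF v fw] loop_count_upward_left[OF v m]
    by (simp add: factor_def)
  ultimately show ?thesis unfolding diagram_act_def gram_def as by simp
qed

text \<open>By \<open>stratum_act\<close> a diagram in the support that takes \<open>u\<close> to
  \<open>v\<close> must be \<open>factor v w\<close> for some \<open>w\<close>, and
  \<open>factor_inj\<close> makes \<open>w\<close> unique. So row \<open>v\<close> of the action
  involves only the coefficients of these diagrams.\<close>

lemma rep_stratum:
  assumes a: "a \<in> carrier B" and supp: "\<And>h. h \<in> X \<Longrightarrow> a h \<noteq> \<zero> \<Longrightarrow> \<exists>p\<le>q. h \<in> stratum p"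
    and v: "v \<in> U q" and u: "u \<in> U q"
  shows "rep a v u = dot (U q) (\<lambda>w. a (factor v w)) (\<lambda>w. gram \<delta> q w u)"
proof -
  note ca = M.coeff_closed[OF a]
  have sub: "factor v ` U q \<subseteq> X" using factor_closed[OF v] by blast
  have "rep a v u = dot (factor v ` U q) a (\<lambda>h. diagram_act h u v)"
    unfolding rep_def
  proof (rule dot_mono_neutral[OF _ sub])
    fix h assume h: "h \<in> X - factor v ` U q"
    show "a h \<otimes> diagram_act h u v = \<zero>"
    proof (rule ccontr)
      assume ne: "a h \<otimes> diagram_act h u v \<noteq> \<zero>"
      then have "a h \<noteq> \<zero>" "diagram_act h u v \<noteq> \<zero>" using h ca diagram_act_closed by auto
      then have hv: "diagram_comp h u = v" by (auto simp: diagram_act_def split: if_splits)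
      obtain p where p: "p \<le> q" "h \<in> stratum p" using supp[of h] h \<open>a h \<noteq> \<zero>\<close> by blast
      have hv': "diagram_comp h u \<in> U q" using hv v by simp
      have "p = q" using stratum_act(1)[OF p(2) u hv'] p(1) by simp
      then obtain w where "w \<in> U q" "h = factor v w" using stratum_act(2)[OF p(2) u hv'] hv by auto
      then show False using h by blast
    qed
  qed (auto simp: ca diagram_act_closed)
  also have "\<dots> = dot (U q) (\<lambda>w. a (factor v w)) (\<lambda>w. diagram_act (factor v w) u v)"
  proof (rule dot_reindex)
    show "bij_betw (factor v) (U q) (factor v ` U q)"
      using factor_inj[OF v] by (auto simp: bij_betw_def inj_on_def)
  qed (use sub ca diagram_act_closed in auto)
  also have "\<dots> = dot (U q) (\<lambda>w. a (factor v w)) (\<lambda>w. gram \<delta> q w u)"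
    by (rule dot_cong_right) (use diagram_act_factor[OF v _ u] ca factor_closed[OF v] gram_closed[OF \<delta>] in auto)
  finally show ?thesis .
qed

lemma gram_inverse: "q \<preceq> r \<Longrightarrow> \<exists>D. inverse_matrices (U q) (gram \<delta> q) D"
proof -
  assume "q \<preceq> r"
  moreover have "r \<preceq> r" by (simp add: parity_le_def)
  ultimately have "eval_int_poly R \<delta> (gram_det q r) \<in> Units R"
    using nonsingular unfolding nonsingular_upto_def by blast
  then show ?thesis by (rule ex_gram_inverse[OF \<delta>])
qed

text \<open>Take the largest \<open>q\<close> for which some diagram with \<open>q\<close> through
  strands has a nonzero coefficient. There \<open>rep_stratum\<close> applies, and multiplying by
  the inverse Gram matrix recovers the coefficients, which must vanish.\<close>

lemma rep_eq_zero:
  assumes a: "a \<in> carrier B" and z: "\<And>q v u. q \<preceq> r \<Longrightarrow> v \<in> U q \<Longrightarrow> u \<in> U q \<Longrightarrow> rep a v u = \<zero>"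
  shows "a = \<zero>\<^bsub>B\<^esub>"
proof -
  note ca = M.coeff_closed[OF a]
  have "\<not> (\<exists>h\<in>X. a h \<noteq> \<zero>)"
  proof
    assume "\<exists>h\<in>X. a h \<noteq> \<zero>"
    define S where "S = {p. p \<preceq> r \<and> (\<exists>h\<in>X. a h \<noteq> \<zero> \<and> h \<in> stratum p)}"
    have finS: "finite S" by (rule finite_subset[of _ "{..r}"]) (auto simp: S_def parity_le_def)
    have "S \<noteq> {}" using \<open>\<exists>h\<in>X. a h \<noteq> \<zero>\<close> ex_stratum unfolding S_def by blast
    define q where "q = Max S"
    have q: "q \<in> S" unfolding q_def by (rule Max_in[OF finS \<open>S \<noteq> {}\<close>])
    then have qr: "q \<preceq> r" by (simp add: S_def)
    have supp: "\<exists>p\<le>q. h \<in> stratum p" if h: "h \<in> X" "a h \<noteq> \<zero>" for h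
    proof -
      obtain p where p: "p \<preceq> r" "h \<in> stratum p" using ex_stratum[OF h(1)] by blast
      then have "p \<in> S" using h by (auto simp: S_def)
      then show ?thesis using Max_ge[OF finS] p unfolding q_def by blast
    qed
    obtain D where D: "inverse_matrices (U q) (gram \<delta> q) D" using gram_inverse[OF qr] by blast
    have "a (factor v w) = \<zero>" if v: "v \<in> U q" and w: "w \<in> U q" for v w
    proof -
      have c: "a (factor v t) \<in> carrier R" "D t w \<in> carrier R" if "t \<in> U q" for t
        using that ca factor_closed[OF v] D w by (auto simp: inverse_matrices_def)
      have "a (factor v w) = dot (U q) (\<lambda>t. a (factor v t)) (\<lambda>t. if t = w then \<one> else \<zero>)"
        using dot_delta[OF _ w, of "\<lambda>t. a (factor v t)" \<one>] c w by simp
      also have "\<dots> = dot (U q) (\<lambda>t. a (factor v t)) (\<lambda>t. dot (U q) (gram \<delta> q t) (\<lambda>s. D s w))"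
        by (rule dot_cong_right) (use D w c gram_closed[OF \<delta>] in \<open>auto simp: inverse_matrices_def intro!: dot_closed\<close>)
      also have "\<dots> = dot (U q) (\<lambda>s. dot (U q) (\<lambda>t. a (factor v t)) (\<lambda>t. gram \<delta> q t s)) (\<lambda>s. D s w)"
        by (rule dot_assoc) (use c gram_closed[OF \<delta>] in auto)
      also have "\<dots> = \<zero>"
        by (rule dot_zero) (use z[OF qr v] rep_stratum[OF a supp v] c in auto)
      finally show ?thesis .
    qed
    then show False using q unfolding S_def stratum_def by blast
  qed
  then show ?thesis
    by (intro M.coeff_eqI[OF a M.zero_closed']) (auto simp: M.zero_A)
qed

text \<open>An element supported on stratum \<open>q\<close> acts in degree \<open>q\<close> as its
  coefficient matrix times the Gram matrix, so the coefficients are found as \<open>T\<close> times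
  the inverse. In degrees above \<open>q\<close> it acts as zero by \<open>stratum_act\<close>,
  which keeps later corrections from spoiling earlier ones.\<close>

lemma rep_surj_stratum:
  assumes q: "q \<preceq> r" and T: "\<And>v u. v \<in> U q \<Longrightarrow> u \<in> U q \<Longrightarrow> T v u \<in> carrier R"
    and eqv: "\<And>v u \<sigma>. v \<in> U q \<Longrightarrow> u \<in> U q \<Longrightarrow> \<sigma> permutes {1..q} \<Longrightarrow>
      T (permute_top q v \<sigma>) (permute_top q u \<sigma>) = T v u"
  shows "\<exists>b\<in>carrier B. (\<forall>v\<in>U q. \<forall>u\<in>U q. rep b v u = T v u) \<and>
    (\<forall>p>q. \<forall>v\<in>U p. \<forall>u\<in>U p. rep b v u = \<zero>)"
proof -
  obtain D where D: "inverse_matrices (U q) (gram \<delta> q) D" using gram_inverse[OF q] by blast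
  have Dc: "D v u \<in> carrier R" if "v \<in> U q" "u \<in> U q" for v u using D that by (auto simp: inverse_matrices_def)
  have Deqv: "D (permute_top q v \<sigma>) (permute_top q u \<sigma>) = D v u"
    if "v \<in> U q" "u \<in> U q" "\<sigma> permutes {1..q}" for v u \<sigma>
    by (rule inverse_matrices_equivariant[OF _ D permute_top_bij[OF that(3)] _ that(1,2)])
      (use gram_equivariant[OF upward_diagramsD upward_diagramsD that(3)] in auto)
  define Y where "Y v w = dot (U q) (T v) (\<lambda>t. D t w)" for v w
  have Yc: "Y v w \<in> carrier R" if "v \<in> U q" "w \<in> U q" for v w
    unfolding Y_def using T Dc that by (intro dot_closed) auto
  have Yeqv: "Y (permute_top q v \<sigma>) (permute_top q w \<sigma>) = Y v w"
    if v: "v \<in> U q" and w: "w \<in> U q" and \<sigma>: "\<sigma> permutes {1..q}" for v w \<sigma>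
  proof -
    note pU = permute_top_upward[OF _ \<sigma>]
    have "Y (permute_top q v \<sigma>) (permute_top q w \<sigma>) =
        dot (U q) (\<lambda>t. T (permute_top q v \<sigma>) (permute_top q t \<sigma>)) (\<lambda>t. D (permute_top q t \<sigma>) (permute_top q w \<sigma>))"
      unfolding Y_def by (rule dot_reindex[OF permute_top_bij[OF \<sigma>]]) (use T Dc pU v w in auto)
    also have "\<dots> = Y v w"
      unfolding Y_def by (rule dot_cong) (use eqv Deqv T Dc v w \<sigma> in auto)
    finally show ?thesis .
  qed
  \<comment> \<open>The coefficient is read off from an arbitrarily chosen factorization. By
    \<open>factor_eq_iff\<close> two factorizations differ by a common permutation, and
    \<open>Y\<close> is invariant under it.\<close>
  define b where "b = (\<lambda>h\<in>X. if h \<in> stratum q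
    then (case SOME (v, w). v \<in> U q \<and> w \<in> U q \<and> h = factor v w of (v, w) \<Rightarrow> Y v w) else \<zero>)"
  have b_factor: "b (factor v w) = Y v w" if v: "v \<in> U q" and w: "w \<in> U q" for v w
  proof -
    let ?P = "\<lambda>(v', w'). v' \<in> U q \<and> w' \<in> U q \<and> factor v w = factor v' w'"
    obtain v' w' where s: "(SOME x. ?P x) = (v', w')" by (cases "SOME x. ?P x") auto
    have "?P (SOME x. ?P x)" by (rule someI[of ?P "(v, w)"]) (use v w in simp)
    then have vw: "v' \<in> U q" "w' \<in> U q" "factor v w = factor v' w'" unfolding s by auto
    then obtain \<sigma> where "\<sigma> permutes {1..q}" "v' = permute_top q v \<sigma>" "w' = permute_top q w \<sigma>"
      using factor_eq_iff[OF v w vw(1,2)] by blast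
    then have "Y v' w' = Y v w" using Yeqv[OF v w] by simp
    moreover have "factor v w \<in> stratum q" using v w unfolding stratum_def by blast
    ultimately show ?thesis using s factor_closed[OF v w] by (simp add: b_def)
  qed
  have b_zero: "b h = \<zero>" if "h \<in> X" "h \<notin> stratum q" for h using that by (simp add: b_def)
  have bB: "b \<in> carrier B"
  proof -
    have "b h \<in> carrier R" if "h \<in> X" for h
    proof (cases "h \<in> stratum q")
      case True
      then obtain v w where "v \<in> U q" "w \<in> U q" "h = factor v w" unfolding stratum_def by blast
      then show ?thesis using b_factor Yc by simp
    qed (use that b_zero in simp)
    moreover have "b \<in> extensional X" unfolding b_def by (rule restrict_extensional)
    ultimately show ?thesis unfolding M.carrier_A by (auto simp: PiE_def)
  qed
  have "rep b v u = T v u" if v: "v \<in> U q" and u: "u \<in> U q" for v u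
  proof -
    have "rep b v u = dot (U q) (\<lambda>w. b (factor v w)) (\<lambda>w. gram \<delta> q w u)"
      by (rule rep_stratum[OF bB _ v u]) (use b_zero in blast)
    also have "\<dots> = dot (U q) (\<lambda>w. dot (U q) (T v) (\<lambda>t. D t w)) (\<lambda>w. gram \<delta> q w u)"
      by (rule dot_cong) (use b_factor v Yc gram_closed[OF \<delta>] in \<open>auto simp: Y_def\<close>)
    also have "\<dots> = dot (U q) (T v) (\<lambda>t. dot (U q) (D t) (\<lambda>w. gram \<delta> q w u))"
      by (rule dot_assoc[symmetric]) (use T v Dc gram_closed[OF \<delta>] in auto)
    also have "\<dots> = dot (U q) (T v) (\<lambda>t. if t = u then \<one> else \<zero>)"
      by (rule dot_cong_right) (use D u T v in \<open>auto simp: inverse_matrices_def\<close>)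
    also have "\<dots> = T v u" using dot_delta[OF _ u, of "T v" \<one>] T u v by simp
    finally show ?thesis .
  qed
  moreover have "rep b v u = \<zero>" if p: "p > q" and v: "v \<in> U p" and u: "u \<in> U p" for p v u
    unfolding rep_def
  proof (rule dot_zero)
    fix h assume h: "h \<in> X"
    show "b h \<otimes> diagram_act h u v = \<zero>"
    proof (cases "h \<in> stratum q")
      case True
      then have "diagram_comp h u \<noteq> v" using stratum_act(1)[OF True u] v p by auto
      then show ?thesis using M.coeff_closed[OF bB h] by (simp add: diagram_act_def)
    next
      case False
      then show ?thesis using b_zero[OF h] diagram_act_closed by simp
    qed
  qed
  ultimately show ?thesis using bB by blast
qed

text \<open>The degrees are treated from the top downwards; the correction for one degree does not
  affect those above it.\<close>

lemma rep_surj: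
  assumes T: "\<And>q v u. q \<preceq> r \<Longrightarrow> v \<in> U q \<Longrightarrow> u \<in> U q \<Longrightarrow> T q v u \<in> carrier R"
    and eqv: "\<And>q v u \<sigma>. q \<preceq> r \<Longrightarrow> v \<in> U q \<Longrightarrow> u \<in> U q \<Longrightarrow> \<sigma> permutes {1..q} \<Longrightarrow>
      T q (permute_top q v \<sigma>) (permute_top q u \<sigma>) = T q v u"
  shows "\<exists>a\<in>carrier B. \<forall>q v u. q \<preceq> r \<longrightarrow> v \<in> U q \<longrightarrow> u \<in> U q \<longrightarrow> rep a v u = T q v u"
proof -
  \<comment> \<open>After \<open>n\<close> steps all degrees above \<open>r - n\<close> are right,
    so \<open>Suc r\<close> steps include degree 0.\<close>
  have "\<exists>a\<in>carrier B. \<forall>q v u. q \<preceq> r \<longrightarrow> r < q + n \<longrightarrow> v \<in> U q \<longrightarrow> u \<in> U q \<longrightarrow> rep a v u = T q v u" for n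
  proof (induction n)
    case 0
    show ?case using M.zero_closed' by (auto simp: parity_le_def)
  next
    case (Suc n)
    then obtain a where a: "a \<in> carrier B"
      "\<And>q v u. q \<preceq> r \<Longrightarrow> r < q + n \<Longrightarrow> v \<in> U q \<Longrightarrow> u \<in> U q \<Longrightarrow> rep a v u = T q v u" by blast
    show ?case
    proof (cases "n \<le> r \<and> r - n \<preceq> r")
      \<comment> \<open>No new degree appears in this step: \<open>n\<close> exceeds
        \<open>r\<close> or \<open>r - n\<close> has the wrong parity.\<close>
      case False
      then have "r < q + n" if "q \<preceq> r" "r < q + Suc n" for q
        using that by (cases "q = r - n") (auto simp: parity_le_def)
      then show ?thesis using a by blast
    next
      case True
      let ?q = "r - n"
      \<comment> \<open>The error of \<open>a\<close> in degree \<open>?q\<close>, again invariant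
        under permutations because \<open>T\<close> and \<open>rep a\<close> are.\<close>
      let ?T = "\<lambda>v u. T ?q v u \<ominus> rep a v u"
      have "\<exists>b\<in>carrier B. (\<forall>v\<in>U ?q. \<forall>u\<in>U ?q. rep b v u = ?T v u) \<and> (\<forall>p>?q. \<forall>v\<in>U p. \<forall>u\<in>U p. rep b v u = \<zero>)"
        by (rule rep_surj_stratum) (use True T eqv rep_closed[OF a(1)] rep_equivariant[OF a(1)] in auto)
      then obtain b where b: "b \<in> carrier B" "\<And>v u. v \<in> U ?q \<Longrightarrow> u \<in> U ?q \<Longrightarrow> rep b v u = ?T v u"
        "\<And>p v u. p > ?q \<Longrightarrow> v \<in> U p \<Longrightarrow> u \<in> U p \<Longrightarrow> rep b v u = \<zero>" by blast
      have "rep (a \<oplus>\<^bsub>B\<^esub> b) v u = T q v u" if q: "q \<preceq> r" "r < q + Suc n" and vu: "v \<in> U q" "u \<in> U q" for q v u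
      proof (cases "q = ?q")
        case True
        have c: "rep a v u \<in> carrier R" "T q v u \<in> carrier R" using rep_closed[OF a(1)] T[OF q(1) vu] by auto
        have "rep (a \<oplus>\<^bsub>B\<^esub> b) v u = rep a v u \<oplus> (T q v u \<ominus> rep a v u)"
          using rep_add[OF a(1) b(1)] b(2) vu True by simp
        also have "\<dots> = T q v u" using c by (simp add: minus_eq a_lcomm[of "rep a v u"] r_neg)
        finally show ?thesis .
      next
        case False
        then have "q > ?q" "r < q + n" using q by auto
        then show ?thesis using rep_add[OF a(1) b(1)] a(2)[OF q(1) _ vu] b(3)[OF _ vu] T[OF q(1) vu] by simp
      qed
      then show ?thesis using M.add_closed[OF a(1) b(1)] by blast
    qed
  qed
  from this[of "Suc r"] show ?thesis by simp
qed

end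

section \<open>Matrix units\<close>

context nonsingular_brauer
begin

abbreviation "W q \<equiv> upward_monotone_diagrams q r"
abbreviation "Q \<equiv> {q. q \<preceq> r}"
abbreviation "perms q \<equiv> carrier (sym_group q)"
abbreviation "GA q \<equiv> group_algebra R (sym_group q)"
abbreviation "S \<equiv> direct_sum_algebra Q GA"

lemma finite_Q: "finite Q"
  by (rule finite_subset[of _ "{..r}"]) (auto simp: parity_le_def)

lemma assoc_algebra_GA: "assoc_algebra R (GA q)"
  by (rule monomial_algebra.assoc_algebra[OF monomial_group_algebra[OF cring_axioms]])

sublocale RS: assoc_algebra R S
  by (rule assoc_direct_sum_algebra[OF assoc_algebra_GA cring_axioms])

sublocale RB: assoc_algebra R B
  by (rule M.assoc_algebra)

lemma rep_inj:
  assumes a: "a \<in> carrier B" and b: "b \<in> carrier B"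
    and eq: "\<And>q v u. q \<preceq> r \<Longrightarrow> v \<in> U q \<Longrightarrow> u \<in> U q \<Longrightarrow> rep a v u = rep b v u"
  shows "a = b"
proof -
  have c: "a \<ominus>\<^bsub>B\<^esub> b \<in> carrier B" using a b by (rule RB.M.minus_closed)
  have "a \<ominus>\<^bsub>B\<^esub> b = \<zero>\<^bsub>B\<^esub>"
  proof (rule rep_eq_zero[OF c])
    fix q v u assume q: "q \<preceq> r" "v \<in> U q" "u \<in> U q"
    have "(a \<ominus>\<^bsub>B\<^esub> b) \<oplus>\<^bsub>B\<^esub> b = a" using a b by (simp add: RB.M.minus_eq RB.M.a_assoc RB.M.l_neg)
    then have "rep (a \<ominus>\<^bsub>B\<^esub> b) v u \<oplus> rep b v u = \<zero> \<oplus> rep b v u"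
      using rep_add[OF c b] eq[OF q] rep_closed[OF b] by simp
    then show "rep (a \<ominus>\<^bsub>B\<^esub> b) v u = \<zero>"
      using rep_closed[OF b] rep_closed[OF c] by (simp only: add.right_cancel zero_closed)
  qed
  moreover have "(a \<ominus>\<^bsub>B\<^esub> b) \<oplus>\<^bsub>B\<^esub> b = a" using a b by (simp add: RB.M.minus_eq RB.M.a_assoc RB.M.l_neg)
  ultimately show ?thesis using b by simp
qed

definition normal_form :: "nat \<Rightarrow> point set set \<Rightarrow> point set set \<times> (nat \<Rightarrow> nat)" where
  "normal_form q = inv_into (W q \<times> perms q) (\<lambda>(f, \<sigma>). permute_top q f \<sigma>)"

abbreviation "mono_part q v \<equiv> fst (normal_form q v)"
abbreviation "perm_part q v \<equiv> snd (normal_form q v)"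

lemma normal_form_bij: "bij_betw (\<lambda>(f, \<sigma>). permute_top q f \<sigma>) (W q \<times> perms q) (U q)"
  unfolding permute_top_def by (rule bij_betw_upward_monotone)

lemma normal_form_eq: "f \<in> W q \<Longrightarrow> \<sigma> \<in> perms q \<Longrightarrow> normal_form q (permute_top q f \<sigma>) = (f, \<sigma>)"
  using inv_into_f_f[OF bij_betw_imp_inj_on[OF normal_form_bij], of "(f, \<sigma>)" q]
  by (simp add: normal_form_def)

lemma normal_formE:
  assumes "v \<in> U q"
  obtains f \<sigma> where "f \<in> W q" and "\<sigma> \<in> perms q" and "v = permute_top q f \<sigma>" and "normal_form q v = (f, \<sigma>)"
proof -
  have "v \<in> (\<lambda>(f, \<sigma>). permute_top q f \<sigma>) ` (W q \<times> perms q)"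
    using assms bij_betw_imp_surj_on[OF normal_form_bij] by simp
  then show ?thesis using that normal_form_eq by auto
qed

lemma permsD: "\<sigma> \<in> perms q \<Longrightarrow> \<sigma> permutes {1..q}" and permsI: "\<sigma> permutes {1..q} \<Longrightarrow> \<sigma> \<in> perms q"
  by (simp_all add: sym_group_carrier)

lemma perms_closed: "\<sigma> \<in> perms q \<Longrightarrow> \<tau> \<in> perms q \<Longrightarrow> \<sigma> \<circ> \<tau> \<in> perms q"
  "\<sigma> \<in> perms q \<Longrightarrow> inv' \<sigma> \<in> perms q" "id \<in> perms q"
  by (simp_all add: sym_group_carrier permutes_compose permutes_inv permutes_id)

lemma W_U: "f \<in> W q \<Longrightarrow> f \<in> U q"
  by (simp add: upward_monotone_iff)

lemma S_coeff: "x \<in> carrier S \<Longrightarrow> q \<preceq> r \<Longrightarrow> x q \<in> carrier (GA q)"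
  by (auto simp: direct_sum_algebra_def)

lemma S_coeff_closed: "x \<in> carrier S \<Longrightarrow> q \<preceq> r \<Longrightarrow> \<sigma> \<in> perms q \<Longrightarrow> x q \<sigma> \<in> carrier R"
  using monomial_algebra.coeff_closed[OF monomial_group_algebra[OF cring_axioms], where a = "x q"] S_coeff by blast

text \<open>The chosen diagonal position in the matrix ring of degree \<open>q\<close>. The full
  idempotent has entry 1 there and 0 elsewhere, in every degree.\<close>

definition base :: "nat \<Rightarrow> point set set" where
  "base q = (SOME f. f \<in> W q)"

lemma base: "q \<preceq> r \<Longrightarrow> base q \<in> W q"
proof -
  assume "q \<preceq> r"
  then obtain u where "u \<in> U q" using upward_diagrams_nonempty by blast
  then obtain f where "f \<in> W q" by (rule normal_formE)
  then show ?thesis unfolding base_def by (rule someI)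
qed

text \<open>With an upward diagram written as a monotone one times a permutation, the equivariant matrix that
  corresponds in degree \<open>q\<close> to the matrix over the group ring with sole entry \<open>x q\<close>, at \<open>(i q, j q)\<close>.\<close>

definition block :: "(nat \<Rightarrow> point set set) \<Rightarrow> (nat \<Rightarrow> point set set) \<Rightarrow> (nat \<Rightarrow> (nat \<Rightarrow> nat) \<Rightarrow> 'a) \<Rightarrow>
    nat \<Rightarrow> point set set \<Rightarrow> point set set \<Rightarrow> 'a" where
  "block i j x q v u = (if mono_part q v = i q \<and> mono_part q u = j q
     then x q (perm_part q v \<circ> inv' (perm_part q u)) else \<zero>)"

lemma block_closed:
  assumes "x \<in> carrier S" "q \<preceq> r" "v \<in> U q" "u \<in> U q"
  shows "block i j x q v u \<in> carrier R"
proof -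
  obtain f \<sigma> where f: "\<sigma> \<in> perms q" "normal_form q v = (f, \<sigma>)" using normal_formE[OF assms(3)] by metis
  obtain g \<tau> where g: "\<tau> \<in> perms q" "normal_form q u = (g, \<tau>)" using normal_formE[OF assms(4)] by metis
  show ?thesis using S_coeff_closed[OF assms(1,2)] perms_closed f g by (simp add: block_def)
qed

text \<open>Both permutation parts are multiplied by \<open>\<rho>\<close> on the right, which
  cancels in the quotient.\<close>

lemma block_equivariant:
  assumes "v \<in> U q" "u \<in> U q" and \<rho>: "\<rho> permutes {1..q}"
  shows "block i j x q (permute_top q v \<rho>) (permute_top q u \<rho>) = block i j x q v u"
proof -
  obtain f \<sigma> where f: "f \<in> W q" "\<sigma> \<in> perms q" "v = permute_top q f \<sigma>" "normal_form q v = (f, \<sigma>)"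
    using normal_formE[OF assms(1)] by metis
  obtain g \<tau> where g: "g \<in> W q" "\<tau> \<in> perms q" "u = permute_top q g \<tau>" "normal_form q u = (g, \<tau>)"
    using normal_formE[OF assms(2)] by metis
  have 1: "normal_form q (permute_top q v \<rho>) = (f, \<sigma> \<circ> \<rho>)" "normal_form q (permute_top q u \<rho>) = (g, \<tau> \<circ> \<rho>)"
    unfolding f(3) g(3) permute_top_comp[OF upward_diagramsD[OF W_U[OF f(1)]] permsD[OF f(2)] \<rho>]
      permute_top_comp[OF upward_diagramsD[OF W_U[OF g(1)]] permsD[OF g(2)] \<rho>]
    by (intro normal_form_eq f g perms_closed permsI[OF \<rho>])+
  have "\<sigma> \<circ> \<rho> \<circ> inv' (\<tau> \<circ> \<rho>) = \<sigma> \<circ> inv' \<tau>"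
  proof -
    have "inv' (\<tau> \<circ> \<rho>) = inv' \<rho> \<circ> inv' \<tau>"
      by (rule o_inv_distrib) (use permutes_bij[OF permsD[OF g(2)]] permutes_bij[OF \<rho>] in auto)
    then show ?thesis using permutes_inv_o(1)[OF \<rho>] by (metis comp_assoc comp_id)
  qed
  then show ?thesis unfolding block_def 1 f(4) g(4) by simp
qed

text \<open>For an equivariant family an element with these matrices exists by
  \<open>rep_surj\<close> and is unique by \<open>rep_inj\<close>, so this is the inverse of the
  isomorphism onto families of equivariant matrices.\<close>

definition lift :: "(nat \<Rightarrow> point set set \<Rightarrow> point set set \<Rightarrow> 'a) \<Rightarrow> point set set \<Rightarrow> 'a" where
  "lift T = (SOME a. a \<in> carrier B \<and> (\<forall>q v u. q \<preceq> r \<longrightarrow> v \<in> U q \<longrightarrow> u \<in> U q \<longrightarrow> rep a v u = T q v u))"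

abbreviation "el i j x \<equiv> lift (block i j x)"

lemma el:
  assumes x: "x \<in> carrier S"
  shows el_closed: "el i j x \<in> carrier B"
    and rep_el: "q \<preceq> r \<Longrightarrow> v \<in> U q \<Longrightarrow> u \<in> U q \<Longrightarrow> rep (el i j x) v u = block i j x q v u"
proof -
  have "\<exists>a\<in>carrier B. \<forall>q v u. q \<preceq> r \<longrightarrow> v \<in> U q \<longrightarrow> u \<in> U q \<longrightarrow> rep a v u = block i j x q v u"
    by (rule rep_surj) (use block_closed[OF x] block_equivariant in auto)
  then have "\<exists>a. a \<in> carrier B \<and> (\<forall>q v u. q \<preceq> r \<longrightarrow> v \<in> U q \<longrightarrow> u \<in> U q \<longrightarrow> rep a v u = block i j x q v u)"
    by blast
  from someI_ex[OF this] show "el i j x \<in> carrier B"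
    "q \<preceq> r \<Longrightarrow> v \<in> U q \<Longrightarrow> u \<in> U q \<Longrightarrow> rep (el i j x) v u = block i j x q v u"
    unfolding lift_def by blast+
qed

text \<open>The convolution product becomes a product of matrices with entries depending on
  \<open>a \<circ> inv' \<rho>\<close> and \<open>\<rho> \<circ> inv' b\<close>, after the
  substitution of \<open>a \<circ> inv' \<rho>\<close> for the first factor. This says that the left
  regular representation is multiplicative.\<close>

lemma group_algebra_mult_coeff:
  assumes x: "x \<in> carrier (GA q)" and y: "y \<in> carrier (GA q)" and a: "a \<in> perms q" and b: "b \<in> perms q"
  shows "(x \<otimes>\<^bsub>GA q\<^esub> y) (a \<circ> inv' b) = dot (perms q) (\<lambda>\<rho>. x (a \<circ> inv' \<rho>)) (\<lambda>\<rho>. y (\<rho> \<circ> inv' b))"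
proof -
  interpret G: monomial_algebra R "GA q" "perms q" "(\<circ>)" "\<lambda>_ _. \<one>" id
    by (rule monomial_group_algebra[OF cring_axioms])
  note cx = G.coeff_closed[OF x] and cy = G.coeff_closed[OF y]
  let ?h = "a \<circ> inv' b"
  have h: "?h \<in> perms q" using a b perms_closed by blast
  have inv_o: "inv' \<alpha> \<circ> \<alpha> = id" "\<alpha> \<circ> inv' \<alpha> = id" if "\<alpha> \<in> perms q" for \<alpha>
    using permutes_inv_o[OF permsD[OF that]] by auto
  have "(x \<otimes>\<^bsub>GA q\<^esub> y) ?h = dot (perms q) (x \<otimes>\<^bsub>GA q\<^esub> y) (\<lambda>z. if z = ?h then \<one> else \<zero>)"
    using dot_delta[OF G.finite_X h, of "x \<otimes>\<^bsub>GA q\<^esub> y" \<one>] G.coeff_closed[OF G.mult_closed[OF x y]] h by simp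
  also have "\<dots> = dot (perms q) x (\<lambda>\<alpha>. dot (perms q) y (\<lambda>\<beta>. \<one> \<otimes> (if \<alpha> \<circ> \<beta> = ?h then \<one> else \<zero>)))"
    by (rule G.dot_mult[OF x y]) auto
  also have "\<dots> = dot (perms q) x (\<lambda>\<alpha>. y (inv' \<alpha> \<circ> ?h))"
  proof (rule dot_cong_right)
    fix \<alpha> assume \<alpha>: "\<alpha> \<in> perms q"
    have m: "inv' \<alpha> \<circ> ?h \<in> perms q" by (intro perms_closed(1,2) \<alpha> h)
    have "\<alpha> \<circ> \<beta> = ?h \<longleftrightarrow> \<beta> = inv' \<alpha> \<circ> ?h" for \<beta>
    proof
      assume "\<alpha> \<circ> \<beta> = ?h"
      then have "inv' \<alpha> \<circ> (\<alpha> \<circ> \<beta>) = inv' \<alpha> \<circ> ?h" by simp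
      then show "\<beta> = inv' \<alpha> \<circ> ?h" using inv_o(1)[OF \<alpha>] by (metis comp_assoc id_comp)
    next
      assume "\<beta> = inv' \<alpha> \<circ> ?h"
      then show "\<alpha> \<circ> \<beta> = ?h" using inv_o(2)[OF \<alpha>] by (metis comp_assoc id_comp)
    qed
    then have "dot (perms q) y (\<lambda>\<beta>. \<one> \<otimes> (if \<alpha> \<circ> \<beta> = ?h then \<one> else \<zero>)) = dot (perms q) y (\<lambda>\<beta>. if \<beta> = inv' \<alpha> \<circ> ?h then \<one> else \<zero>)"
      by (intro dot_cong_right) (use cy in auto)
    also have "\<dots> = y (inv' \<alpha> \<circ> ?h)" using dot_delta[OF G.finite_X m, of y \<one>] cy m by simp
    finally show "dot (perms q) y (\<lambda>\<beta>. \<one> \<otimes> (if \<alpha> \<circ> \<beta> = ?h then \<one> else \<zero>)) = y (inv' \<alpha> \<circ> ?h)" .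
  qed (use cx cy perms_closed h in blast)+
  also have "\<dots> = dot (perms q) (\<lambda>\<rho>. x (a \<circ> inv' \<rho>)) (\<lambda>\<rho>. y (inv' (a \<circ> inv' \<rho>) \<circ> ?h))"
  proof (rule dot_reindex)
    show "bij_betw (\<lambda>\<rho>. a \<circ> inv' \<rho>) (perms q) (perms q)"
    proof (rule bij_betw_byWitness[where f' = "\<lambda>\<rho>. inv' \<rho> \<circ> a"])
      have "inv' (a \<circ> inv' \<rho>) = \<rho> \<circ> inv' a" "inv' (inv' \<rho> \<circ> a) = inv' a \<circ> \<rho>" if "\<rho> \<in> perms q" for \<rho>
        using o_inv_distrib[OF permutes_bij[OF permsD[OF a]] permutes_bij[OF permsD[OF perms_closed(2)[OF that]]]]
          o_inv_distrib[OF permutes_bij[OF permsD[OF perms_closed(2)[OF that]]] permutes_bij[OF permsD[OF a]]]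
          permutes_inv_inv[OF permsD[OF that]] by simp_all
      then show "\<forall>\<rho>\<in>perms q. inv' (a \<circ> inv' \<rho>) \<circ> a = \<rho>" "\<forall>\<rho>\<in>perms q. a \<circ> inv' (inv' \<rho> \<circ> a) = \<rho>"
        using inv_o[OF a] by (simp_all add: comp_assoc) (simp_all flip: comp_assoc)
    qed (use a perms_closed in blast)+
  qed (use cx cy perms_closed h in blast)+
  also have "\<dots> = dot (perms q) (\<lambda>\<rho>. x (a \<circ> inv' \<rho>)) (\<lambda>\<rho>. y (\<rho> \<circ> inv' b))"
  proof (rule dot_cong_right)
    fix \<rho> assume \<rho>: "\<rho> \<in> perms q"
    have "inv' (a \<circ> inv' \<rho>) = \<rho> \<circ> inv' a"
      using o_inv_distrib[OF permutes_bij[OF permsD[OF a]] permutes_bij[OF permsD[OF perms_closed(2)[OF \<rho>]]]]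
        permutes_inv_inv[OF permsD[OF \<rho>]] by simp
    then have "inv' (a \<circ> inv' \<rho>) \<circ> ?h = \<rho> \<circ> (inv' a \<circ> a) \<circ> inv' b" by (simp only: comp_assoc)
    then show "y (inv' (a \<circ> inv' \<rho>) \<circ> ?h) = y (\<rho> \<circ> inv' b)" using inv_o(1)[OF a] by simp
  qed (auto intro!: cx cy perms_closed a b)
  finally show ?thesis .
qed

lemma S_mult: "q \<preceq> r \<Longrightarrow> (x \<otimes>\<^bsub>S\<^esub> y) q = x q \<otimes>\<^bsub>GA q\<^esub> y q"
  and S_add: "q \<preceq> r \<Longrightarrow> \<sigma> \<in> perms q \<Longrightarrow> (x \<oplus>\<^bsub>S\<^esub> y) q \<sigma> = x q \<sigma> \<oplus> y q \<sigma>"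
  and S_smult: "q \<preceq> r \<Longrightarrow> \<sigma> \<in> perms q \<Longrightarrow> (c \<odot>\<^bsub>S\<^esub> x) q \<sigma> = c \<otimes> x q \<sigma>"
  and S_one: "q \<preceq> r \<Longrightarrow> \<sigma> \<in> perms q \<Longrightarrow> \<one>\<^bsub>S\<^esub> q \<sigma> = (if \<sigma> = id then \<one> else \<zero>)"
  by (simp_all add: direct_sum_algebra_def group_algebra_def sym_group_one)

text \<open>The rule for matrix units. Only intermediate diagrams with monotone part
  \<open>j q\<close> contribute; they are parametrised by a permutation, and the sum over it is the
  product in the group algebra.\<close>

lemma block_mult:
  assumes x: "x \<in> carrier S" and y: "y \<in> carrier S" and q: "q \<preceq> r" and v: "v \<in> U q" and u: "u \<in> U q"
    and j: "j q \<in> W q"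
  shows "dot (U q) (block i j x q v) (\<lambda>t. block j l y q t u) = block i l (x \<otimes>\<^bsub>S\<^esub> y) q v u"
proof -
  let ?p = "permute_top q (j q)"
  obtain f \<sigma> where f: "f \<in> W q" "\<sigma> \<in> perms q" "normal_form q v = (f, \<sigma>)" using normal_formE[OF v] by metis
  obtain g \<tau> where g: "g \<in> W q" "\<tau> \<in> perms q" "normal_form q u = (g, \<tau>)" using normal_formE[OF u] by metis
  have sub: "?p ` perms q \<subseteq> U q" using permute_top_upward[OF W_U[OF j]] permsD by blast
  have bc: "block i j x q v t \<in> carrier R" "block j l y q t u \<in> carrier R" if "t \<in> U q" for t
    using block_closed[OF x q v that] block_closed[OF y q that u] by auto
  have "dot (U q) (block i j x q v) (\<lambda>t. block j l y q t u) = dot (?p ` perms q) (block i j x q v) (\<lambda>t. block j l y q t u)"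
  proof (rule dot_mono_neutral[OF _ sub])
    fix t assume t: "t \<in> U q - ?p ` perms q"
    then obtain h \<rho> where h: "\<rho> \<in> perms q" "t = permute_top q h \<rho>" "normal_form q t = (h, \<rho>)"
      using normal_formE[of t q] by blast
    then have "h \<noteq> j q" using t by blast
    then have "block i j x q v t = \<zero>" by (simp add: block_def h(3))
    then show "block i j x q v t \<otimes> block j l y q t u = \<zero>" using bc(2)[of t] t by simp
  qed (use bc in auto)
  also have "\<dots> = dot (perms q) (\<lambda>\<rho>. block i j x q v (?p \<rho>)) (\<lambda>\<rho>. block j l y q (?p \<rho>) u)"
  proof (rule dot_reindex)
    have "inj_on ?p (perms q)"
    proof (rule inj_onI)
      fix \<rho> \<rho>' assume \<rho>: "\<rho> \<in> perms q" and \<rho>': "\<rho>' \<in> perms q" and "?p \<rho> = ?p \<rho>'"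
      then have "(j q, \<rho>) = (j q, \<rho>')" by (simp only: normal_form_eq[OF j \<rho>, symmetric] normal_form_eq[OF j \<rho>', symmetric])
      then show "\<rho> = \<rho>'" by simp
    qed
    then show "bij_betw ?p (perms q) (?p ` perms q)" by (simp add: bij_betw_def)
  qed (use sub bc in auto)
  also have "\<dots> = block i l (x \<otimes>\<^bsub>S\<^esub> y) q v u"
  proof (cases "f = i q \<and> g = l q")
    case True
    have "dot (perms q) (\<lambda>\<rho>. block i j x q v (?p \<rho>)) (\<lambda>\<rho>. block j l y q (?p \<rho>) u) =
        dot (perms q) (\<lambda>\<rho>. x q (\<sigma> \<circ> inv' \<rho>)) (\<lambda>\<rho>. y q (\<rho> \<circ> inv' \<tau>))"
      by (rule dot_cong)
        (use True f g normal_form_eq[OF j] S_coeff_closed[OF x q] S_coeff_closed[OF y q] perms_closed in \<open>auto simp: block_def\<close>)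
    also have "\<dots> = (x q \<otimes>\<^bsub>GA q\<^esub> y q) (\<sigma> \<circ> inv' \<tau>)"
      by (rule group_algebra_mult_coeff[OF S_coeff[OF x q] S_coeff[OF y q] f(2) g(2), symmetric])
    also have "\<dots> = block i l (x \<otimes>\<^bsub>S\<^esub> y) q v u"
      using True f g S_mult[OF q] by (simp add: block_def)
    finally show ?thesis .
  next
    case False
    have "dot (perms q) (\<lambda>\<rho>. block i j x q v (?p \<rho>)) (\<lambda>\<rho>. block j l y q (?p \<rho>) u) = \<zero>"
    proof (rule dot_zero)
      fix \<rho> assume "\<rho> \<in> perms q"
      then have "?p \<rho> \<in> U q" using sub by blast
      then show "block i j x q v (?p \<rho>) \<otimes> block j l y q (?p \<rho>) u = \<zero>"
        using bc[of "?p \<rho>"] False f(3) g(3) by (auto simp: block_def)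
    qed
    then show ?thesis using False f(3) g(3) by (auto simp: block_def)
  qed
  finally show ?thesis .
qed

lemma el_mult:
  assumes x: "x \<in> carrier S" and y: "y \<in> carrier S" and j: "\<And>q. q \<preceq> r \<Longrightarrow> j q \<in> W q"
  shows "el i j x \<otimes>\<^bsub>B\<^esub> el j l y = el i l (x \<otimes>\<^bsub>S\<^esub> y)"
proof (rule rep_inj)
  have xy: "x \<otimes>\<^bsub>S\<^esub> y \<in> carrier S" by (rule RS.A.m_closed[OF x y])
  show "el i j x \<otimes>\<^bsub>B\<^esub> el j l y \<in> carrier B" by (rule M.mult_closed[OF el_closed[OF x] el_closed[OF y]])
  show "el i l (x \<otimes>\<^bsub>S\<^esub> y) \<in> carrier B" by (rule el_closed[OF xy])
  fix q v u assume q: "q \<preceq> r" and v: "v \<in> U q" and u: "u \<in> U q"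
  have "rep (el i j x \<otimes>\<^bsub>B\<^esub> el j l y) v u = dot (U q) (rep (el i j x) v) (\<lambda>t. rep (el j l y) t u)"
    by (rule rep_mult[OF el_closed[OF x] el_closed[OF y] u v])
  also have "\<dots> = dot (U q) (block i j x q v) (\<lambda>t. block j l y q t u)"
    by (rule dot_cong) (use rep_el[OF x q v] rep_el[OF y q _ u] block_closed[OF x q v] block_closed[OF y q _ u] in auto)
  also have "\<dots> = rep (el i l (x \<otimes>\<^bsub>S\<^esub> y)) v u"
    unfolding block_mult[where i = i and j = j and l = l, OF x y q v u j[OF q]] rep_el[OF xy q v u] ..
  finally show "rep (el i j x \<otimes>\<^bsub>B\<^esub> el j l y) v u = rep (el i l (x \<otimes>\<^bsub>S\<^esub> y)) v u" .
qed

lemma el_mult_base: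
  "x \<in> carrier S \<Longrightarrow> y \<in> carrier S \<Longrightarrow> el i base x \<otimes>\<^bsub>B\<^esub> el base l y = el i l (x \<otimes>\<^bsub>S\<^esub> y)"
  by (rule el_mult) (simp_all only: base)

lemma el_add:
  assumes x: "x \<in> carrier S" and y: "y \<in> carrier S"
  shows "el i j (x \<oplus>\<^bsub>S\<^esub> y) = el i j x \<oplus>\<^bsub>B\<^esub> el i j y"
proof (rule rep_inj)
  have xy: "x \<oplus>\<^bsub>S\<^esub> y \<in> carrier S" by (rule RS.M.a_closed[OF x y])
  show "el i j (x \<oplus>\<^bsub>S\<^esub> y) \<in> carrier B" by (rule el_closed[OF xy])
  show "el i j x \<oplus>\<^bsub>B\<^esub> el i j y \<in> carrier B" by (rule M.add_closed[OF el_closed[OF x] el_closed[OF y]])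
  fix q v u assume q: "q \<preceq> r" and v: "v \<in> U q" and u: "u \<in> U q"
  obtain f \<sigma> where f: "\<sigma> \<in> perms q" "normal_form q v = (f, \<sigma>)" using normal_formE[OF v] by metis
  obtain g \<tau> where g: "\<tau> \<in> perms q" "normal_form q u = (g, \<tau>)" using normal_formE[OF u] by metis
  show "rep (el i j (x \<oplus>\<^bsub>S\<^esub> y)) v u = rep (el i j x \<oplus>\<^bsub>B\<^esub> el i j y) v u"
    unfolding rep_add[OF el_closed[OF x] el_closed[OF y]] rep_el[OF xy q v u] rep_el[OF x q v u] rep_el[OF y q v u]
    using f g perms_closed S_add[OF q] by (simp add: block_def)
qed

lemma el_smult:
  assumes c: "c \<in> carrier R" and x: "x \<in> carrier S"
  shows "el i j (c \<odot>\<^bsub>S\<^esub> x) = c \<odot>\<^bsub>B\<^esub> el i j x"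
proof (rule rep_inj)
  have cx: "c \<odot>\<^bsub>S\<^esub> x \<in> carrier S" by (rule RS.smult_closed[OF c x])
  show "el i j (c \<odot>\<^bsub>S\<^esub> x) \<in> carrier B" by (rule el_closed[OF cx])
  show "c \<odot>\<^bsub>B\<^esub> el i j x \<in> carrier B" by (rule M.smult_closed[OF c el_closed[OF x]])
  fix q v u assume q: "q \<preceq> r" and v: "v \<in> U q" and u: "u \<in> U q"
  obtain f \<sigma> where f: "\<sigma> \<in> perms q" "normal_form q v = (f, \<sigma>)" using normal_formE[OF v] by metis
  obtain g \<tau> where g: "\<tau> \<in> perms q" "normal_form q u = (g, \<tau>)" using normal_formE[OF u] by metis
  show "rep (el i j (c \<odot>\<^bsub>S\<^esub> x)) v u = rep (c \<odot>\<^bsub>B\<^esub> el i j x) v u"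
    unfolding rep_smult[OF c el_closed[OF x]] rep_el[OF cx q v u] rep_el[OF x q v u]
    using f g perms_closed S_smult[OF q] c by (simp add: block_def)
qed

lemma S_eqI:
  assumes x: "x \<in> carrier S" and y: "y \<in> carrier S" and eq: "\<And>q \<sigma>. q \<preceq> r \<Longrightarrow> \<sigma> \<in> perms q \<Longrightarrow> x q \<sigma> = y q \<sigma>"
  shows "x = y"
proof (rule extensionalityI[of x Q y])
  fix q assume "q \<in> Q"
  then have q: "q \<preceq> r" by simp
  show "x q = y q"
    by (rule monomial_algebra.coeff_eqI[OF monomial_group_algebra[OF cring_axioms] S_coeff[OF x q] S_coeff[OF y q] eq[OF q]])
qed (use x y in \<open>auto simp: direct_sum_algebra_def PiE_def\<close>)

text \<open>The column at \<open>base q\<close> displays every coefficient of \<open>x q\<close>,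
  from which injectivity of the embedding of the corner is read off.\<close>

lemma block_base:
  assumes "q \<preceq> r" and "\<sigma> \<in> perms q"
  shows "block base base x q (permute_top q (base q) \<sigma>) (base q) = x q \<sigma>"
  using normal_form_eq[OF base[OF assms(1)] assms(2)] normal_form_eq[OF base[OF assms(1)] perms_closed(3)]
    permute_top_id[OF upward_diagramsD[OF W_U[OF base[OF assms(1)]]]]
  by (simp add: block_def)

lemma el_base_inj: "inj_on (el base base) (carrier S)"
proof (rule inj_onI)
  fix x y assume x: "x \<in> carrier S" and y: "y \<in> carrier S" and eq: "el base base x = el base base y"
  show "x = y"
  proof (rule S_eqI[OF x y])
    fix q \<sigma> assume q: "q \<preceq> r" and \<sigma>: "\<sigma> \<in> perms q"
    have U: "base q \<in> U q" "permute_top q (base q) \<sigma> \<in> U q"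
      using W_U[OF base[OF q]] permute_top_upward[OF W_U[OF base[OF q]] permsD[OF \<sigma>]] by auto
    show "x q \<sigma> = y q \<sigma>"
      using rep_el[OF x q U(2,1)] rep_el[OF y q U(2,1)] eq block_base[OF q \<sigma>] by metis
  qed
qed

text \<open>A diagonal matrix unit is the projection onto the upward diagrams with one given
  monotone part.\<close>

lemma block_one:
  assumes q: "q \<preceq> r" and v: "v \<in> U q" and u: "u \<in> U q"
  shows "block i i \<one>\<^bsub>S\<^esub> q v u = (if v = u \<and> mono_part q v = i q then \<one> else \<zero>)"
proof -
  obtain f \<sigma> where f: "f \<in> W q" "\<sigma> \<in> perms q" "v = permute_top q f \<sigma>" "normal_form q v = (f, \<sigma>)"
    using normal_formE[OF v] by metis
  obtain g \<tau> where g: "g \<in> W q" "\<tau> \<in> perms q" "u = permute_top q g \<tau>" "normal_form q u = (g, \<tau>)"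
    using normal_formE[OF u] by metis
  have "\<sigma> \<circ> inv' \<tau> = id \<longleftrightarrow> \<sigma> = \<tau>"
  proof
    assume "\<sigma> \<circ> inv' \<tau> = id"
    then have "\<sigma> \<circ> inv' \<tau> \<circ> \<tau> = \<tau>" by simp
    then show "\<sigma> = \<tau>" using permutes_inv_o(2)[OF permsD[OF g(2)]] by (simp add: comp_assoc)
  qed (use permutes_inv_o(1)[OF permsD[OF g(2)]] in simp)
  moreover have "v = u \<longleftrightarrow> f = g \<and> \<sigma> = \<tau>"
  proof
    assume "v = u"
    then have "(f, \<sigma>) = (g, \<tau>)" by (simp only: f(4)[symmetric] g(4)[symmetric])
    then show "f = g \<and> \<sigma> = \<tau>" by simp
  qed (simp only: f(3) g(3))
  moreover have "\<sigma> \<circ> inv' \<tau> \<in> perms q" using f g perms_closed by blast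
  ultimately show ?thesis using f(4) g(4) S_one[OF q] by (auto simp: block_def)
qed

text \<open>Multiplication by the idempotent on both sides keeps only the rows and columns with
  monotone part \<open>base q\<close>. By equivariance such a matrix is determined by its column at
  \<open>base q\<close> itself, whose entries make up an element of the group algebra.\<close>

lemma el_base_corner:
  assumes a: "a \<in> carrier B"
  shows "el base base \<one>\<^bsub>S\<^esub> \<otimes>\<^bsub>B\<^esub> a \<otimes>\<^bsub>B\<^esub> el base base \<one>\<^bsub>S\<^esub> \<in> el base base ` carrier S"
proof -
  let ?e = "el base base \<one>\<^bsub>S\<^esub>"
  note e = el_closed[OF RS.A.one_closed, of base base]
  note ea = M.mult_closed[OF e a]
  \<comment> \<open>Row \<open>permute_top q (base q) \<sigma>\<close> of that column is the
    coefficient at \<open>\<sigma>\<close>.\<close>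
  define x where "x = (\<lambda>q\<in>Q. \<lambda>\<sigma>\<in>perms q. rep a (permute_top q (base q) \<sigma>) (base q))"
  have x: "x \<in> carrier S"
    using rep_closed[OF a] by (auto simp: x_def direct_sum_algebra_def group_algebra_def)
  have "?e \<otimes>\<^bsub>B\<^esub> a \<otimes>\<^bsub>B\<^esub> ?e = el base base x"
  proof (rule rep_inj)
    show "?e \<otimes>\<^bsub>B\<^esub> a \<otimes>\<^bsub>B\<^esub> ?e \<in> carrier B" by (rule M.mult_closed[OF ea e])
    show "el base base x \<in> carrier B" by (rule el_closed[OF x])
    fix q v u assume q: "q \<preceq> r" and v: "v \<in> U q" and u: "u \<in> U q"
    have left: "rep (?e \<otimes>\<^bsub>B\<^esub> a) v s = (if mono_part q v = base q then rep a v s else \<zero>)" if s: "s \<in> U q" for s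
    proof -
      have "rep (?e \<otimes>\<^bsub>B\<^esub> a) v s = dot (U q) (rep ?e v) (\<lambda>t. rep a t s)" by (rule rep_mult[OF e a s v])
      also have "\<dots> = dot (U q) (\<lambda>t. rep a t s) (\<lambda>t. if t = v then (if mono_part q v = base q then \<one> else \<zero>) else \<zero>)"
      proof (rule dot_cong)
        fix t assume t: "t \<in> U q"
        show "rep ?e v t \<otimes> rep a t s = rep a t s \<otimes> (if t = v then if mono_part q v = base q then \<one> else \<zero> else \<zero>)"
          unfolding rep_el[OF RS.A.one_closed q v t] block_one[OF q v t] using rep_closed[OF a] by auto
      qed (use rep_closed[OF a] in auto)
      also have "\<dots> = rep a v s \<otimes> (if mono_part q v = base q then \<one> else \<zero>)"
        by (rule dot_delta[OF _ v]) (use rep_closed[OF a] in auto)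
      finally show ?thesis using rep_closed[OF a] by simp
    qed
    have "rep (?e \<otimes>\<^bsub>B\<^esub> a \<otimes>\<^bsub>B\<^esub> ?e) v u = dot (U q) (rep (?e \<otimes>\<^bsub>B\<^esub> a) v) (\<lambda>s. rep ?e s u)"
      by (rule rep_mult[OF ea e u v])
    also have "\<dots> = dot (U q) (rep (?e \<otimes>\<^bsub>B\<^esub> a) v) (\<lambda>s. if s = u then (if mono_part q u = base q then \<one> else \<zero>) else \<zero>)"
    proof (rule dot_cong_right)
      fix s assume s: "s \<in> U q"
      show "rep ?e s u = (if s = u then if mono_part q u = base q then \<one> else \<zero> else \<zero>)"
        unfolding rep_el[OF RS.A.one_closed q s u] block_one[OF q s u] by auto
    qed (use rep_closed[OF ea] in auto)
    also have "\<dots> = rep (?e \<otimes>\<^bsub>B\<^esub> a) v u \<otimes> (if mono_part q u = base q then \<one> else \<zero>)"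
      by (rule dot_delta[OF _ u]) (use rep_closed[OF ea] in auto)
    also have "\<dots> = (if mono_part q v = base q \<and> mono_part q u = base q then rep a v u else \<zero>)"
      unfolding left[OF u] using rep_closed[OF a] by simp
    also have "\<dots> = block base base x q v u"
    proof (cases "mono_part q v = base q \<and> mono_part q u = base q")
      case True
      obtain \<sigma> where f: "\<sigma> \<in> perms q" "v = permute_top q (base q) \<sigma>" "normal_form q v = (base q, \<sigma>)"
        using normal_formE[OF v] True by (metis fst_conv)
      obtain \<tau> where g: "\<tau> \<in> perms q" "u = permute_top q (base q) \<tau>" "normal_form q u = (base q, \<tau>)"
        using normal_formE[OF u] True by (metis fst_conv)
      note bU = W_U[OF base[OF q]]
      note bd = upward_diagramsD[OF bU]
      have st: "\<sigma> \<circ> inv' \<tau> \<in> perms q" using f g perms_closed by blast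
      \<comment> \<open>Moving the permutation part of \<open>u\<close> over to \<open>v\<close>
        turns the column into that of \<open>base q\<close>.\<close>
      let ?v' = "permute_top q (base q) (\<sigma> \<circ> inv' \<tau>)"
      have "permute_top q ?v' \<tau> = v"
        unfolding f(2) permute_top_comp[OF bd permsD[OF st] permsD[OF g(1)]]
        using permutes_inv_o(2)[OF permsD[OF g(1)]] by (simp add: comp_assoc)
      then have "rep a v u = rep a (permute_top q ?v' \<tau>) (permute_top q (base q) \<tau>)" using g(2) by simp
      also have "\<dots> = rep a ?v' (base q)"
        by (rule rep_equivariant[OF a bU permute_top_upward[OF bU permsD[OF st]] permsD[OF g(1)]])
      also have "\<dots> = x q (\<sigma> \<circ> inv' \<tau>)" using st q by (simp add: x_def)
      finally show ?thesis using f(3) g(3) by (simp add: block_def)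
    qed (auto simp: block_def)
    also have "\<dots> = rep (el base base x) v u" by (rule rep_el[OF x q v u, symmetric])
    finally show "rep (?e \<otimes>\<^bsub>B\<^esub> a \<otimes>\<^bsub>B\<^esub> ?e) v u = rep (el base base x) v u" .
  qed
  then show ?thesis using x by blast
qed

text \<open>The central idempotent of the summand of degree \<open>p\<close>. A \<open>block\<close>
  carries one matrix position in every degree at once; with this entry all degrees except
  \<open>p\<close> vanish. So \<open>base(p := f)\<close> with \<open>unit_at p\<close> describes a
  single matrix unit in degree \<open>p\<close>, at a position involving \<open>f\<close>.\<close>

definition unit_at :: "nat \<Rightarrow> nat \<Rightarrow> (nat \<Rightarrow> nat) \<Rightarrow> 'a" where
  "unit_at p = (\<lambda>q\<in>Q. if q = p then \<one>\<^bsub>GA q\<^esub> else \<zero>\<^bsub>GA q\<^esub>)"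

lemma unit_at_closed: "unit_at p \<in> carrier S"
  by (auto simp: unit_at_def direct_sum_algebra_def group_algebra_def)

lemma unit_at_idem: "unit_at p \<otimes>\<^bsub>S\<^esub> unit_at p = unit_at p"
proof (rule extensionalityI[of _ Q])
  fix q assume q: "q \<in> Q"
  interpret G: assoc_algebra R "GA q" by (rule assoc_algebra_GA)
  show "(unit_at p \<otimes>\<^bsub>S\<^esub> unit_at p) q = unit_at p q"
  proof -
    have "unit_at p q = \<one>\<^bsub>GA q\<^esub> \<or> unit_at p q = \<zero>\<^bsub>GA q\<^esub>" using q by (simp add: unit_at_def)
    then have "unit_at p q \<otimes>\<^bsub>GA q\<^esub> unit_at p q = unit_at p q"
      by (elim disjE) (simp_all only: G.A.l_one[OF G.A.one_closed] G.A.l_null[OF G.M.zero_closed])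
    moreover have "q \<preceq> r" using q by simp
    ultimately show ?thesis by (simp only: S_mult)
  qed
qed (simp_all add: direct_sum_algebra_def unit_at_def)

lemma block_unit_at:
  assumes q: "q \<preceq> r" and v: "v \<in> U q" and u: "u \<in> U q"
  shows "block i i (unit_at p) q v u = (if p = q \<and> v = u \<and> mono_part q v = i q then \<one> else \<zero>)"
proof (cases "p = q")
  case True
  have "unit_at p q = \<one>\<^bsub>S\<^esub> q" using q True by (simp add: unit_at_def direct_sum_algebra_def)
  then have "block i i (unit_at p) q v u = block i i \<one>\<^bsub>S\<^esub> q v u" unfolding block_def by (simp only:)
  then show ?thesis using block_one[OF q v u, of i] True by simp
next
  case False
  obtain f \<sigma> where f: "\<sigma> \<in> perms q" "normal_form q v = (f, \<sigma>)" using normal_formE[OF v] by metis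
  obtain g \<tau> where g: "\<tau> \<in> perms q" "normal_form q u = (g, \<tau>)" using normal_formE[OF u] by metis
  have "\<sigma> \<circ> inv' \<tau> \<in> perms q" using f g perms_closed by blast
  then show ?thesis using q False f g by (simp add: block_def unit_at_def group_algebra_def)
qed

text \<open>Matrix units from \<open>f\<close> to \<open>base p\<close> and back multiply to the
  diagonal unit at \<open>f\<close> in degree \<open>p\<close>, and the sum of all diagonal units is
  1. This is the fullness of the idempotent.\<close>

lemma el_resolution:
  "(\<Oplus>\<^bsub>B\<^esub>i\<in>Sigma Q W. el (base(fst i := snd i)) base (unit_at (fst i)) \<otimes>\<^bsub>B\<^esub>
     el base (base(fst i := snd i)) (unit_at (fst i))) = \<one>\<^bsub>B\<^esub>"
proof -
  let ?g = "\<lambda>i. el (base(fst i := snd i)) (base(fst i := snd i)) (unit_at (fst i))"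
  have fin: "finite (Sigma Q W)"
  proof (rule finite_SigmaI[OF finite_Q])
    show "finite (W q)" for q by (rule finite_subset[OF _ finite_upward_diagrams[of q r]]) (use W_U in blast)
  qed
  have g: "?g i \<in> carrier B" for i by (rule el_closed[OF unit_at_closed])
  have "el (base(fst i := snd i)) base (unit_at (fst i)) \<otimes>\<^bsub>B\<^esub> el base (base(fst i := snd i)) (unit_at (fst i)) = ?g i" for i
    unfolding el_mult_base[OF unit_at_closed unit_at_closed] unit_at_idem ..
  then have "(\<Oplus>\<^bsub>B\<^esub>i\<in>Sigma Q W. el (base(fst i := snd i)) base (unit_at (fst i)) \<otimes>\<^bsub>B\<^esub>
     el base (base(fst i := snd i)) (unit_at (fst i))) = finsum B ?g (Sigma Q W)"
    by simp
  also have "\<dots> = \<one>\<^bsub>B\<^esub>"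
  proof (rule rep_inj)
    show s: "finsum B ?g (Sigma Q W) \<in> carrier B" by (rule RB.M.finsum_closed) (use g in auto)
    show "\<one>\<^bsub>B\<^esub> \<in> carrier B" by (rule M.one_closed')
    fix q v u assume q: "q \<preceq> r" and v: "v \<in> U q" and u: "u \<in> U q"
    obtain f \<sigma> where f: "f \<in> W q" "normal_form q v = (f, \<sigma>)" using normal_formE[OF v] by metis
    have "rep (finsum B ?g (Sigma Q W)) v u = (\<Oplus>i\<in>Sigma Q W. rep (?g i) v u)"
    proof (rule additive_finsum[OF RB.M.abelian_group_axioms abelian_group_axioms _ _ fin])
      show "(\<lambda>a. rep a v u) \<in> carrier B \<rightarrow> carrier R" using rep_closed by blast
      show "?g \<in> Sigma Q W \<rightarrow> carrier B" using g by (rule Pi_I)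
    qed (rule rep_add)
    \<comment> \<open>In degree \<open>q\<close> a row with monotone part \<open>f\<close> sees only
      the diagonal unit indexed by \<open>(q, f)\<close>.\<close>
    also have "\<dots> = (\<Oplus>i\<in>Sigma Q W. if (q, f) = i then (if v = u then \<one> else \<zero>) else \<zero>)"
    proof (rule finsum_cong'[OF refl])
      fix i assume "i \<in> Sigma Q W"
      show "rep (?g i) v u = (if (q, f) = i then (if v = u then \<one> else \<zero>) else \<zero>)"
        unfolding rep_el[OF unit_at_closed q v u] block_unit_at[OF q v u] using f(2) by (cases i) auto
    qed auto
    also have "\<dots> = (if v = u then \<one> else \<zero>)"
      by (rule finsum_singleton[OF _ fin]) (use q f(1) in auto)
    also have "\<dots> = rep \<one>\<^bsub>B\<^esub> v u" by (rule rep_one[OF u, symmetric])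
    finally show "rep (finsum B ?g (Sigma Q W)) v u = rep \<one>\<^bsub>B\<^esub> v u" .
  qed
  finally show ?thesis .
qed

text \<open>The corner of the idempotent with entry 1 at every \<open>base q\<close> is a copy of
  \<open>S\<close>, embedded by \<open>el base base\<close>. The generators are the matrix units
  that lead from \<open>base q\<close> to an arbitrary monotone diagram and back.\<close>

theorem morita_equivalent_symmetric_groups: "morita_equivalent TYPE('u::infinite) R B S"
proof (rule morita_equivalentI[where \<phi> = "el base base" and I = "Sigma Q W" and
      \<alpha> = "\<lambda>i. el (base(fst i := snd i)) base (unit_at (fst i))" and
      \<beta> = "\<lambda>i. el base (base(fst i := snd i)) (unit_at (fst i))"])
  show "assoc_algebra R B" by (rule M.assoc_algebra)
  show "assoc_algebra R S" by (rule RS.assoc_algebra_axioms)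
  show "finite (Sigma Q W)"
  proof (rule finite_SigmaI[OF finite_Q])
    show "finite (W q)" for q by (rule finite_subset[OF _ finite_upward_diagrams[of q r]]) (use W_U in blast)
  qed
  show "el base base (x \<otimes>\<^bsub>S\<^esub> y) = el base base x \<otimes>\<^bsub>B\<^esub> el base base y"
    if "x \<in> carrier S" "y \<in> carrier S" for x y
    by (rule el_mult_base[OF that, symmetric])
  show "el i base (unit_at p) \<otimes>\<^bsub>B\<^esub> el base base \<one>\<^bsub>S\<^esub> = el i base (unit_at p)" for i p
    unfolding el_mult_base[OF unit_at_closed RS.A.one_closed] RS.A.r_one[OF unit_at_closed] ..
  show "el base base \<one>\<^bsub>S\<^esub> \<otimes>\<^bsub>B\<^esub> el base i (unit_at p) = el base i (unit_at p)" for i p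
    unfolding el_mult_base[OF RS.A.one_closed unit_at_closed] RS.A.l_one[OF unit_at_closed] ..
  show "(\<Oplus>\<^bsub>B\<^esub>i\<in>Sigma Q W. el (base(fst i := snd i)) base (unit_at (fst i)) \<otimes>\<^bsub>B\<^esub>
     el base (base(fst i := snd i)) (unit_at (fst i))) = \<one>\<^bsub>B\<^esub>"
    by (rule el_resolution)
qed (rule el_closed el_add el_smult el_base_inj el_base_corner unit_at_closed; assumption?)+

end

theorem theorem8p14:
  fixes k :: "('k, 'm) ring_scheme" and \<delta> :: 'k and r :: nat
  assumes "cring k"
    and "\<delta> \<in> carrier k"
    and "nonsingular_upto k \<delta> r"
  shows "morita_equivalent TYPE('u::infinite) k
    (brauer_algebra k \<delta> r)
    (direct_sum_algebra {q. q \<preceq> r} (\<lambda>q. group_algebra k (sym_group q)))"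
proof -
  interpret nonsingular_brauer k \<delta> r
    by (rule nonsingular_brauer.intro[OF assms(1)]) (use assms(2,3) in unfold_locales)
  show ?thesis by (rule morita_equivalent_symmetric_groups)
qed

end
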